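(* Let $N>2$, let $\Omega\subseteq\mathbb{R}^N$ be a bounded domain with $C^2$-boundary, and let $p:\overline\Omega\to\mathbb{R}$ be continuous with $1<p^-\le p(x)\le p^+<N$ on $\Omega$ and $p^+\le \widehat p^*$. Let $\lambda\in\mathbb{R}$ satisfy $\lambda<\frac{p^-}{p^+}\lambda_*$. Let $j:\Omega\times\mathbb{R}\to\mathbb{R}$ be a function with $j(x,0)=0$ on $\Omega$ such that: (i) for all $t\in\mathbb{R}$, the function $\Omega\ni x\mapsto j(x,t)\in\mathbb{R}$ is measurable; (ii) for almost all $x\in\Omega$, the function $\mathbb{R}\ni t\mapsto j(x,t)\in\mathbb{R}$ is locally Lipschitz; (iii) for almost all $x\in\Omega$, all $t\in\mathbb{R}$ and all $v\in\partial j(x,t)$, we have $|v|\le a(x)+c_1|t|^{r(x)-1}$, with $a\in L^\infty_+(\Omega)$, $c_1>0$ and $r\in C(\overline\Omega)$ such that $p^+\le r^+:=\max_{x\in\overline\Omega} r(x)<\widehat p^*$; (iv) $\limsup_{|t|\to\infty}\frac{j(x,t)}{|t|^{p(x)}}<0$ uniformly for almost all $x\in\Omega$; (v) there exists $\mu>0$ such that $\limsup_{|t|\to 0}\frac{j(x,t)}{|t|^{p(x)}}\le-\mu$ uniformly for almost all $x\in\Omega$; (vi) there exists $\overline u\in W_0^{1,p(x)}(\Omega)\setminus\{0\}$ such that $$\frac{1}{p^-}\int_\Omega|\nabla\overline u(x)|^{p(x)}dx+\frac{\lambda_-}{p^-}\int_\Omega|\overline u(x)|^{p(x)}dx\le\int_\Omega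 j(x,\overline u(x))\,dx,$$ where $\lambda_-:=\max\{0,-\lambda\}$. Then the problem $$-\Delta_{p(x)}u-\lambda|u(x)|^{p(x)-2}u(x)\in\partial j(x,u(x))\ \text{ in }\Omega,\qquad u=0\ \text{ on }\partial\Omega,$$ has a nontrivial solution $u\in W_0^{1,p(x)}(\Omega)$, $u\ne 0$.
   Context: Notation: $p^-:=\inf_{x\in\Omega}p(x)$, $p^+:=\sup_{x\in\Omega}p(x)$, $\widehat p^*:=\frac{Np^-}{N-p^-}$. $L^{p(x)}(\Omega)$ is the space of measurable $u:\Omega\to\mathbb{R}$ with $\int_\Omega|u(x)|^{p(x)}dx<\infty$, with the Luxemburg norm $\|u\|_{p(x)}=\inf\{s>0:\int_\Omega|u(x)/s|^{p(x)}dx\le1\}$. $W^{1,p(x)}(\Omega)=\{u\in L^{p(x)}(\Omega):|\nabla u|\in L^{p(x)}(\Omega)\}$ with norm $\|u\|=\|u\|_{p(x)}+\|\nabla u\|_{p(x)}$, and $W_0^{1,p(x)}(\Omega)$ is the closure of $C_0^\infty(\Omega)$ in $W^{1,p(x)}(\Omega)$. $L^\infty_+(\Omega)$ denotes the nonnegative functions in $L^\infty(\Omega)$. $$\lambda_*:=\inf_{u\in W_0^{1,p(x)}(\Omega)\setminus\{0\}}\frac{\int_\Omega|\nabla u(x)|^{p(x)}dx}{\int_\Omega|u(x)|^{p(x)}dx}$$ (possibly $\lambda_*=0$). $\Delta_{p(x)}u:=\mathrm{div}(|\nabla u(x)|^{p(x)-2}\nabla u(x))$. $\partial j(x,t)$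 denotes the Clarke subdifferential at $t$ of the locally Lipschitz function $j(x,\cdot)$. For a locally Lipschitz $f:X\to\mathbb{R}$ on a Banach space $X$, $f^0(x;h)=\limsup_{x'\to0,\,s\downarrow0}\frac{f(x+x'+sh)-f(x+x')}{s}$ and $\partial f(x)=\{x^*\in X^*:\langle x^*,h\rangle\le f^0(x;h)\text{ for all }h\in X\}$. The uniform conditions mean: in (iv), there exist $c>0$ and $L>0$ such that for almost all $x\in\Omega$ and all $|t|\ge L$, $j(x,t)\le-c|t|^{p(x)}$; in (v), for every $\varepsilon>0$ there is $\delta>0$ such that for almost all $x\in\Omega$ and all $0<|t|\le\delta$, $j(x,t)\le(-\mu+\varepsilon)|t|^{p(x)}$. A solution is understood in the weak sense: $u\in W_0^{1,p(x)}(\Omega)$ for which there is a locally integrable function $v^*:\Omega\to\mathbb{R}$ with $v^*(x)\in\partial j(x,u(x))$ for almost all $x\in\Omega$ and $$\int_\Omega|\nabla u|^{p(x)-2}(\nabla u,\nabla\varphi)_{\mathbb{R}^N}dx=\int_\Omega\lambda|u|^{p(x)-2}u\,\varphi\,dx+\int_\Omega v^*\varphi\,dx\quad\text{for all }\varphi\in C_0^\infty(\Omega).$$ *)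

theory Defs
  imports "HOL-Analysis.Analysis"
begin

section \<open>Smooth functions and boundary regularity\<close>

primrec C_k :: "nat \<Rightarrow> ('a::euclidean_space \<Rightarrow> real) \<Rightarrow> bool" where
  "C_k 0 f \<longleftrightarrow> continuous_on UNIV f"
| "C_k (Suc k) f \<longleftrightarrow>
     (\<forall>x. f differentiable (at x)) \<and> (\<forall>b\<in>Basis. C_k k (\<lambda>x. frechet_derivative f (at x) b))"

definition grad :: "('a::euclidean_space \<Rightarrow> real) \<Rightarrow> 'a \<Rightarrow> 'a" where
  "grad f x = (\<Sum>b\<in>Basis. frechet_derivative f (at x) b *\<^sub>R b)"

text \<open>The space of test functions, usually written $C_0^\infty(\Omega)$; its elements are
  extended by zero to the whole space.\<close>

definition test_functions :: "'a::euclidean_space set \<Rightarrow> ('a \<Rightarrow> real) set" where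
  "test_functions \<Omega> =
     {\<phi>. (\<forall>k. C_k k \<phi>) \<and> compact (closure {x. \<phi> x \<noteq> 0}) \<and> closure {x. \<phi> x \<noteq> 0} \<subseteq> \<Omega>}"

text \<open>Near each boundary point, and for a suitable unit vector \<open>\<nu>\<close>, the set is the part above
  the graph of a $C^2$ function on the hyperplane orthogonal to \<open>\<nu>\<close>.  Only the restriction of
  \<open>\<gamma>\<close> to that hyperplane is used: \<open>y - (y \<bullet> \<nu>) *\<^sub>R \<nu>\<close> is the orthogonal projection of \<open>y\<close>.\<close>

definition C2_boundary :: "'a::euclidean_space set \<Rightarrow> bool" where
  "C2_boundary \<Omega> \<longleftrightarrow>
     (\<forall>z\<in>frontier \<Omega>. \<exists>\<rho>>0. \<exists>\<nu> \<gamma>. norm \<nu> = 1 \<and> C_k 2 \<gamma> \<and>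
        \<Omega> \<inter> ball z \<rho> = {y \<in> ball z \<rho>. \<gamma> (y - (y \<bullet> \<nu>) *\<^sub>R \<nu>) < y \<bullet> \<nu>})"

definition bounded_domain :: "'a::euclidean_space set \<Rightarrow> bool" where
  "bounded_domain \<Omega> \<longleftrightarrow> open \<Omega> \<and> connected \<Omega> \<and> bounded \<Omega> \<and> \<Omega> \<noteq> {}"


section \<open>Variable exponents\<close>

definition exp_inf :: "'a set \<Rightarrow> ('a \<Rightarrow> real) \<Rightarrow> real" where
  "exp_inf \<Omega> p = (INF x\<in>\<Omega>. p x)"

definition exp_sup :: "'a set \<Rightarrow> ('a \<Rightarrow> real) \<Rightarrow> real" where
  "exp_sup \<Omega> p = (SUP x\<in>\<Omega>. p x)"

definition crit_exp :: "'a::euclidean_space set \<Rightarrow> ('a \<Rightarrow> real) \<Rightarrow> real" where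
  "crit_exp \<Omega> p = real DIM('a) * exp_inf \<Omega> p / (real DIM('a) - exp_inf \<Omega> p)"

text \<open>Real power with the convention $0^0 = 1$, whereas \<open>0 powr 0 = 0\<close>.\<close>

definition rpow :: "real \<Rightarrow> real \<Rightarrow> real" where
  "rpow s e = (if e = 0 then 1 else s powr e)"


section \<open>Variable exponent Lebesgue and Sobolev spaces\<close>

text \<open>Elements of these spaces are functions, not classes modulo equality almost everywhere, so
  being zero or nonzero in such a space has to be expressed by \<open>ae_zero\<close>.  Values outside
  \<open>\<Omega>\<close> play no role.\<close>

definition ae_zero :: "'a::euclidean_space set \<Rightarrow> ('a \<Rightarrow> real) \<Rightarrow> bool" where
  "ae_zero \<Omega> u \<longleftrightarrow> (AE x in lebesgue_on \<Omega>. u x = 0)"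

definition Lp_var :: "'a::euclidean_space set \<Rightarrow> ('a \<Rightarrow> real) \<Rightarrow> ('a \<Rightarrow> real) set" where
  "Lp_var \<Omega> p = {u \<in> borel_measurable (lebesgue_on \<Omega>).
     (\<integral>\<^sup>+x. ennreal (\<bar>u x\<bar> powr p x) \<partial>lebesgue_on \<Omega>) < \<infinity>}"

definition luxemburg_norm ::
    "'a::euclidean_space set \<Rightarrow> ('a \<Rightarrow> real) \<Rightarrow> ('a \<Rightarrow> real) \<Rightarrow> real" where
  "luxemburg_norm \<Omega> p u =
     Inf {s. s > 0 \<and> (\<integral>\<^sup>+x. ennreal (\<bar>u x / s\<bar> powr p x) \<partial>lebesgue_on \<Omega>) \<le> 1}"

definition locally_integrable ::
    "'a::euclidean_space set \<Rightarrow> ('a \<Rightarrow> 'b::euclidean_space) \<Rightarrow> bool" where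
  "locally_integrable \<Omega> f \<longleftrightarrow>
     (\<forall>K. compact K \<and> K \<subseteq> \<Omega> \<longrightarrow> integrable (lebesgue_on K) f)"

definition has_weak_grad ::
    "'a::euclidean_space set \<Rightarrow> ('a \<Rightarrow> real) \<Rightarrow> ('a \<Rightarrow> 'a) \<Rightarrow> bool" where
  "has_weak_grad \<Omega> u g \<longleftrightarrow>
     locally_integrable \<Omega> u \<and> locally_integrable \<Omega> g \<and>
     (\<forall>\<phi>\<in>test_functions \<Omega>.
        (LINT x|lebesgue_on \<Omega>. u x *\<^sub>R grad \<phi> x) = - (LINT x|lebesgue_on \<Omega>. \<phi> x *\<^sub>R g x))"

text \<open>Weak gradients are unique up to null sets; \<open>weak_grad\<close> selects a representative.\<close>

definition weak_grad :: "'a::euclidean_space set \<Rightarrow> ('a \<Rightarrow> real) \<Rightarrow> 'a \<Rightarrow> 'a" where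
  "weak_grad \<Omega> u = (SOME g. has_weak_grad \<Omega> u g)"

definition W1p :: "'a::euclidean_space set \<Rightarrow> ('a \<Rightarrow> real) \<Rightarrow> ('a \<Rightarrow> real) set" where
  "W1p \<Omega> p = {u \<in> Lp_var \<Omega> p.
     (\<exists>g. has_weak_grad \<Omega> u g) \<and> (\<lambda>x. norm (weak_grad \<Omega> u x)) \<in> Lp_var \<Omega> p}"

definition W1p_norm ::
    "'a::euclidean_space set \<Rightarrow> ('a \<Rightarrow> real) \<Rightarrow> ('a \<Rightarrow> real) \<Rightarrow> real" where
  "W1p_norm \<Omega> p u =
     luxemburg_norm \<Omega> p u + luxemburg_norm \<Omega> p (\<lambda>x. norm (weak_grad \<Omega> u x))"

definition W01p :: "'a::euclidean_space set \<Rightarrow> ('a \<Rightarrow> real) \<Rightarrow> ('a \<Rightarrow> real) set" where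
  "W01p \<Omega> p = {u \<in> W1p \<Omega> p.
     \<forall>\<epsilon>>0. \<exists>\<phi>\<in>test_functions \<Omega>. W1p_norm \<Omega> p (\<lambda>x. u x - \<phi> x) < \<epsilon>}"

definition lambda_star :: "'a::euclidean_space set \<Rightarrow> ('a \<Rightarrow> real) \<Rightarrow> real" where
  "lambda_star \<Omega> p =
     (INF u \<in> {u \<in> W01p \<Omega> p. \<not> ae_zero \<Omega> u}.
        (LINT x|lebesgue_on \<Omega>. norm (weak_grad \<Omega> u x) powr p x) /
        (LINT x|lebesgue_on \<Omega>. \<bar>u x\<bar> powr p x))"


section \<open>The Clarke subdifferential\<close>

definition locally_lipschitz :: "('a::metric_space \<Rightarrow> real) \<Rightarrow> bool" where
  "locally_lipschitz f \<longleftrightarrow> (\<forall>x. \<exists>\<rho>>0. \<exists>L. L-lipschitz_on (ball x \<rho>) f)"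

definition clarke_deriv :: "('a::real_normed_vector \<Rightarrow> real) \<Rightarrow> 'a \<Rightarrow> 'a \<Rightarrow> ereal" where
  "clarke_deriv f x h =
     Limsup (nhds 0 \<times>\<^sub>F at_right 0)
       (\<lambda>(x', s). ereal ((f (x + x' + s *\<^sub>R h) - f (x + x')) / s))"

text \<open>For functions of a real variable, the dual of the real line being identified with the
  real line.\<close>

definition clarke_subdiff :: "(real \<Rightarrow> real) \<Rightarrow> real \<Rightarrow> real set" where
  "clarke_subdiff f t = {v. \<forall>h. ereal (v * h) \<le> clarke_deriv f t h}"


section \<open>Weak solutions\<close>

text \<open>The differential inclusion
  $-\Delta_{p(x)} u - \lambda |u|^{p(x)-2} u \in \partial j(x, u)$ with zero boundary values.\<close>

definition weak_solution :: "'a::euclidean_space set \<Rightarrow> ('a \<Rightarrow> real) \<Rightarrow> real \<Rightarrow>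
    ('a \<Rightarrow> real \<Rightarrow> real) \<Rightarrow> ('a \<Rightarrow> real) \<Rightarrow> bool" where
  "weak_solution \<Omega> p lam j u \<longleftrightarrow>
     u \<in> W01p \<Omega> p \<and>
     (\<exists>v. locally_integrable \<Omega> v \<and>
          (AE x in lebesgue_on \<Omega>. v x \<in> clarke_subdiff (j x) (u x)) \<and>
          (\<forall>\<phi>\<in>test_functions \<Omega>.
             (LINT x|lebesgue_on \<Omega>.
                norm (weak_grad \<Omega> u x) powr (p x - 2) * (weak_grad \<Omega> u x \<bullet> grad \<phi> x)) =
             (LINT x|lebesgue_on \<Omega>. lam * \<bar>u x\<bar> powr (p x - 2) * u x * \<phi> x) +
             (LINT x|lebesgue_on \<Omega>. v x * \<phi> x)))"

end

theory Submission
  imports Defs "HOL-Complex_Analysis.Great_Picard"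
begin

text \<open>The solution is a global minimiser over the Sobolev space with zero boundary values of the functional
\<open>R u = \<integral> |\<nabla>u|^p(x) / p(x) - \<lambda> |u|^p(x) / p(x) - j(x, u) dx\<close>.

Coercivity comes from two sources.  The condition on \<open>\<lambda>\<close> allows the second term to be absorbed by a
fraction \<open>\<theta> < 1\<close> of the gradient energy, and the decay of \<open>j\<close> at infinity together with its Lipschitz
bound on bounded sets makes \<open>j\<close> bounded above (\<open>functional_coercive\<close>).  A minimising sequence therefore
has bounded gradient energy.  As the growth of \<open>j\<close> is subcritical, a subsequence converges strongly
enough for the integral of \<open>j\<close> to pass to the limit (\<open>W0_compact\<close>), while the gradient energy is lower
semicontinuous (\<open>W0_lower_semicontinuous\<close>).  So a minimiser exists (\<open>minimiser_exists\<close>).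

The minimiser may be zero.  In that case the minimum is \<open>R 0 = 0\<close>, and the function \<open>ubar\<close> of the
hypotheses satisfies \<open>R ubar \<le> 0\<close>, because \<open>1 / p(x) \<le> 1 / pm\<close>.  Hence \<open>ubar\<close> is itself a minimiser,
and it is nonzero (\<open>nontrivial_solution\<close>).

A minimiser solves the differential inclusion (\<open>euler_lagrange_inclusion\<close>).  Comparing \<open>u\<close> with
\<open>u + t \<phi>\<close> for a test function \<open>\<phi>\<close> and letting \<open>t\<close> tend to zero bounds the derivative of the smooth part
of \<open>R\<close> in direction \<open>\<phi>\<close> by the integral of the support function, at \<open>- \<phi> x\<close>, of the Clarke
subdifferential \<open>[lo x, hi x]\<close> of \<open>j x\<close> at \<open>u x\<close>.
After subtraction of the midpoint of that interval there remains a linear functional of \<open>\<phi>\<close> bounded by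
the integral of \<open>d |\<phi>|\<close>, where \<open>d\<close> is half the length of the interval.  Such a functional is integration
against some \<open>V\<close> with \<open>|V| \<le> d\<close> (\<open>representation_weighted_L1\<close>), and the midpoint plus \<open>V\<close> is the required
selection.

Compactness is proved on test functions extended by zero.  Integrating the gradient along segments and
averaging the directions over a cube gives a subcritical Sobolev inequality
(\<open>sobolev_test_functions\<close>), and averages over small cubes give Rellich's theorem
(\<open>rellich_test_functions\<close>).  The variable exponent enters through the modular, the integral of
\<open>|f|^p(x)\<close>: for a bounded exponent it defines the same convergence as the Luxemburg norm, and since the
exponent stays away from one it is uniformly convex (\<open>uniform_convexity_powr\<close>).  Uniform convexity
takes the place of reflexivity and weak limits in the lower semicontinuity argument.\<close>

section \<open>Smooth functions and the fundamental lemma\<close>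

lemma C_k_SucI:
  assumes "\<And>x. (f has_derivative F x) (at x)" "\<And>b. b \<in> Basis \<Longrightarrow> C_k k (\<lambda>x. F x b)"
  shows "C_k (Suc k) f"
proof -
  have "frechet_derivative f (at x) = F x" for x
    using frechet_derivative_at[OF assms(1)] by simp
  then show ?thesis
    using assms by (auto simp: differentiable_def)
qed

lemma C_k_SucD:
  assumes "C_k (Suc k) f"
  shows "(f has_derivative frechet_derivative f (at x)) (at x)"
    and "b \<in> Basis \<Longrightarrow> C_k k (\<lambda>x. frechet_derivative f (at x) b)"
  using assms by (auto simp: frechet_derivative_works[symmetric])

lemma C_k_Suc_imp: "C_k (Suc k) f \<Longrightarrow> C_k k f"
proof (induction k arbitrary: f)
  case 0
  then show ?case
    by (auto simp: continuous_on_eq_continuous_at intro: differentiable_imp_continuous_within)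
next
  case (Suc k)
  show ?case
    by (rule C_k_SucI[where F = "\<lambda>x. frechet_derivative f (at x)"])
      (use C_k_SucD[OF Suc.prems] Suc.IH in auto)
qed

lemma C_k_const: "C_k k (\<lambda>x. c)"
proof (induction k arbitrary: c)
  case (Suc k)
  show ?case by (rule C_k_SucI[where F = "\<lambda>x h. 0"]) (use Suc in auto)
qed auto

lemma C_k_add: "C_k k f \<Longrightarrow> C_k k g \<Longrightarrow> C_k k (\<lambda>x. f x + g x)"
proof (induction k arbitrary: f g)
  case (Suc k)
  show ?case
    by (rule C_k_SucI[where F = "\<lambda>x h. frechet_derivative f (at x) h + frechet_derivative g (at x) h"])
      (use Suc.IH C_k_SucD[OF Suc.prems(1)] C_k_SucD[OF Suc.prems(2)] in
        \<open>auto intro!: has_derivative_add\<close>)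
qed (auto intro: continuous_on_add)

lemma C_k_mult: "C_k k f \<Longrightarrow> C_k k g \<Longrightarrow> C_k k (\<lambda>x. f x * g x)"
proof (induction k arbitrary: f g)
  case (Suc k)
  show ?case
  proof (rule C_k_SucI[where F = "\<lambda>x h. f x * frechet_derivative g (at x) h + frechet_derivative f (at x) h * g x"])
    show "((\<lambda>x. f x * g x) has_derivative
          (\<lambda>h. f x * frechet_derivative g (at x) h + frechet_derivative f (at x) h * g x)) (at x)" for x
      by (rule has_derivative_mult) (use C_k_SucD(1) Suc.prems in blast)+
    show "C_k k (\<lambda>x. f x * frechet_derivative g (at x) b + frechet_derivative f (at x) b * g x)"
      if "b \<in> Basis" for b
      by (intro C_k_add Suc.IH) (use C_k_SucD(2) Suc.prems that C_k_Suc_imp in blast)+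
  qed
qed (auto intro: continuous_on_mult)

lemma C_k_prod: "(\<And>i. i \<in> I \<Longrightarrow> C_k k (f i)) \<Longrightarrow> C_k k (\<lambda>x. \<Prod>i\<in>I. f i x)"
  by (induction I rule: infinite_finite_induct) (auto intro: C_k_mult C_k_const)

lemma C_k_power: "C_k k f \<Longrightarrow> C_k k (\<lambda>x. f x ^ n)"
  by (induction n) (auto intro: C_k_mult C_k_const)

lemma C_k_minus: "C_k k f \<Longrightarrow> C_k k g \<Longrightarrow> C_k k (\<lambda>x. f x - g x)"
  using C_k_add[of k f "\<lambda>x. (-1) * g x"] C_k_mult[of k "\<lambda>x. -1" g] C_k_const by auto

text \<open>The partial derivatives of a ridge function are multiples of ridge functions with profile
  \<open>f'\<close>, so the induction does not leave this class.\<close>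

lemma C_k_ridge:
  fixes f :: "real \<Rightarrow> real" and v :: "'a::euclidean_space"
  shows "C_k k f \<Longrightarrow> C_k k (\<lambda>x. f (x \<bullet> v + c))"
proof (induction k arbitrary: f)
  case 0
  then show ?case
    by (auto intro!: continuous_on_compose2[where g = f and t = UNIV] continuous_intros)
next
  case (Suc k)
  let ?D = "\<lambda>y. frechet_derivative f (at y) 1"
  have lin: "frechet_derivative f (at y) h = h * ?D y" for y h
  proof -
    have "linear (frechet_derivative f (at y))"
      using C_k_SucD(1)[OF Suc.prems] has_derivative_linear by blast
    from linear_scale[OF this, of h 1] show ?thesis by simp
  qed
  show ?case
  proof (rule C_k_SucI[where F = "\<lambda>x h. (h \<bullet> v) * ?D (x \<bullet> v + c)"])
    show "((\<lambda>x. f (x \<bullet> v + c)) has_derivative (\<lambda>h. (h \<bullet> v) * ?D (x \<bullet> v + c))) (at x)" for x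
    proof -
      have "((\<lambda>x. x \<bullet> v + c) has_derivative (\<lambda>h. h \<bullet> v)) (at x)"
        by (auto intro!: derivative_eq_intros)
      from has_derivative_compose[OF this C_k_SucD(1)[OF Suc.prems]]
      show ?thesis by (simp only: lin[of "x \<bullet> v + c" "h \<bullet> v" for h])
    qed
    show "C_k k (\<lambda>x. (b \<bullet> v) * ?D (x \<bullet> v + c))" for b
      by (intro C_k_mult C_k_const Suc.IH C_k_SucD(2)[OF Suc.prems]) auto
  qed
qed

text \<open>The linear combinations of these functions are closed under differentiation and contain the
  classical smooth function \<open>exp (- (1 / t))\<close>, extended by zero, as \<open>flat 0\<close>.\<close>

definition flat :: "nat \<Rightarrow> real \<Rightarrow> real" where
  "flat n t = (if t > 0 then (1 / t) ^ n * exp (- (1 / t)) else 0)"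

lemma flat_tendsto_0: "(flat n \<longlongrightarrow> 0) (at_right 0)"
proof -
  have "((\<lambda>t. inverse t ^ n / exp (inverse t)) \<longlongrightarrow> 0) (at_right (0::real))"
    by (rule filterlim_compose[OF tendsto_power_div_exp_0 filterlim_inverse_at_top_right])
  then show ?thesis
    by (rule Lim_transform_eventually)
      (auto simp: flat_def eventually_at_right_field exp_minus field_simps intro!: exI[of _ 1])
qed

lemma flat_deriv: "(flat n has_real_derivative (flat (n + 2) t - real n * flat (n + 1) t)) (at t)"
proof -
  consider "t > 0" | "t < 0" | "t = 0" by linarith
  then show ?thesis
  proof cases
    case 1
    define y where "y = 1 / t"
    have y: "((\<lambda>t. 1 / t) has_real_derivative - (y ^ 2)) (at t)"
      using 1 DERIV_inverse[of t UNIV] by (simp add: y_def inverse_eq_divide power2_eq_square)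
    have "((\<lambda>t. (1 / t) ^ n * exp (- (1 / t))) has_real_derivative
        (real n * (1 / t) ^ (n - 1) * - (y ^ 2)) * exp (- (1 / t)) + (exp (- (1 / t)) * (y ^ 2)) * (1 / t) ^ n) (at t)"
    proof (rule DERIV_mult)
      show "((\<lambda>t. (1 / t) ^ n) has_real_derivative real n * (1 / t) ^ (n - 1) * - (y ^ 2)) (at t)"
        using DERIV_power[OF y, of n] by (simp add: algebra_simps)
      show "((\<lambda>t. exp (- (1 / t))) has_real_derivative exp (- (1 / t)) * y ^ 2) (at t)"
        using DERIV_chain2[OF DERIV_exp DERIV_minus[OF y]] by simp
    qed
    also have "(real n * (1 / t) ^ (n - 1) * - (y ^ 2)) * exp (- (1 / t)) + (exp (- (1 / t)) * (y ^ 2)) * (1 / t) ^ n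
        = flat (n + 2) t - real n * flat (n + 1) t"
      using 1 by (cases n) (simp_all add: flat_def y_def[symmetric] power2_eq_square)
    finally have "((\<lambda>t. (1 / t) ^ n * exp (- (1 / t))) has_real_derivative
        (flat (n + 2) t - real n * flat (n + 1) t)) (at t)" .
    then show ?thesis
      by (rule has_field_derivative_transform_within_open[where S = "{0<..}"]) (use 1 in \<open>auto simp: flat_def\<close>)
  next
    case 2
    have "((\<lambda>t. 0) has_real_derivative 0) (at t)" by simp
    then have "(flat n has_real_derivative 0) (at t)"
      by (rule has_field_derivative_transform_within_open[where S = "{..<0}"]) (use 2 in \<open>auto simp: flat_def\<close>)
    then show ?thesis using 2 by (simp add: flat_def)
  next
    case 3
    have r: "((\<lambda>h. flat n h / h) \<longlongrightarrow> 0) (at_right 0)"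
      by (rule Lim_transform_eventually[OF flat_tendsto_0[of "Suc n"]])
        (auto simp: flat_def eventually_at_right_field intro!: exI[of _ 1])
    have l: "((\<lambda>h. flat n h / h) \<longlongrightarrow> 0) (at_left 0)"
      by (rule Lim_transform_eventually[where f = "\<lambda>_. 0"])
        (auto simp: flat_def eventually_at_left_field intro!: exI[of _ "-1"])
    show ?thesis unfolding 3 using r l
      by (simp add: DERIV_def filterlim_split_at flat_def)
  qed
qed

lemma C_k_flat: "C_k k (flat n)"
proof (induction k arbitrary: n)
  case 0
  show ?case
    using flat_deriv by (auto simp: continuous_on_eq_continuous_at intro: DERIV_isCont)
next
  case (Suc k)
  show ?case
  proof (rule C_k_SucI[where F = "\<lambda>t h. (flat (n + 2) t - real n * flat (n + 1) t) * h"])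
    show "C_k k (\<lambda>t. (flat (n + 2) t - real n * flat (n + 1) t) * b)" for b
      by (intro C_k_mult C_k_minus C_k_const Suc)
  qed (use flat_deriv in \<open>auto simp: has_field_derivative_def\<close>)
qed

text \<open>Bumps that are positive exactly on an open box, rather than on a ball, because finite unions of
  boxes are what compact sets are covered with.\<close>

definition bump :: "'a::euclidean_space \<Rightarrow> 'a \<Rightarrow> 'a \<Rightarrow> real" where
  "bump a b x = (\<Prod>i\<in>Basis. flat 0 (x \<bullet> i - a \<bullet> i) * flat 0 (b \<bullet> i - x \<bullet> i))"

lemma C_k_bump: "C_k k (bump a b)"
proof -
  have "C_k k (\<lambda>x. flat 0 (x \<bullet> i - a \<bullet> i) * flat 0 (b \<bullet> i - x \<bullet> i))" for i
  proof (rule C_k_mult)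
    show "C_k k (\<lambda>x. flat 0 (x \<bullet> i - a \<bullet> i))"
      using C_k_ridge[OF C_k_flat[of k 0], of i "- (a \<bullet> i)"] by simp
    show "C_k k (\<lambda>x. flat 0 (b \<bullet> i - x \<bullet> i))"
      using C_k_ridge[OF C_k_flat[of k 0], of "- i" "b \<bullet> i"] by simp
  qed
  then show ?thesis unfolding bump_def[abs_def] by (rule C_k_prod)
qed

lemma flat_0_bounds: "0 \<le> flat 0 t" "flat 0 t \<le> 1" "flat 0 t > 0 \<longleftrightarrow> t > 0"
  unfolding flat_def by simp_all

lemma bump_bounds: "0 \<le> bump a b x" "bump a b x \<le> 1"
proof -
  have f: "0 \<le> flat 0 s * flat 0 t \<and> flat 0 s * flat 0 t \<le> 1" for s t
    using flat_0_bounds[of s] flat_0_bounds[of t] by (simp add: mult_le_one)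
  show "0 \<le> bump a b x" unfolding bump_def by (rule prod_nonneg) (use f in blast)
  show "bump a b x \<le> 1" unfolding bump_def by (rule prod_le_1) (use f in blast)
qed

lemma bump_pos_iff: "bump a b x > 0 \<longleftrightarrow> x \<in> box a b"
proof
  assume "x \<in> box a b"
  then show "bump a b x > 0" unfolding bump_def
    by (intro prod_pos) (auto simp: flat_0_bounds mem_box)
next
  assume "bump a b x > 0"
  then have "\<forall>i\<in>Basis. flat 0 (x \<bullet> i - a \<bullet> i) * flat 0 (b \<bullet> i - x \<bullet> i) \<noteq> 0"
    unfolding bump_def by (simp add: prod_zero_iff less_le)
  then have "\<forall>i\<in>Basis. flat 0 (x \<bullet> i - a \<bullet> i) > 0 \<and> flat 0 (b \<bullet> i - x \<bullet> i) > 0"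
    using flat_0_bounds(1) by (simp add: less_le)
  then show "x \<in> box a b" by (auto simp: flat_0_bounds mem_box)
qed

text \<open>The product of the functions \<open>1 - bump a b\<close> is one outside the boxes and less than one inside
  any of them, so its powers converge to the indicator function of the complement.\<close>

lemma test_functions_approx_boxes:
  fixes \<Omega> :: "'a::euclidean_space set" and F :: "('a \<times> 'a) set"
  assumes F: "finite F" "\<And>a b. (a, b) \<in> F \<Longrightarrow> cbox a b \<subseteq> \<Omega>"
  obtains \<psi> :: "nat \<Rightarrow> 'a \<Rightarrow> real"
  where "\<And>n. \<psi> n \<in> test_functions \<Omega>" "\<And>n x. 0 \<le> \<psi> n x" "\<And>n x. \<psi> n x \<le> 1"
    "\<And>n x. x \<notin> (\<Union>(a,b)\<in>F. box a b) \<Longrightarrow> \<psi> n x = 0"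
    "\<And>x. x \<in> (\<Union>(a,b)\<in>F. box a b) \<Longrightarrow> (\<lambda>n. \<psi> n x) \<longlonglongrightarrow> 1"
proof
  define \<psi> where "\<psi> n x = 1 - (\<Prod>(a,b)\<in>F. 1 - bump a b x) ^ n" for n x
  let ?P = "\<lambda>x. \<Prod>(a,b)\<in>F. 1 - bump a b x"
  have q: "0 \<le> (case z of (a, b) \<Rightarrow> 1 - bump a b x) \<and> (case z of (a, b) \<Rightarrow> 1 - bump a b x) \<le> 1" for z x
    by (cases z) (simp add: bump_bounds)
  have P: "0 \<le> ?P x" "?P x \<le> 1" for x
    by (rule prod_nonneg, use q in blast) (rule prod_le_1, use q in blast)
  have P1: "?P x = 1" if "x \<notin> (\<Union>(a,b)\<in>F. box a b)" for x
  proof -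
    have "bump a b x = 0" if "(a, b) \<in> F" for a b
      using that \<open>x \<notin> _\<close> bump_pos_iff[of a b x] bump_bounds(1)[of a b x] by fastforce
    then show ?thesis by (intro prod.neutral) auto
  qed
  have P2: "?P x < 1" if "x \<in> (\<Union>(a,b)\<in>F. box a b)" for x
  proof -
    from that obtain a b where ab: "(a, b) \<in> F" "x \<in> box a b" by auto
    have "?P x = (1 - bump a b x) * (\<Prod>(a,b)\<in>F - {(a,b)}. 1 - bump a b x)"
      using F(1) ab by (subst prod.remove[of _ "(a,b)"]) auto
    also have "\<dots> \<le> (1 - bump a b x) * 1"
      by (rule mult_left_mono, rule prod_le_1, use q in blast) (simp add: bump_bounds)
    also have "\<dots> < 1" using ab bump_pos_iff by auto
    finally show ?thesis .
  qed
  show 0: "\<psi> n x = 0" if "x \<notin> (\<Union>(a,b)\<in>F. box a b)" for n x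
    using P1[OF that] by (simp add: \<psi>_def)
  show "0 \<le> \<psi> n x" "\<psi> n x \<le> 1" for n x
    using P[of x] by (auto simp: \<psi>_def power_le_one)
  show "(\<lambda>n. \<psi> n x) \<longlonglongrightarrow> 1" if "x \<in> (\<Union>(a,b)\<in>F. box a b)" for x
    using tendsto_diff[OF tendsto_const LIMSEQ_realpow_zero[OF P(1) P2[OF that]], of 1]
    by (simp add: \<psi>_def)
  show "\<psi> n \<in> test_functions \<Omega>" for n
  proof -
    have "C_k k (\<psi> n)" for k unfolding \<psi>_def[abs_def] case_prod_unfold
      by (intro C_k_minus C_k_power C_k_prod C_k_const C_k_bump)
    moreover have sub: "closure {x. \<psi> n x \<noteq> 0} \<subseteq> (\<Union>(a,b)\<in>F. cbox a b)"
    proof (rule closure_minimal)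
      show "{x. \<psi> n x \<noteq> 0} \<subseteq> (\<Union>(a,b)\<in>F. cbox a b)"
        using 0 box_subset_cbox by fastforce
      show "closed (\<Union>(a,b)\<in>F. cbox a b)" using F(1) by auto
    qed
    moreover have "compact (\<Union>(a,b)\<in>F. cbox a b)" using F(1) by auto
    moreover have "(\<Union>(a,b)\<in>F. cbox a b) \<subseteq> \<Omega>" using F(2) by auto
    ultimately show ?thesis
      using closed_Int_compact[OF closed_closure, of "\<Union>(a,b)\<in>F. cbox a b" "{x. \<psi> n x \<noteq> 0}"]
      by (simp add: test_functions_def Int_absorb2 subset_trans[OF sub])
  qed
qed

lemma integral_lebesgue_on_mult_indicator:
  fixes f :: "'a::euclidean_space \<Rightarrow> real"
  assumes "S \<in> sets lebesgue" "T \<in> sets lebesgue" "T \<subseteq> S"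
  shows "(LINT x|lebesgue_on S. f x * indicator T x) = (LINT x|lebesgue_on T. f x)"
proof -
  have "(LINT x|lebesgue_on S. f x * indicator T x) = (LINT x|lebesgue. indicator S x *\<^sub>R (f x * indicator T x))"
    using assms by (subst integral_restrict_space) auto
  also have "\<dots> = (LINT x|lebesgue. indicator T x *\<^sub>R f x)"
    using assms(3) by (intro Bochner_Integration.integral_cong) (auto simp: indicator_def)
  also have "\<dots> = (LINT x|lebesgue_on T. f x)"
    using assms by (subst integral_restrict_space) auto
  finally show ?thesis .
qed

lemma integrable_lebesgue_on_mult_indicator:
  fixes f :: "'a::euclidean_space \<Rightarrow> real"
  assumes "S \<in> sets lebesgue" "T \<in> sets lebesgue" "T \<subseteq> S"
  shows "integrable (lebesgue_on S) (\<lambda>x. f x * indicator T x) \<longleftrightarrow> integrable (lebesgue_on T) f"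
proof -
  have "integrable (lebesgue_on S) (\<lambda>x. f x * indicator T x) \<longleftrightarrow>
      integrable lebesgue (\<lambda>x. indicator S x *\<^sub>R (f x * indicator T x))"
    using assms by (subst integrable_restrict_space) auto
  also have "\<dots> \<longleftrightarrow> integrable lebesgue (\<lambda>x. indicator T x *\<^sub>R f x)"
    using assms(3) by (intro Bochner_Integration.integrable_cong) (auto simp: indicator_def)
  also have "\<dots> \<longleftrightarrow> integrable (lebesgue_on T) f"
    using assms by (subst integrable_restrict_space) auto
  finally show ?thesis .
qed

text \<open>The indicator function of \<open>K\<close> is a limit of indicator functions of finite unions of boxes that
  shrink to \<open>K\<close>, and each of these is a limit of test functions with values between zero and one.  Dominated
  convergence on a compact neighbourhood of \<open>K\<close> carries the inequality through both limits.\<close>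

lemma integral_compact_nonneg:
  fixes f :: "'a::euclidean_space \<Rightarrow> real"
  assumes \<Omega>: "open \<Omega>" and f: "locally_integrable \<Omega> f"
    and nn: "\<forall>\<phi>\<in>test_functions \<Omega>. (\<forall>x. 0 \<le> \<phi> x \<and> \<phi> x \<le> 1) \<longrightarrow>
        0 \<le> (LINT x|lebesgue_on \<Omega>. f x * \<phi> x)"
    and K: "compact K" "K \<subseteq> \<Omega>"
  shows "0 \<le> (LINT x|lebesgue_on K. f x)"
proof (cases "K = {}")
  case True
  then show ?thesis by (simp add: integral_restrict_space)
next
  case False
  obtain d where d: "d > 0" "\<And>x. x \<in> K \<Longrightarrow> cball x d \<subseteq> \<Omega>"
  proof (cases "\<Omega> = UNIV")
    case True
    then show ?thesis using that[of 1] by auto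
  next
    case False
    have "setdist K (- \<Omega>) > 0"
      using setdist_gt_0_compact_closed[of K "- \<Omega>"] K \<Omega> False \<open>K \<noteq> {}\<close> by auto
    moreover have "cball x (setdist K (- \<Omega>) / 2) \<subseteq> \<Omega>" if "x \<in> K" for x
    proof
      fix y assume y: "y \<in> cball x (setdist K (- \<Omega>) / 2)"
      show "y \<in> \<Omega>"
      proof (rule ccontr)
        assume "y \<notin> \<Omega>"
        then have "setdist K (- \<Omega>) \<le> dist x y" using that by (intro setdist_le_dist) auto
        then show False using y \<open>setdist K (- \<Omega>) > 0\<close> by simp
      qed
    qed
    ultimately show ?thesis using that[of "setdist K (- \<Omega>) / 2"] by simp
  qed
  \<comment> \<open>A compact neighbourhood of \<open>K\<close> in \<open>\<Omega>\<close>: there \<open>f\<close> is integrable and serves as majorant.\<close>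
  define K' where "K' = {x + y | x y. x \<in> K \<and> y \<in> cball 0 d}"
  have K': "compact K'" unfolding K'_def
    by (rule compact_sums[OF K(1) compact_cball])
  have mem_K': "z \<in> K'" if "x \<in> K" "dist x z \<le> d" for x z
    unfolding K'_def mem_Collect_eq using that
    by (intro exI[of _ x] exI[of _ "z - x"]) (simp add: dist_norm norm_minus_commute)
  have K'\<Omega>: "K' \<subseteq> \<Omega>"
  proof
    fix z assume "z \<in> K'"
    then obtain x y where "z = x + y" "x \<in> K" "y \<in> cball 0 d" unfolding K'_def by blast
    then show "z \<in> \<Omega>" using d(2)[of x] by (auto simp: subset_eq dist_norm)
  qed
  have S[measurable]: "K' \<in> sets lebesgue" "K \<in> sets lebesgue" "\<Omega> \<in> sets lebesgue"
    using K' K \<Omega> by (auto intro: lmeasurable_compact fmeasurableD)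
  have fK': "integrable (lebesgue_on \<Omega>) (\<lambda>x. f x * indicator K' x)"
    using f K' K'\<Omega> S by (subst integrable_lebesgue_on_mult_indicator) (auto simp: locally_integrable_def)
  have "\<exists>W. open W \<and> K \<subseteq> W \<and> W \<subseteq> (\<Union>x\<in>K. cball x (d / real (Suc m))) \<and>
      0 \<le> (LINT x|lebesgue_on \<Omega>. f x * indicator W x)" for m
  proof -
    define e where "e = d / real (Suc m)"
    have e: "e > 0" "e \<le> d" using d(1) by (auto simp: e_def field_simps)
    have "\<forall>x::'a. \<exists>a b. x \<in> box a b \<and> cbox a b \<subseteq> cball x e"
    proof
      fix x :: 'a
      obtain a b where "x \<in> box a b" "cbox a b \<subseteq> ball x e"
        using open_contains_cbox[OF open_ball, of x x e] e(1) by (metis centre_in_ball)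
      then show "\<exists>a b. x \<in> box a b \<and> cbox a b \<subseteq> cball x e" using ball_subset_cball by blast
    qed
    then obtain a b where ab: "\<And>x::'a. x \<in> box (a x) (b x)" "\<And>x. cbox (a x) (b x) \<subseteq> cball x e"
      by metis
    obtain C where C: "C \<subseteq> K" "finite C" "K \<subseteq> (\<Union>x\<in>C. box (a x) (b x))"
    proof -
      have "K \<subseteq> (\<Union>x\<in>K. box (a x) (b x))" using ab(1) by blast
      from compactE_image[OF K(1) open_box this] that show ?thesis by blast
    qed
    define F where "F = (\<lambda>x. (a x, b x)) ` C"
    have F: "finite F" "\<And>a b. (a, b) \<in> F \<Longrightarrow> cbox a b \<subseteq> \<Omega>"
    proof -
      show "finite F" unfolding F_def using C(2) by simp
      fix u v assume "(u, v) \<in> F"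
      then obtain x where x: "x \<in> C" "u = a x" "v = b x" unfolding F_def by auto
      have "cbox u v \<subseteq> cball x d" using ab(2)[of x] e(2) x by auto
      then show "cbox u v \<subseteq> \<Omega>" using d(2)[of x] x(1) C(1) by blast
    qed
    obtain \<psi> where \<psi>: "\<And>n. \<psi> n \<in> test_functions \<Omega>" "\<And>n x. 0 \<le> \<psi> n x" "\<And>n x. \<psi> n x \<le> 1"
      "\<And>n x. x \<notin> (\<Union>(a,b)\<in>F. box a b) \<Longrightarrow> \<psi> n x = 0"
      "\<And>x. x \<in> (\<Union>(a,b)\<in>F. box a b) \<Longrightarrow> (\<lambda>n. \<psi> n x) \<longlonglongrightarrow> 1"
      using test_functions_approx_boxes[OF F] by metis
    define W where "W = (\<Union>(a,b)\<in>F. box a b)"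
    have W1: "open W" "K \<subseteq> W" unfolding W_def F_def using C by auto
    have W2: "W \<subseteq> (\<Union>x\<in>K. cball x e)" unfolding W_def F_def using C(1) ab(2) box_subset_cbox by fastforce
    have WK': "W \<subseteq> K'" using W2 mem_K' e(2) by (auto simp: subset_eq)
    have eq: "f x * indicator K' x * \<psi> n x = f x * \<psi> n x" for n x
      using WK' \<psi>(4)[of x n] by (cases "x \<in> W") (auto simp: W_def[symmetric] indicator_def subset_eq)
    have meas[measurable]: "\<psi> n \<in> borel_measurable (lebesgue_on \<Omega>)" for n
    proof -
      have "C_k 0 (\<psi> n)" using \<psi>(1)[of n] unfolding test_functions_def by blast
      then show ?thesis
        by (auto intro!: continuous_imp_measurable_on_sets_lebesgue S intro: continuous_on_subset)
    qed
    have "(\<lambda>n. LINT x|lebesgue_on \<Omega>. f x * indicator K' x * \<psi> n x) \<longlonglongrightarrow>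
        (LINT x|lebesgue_on \<Omega>. f x * indicator K' x * indicator W x)"
    proof (rule integral_dominated_convergence[where w = "\<lambda>x. \<bar>f x * indicator K' x\<bar>"])
      have "(\<lambda>n. \<psi> n x) \<longlonglongrightarrow> indicator W x" for x
        using \<psi>(4)[of x] \<psi>(5)[of x] by (cases "x \<in> W") (auto simp: W_def[symmetric])
      then show "AE x in lebesgue_on \<Omega>. (\<lambda>n. f x * indicator K' x * \<psi> n x) \<longlonglongrightarrow> f x * indicator K' x * indicator W x"
        by (auto intro!: tendsto_intros)
      have "\<bar>\<psi> n x\<bar> \<le> 1" for n x using \<psi>(2,3)[of n x] by simp
      then show "AE x in lebesgue_on \<Omega>. norm (f x * indicator K' x * \<psi> n x) \<le> \<bar>f x * indicator K' x\<bar>" for n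
        by (simp add: abs_mult mult_left_le)
      have "W \<in> sets lebesgue" using W1(1) by auto
      then show "(\<lambda>x. f x * indicator K' x * indicator W x) \<in> borel_measurable (lebesgue_on \<Omega>)"
        using WK' K'\<Omega> S
        by (intro borel_measurable_times[OF borel_measurable_integrable[OF fK']] borel_measurable_indicator)
          (simp add: sets_restrict_space_iff)
    qed (use fK' in auto)
    moreover have "f x * indicator K' x * indicator W x = f x * indicator W x" for x
      using WK' by (auto simp: indicator_def)
    ultimately have "0 \<le> (LINT x|lebesgue_on \<Omega>. f x * indicator W x)"
      unfolding eq using nn \<psi>(1-3) by (intro LIMSEQ_le_const) auto
    with W1 W2 show ?thesis by (auto simp: e_def)
  qed
  then obtain W where W: "\<And>m. open (W m)" "\<And>m. K \<subseteq> W m"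
      "\<And>m. W m \<subseteq> (\<Union>x\<in>K. cball x (d / real (Suc m)))"
      "\<And>m. 0 \<le> (LINT x|lebesgue_on \<Omega>. f x * indicator (W m) x)"
    by metis
  have ed: "d / real (Suc m) \<le> d" for m using d(1) by (auto simp: field_simps)
  have WK': "W m \<subseteq> K'" for m
    using W(3)[of m] mem_K' ed[of m] by (force simp: subset_eq)
  have lim: "(\<lambda>m. indicator (W m) x :: real) \<longlonglongrightarrow> indicator K x" for x
  proof (cases "x \<in> K")
    case True
    then show ?thesis using W(2) by (simp add: subset_eq)
  next
    case False
    then have "infdist x K > 0"
      using K(1) \<open>K \<noteq> {}\<close> by (simp add: compact_imp_closed infdist_pos_not_in_closed)
    moreover have "(\<lambda>m. d / real (Suc m)) \<longlonglongrightarrow> 0"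
      by (rule LIMSEQ_Suc[OF lim_const_over_n])
    ultimately have "\<forall>\<^sub>F m in sequentially. d / real (Suc m) < infdist x K"
      by (rule order_tendstoD(2)[rotated])
    then have "\<forall>\<^sub>F m in sequentially. indicator (W m) x = (0::real)"
    proof eventually_elim
      case (elim m)
      have "x \<notin> W m"
      proof
        assume "x \<in> W m"
        then obtain y where "y \<in> K" "dist y x \<le> d / real (Suc m)" using W(3)[of m] by auto
        then show False using elim infdist_le[of y K x] by (simp add: dist_commute)
      qed
      then show ?case by simp
    qed
    then show ?thesis using False by (simp add: tendsto_eventually)
  qed
  have "(\<lambda>m. LINT x|lebesgue_on \<Omega>. f x * indicator K' x * indicator (W m) x) \<longlonglongrightarrow>
        (LINT x|lebesgue_on \<Omega>. f x * indicator K' x * indicator K x)"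
  proof (rule integral_dominated_convergence[where w = "\<lambda>x. \<bar>f x * indicator K' x\<bar>"])
    show "AE x in lebesgue_on \<Omega>. (\<lambda>n. f x * indicator K' x * indicator (W n) x) \<longlonglongrightarrow> f x * indicator K' x * indicator K x"
      using lim by (auto intro!: tendsto_intros)
    show "AE x in lebesgue_on \<Omega>. norm (f x * indicator K' x * indicator (W n) x) \<le> \<bar>f x * indicator K' x\<bar>" for n
      by (auto simp: abs_mult indicator_def)
    show "(\<lambda>x. f x * indicator K' x * indicator K x) \<in> borel_measurable (lebesgue_on \<Omega>)"
      using K(2) K'\<Omega> K S
      by (intro borel_measurable_times[OF borel_measurable_integrable[OF fK']] borel_measurable_indicator)
        (simp add: sets_restrict_space_iff)
    have "W n \<in> sets lebesgue" for n using W(1) by auto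
    then show "(\<lambda>x. f x * indicator K' x * indicator (W n) x) \<in> borel_measurable (lebesgue_on \<Omega>)" for n
      using WK'[of n] K'\<Omega> K S
      by (intro borel_measurable_times[OF borel_measurable_integrable[OF fK']] borel_measurable_indicator)
        (simp add: sets_restrict_space_iff)
  qed (use fK' in auto)
  moreover have "f x * indicator K' x * indicator (W m) x = f x * indicator (W m) x" for m x
    using WK' by (auto simp: indicator_def subset_eq)
  moreover have "f x * indicator K' x * indicator K x = f x * indicator K x" for x
    using mem_K'[of x x] d(1) by (auto simp: indicator_def)
  ultimately have "0 \<le> (LINT x|lebesgue_on \<Omega>. f x * indicator K x)"
    using W(4) by (intro LIMSEQ_le_const) auto
  then show ?thesis
    using K S by (simp add: integral_lebesgue_on_mult_indicator)
qed

text \<open>The fundamental lemma of the calculus of variations in one-sided form.  If \<open>f\<close> were negative on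
  a set of positive measure, then by inner regularity also on a compact set of positive measure, and its
  integral over that set would be negative.\<close>

lemma AE_nonneg_of_test_functions:
  fixes f :: "'a::euclidean_space \<Rightarrow> real"
  assumes \<Omega>: "open \<Omega>" and f: "locally_integrable \<Omega> f"
    and nn: "\<forall>\<phi>\<in>test_functions \<Omega>. (\<forall>x. 0 \<le> \<phi> x \<and> \<phi> x \<le> 1) \<longrightarrow>
        0 \<le> (LINT x|lebesgue_on \<Omega>. f x * \<phi> x)"
  shows "AE x in lebesgue_on \<Omega>. 0 \<le> f x"
proof -
  note Knn = integral_compact_nonneg[OF \<Omega> f nn]
  obtain \<D> where \<D>: "countable \<D>" "\<And>X. X \<in> \<D> \<Longrightarrow> X \<subseteq> \<Omega>" "\<And>X. X \<in> \<D> \<Longrightarrow> \<exists>a b. X = cbox a b" "\<Union>\<D> = \<Omega>"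
    by (rule open_countable_Union_open_cbox[OF \<Omega>]) blast
  have null_compact: "T \<in> null_sets lebesgue" if T: "compact T" "T \<subseteq> \<Omega>" "\<And>x. x \<in> T \<Longrightarrow> f x < 0" for T
  proof -
    have Tl: "T \<in> sets lebesgue" using T by (auto intro: lmeasurable_compact fmeasurableD)
    have int: "integrable (lebesgue_on T) f" using f T by (auto simp: locally_integrable_def)
    have 1: "integral\<^sup>L (lebesgue_on T) (\<lambda>x. - f x) \<le> 0" using Knn[OF T(1,2)] by auto
    have 2: "AE x in lebesgue_on T. 0 \<le> - f x" using T(3) by (auto intro!: AE_I2 simp: less_imp_le)
    have "integral\<^sup>L (lebesgue_on T) (\<lambda>x. - f x) = 0"
      using 1 integral_nonneg_AE[OF 2] by linarith
    then have "AE x in lebesgue_on T. - f x = 0"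
      using integral_nonneg_eq_0_iff_AE[OF _ 2] int by auto
    then have "AE x in lebesgue_on T. False"
      by (rule AE_mp) (rule AE_I2, use T(3) in fastforce)
    then have "AE x in lebesgue. x \<notin> T"
      using Tl by (subst (asm) AE_restrict_space_iff) auto
    then show ?thesis using Tl by (simp add: AE_iff_null_sets)
  qed
  have "AE x in lebesgue. x \<in> X \<longrightarrow> 0 \<le> f x" if XD: "X \<in> \<D>" for X
  proof -
    obtain a b where X: "X = cbox a b" using \<D>(3)[OF XD] by auto
    have Xl: "X \<in> sets lebesgue" by (auto simp: X)
    have "integrable (lebesgue_on X) f" using f \<D>(2)[OF XD] X by (auto simp: locally_integrable_def)
    then have "f \<in> borel_measurable (lebesgue_on X)" by auto
    then have "{x \<in> space (lebesgue_on X). f x < 0} \<in> sets (lebesgue_on X)" by measurable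
    then have N: "{x\<in>X. f x < 0} \<in> sets lebesgue"
      using Xl by (auto simp: sets_restrict_space_iff)
    have "emeasure lebesgue {x\<in>X. f x < 0} \<le> ennreal e" if "e > 0" for e
    proof -
      obtain T where T: "closed T" "T \<subseteq> {x\<in>X. f x < 0}" "emeasure lebesgue ({x\<in>X. f x < 0} - T) < ennreal e"
        by (rule sets_lebesgue_inner_closed[OF N \<open>e > 0\<close>])
      have "bounded T" using T(2) X by (intro bounded_subset[OF bounded_cbox[of a b]]) auto
      then have "compact T" using T(1) by (simp add: compact_eq_bounded_closed)
      then have T0: "T \<in> null_sets lebesgue" using T(2) \<D>(2)[OF \<open>X \<in> \<D>\<close>] by (intro null_compact) auto
      have "emeasure lebesgue {x\<in>X. f x < 0} \<le> emeasure lebesgue (({x\<in>X. f x < 0} - T) \<union> T)"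
        using N T0 by (intro emeasure_mono) auto
      also have "\<dots> \<le> emeasure lebesgue ({x\<in>X. f x < 0} - T) + emeasure lebesgue T"
        using N T0 by (intro emeasure_subadditive) auto
      also have "\<dots> \<le> ennreal e" using T(3) T0 by (simp add: null_setsD1)
      finally show ?thesis .
    qed
    then have "emeasure lebesgue {x\<in>X. f x < 0} \<le> 0"
      using ennreal_le_epsilon[of 0] by simp
    then have "{x\<in>X. f x < 0} \<in> null_sets lebesgue" using N by auto
    then show ?thesis by (rule AE_I') auto
  qed
  then have "AE x in lebesgue. \<forall>X\<in>\<D>. x \<in> X \<longrightarrow> 0 \<le> f x"
    by (subst AE_ball_countable[OF \<D>(1)]) blast
  then have "AE x in lebesgue. x \<in> \<Omega> \<longrightarrow> 0 \<le> f x" by (rule AE_mp) (rule AE_I2, use \<D>(4) in blast)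
  then show ?thesis using \<Omega> by (subst AE_restrict_space_iff) auto
qed

section \<open>Test functions and weak gradients\<close>

lemma test_functionsD:
  assumes "\<phi> \<in> test_functions \<Omega>"
  shows "C_k k \<phi>" "compact (closure {x. \<phi> x \<noteq> 0})" "closure {x. \<phi> x \<noteq> 0} \<subseteq> \<Omega>"
  using assms by (auto simp: test_functions_def)

lemma has_derivative_test_function:
  assumes "\<phi> \<in> test_functions \<Omega>"
  shows "(\<phi> has_derivative (\<lambda>h. grad \<phi> x \<bullet> h)) (at x)"
proof -
  let ?D = "frechet_derivative \<phi> (at x)"
  have D: "(\<phi> has_derivative ?D) (at x)" by (rule C_k_SucD[OF test_functionsD(1)[OF assms, of "Suc 0"]])
  have "?D h = grad \<phi> x \<bullet> h" for h
  proof -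
    have "?D h = ?D (\<Sum>b\<in>Basis. (h \<bullet> b) *\<^sub>R b)" by (simp add: euclidean_representation)
    also have "\<dots> = (\<Sum>b\<in>Basis. (h \<bullet> b) * ?D b)"
      using has_derivative_linear[OF D] by (simp add: linear_sum linear_scale)
    also have "\<dots> = grad \<phi> x \<bullet> h"
      by (simp add: grad_def inner_sum_left inner_commute[of h] mult.commute)
    finally show ?thesis .
  qed
  then have "?D = (\<lambda>h. grad \<phi> x \<bullet> h)" by (rule ext)
  then show ?thesis using D by simp
qed

lemma grad_eqI:
  fixes f :: "'a::euclidean_space \<Rightarrow> real"
  assumes "(f has_derivative (\<lambda>h. g \<bullet> h)) (at x)"
  shows "grad f x = g"
proof -
  have "frechet_derivative f (at x) = (\<lambda>h. g \<bullet> h)"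
    using frechet_derivative_at[OF assms] by simp
  then show ?thesis by (simp add: grad_def euclidean_representation)
qed

lemma continuous_on_test_function:
  assumes "\<phi> \<in> test_functions \<Omega>"
  shows "continuous_on A \<phi>" "continuous_on A (grad \<phi>)"
proof -
  have "C_k 0 \<phi>" by (rule test_functionsD(1)[OF assms])
  then show "continuous_on A \<phi>" using continuous_on_subset by auto
  have "C_k 0 (\<lambda>x. frechet_derivative \<phi> (at x) b)" if "b \<in> Basis" for b
    using C_k_SucD(2)[OF test_functionsD(1)[OF assms, of "Suc 0"] that] .
  then have "continuous_on UNIV (grad \<phi>)"
    unfolding grad_def[abs_def] by (auto intro!: continuous_intros)
  then show "continuous_on A (grad \<phi>)" using continuous_on_subset by auto
qed

lemma borel_measurable_test_function [measurable_dest]: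
  assumes "\<phi> \<in> test_functions \<Omega>"
  shows "\<phi> \<in> borel_measurable borel" "grad \<phi> \<in> borel_measurable borel"
  using continuous_on_test_function[OF assms] by (auto intro: borel_measurable_continuous_onI)

lemma test_function_support:
  assumes "\<phi> \<in> test_functions \<Omega>" "x \<notin> closure {x. \<phi> x \<noteq> 0}"
  shows "\<phi> x = 0" "grad \<phi> x = 0"
proof -
  show "\<phi> x = 0" using assms(2) closure_subset[of "{x. \<phi> x \<noteq> 0}"] by auto
  have "((\<lambda>x. 0) has_derivative (\<lambda>h. 0 \<bullet> h)) (at x)" by simp
  then have "(\<phi> has_derivative (\<lambda>h. 0 \<bullet> h)) (at x)"
  proof (rule has_derivative_transform_within_open)
    show "open (- closure {x. \<phi> x \<noteq> 0})" by (rule open_Compl[OF closed_closure])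
    show "x \<in> - closure {x. \<phi> x \<noteq> 0}" using assms by blast
    show "0 = \<phi> y" if "y \<in> - closure {x. \<phi> x \<noteq> 0}" for y
      using that closure_subset[of "{x. \<phi> x \<noteq> 0}"] by auto
  qed
  then show "grad \<phi> x = 0" by (rule grad_eqI)
qed

lemma test_function_outside:
  assumes "\<phi> \<in> test_functions \<Omega>" "x \<notin> \<Omega>"
  shows "\<phi> x = 0" "grad \<phi> x = 0"
  using test_function_support[OF assms(1)] test_functionsD(3)[OF assms(1)] assms(2) by blast+

lemma test_function_bounded:
  assumes "\<phi> \<in> test_functions \<Omega>"
  obtains B where "B > 0" "\<And>x. \<bar>\<phi> x\<bar> \<le> B" "\<And>x. norm (grad \<phi> x) \<le> B"
proof -
  let ?K = "closure {x. \<phi> x \<noteq> 0}"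
  have "bounded (\<phi> ` ?K)"
    by (rule compact_imp_bounded[OF compact_continuous_image[OF continuous_on_test_function(1)[OF assms] test_functionsD(2)[OF assms]]])
  moreover have "bounded (grad \<phi> ` ?K)"
    by (rule compact_imp_bounded[OF compact_continuous_image[OF continuous_on_test_function(2)[OF assms] test_functionsD(2)[OF assms]]])
  ultimately obtain B1 B2 where B: "\<And>x. x \<in> ?K \<Longrightarrow> norm (\<phi> x) \<le> B1" "\<And>x. x \<in> ?K \<Longrightarrow> norm (grad \<phi> x) \<le> B2"
    by (auto simp: bounded_iff)
  show ?thesis
  proof (rule that[of "\<bar>B1\<bar> + \<bar>B2\<bar> + 1"])
    show "\<bar>\<phi> x\<bar> \<le> \<bar>B1\<bar> + \<bar>B2\<bar> + 1" for x
      using B(1)[of x] test_function_support[OF assms, of x] by (cases "x \<in> ?K") auto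
    show "norm (grad \<phi> x) \<le> \<bar>B1\<bar> + \<bar>B2\<bar> + 1" for x
      using B(2)[of x] test_function_support[OF assms, of x] by (cases "x \<in> ?K") auto
  qed simp
qed

lemma test_functions_closedI:
  assumes "\<And>k. C_k k f" "\<phi> \<in> test_functions \<Omega>" "\<psi> \<in> test_functions \<Omega>"
    and "\<And>x. \<phi> x = 0 \<Longrightarrow> \<psi> x = 0 \<Longrightarrow> f x = 0"
  shows "f \<in> test_functions \<Omega>"
proof -
  let ?K = "closure {x. \<phi> x \<noteq> 0} \<union> closure {x. \<psi> x \<noteq> 0}"
  have K: "compact ?K" "?K \<subseteq> \<Omega>" using test_functionsD(2,3) assms(2,3) by blast+
  have "{x. f x \<noteq> 0} \<subseteq> {x. \<phi> x \<noteq> 0} \<union> {x. \<psi> x \<noteq> 0}" using assms(4) by blast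
  then have "closure {x. f x \<noteq> 0} \<subseteq> ?K" by (metis closure_Un closure_mono)
  then show ?thesis
    using K assms(1) closed_Int_compact[OF closed_closure[of "{x. f x \<noteq> 0}"] K(1)]
    by (auto simp: test_functions_def Int_absorb2)
qed

lemma test_functions_lincomb:
  assumes "\<phi> \<in> test_functions \<Omega>" "\<psi> \<in> test_functions \<Omega>"
  shows "(\<lambda>x. a * \<phi> x + b * \<psi> x) \<in> test_functions \<Omega>"
    and "grad (\<lambda>x. a * \<phi> x + b * \<psi> x) x = a *\<^sub>R grad \<phi> x + b *\<^sub>R grad \<psi> x"
proof -
  show "(\<lambda>x. a * \<phi> x + b * \<psi> x) \<in> test_functions \<Omega>"
    by (rule test_functions_closedI[OF _ assms]) (auto intro!: C_k_add C_k_mult C_k_const test_functionsD(1)[OF assms(1)] test_functionsD(1)[OF assms(2)])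
  show "grad (\<lambda>x. a * \<phi> x + b * \<psi> x) x = a *\<^sub>R grad \<phi> x + b *\<^sub>R grad \<psi> x"
    by (rule grad_eqI) (auto intro!: derivative_eq_intros
      has_derivative_test_function[OF assms(1)] has_derivative_test_function[OF assms(2)] simp: inner_add_left)
qed

lemma test_functions_mult:
  assumes "\<phi> \<in> test_functions \<Omega>" "\<psi> \<in> test_functions \<Omega>"
  shows "(\<lambda>x. \<phi> x * \<psi> x) \<in> test_functions \<Omega>"
    and "grad (\<lambda>x. \<phi> x * \<psi> x) x = \<phi> x *\<^sub>R grad \<psi> x + \<psi> x *\<^sub>R grad \<phi> x"
proof -
  show "(\<lambda>x. \<phi> x * \<psi> x) \<in> test_functions \<Omega>"
    by (rule test_functions_closedI[OF _ assms]) (auto intro!: C_k_mult test_functionsD(1)[OF assms(1)] test_functionsD(1)[OF assms(2)])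
  show "grad (\<lambda>x. \<phi> x * \<psi> x) x = \<phi> x *\<^sub>R grad \<psi> x + \<psi> x *\<^sub>R grad \<phi> x"
    by (rule grad_eqI) (auto intro!: derivative_eq_intros
      has_derivative_test_function[OF assms(1)] has_derivative_test_function[OF assms(2)]
      simp: inner_add_left algebra_simps)
qed

lemma test_functions_zero: "(\<lambda>x. 0) \<in> test_functions \<Omega>" "grad (\<lambda>x. 0) x = 0"
proof -
  show "(\<lambda>x. 0) \<in> test_functions \<Omega>" by (simp add: test_functions_def C_k_const)
  show "grad (\<lambda>x. 0) x = 0" by (rule grad_eqI) simp
qed

lemma integral_lebesgue_on_eq_lborel:
  fixes f :: "'a::euclidean_space \<Rightarrow> 'b::euclidean_space"
  assumes "S \<in> sets lebesgue" "f \<in> borel_measurable borel" "\<And>x. x \<notin> S \<Longrightarrow> f x = 0"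
  shows "(LINT x|lebesgue_on S. f x) = (LINT x|lborel. f x)"
    and "integrable (lebesgue_on S) f \<longleftrightarrow> integrable lborel f"
proof -
  have e: "(\<lambda>x. indicator S x *\<^sub>R f x) = f" using assms(3) by (auto simp: indicator_def fun_eq_iff)
  show "(LINT x|lebesgue_on S. f x) = (LINT x|lborel. f x)"
    using assms(1,2) by (simp add: integral_restrict_space e integral_completion)
  show "integrable (lebesgue_on S) f \<longleftrightarrow> integrable lborel f"
    using assms(1,2) by (simp add: integrable_restrict_space e integrable_completion)
qed

lemma nn_integral_lebesgue_on_eq_lborel:
  fixes f :: "'a::euclidean_space \<Rightarrow> ennreal"
  assumes "S \<in> sets lebesgue" "f \<in> borel_measurable borel" "\<And>x. x \<notin> S \<Longrightarrow> f x = 0"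
  shows "(\<integral>\<^sup>+x. f x \<partial>lebesgue_on S) = (\<integral>\<^sup>+x. f x \<partial>lborel)"
proof -
  have e: "f x * indicator S x = f x" for x using assms(3) by (auto simp: indicator_def)
  show ?thesis
    using assms(1,2) by (simp add: nn_integral_restrict_space e nn_integral_completion)
qed

lemma integrable_lebesgue_on_support:
  fixes f :: "'a::euclidean_space \<Rightarrow> 'b::euclidean_space"
  assumes "S \<in> sets lebesgue" "T \<in> sets lebesgue" "T \<subseteq> S" "\<And>x. x \<in> S - T \<Longrightarrow> f x = 0"
  shows "integrable (lebesgue_on S) f \<longleftrightarrow> integrable (lebesgue_on T) f"
proof -
  have e: "(\<lambda>x. indicator S x *\<^sub>R f x) = (\<lambda>x. indicator T x *\<^sub>R f x)"
    using assms(3,4) by (auto simp: indicator_def fun_eq_iff)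
  show ?thesis using assms(1,2) by (simp add: integrable_restrict_space e)
qed

lemma integrable_locally_integrable_test:
  fixes g :: "'a::euclidean_space \<Rightarrow> 'b::euclidean_space"
  assumes \<Omega>: "open \<Omega>" and g: "locally_integrable \<Omega> g" and \<phi>: "\<phi> \<in> test_functions \<Omega>"
  shows "integrable (lebesgue_on \<Omega>) (\<lambda>x. \<phi> x *\<^sub>R g x)"
proof -
  let ?K = "closure {x. \<phi> x \<noteq> 0}"
  obtain B where B: "\<And>x. \<bar>\<phi> x\<bar> \<le> B" using test_function_bounded[OF \<phi>] by metis
  have K: "compact ?K" "?K \<subseteq> \<Omega>" using test_functionsD[OF \<phi>] by auto
  have int: "integrable (lebesgue_on ?K) g" using g K by (auto simp: locally_integrable_def)
  have m: "\<phi> \<in> borel_measurable (lebesgue_on ?K)"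
    using borel_measurable_test_function(1)[OF \<phi>] by (intro measurable_restrict_space1 measurable_completion) simp
  have "integrable (lebesgue_on ?K) (\<lambda>x. \<phi> x *\<^sub>R g x)"
  proof (rule Bochner_Integration.integrable_bound[where f = "\<lambda>x. B *\<^sub>R g x"])
    show "integrable (lebesgue_on ?K) (\<lambda>x. B *\<^sub>R g x)" using int by simp
    show "(\<lambda>x. \<phi> x *\<^sub>R g x) \<in> borel_measurable (lebesgue_on ?K)"
      by (intro borel_measurable_scaleR m borel_measurable_integrable[OF int])
    have "norm (\<phi> x *\<^sub>R g x) \<le> norm (B *\<^sub>R g x)" for x
      using B[of x] by (simp add: mult_right_mono)
    then show "AE x in lebesgue_on ?K. norm (\<phi> x *\<^sub>R g x) \<le> norm (B *\<^sub>R g x)" by simp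
  qed
  moreover have "\<Omega> \<in> sets lebesgue" "?K \<in> sets lebesgue"
    using \<Omega> K(1) by (simp_all add: lmeasurable_compact fmeasurableD)
  moreover have "\<phi> x *\<^sub>R g x = 0" if "x \<in> \<Omega> - ?K" for x
    using test_function_support(1)[OF \<phi>, of x] that by simp
  ultimately show ?thesis
    using integrable_lebesgue_on_support[of \<Omega> ?K "\<lambda>x. \<phi> x *\<^sub>R g x"] K(2) by blast
qed

lemma test_function_lipschitz:
  assumes \<phi>: "\<phi> \<in> test_functions \<Omega>" and B: "\<And>x. norm (grad \<phi> x) \<le> B"
  shows "\<bar>\<phi> x - \<phi> y\<bar> \<le> B * norm (x - y)"
proof -
  have "norm (\<phi> x - \<phi> y) \<le> B * norm (x - y)"
  proof (rule differentiable_bound[of UNIV \<phi> "\<lambda>x h. grad \<phi> x \<bullet> h"])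
    show "(\<phi> has_derivative (\<lambda>h. grad \<phi> x \<bullet> h)) (at x within UNIV)" for x
      using has_derivative_test_function[OF \<phi>] by simp
    show "onorm ((\<bullet>) (grad \<phi> x)) \<le> B" for x
    proof (rule onorm_le)
      fix h
      have "norm (grad \<phi> x \<bullet> h) \<le> norm (grad \<phi> x) * norm h" by (rule Cauchy_Schwarz_ineq2[folded real_norm_def])
      also have "\<dots> \<le> B * norm h" using B by (simp add: mult_right_mono)
      finally show "norm (grad \<phi> x \<bullet> h) \<le> B * norm h" .
    qed
  qed auto
  then show ?thesis by simp
qed

lemma lborel_integral_translation:
  fixes f :: "'a::euclidean_space \<Rightarrow> 'b::euclidean_space"
  assumes [measurable]: "f \<in> borel_measurable borel"
  shows "(LINT x|lborel. f (x + c)) = (LINT x|lborel. f x)"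
proof -
  have "(LINT x|lborel. f x) = (LINT x|distr lborel borel ((+) c). f x)"
    by (simp add: lborel_distr_plus)
  also have "\<dots> = (LINT x|lborel. f (c + x))" by (rule integral_distr) auto
  finally show ?thesis by (simp add: add.commute)
qed

lemma lborel_nn_integral_translation:
  fixes f :: "'a::euclidean_space \<Rightarrow> ennreal"
  assumes [measurable]: "f \<in> borel_measurable borel"
  shows "(\<integral>\<^sup>+x. f (x + c) \<partial>lborel) = (\<integral>\<^sup>+x. f x \<partial>lborel)"
proof -
  have "(\<integral>\<^sup>+x. f x \<partial>lborel) = (\<integral>\<^sup>+x. f x \<partial>distr lborel borel ((+) c))"
    by (simp add: lborel_distr_plus)
  also have "\<dots> = (\<integral>\<^sup>+x. f (c + x) \<partial>lborel)" by (rule nn_integral_distr) auto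
  finally show ?thesis by (simp add: add.commute)
qed

lemma integrable_test_function:
  fixes \<phi> :: "'a::euclidean_space \<Rightarrow> real"
  assumes \<phi>: "\<phi> \<in> test_functions \<Omega>"
  shows "integrable lborel \<phi>" "integrable lborel (grad \<phi>)"
proof -
  let ?K = "closure {x. \<phi> x \<noteq> 0}"
  have 1: "indicator ?K x *\<^sub>R \<phi> x = \<phi> x" "indicator ?K x *\<^sub>R grad \<phi> x = grad \<phi> x" for x
  proof -
    consider "x \<in> ?K" | "x \<notin> ?K" by blast
    then show "indicator ?K x *\<^sub>R \<phi> x = \<phi> x" "indicator ?K x *\<^sub>R grad \<phi> x = grad \<phi> x"
      by (cases; simp only: indicator_simps test_function_support[OF \<phi>] scaleR_one scaleR_zero_right)+
  qed
  show "integrable lborel \<phi>" "integrable lborel (grad \<phi>)"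
    using borel_integrable_compact[OF test_functionsD(2)[OF \<phi>] continuous_on_test_function(1)[OF \<phi>]]
      borel_integrable_compact[OF test_functionsD(2)[OF \<phi>] continuous_on_test_function(2)[OF \<phi>]]
    unfolding 1 by auto
qed

text \<open>The integral of every difference quotient vanishes by translation invariance, and the quotients
  are dominated by a multiple of the indicator function of a compact set.\<close>

lemma integral_grad_test_function:
  fixes \<phi> :: "'a::euclidean_space \<Rightarrow> real"
  assumes \<phi>: "\<phi> \<in> test_functions \<Omega>"
  shows "(LINT x|lborel. grad \<phi> x) = 0"
proof (rule euclidean_eqI)
  fix b :: 'a assume b: "b \<in> Basis"
  obtain B where B: "B > 0" "\<And>x. norm (grad \<phi> x) \<le> B" using test_function_bounded[OF \<phi>] by metis
  let ?K = "closure {x. \<phi> x \<noteq> 0}"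
  define K where "K = {x + y | x y. x \<in> ?K \<and> y \<in> cball 0 (1::real)}"
  have K: "compact K" unfolding K_def by (rule compact_sums[OF test_functionsD(2)[OF \<phi>] compact_cball])
  define s where "s n = inverse (real (Suc n))" for n
  have s: "0 < s n" "s n \<le> 1" for n by (auto simp: s_def field_simps)
  have s0: "s \<longlonglongrightarrow> 0" unfolding s_def by (rule LIMSEQ_inverse_real_of_nat)
  define q where "q n x = (\<phi> (x + s n *\<^sub>R b) - \<phi> x) / s n" for n x
  note [measurable] = borel_measurable_test_function[OF \<phi>]
  have "(\<lambda>n. LINT x|lborel. q n x) \<longlonglongrightarrow> (LINT x|lborel. grad \<phi> x \<bullet> b)"
  proof (rule integral_dominated_convergence[where w = "\<lambda>x. indicator K x *\<^sub>R B"])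
    show "integrable lborel (\<lambda>x. indicator K x *\<^sub>R B)"
      by (rule borel_integrable_compact[OF K]) auto
    show "AE x in lborel. (\<lambda>n. q n x) \<longlonglongrightarrow> grad \<phi> x \<bullet> b"
    proof (rule AE_I2)
      fix x
      have "((\<lambda>t. \<phi> (x + t *\<^sub>R b)) has_derivative (\<lambda>h. grad \<phi> x \<bullet> (h *\<^sub>R b))) (at 0)"
        by (rule has_derivative_compose[where g = \<phi> and f = "\<lambda>t. x + t *\<^sub>R b"])
          (use has_derivative_test_function[OF \<phi>, of x] in \<open>auto intro!: derivative_eq_intros\<close>)
      then have "((\<lambda>t. \<phi> (x + t *\<^sub>R b)) has_real_derivative (grad \<phi> x \<bullet> b)) (at 0)"
        by (simp add: has_field_derivative_def mult.commute[of _ "grad \<phi> x \<bullet> b"])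
      then have "((\<lambda>h. (\<phi> (x + h *\<^sub>R b) - \<phi> x) / h) \<longlongrightarrow> grad \<phi> x \<bullet> b) (at 0)"
        by (simp add: DERIV_def)
      moreover have "filterlim s (at 0) sequentially"
        using s0 s(1) by (auto simp: filterlim_at less_imp_neq[THEN not_sym] intro!: always_eventually)
      ultimately show "(\<lambda>n. q n x) \<longlonglongrightarrow> grad \<phi> x \<bullet> b"
        unfolding q_def by (rule filterlim_compose)
    qed
    show "AE x in lborel. norm (q n x) \<le> indicator K x *\<^sub>R B" for n
    proof (rule AE_I2)
      fix x
      have 1: "\<bar>q n x\<bar> \<le> B"
        using test_function_lipschitz[OF \<phi> B(2), of "x + s n *\<^sub>R b" x] s[of n] b
        by (simp add: q_def abs_divide divide_le_eq)
      have 2: "q n x = 0" if "x \<notin> K"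
      proof -
        have "x \<notin> ?K"
        proof
          assume "x \<in> ?K"
          then have "x + 0 \<in> K" unfolding K_def by (intro CollectI exI[of _ x] exI[of _ 0]) auto
          then show False using that by simp
        qed
        moreover have "x + s n *\<^sub>R b \<notin> ?K"
        proof
          assume "x + s n *\<^sub>R b \<in> ?K"
          then have "(x + s n *\<^sub>R b) + (- (s n *\<^sub>R b)) \<in> K" unfolding K_def
            by (intro CollectI exI[of _ "x + s n *\<^sub>R b"] exI[of _ "- (s n *\<^sub>R b)"]) (use s[of n] b in auto)
          then show False using that by simp
        qed
        ultimately have "\<phi> x = 0" "\<phi> (x + s n *\<^sub>R b) = 0" using test_function_support(1)[OF \<phi>] by blast+
        then show ?thesis by (simp add: q_def)
      qed
      show "norm (q n x) \<le> indicator K x *\<^sub>R B" using 1 2 by (cases "x \<in> K") auto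
    qed
  qed (unfold q_def, measurable)
  moreover have "(LINT x|lborel. q n x) = 0" for n
  proof -
    have 1: "(LINT x|lborel. \<phi> (x + s n *\<^sub>R b)) = (LINT x|lborel. \<phi> x)"
      by (rule lborel_integral_translation) simp
    have 2: "integrable lborel (\<lambda>x. \<phi> (x + s n *\<^sub>R b))"
    proof -
      have "integrable (distr lborel borel ((+) (s n *\<^sub>R b))) \<phi>"
        using integrable_test_function(1)[OF \<phi>] by (simp add: lborel_distr_plus)
      then show ?thesis by (subst (asm) integrable_distr_eq) (auto simp: add.commute)
    qed
    show ?thesis unfolding q_def using 1 2 integrable_test_function(1)[OF \<phi>] by simp
  qed
  ultimately have "(LINT x|lborel. grad \<phi> x \<bullet> b) = 0" using LIMSEQ_unique[OF _ tendsto_const] by simp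
  then show "(LINT x|lborel. grad \<phi> x) \<bullet> b = 0 \<bullet> b"
    using integrable_test_function(2)[OF \<phi>] by simp
qed

lemma locally_integrable_integrable:
  fixes f :: "'a::euclidean_space \<Rightarrow> 'b::euclidean_space"
  assumes "open \<Omega>" "integrable (lebesgue_on \<Omega>) f"
  shows "locally_integrable \<Omega> f"
  unfolding locally_integrable_def
proof (intro allI impI)
  fix K :: "'a set" assume K: "compact K \<and> K \<subseteq> \<Omega>"
  then have Kl: "K \<in> sets lebesgue" by (auto intro: lmeasurable_compact fmeasurableD)
  have "integrable lebesgue (\<lambda>x. indicator K x *\<^sub>R (indicator \<Omega> x *\<^sub>R f x))"
    by (rule integrable_mult_indicator[OF Kl]) (use assms in \<open>simp add: integrable_restrict_space\<close>)
  also have "(\<lambda>x. indicator K x *\<^sub>R (indicator \<Omega> x *\<^sub>R f x)) = (\<lambda>x. indicator K x *\<^sub>R f x)"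
    using K by (auto simp: indicator_def fun_eq_iff)
  finally show "integrable (lebesgue_on K) f" using Kl by (simp add: integrable_restrict_space)
qed

text \<open>Integration by parts: the gradient of a product of two test functions has integral zero.\<close>

lemma has_weak_grad_test_function:
  fixes \<phi> :: "'a::euclidean_space \<Rightarrow> real"
  assumes \<Omega>: "open \<Omega>" and \<phi>: "\<phi> \<in> test_functions \<Omega>"
  shows "has_weak_grad \<Omega> \<phi> (grad \<phi>)"
proof -
  have \<Omega>l: "\<Omega> \<in> sets lebesgue" using \<Omega> by auto
  note L = integral_lebesgue_on_eq_lborel(2)[OF \<Omega>l]
  note [measurable] = borel_measurable_test_function[OF \<phi>]
  have li: "locally_integrable \<Omega> \<phi>" "locally_integrable \<Omega> (grad \<phi>)"
    using integrable_test_function[OF \<phi>] test_function_outside[OF \<phi>]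
    by (auto intro!: locally_integrable_integrable[OF \<Omega>] L[THEN iffD2])
  have "(LINT x|lebesgue_on \<Omega>. \<phi> x *\<^sub>R grad \<psi> x) = - (LINT x|lebesgue_on \<Omega>. \<psi> x *\<^sub>R grad \<phi> x)"
    if \<psi>: "\<psi> \<in> test_functions \<Omega>" for \<psi>
  proof -
    have li': "locally_integrable \<Omega> (grad \<psi>)"
      using integrable_test_function[OF \<psi>] test_function_outside[OF \<psi>] borel_measurable_test_function[OF \<psi>]
      by (auto intro!: locally_integrable_integrable[OF \<Omega>] L[THEN iffD2])
    have i: "integrable (lebesgue_on \<Omega>) (\<lambda>x. \<phi> x *\<^sub>R grad \<psi> x)" "integrable (lebesgue_on \<Omega>) (\<lambda>x. \<psi> x *\<^sub>R grad \<phi> x)"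
      by (rule integrable_locally_integrable_test[OF \<Omega>] li li' \<phi> \<psi>)+
    have "(LINT x|lebesgue_on \<Omega>. \<phi> x *\<^sub>R grad \<psi> x + \<psi> x *\<^sub>R grad \<phi> x) = (LINT x|lebesgue_on \<Omega>. grad (\<lambda>x. \<phi> x * \<psi> x) x)"
      by (simp add: test_functions_mult(2)[OF \<phi> \<psi>])
    also have "\<dots> = 0"
      using integral_grad_test_function[OF test_functions_mult(1)[OF \<phi> \<psi>]]
        test_function_outside(2)[OF test_functions_mult(1)[OF \<phi> \<psi>]]
        borel_measurable_test_function(2)[OF test_functions_mult(1)[OF \<phi> \<psi>]]
      by (subst integral_lebesgue_on_eq_lborel(1)[OF \<Omega>l]) auto
    finally show ?thesis using i by (simp add: add_eq_0_iff2)
  qed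
  with li show ?thesis by (auto simp: has_weak_grad_def)
qed

lemma AE_zero_of_test_functions:
  fixes f :: "'a::euclidean_space \<Rightarrow> real"
  assumes \<Omega>: "open \<Omega>" and f: "locally_integrable \<Omega> f"
    and z: "\<And>\<phi>. \<phi> \<in> test_functions \<Omega> \<Longrightarrow> (LINT x|lebesgue_on \<Omega>. \<phi> x * f x) = 0"
  shows "AE x in lebesgue_on \<Omega>. f x = 0"
proof -
  have "AE x in lebesgue_on \<Omega>. 0 \<le> f x"
    using z by (intro AE_nonneg_of_test_functions[OF \<Omega> f]) (auto simp: mult.commute)
  moreover have "locally_integrable \<Omega> (\<lambda>x. - f x)" using f by (auto simp: locally_integrable_def)
  then have "AE x in lebesgue_on \<Omega>. 0 \<le> - f x"
    using z by (intro AE_nonneg_of_test_functions[OF \<Omega>]) (auto simp: mult.commute)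
  ultimately show ?thesis by eventually_elim auto
qed

text \<open>The difference of two weak gradients annihilates all test functions, coordinate by coordinate.\<close>

lemma weak_grad_unique:
  fixes u :: "'a::euclidean_space \<Rightarrow> real"
  assumes \<Omega>: "open \<Omega>" and g: "has_weak_grad \<Omega> u g" and h: "has_weak_grad \<Omega> u h"
  shows "AE x in lebesgue_on \<Omega>. g x = h x"
proof -
  have lg: "locally_integrable \<Omega> g" and lh: "locally_integrable \<Omega> h" using g h by (auto simp: has_weak_grad_def)
  have "AE x in lebesgue_on \<Omega>. (g x - h x) \<bullet> b = 0" if b: "b \<in> Basis" for b
  proof (rule AE_zero_of_test_functions[OF \<Omega>])
    show "locally_integrable \<Omega> (\<lambda>x. (g x - h x) \<bullet> b)" using lg lh by (auto simp: locally_integrable_def)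
    fix \<phi> assume \<phi>: "\<phi> \<in> test_functions \<Omega>"
    have i: "integrable (lebesgue_on \<Omega>) (\<lambda>x. \<phi> x *\<^sub>R g x)" "integrable (lebesgue_on \<Omega>) (\<lambda>x. \<phi> x *\<^sub>R h x)"
      by (rule integrable_locally_integrable_test[OF \<Omega>] lg lh \<phi>)+
    have "(LINT x|lebesgue_on \<Omega>. \<phi> x *\<^sub>R g x) = (LINT x|lebesgue_on \<Omega>. \<phi> x *\<^sub>R h x)"
      using g h \<phi> by (auto simp: has_weak_grad_def)
    then have "(LINT x|lebesgue_on \<Omega>. \<phi> x *\<^sub>R g x - \<phi> x *\<^sub>R h x) \<bullet> b = 0" using i by simp
    then have "(LINT x|lebesgue_on \<Omega>. (\<phi> x *\<^sub>R g x - \<phi> x *\<^sub>R h x) \<bullet> b) = 0" using i by simp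
    then show "(LINT x|lebesgue_on \<Omega>. \<phi> x * ((g x - h x) \<bullet> b)) = 0"
      by (simp add: inner_diff_left right_diff_distrib)
  qed
  then have "AE x in lebesgue_on \<Omega>. \<forall>b\<in>Basis. (g x - h x) \<bullet> b = 0"
    by (subst AE_ball_countable) (auto intro: countable_finite)
  then show ?thesis
  proof eventually_elim
    case (elim x)
    then have "g x - h x = 0" by (subst euclidean_all_zero_iff[symmetric]) auto
    then show ?case by simp
  qed
qed

section \<open>The Clarke subdifferential of a function of one real variable\<close>

definition dq :: "(real \<Rightarrow> real) \<Rightarrow> real \<Rightarrow> real \<Rightarrow> real \<Rightarrow> real" where
  "dq f t y s = (f (t + y + s) - f (t + y)) / s"

lemma eventually_nhds_at_right_0:
  "eventually P (nhds (0::real) \<times>\<^sub>F at_right (0::real)) \<longleftrightarrow>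
    (\<exists>d>0. \<forall>y s. \<bar>y\<bar> < d \<and> 0 < s \<and> s < d \<longrightarrow> P (y, s))"
proof
  assume "eventually P (nhds (0::real) \<times>\<^sub>F at_right (0::real))"
  then obtain Q R where Q: "eventually Q (nhds (0::real))" and R: "eventually R (at_right (0::real))"
    and QR: "\<And>y s. Q y \<Longrightarrow> R s \<Longrightarrow> P (y, s)" by (auto simp: eventually_prod_filter)
  obtain d1 where "d1 > 0" "\<And>y. \<bar>y\<bar> < d1 \<Longrightarrow> Q y" using Q by (auto simp: eventually_nhds_metric)
  moreover obtain d2 where "d2 > 0" "\<And>s. 0 < s \<Longrightarrow> s < d2 \<Longrightarrow> R s"
    using R by (auto simp: eventually_at_right_field)
  ultimately show "\<exists>d>0. \<forall>y s. \<bar>y\<bar> < d \<and> 0 < s \<and> s < d \<longrightarrow> P (y, s)"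
    using QR by (intro exI[of _ "min d1 d2"]) auto
next
  assume "\<exists>d>0. \<forall>y s. \<bar>y\<bar> < d \<and> 0 < s \<and> s < d \<longrightarrow> P (y, s)"
  then obtain d where d: "d > 0" "\<And>y s. \<bar>y\<bar> < d \<Longrightarrow> 0 < s \<Longrightarrow> s < d \<Longrightarrow> P (y, s)" by blast
  show "eventually P (nhds (0::real) \<times>\<^sub>F at_right (0::real))"
    unfolding eventually_prod_filter
  proof (intro exI conjI allI impI)
    show "eventually (\<lambda>y. \<bar>y\<bar> < d) (nhds (0::real))" using d(1) by (auto simp: eventually_nhds_metric)
    show "eventually (\<lambda>s. 0 < s \<and> s < d) (at_right (0::real))"
      using d(1) by (auto simp: eventually_at_right_field)
  qed (use d in auto)
qed

lemma le_clarke_deriv_iff: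
  "ereal v \<le> clarke_deriv f t h \<longleftrightarrow>
    (\<forall>c<v. \<forall>d>0. \<exists>y s. \<bar>y\<bar> < d \<and> 0 < s \<and> s < d \<and> c < (f (t + y + s * h) - f (t + y)) / s)"
  (is "_ \<longleftrightarrow> ?R")
proof -
  let ?F = "nhds (0::real) \<times>\<^sub>F at_right (0::real)"
  let ?X = "\<lambda>(x', s). ereal ((f (t + x' + s *\<^sub>R h) - f (t + x')) / s)"
  have C: "clarke_deriv f t h = Limsup ?F ?X" by (simp add: clarke_deriv_def)
  show ?thesis
  proof
    assume L: "ereal v \<le> clarke_deriv f t h"
    show ?R
    proof (intro allI impI, rule ccontr)
      fix c d :: real assume c: "c < v" and d: "d > 0"
        and n: "\<nexists>y s. \<bar>y\<bar> < d \<and> 0 < s \<and> s < d \<and> c < (f (t + y + s * h) - f (t + y)) / s"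
      have "eventually (\<lambda>x. ?X x \<le> ereal c) ?F"
        unfolding eventually_nhds_at_right_0 using n d by (intro exI[of _ d]) (clarsimp, meson not_less)
      then have "Limsup ?F ?X \<le> ereal c" by (rule Limsup_bounded)
      then have "ereal v \<le> ereal c" using L C by (metis order_trans)
      then show False using c by simp
    qed
  next
    assume R: ?R
    show "ereal v \<le> clarke_deriv f t h"
    proof (rule ccontr)
      assume "\<not> ereal v \<le> clarke_deriv f t h"
      then have "Limsup ?F ?X < ereal v" using C by simp
      from ereal_dense2[OF this] obtain c where c: "Limsup ?F ?X < ereal c" "c < v" by auto
      then have "eventually (\<lambda>x. ?X x < ereal c) ?F"
        using Limsup_le_iff[THEN iffD1, OF order_refl] by blast
      then obtain d where d: "d > 0"
        "\<And>y s. \<bar>y\<bar> < d \<Longrightarrow> 0 < s \<Longrightarrow> s < d \<Longrightarrow> (f (t + y + s * h) - f (t + y)) / s < c"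
        unfolding eventually_nhds_at_right_0 by auto
      obtain y s where "\<bar>y\<bar> < d" "0 < s" "s < d" "c < (f (t + y + s * h) - f (t + y)) / s"
        using R c(2) d(1) by blast
      then show False using d(2)[of y s] by simp
    qed
  qed
qed

text \<open>By homogeneity only the directions one and minus one matter.  A difference quotient in a negative
  direction is a reversed quotient in the positive direction with its base at the other end of the step, which
  still tends to \<open>t\<close>.\<close>

lemma clarke_subdiffI:
  assumes up: "\<And>c d. c < v \<Longrightarrow> d > 0 \<Longrightarrow> \<exists>y s. \<bar>y\<bar> < d \<and> 0 < s \<and> s < d \<and> c < dq f t y s"
    and lo: "\<And>c d. v < c \<Longrightarrow> d > 0 \<Longrightarrow> \<exists>y s. \<bar>y\<bar> < d \<and> 0 < s \<and> s < d \<and> dq f t y s < c"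
  shows "v \<in> clarke_subdiff f t"
  unfolding clarke_subdiff_def mem_Collect_eq
proof
  fix h :: real
  consider "h = 0" | "h > 0" | "h < 0" by linarith
  then show "ereal (v * h) \<le> clarke_deriv f t h"
  proof cases
    case 1
    then show ?thesis unfolding le_clarke_deriv_iff
    proof (intro allI impI)
      fix c d :: real assume "c < v * h" "d > 0"
      then show "\<exists>y s. \<bar>y\<bar> < d \<and> 0 < s \<and> s < d \<and> c < (f (t + y + s * h) - f (t + y)) / s"
        using 1 by (intro exI[of _ 0] exI[of _ "d / 2"]) simp
    qed
  next
    case 2
    show ?thesis unfolding le_clarke_deriv_iff
    proof (intro allI impI)
      fix c d :: real assume c: "c < v * h" and d: "d > 0"
      have "c / h < v" using 2 c by (simp add: divide_less_eq)
      moreover have "min d (d * h) > 0" using d 2 by simp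
      ultimately obtain y s where ys: "\<bar>y\<bar> < min d (d * h)" "0 < s" "s < min d (d * h)" "c / h < dq f t y s"
        using up by blast
      have "c < (f (t + y + s / h * h) - f (t + y)) / (s / h)"
        using ys(2,4) 2 by (simp add: dq_def field_simps)
      moreover have "s / h < d" using ys(3) 2 by (simp add: divide_less_eq)
      ultimately show "\<exists>y s. \<bar>y\<bar> < d \<and> 0 < s \<and> s < d \<and> c < (f (t + y + s * h) - f (t + y)) / s"
        using ys 2 by (intro exI[of _ y] exI[of _ "s / h"]) simp
    qed
  next
    case 3
    show ?thesis unfolding le_clarke_deriv_iff
    proof (intro allI impI)
      fix c d :: real assume c: "c < v * h" and d: "d > 0"
      define e where "e = min (d / 2) (min (d * (- h)) (d / 2))"
      have "v < c / h" using 3 c by (simp add: less_divide_eq)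
      moreover have "e > 0" using d 3 by (simp add: e_def mult_pos_neg)
      ultimately obtain y s where ys: "\<bar>y\<bar> < e" "0 < s" "s < e" "dq f t y s < c / h"
        using lo by blast
      have "c < (f (t + (y + s) + s / (- h) * h) - f (t + (y + s))) / (s / (- h))"
        using ys(2,4) 3 by (simp add: dq_def field_simps)
      moreover have "s / (- h) < d" using ys(3) 3 by (subst pos_divide_less_eq) (auto simp: e_def)
      moreover have "\<bar>y + s\<bar> < d" using ys by (auto simp: e_def abs_if split: if_splits)
      ultimately show "\<exists>y s. \<bar>y\<bar> < d \<and> 0 < s \<and> s < d \<and> c < (f (t + y + s * h) - f (t + y)) / s"
        using ys 3 by (intro exI[of _ "y + s"] exI[of _ "s / (- h)"]) (simp add: divide_pos_neg)
    qed
  qed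
qed

text \<open>Base points and steps are restricted to rational numbers so that the extrema below are countable
  and hence measurable in a parameter.  For continuous \<open>f\<close>, by \<open>dq_dense\<close>, the restriction does not change
  them: \<open>clarke_hi\<close> and \<open>clarke_lo\<close> are \<open>f\<^sup>0(t; 1)\<close> and \<open>- f\<^sup>0(t; - 1)\<close>, the endpoints of the Clarke
  subdifferential.\<close>

definition qpairs :: "nat \<Rightarrow> (real \<times> real) set" where
  "qpairs n = {(y, s). y \<in> \<rat> \<and> s \<in> \<rat> \<and> \<bar>y\<bar> < 1 / real (Suc n) \<and> 0 < s \<and> s < 1 / real (Suc n)}"

definition clarke_hi :: "(real \<Rightarrow> real) \<Rightarrow> real \<Rightarrow> ereal" where
  "clarke_hi f t = (INF n. SUP (y, s)\<in>qpairs n. ereal (dq f t y s))"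

definition clarke_lo :: "(real \<Rightarrow> real) \<Rightarrow> real \<Rightarrow> ereal" where
  "clarke_lo f t = (SUP n. INF (y, s)\<in>qpairs n. ereal (dq f t y s))"

lemma countable_qpairs: "countable (qpairs n)"
  by (rule countable_subset[of _ "\<rat> \<times> \<rat>"]) (auto simp: qpairs_def intro!: countable_SIGMA countable_rat)

lemma qpairs_nonempty: "qpairs n \<noteq> {}"
proof -
  obtain s :: real where "s \<in> \<rat>" "0 < s" "s < 1 / real (Suc n)"
    using Rats_dense_in_real[of 0 "1 / real (Suc n)"] by auto
  then have "(0, s) \<in> qpairs n" by (auto simp: qpairs_def)
  then show ?thesis by blast
qed

lemma qpairs_antimono: "m \<le> n \<Longrightarrow> qpairs n \<subseteq> qpairs m"
proof -
  assume "m \<le> n"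
  then have "1 / real (Suc n) \<le> 1 / real (Suc m)" by (simp add: frac_le)
  then show ?thesis by (auto simp: qpairs_def intro: less_le_trans)
qed

lemma locally_lipschitz_continuous:
  fixes f :: "real \<Rightarrow> real"
  assumes "locally_lipschitz f" shows "continuous_on UNIV f"
proof -
  have "isCont f x" for x
  proof -
    obtain \<rho> L where \<rho>: "\<rho> > 0" "L-lipschitz_on (ball x \<rho>) f" using assms unfolding locally_lipschitz_def by blast
    have "continuous_on (ball x \<rho>) f" by (rule lipschitz_on_continuous_on[OF \<rho>(2)])
    then show ?thesis using \<rho>(1) by (simp add: continuous_on_eq_continuous_at)
  qed
  then show ?thesis by (simp add: continuous_on_eq_continuous_at)
qed

lemma Rats_meet_open:
  fixes y :: real
  assumes "open A" "y \<in> A"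
  obtains q where "q \<in> \<rat>" "q \<in> A"
proof -
  obtain e where e: "e > 0" "ball y e \<subseteq> A" using assms by (auto simp: open_contains_ball)
  obtain q where "q \<in> \<rat>" "y < q" "q < y + e" using Rats_dense_in_real[of y "y + e"] e(1) by auto
  then show ?thesis using that e(2) by (auto simp: subset_eq dist_real_def)
qed

lemma dq_dense:
  assumes cont: "continuous_on UNIV f"
    and P: "open P" and b: "dq f t y s \<in> P" "\<bar>y\<bar> < d" "0 < s" "s < d"
  obtains y' s' where "y' \<in> \<rat>" "s' \<in> \<rat>" "\<bar>y'\<bar> < d" "0 < s'" "s' < d" "dq f t y' s' \<in> P"
proof -
  define U where "U = {-d<..<d} \<times> {0<..<d}"
  have oU: "open U" unfolding U_def by (intro open_Times) auto
  have c: "continuous_on U (\<lambda>z. dq f t (fst z) (snd z))"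
    unfolding dq_def U_def by (intro continuous_intros continuous_on_compose2[OF cont]) auto
  define V where "V = U \<inter> (\<lambda>z. dq f t (fst z) (snd z)) -` P"
  have oV: "open V" unfolding V_def by (rule continuous_open_preimage[OF c oU P])
  have "(y, s) \<in> V" using b by (auto simp: V_def U_def)
  then obtain A B where "open A" "open B" "(y, s) \<in> A \<times> B" "A \<times> B \<subseteq> V"
    by (rule open_prod_elim[OF oV])
  then have AB: "open A" "open B" "y \<in> A" "s \<in> B" "A \<times> B \<subseteq> V" by auto
  obtain y' where y': "y' \<in> \<rat>" "y' \<in> A" by (rule Rats_meet_open[OF AB(1,3)])
  obtain s' where s': "s' \<in> \<rat>" "s' \<in> B" by (rule Rats_meet_open[OF AB(2,4)])
  have "(y', s') \<in> V" using AB(5) y' s' by blast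
  then show ?thesis using that[OF y'(1) s'(1)] by (auto simp: V_def U_def)
qed

lemma clarke_hi_lessD:
  assumes cont: "continuous_on UNIV f" and c: "clarke_hi f t < ereal c"
  shows "\<exists>d>0. \<forall>y s. \<bar>y\<bar> < d \<and> 0 < s \<and> s < d \<longrightarrow> dq f t y s \<le> c"
proof -
  obtain n where n: "(SUP (y, s)\<in>qpairs n. ereal (dq f t y s)) < ereal c"
    using c unfolding clarke_hi_def by (auto simp: INF_less_iff)
  have "dq f t y s \<le> c" if ys: "\<bar>y\<bar> < 1 / real (Suc n)" "0 < s" "s < 1 / real (Suc n)" for y s
  proof (rule ccontr)
    assume "\<not> dq f t y s \<le> c"
    then have "dq f t y s \<in> {c<..}" by simp
    then obtain y' s' where "y' \<in> \<rat>" "s' \<in> \<rat>" "\<bar>y'\<bar> < 1 / real (Suc n)" "0 < s'" "s' < 1 / real (Suc n)"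
        "dq f t y' s' \<in> {c<..}"
      by (rule dq_dense[OF cont open_greaterThan _ ys])
    then have "(y', s') \<in> qpairs n" "c < dq f t y' s'" by (simp_all add: qpairs_def)
    then have "ereal c < ereal (dq f t y' s')" "ereal (dq f t y' s') \<le> (SUP (y, s)\<in>qpairs n. ereal (dq f t y s))"
      by (auto intro: SUP_upper2)
    then show False using n by order
  qed
  then show ?thesis by (intro exI[of _ "1 / real (Suc n)"]) auto
qed

lemma clarke_lo_greaterD:
  assumes cont: "continuous_on UNIV f" and c: "ereal c < clarke_lo f t"
  shows "\<exists>d>0. \<forall>y s. \<bar>y\<bar> < d \<and> 0 < s \<and> s < d \<longrightarrow> c \<le> dq f t y s"
proof -
  obtain n where n: "ereal c < (INF (y, s)\<in>qpairs n. ereal (dq f t y s))"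
    using c unfolding clarke_lo_def by (auto simp: less_SUP_iff)
  have "c \<le> dq f t y s" if ys: "\<bar>y\<bar> < 1 / real (Suc n)" "0 < s" "s < 1 / real (Suc n)" for y s
  proof (rule ccontr)
    assume "\<not> c \<le> dq f t y s"
    then have "dq f t y s \<in> {..<c}" by simp
    then obtain y' s' where "y' \<in> \<rat>" "s' \<in> \<rat>" "\<bar>y'\<bar> < 1 / real (Suc n)" "0 < s'" "s' < 1 / real (Suc n)"
        "dq f t y' s' \<in> {..<c}"
      by (rule dq_dense[OF cont open_lessThan _ ys])
    then have "(y', s') \<in> qpairs n" "dq f t y' s' < c" by (simp_all add: qpairs_def)
    then have "ereal (dq f t y' s') < ereal c" "(INF (y, s)\<in>qpairs n. ereal (dq f t y s)) \<le> ereal (dq f t y' s')"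
      by (auto intro: INF_lower2)
    then show False using n by order
  qed
  then show ?thesis by (intro exI[of _ "1 / real (Suc n)"]) auto
qed

lemma clarke_lo_le_hi: "clarke_lo f t \<le> clarke_hi f t"
  unfolding clarke_lo_def clarke_hi_def
proof (rule SUP_least, rule INF_greatest)
  fix m n :: nat
  obtain z where z: "z \<in> qpairs (max m n)" using qpairs_nonempty by blast
  then have "z \<in> qpairs m" "z \<in> qpairs n" using qpairs_antimono by (metis max.cobounded1 max.cobounded2 subsetD)+
  then have "(INF (y, s)\<in>qpairs m. ereal (dq f t y s)) \<le> (case z of (y, s) \<Rightarrow> ereal (dq f t y s))"
    "(case z of (y, s) \<Rightarrow> ereal (dq f t y s)) \<le> (SUP (y, s)\<in>qpairs n. ereal (dq f t y s))"
    by (auto intro: INF_lower SUP_upper)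
  then show "(INF (y, s)\<in>qpairs m. ereal (dq f t y s)) \<le> (SUP (y, s)\<in>qpairs n. ereal (dq f t y s))"
    by (rule order_trans)
qed

lemma clarke_between:
  assumes "clarke_lo f t \<le> ereal v" "ereal v \<le> clarke_hi f t"
  shows "v \<in> clarke_subdiff f t"
proof (rule clarke_subdiffI)
  fix c d :: real assume "d > 0"
  then obtain n where n: "1 / real (Suc n) < d" using nat_approx_posE by blast
  have q: "\<bar>y\<bar> < d" "0 < s" "s < d" if "(y, s) \<in> qpairs n" for y s
    using that n by (auto simp: qpairs_def)
  {
    assume "c < v"
    then have "ereal c < clarke_hi f t" using assms(2) by (metis less_ereal.simps(1) less_le_trans)
    also have "clarke_hi f t \<le> (SUP (y, s)\<in>qpairs n. ereal (dq f t y s))"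
      unfolding clarke_hi_def by (rule INF_lower) simp
    finally obtain z where "z \<in> qpairs n" "ereal c < (case z of (y, s) \<Rightarrow> ereal (dq f t y s))"
      by (auto simp: less_SUP_iff)
    then show "\<exists>y s. \<bar>y\<bar> < d \<and> 0 < s \<and> s < d \<and> c < dq f t y s" using q by (cases z) (auto, blast)
  }
  {
    assume "v < c"
    have "(INF (y, s)\<in>qpairs n. ereal (dq f t y s)) \<le> clarke_lo f t"
      unfolding clarke_lo_def by (rule SUP_upper) simp
    also have "\<dots> < ereal c" using assms(1) by (rule le_less_trans) (simp add: \<open>v < c\<close>)
    finally obtain z where "z \<in> qpairs n" "(case z of (y, s) \<Rightarrow> ereal (dq f t y s)) < ereal c"
      by (auto simp: INF_less_iff)
    then show "\<exists>y s. \<bar>y\<bar> < d \<and> 0 < s \<and> s < d \<and> dq f t y s < c" using q by (cases z) (auto, blast)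
  }
qed

lemma clarke_finite:
  assumes "locally_lipschitz f"
  obtains L where "\<bar>clarke_lo f t\<bar> \<le> ereal L" "\<bar>clarke_hi f t\<bar> \<le> ereal L"
proof -
  obtain \<rho> L where \<rho>: "\<rho> > 0" "L-lipschitz_on (ball t \<rho>) f" using assms unfolding locally_lipschitz_def by blast
  obtain n where n: "1 / real (Suc n) < \<rho> / 2" using nat_approx_posE[of "\<rho> / 2"] \<rho>(1) by auto
  have b: "\<bar>dq f t y s\<bar> \<le> L" if "(y, s) \<in> qpairs n" for y s
  proof -
    have ys: "\<bar>y\<bar> < \<rho> / 2" "0 < s" "s < \<rho> / 2" using that n by (auto simp: qpairs_def)
    then have "t + y + s \<in> ball t \<rho>" "t + y \<in> ball t \<rho>" by (auto simp: dist_real_def)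
    then have "dist (f (t + y + s)) (f (t + y)) \<le> L * dist (t + y + s) (t + y)"
      using lipschitz_onD[OF \<rho>(2)] by blast
    then show ?thesis using ys(2) by (simp add: dq_def dist_real_def abs_divide divide_le_eq)
  qed
  have hi: "clarke_hi f t \<le> ereal L"
  proof -
    have "clarke_hi f t \<le> (SUP (y, s)\<in>qpairs n. ereal (dq f t y s))"
      unfolding clarke_hi_def by (rule INF_lower) simp
    also have "\<dots> \<le> ereal L" using b by (intro SUP_least) (auto simp: abs_le_iff)
    finally show ?thesis .
  qed
  have lo: "- ereal L \<le> clarke_lo f t"
  proof -
    have "- ereal L \<le> (INF (y, s)\<in>qpairs n. ereal (dq f t y s))"
      using b by (intro INF_greatest) (auto simp: abs_le_iff minus_le_iff)
    also have "\<dots> \<le> clarke_lo f t" unfolding clarke_lo_def by (rule SUP_upper) simp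
    finally show ?thesis .
  qed
  have "\<bar>clarke_lo f t\<bar> \<le> ereal L" "\<bar>clarke_hi f t\<bar> \<le> ereal L"
    using hi lo clarke_lo_le_hi[of f t] by (cases "clarke_lo f t"; cases "clarke_hi f t"; auto)+
  then show ?thesis by (rule that)
qed

lemma clarke_hi_lo_real:
  assumes "locally_lipschitz f"
  shows "clarke_hi f t = ereal (real_of_ereal (clarke_hi f t))" "clarke_lo f t = ereal (real_of_ereal (clarke_lo f t))"
    "real_of_ereal (clarke_lo f t) \<le> real_of_ereal (clarke_hi f t)"
proof -
  obtain L where L: "\<bar>clarke_lo f t\<bar> \<le> ereal L" "\<bar>clarke_hi f t\<bar> \<le> ereal L" by (rule clarke_finite[OF assms])
  show 1: "clarke_hi f t = ereal (real_of_ereal (clarke_hi f t))" using L by (cases "clarke_hi f t") auto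
  show 2: "clarke_lo f t = ereal (real_of_ereal (clarke_lo f t))" using L by (cases "clarke_lo f t") auto
  show "real_of_ereal (clarke_lo f t) \<le> real_of_ereal (clarke_hi f t)"
    using clarke_lo_le_hi[of f t] 1 2 by (metis ereal_less_eq(3))
qed

lemma clarke_interval:
  assumes "locally_lipschitz f" "real_of_ereal (clarke_lo f t) \<le> v" "v \<le> real_of_ereal (clarke_hi f t)"
  shows "v \<in> clarke_subdiff f t"
  using assms(2,3) clarke_hi_lo_real[OF assms(1), of t]
  by (intro clarke_between) (metis ereal_less_eq(3))+

text \<open>A mean value inequality in the spirit of Lebourg.  Both endpoints of the subdifferential at a
  point have absolute value at most \<open>M\<close>, so the difference quotients near that point are bounded by \<open>M + e\<close>;
  the bisection argument of Bolzano joins these local bounds.\<close>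

lemma lipschitz_of_clarke_subdiff_bound:
  assumes f: "locally_lipschitz f" and st: "s \<le> t"
    and M: "\<And>\<tau> v. s \<le> \<tau> \<Longrightarrow> \<tau> \<le> t \<Longrightarrow> v \<in> clarke_subdiff f \<tau> \<Longrightarrow> \<bar>v\<bar> \<le> M"
  shows "\<bar>f t - f s\<bar> \<le> M * (t - s)"
proof -
  have cont: "continuous_on UNIV f" by (rule locally_lipschitz_continuous[OF f])
  have "\<bar>f t - f s\<bar> \<le> (M + e) * (t - s)" if e: "e > 0" for e
  proof -
    have "\<bar>f t - f s\<bar> \<le> (M + e) * (t - s)"
    proof (rule Bolzano[OF st, of "\<lambda>a b. \<bar>f b - f a\<bar> \<le> (M + e) * (b - a)"])
      show "\<bar>f c - f a\<bar> \<le> (M + e) * (c - a)"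
        if "\<bar>f b - f a\<bar> \<le> (M + e) * (b - a)" "\<bar>f c - f b\<bar> \<le> (M + e) * (c - b)" for a b c
      proof -
        have "\<bar>f c - f a\<bar> \<le> \<bar>f b - f a\<bar> + \<bar>f c - f b\<bar>" by simp
        also have "\<dots> \<le> (M + e) * (b - a) + (M + e) * (c - b)" using that by simp
        also have "\<dots> = (M + e) * (c - a)" by (simp add: algebra_simps)
        finally show ?thesis .
      qed
      fix x assume x: "s \<le> x" "x \<le> t"
      let ?hi = "real_of_ereal (clarke_hi f x)" and ?lo = "real_of_ereal (clarke_lo f x)"
      note R = clarke_hi_lo_real[OF f, of x]
      have "\<bar>?hi\<bar> \<le> M" "\<bar>?lo\<bar> \<le> M"
        by (rule M[OF x]; rule clarke_interval[OF f]; use R(3) in blast)+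
      then have h: "?hi < M + e" "- (M + e) < ?lo" using e by linarith+
      have h1: "clarke_hi f x < ereal (M + e)" using h(1) by (subst R(1)) simp
      have h2: "ereal (- (M + e)) < clarke_lo f x" using h(2) by (subst R(2)) (simp only: less_ereal.simps)
      obtain d1 where d1: "d1 > 0" "\<And>y s. \<bar>y\<bar> < d1 \<Longrightarrow> 0 < s \<Longrightarrow> s < d1 \<Longrightarrow> dq f x y s \<le> M + e"
        using clarke_hi_lessD[OF cont h1] by blast
      obtain d2 where d2: "d2 > 0" "\<And>y s. \<bar>y\<bar> < d2 \<Longrightarrow> 0 < s \<Longrightarrow> s < d2 \<Longrightarrow> - (M + e) \<le> dq f x y s"
        using clarke_lo_greaterD[OF cont h2] by blast
      have "\<bar>f b - f a\<bar> \<le> (M + e) * (b - a)" if ab: "a \<le> x" "x \<le> b" "b - a < min d1 d2" for a b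
      proof (cases "a = b")
        case False
        then have "b - a > 0" using ab by simp
        then have "\<bar>dq f x (a - x) (b - a)\<bar> \<le> M + e"
          using d1(2)[of "a - x" "b - a"] d2(2)[of "a - x" "b - a"] ab by (simp add: abs_le_iff)
        then show ?thesis using \<open>b - a > 0\<close> by (simp add: dq_def abs_divide divide_le_eq)
      qed simp
      then show "\<exists>d>0. \<forall>a b. a \<le> x \<and> x \<le> b \<and> b - a < d \<longrightarrow> \<bar>f b - f a\<bar> \<le> (M + e) * (b - a)"
        using d1(1) d2(1) by (intro exI[of _ "min d1 d2"]) auto
    qed
    then show ?thesis .
  qed
  then have *: "\<bar>f t - f s\<bar> \<le> M * (t - s) + e * (t - s)" if "e > 0" for e
    using that by (simp add: distrib_right)
  show ?thesis
  proof (rule field_le_epsilon)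
    fix e :: real assume "e > 0"
    have "\<bar>f t - f s\<bar> \<le> M * (t - s) + e / (t - s + 1) * (t - s)"
      using *[of "e / (t - s + 1)"] st \<open>e > 0\<close> by simp
    also have "e / (t - s + 1) * (t - s) \<le> e"
      using st \<open>e > 0\<close> by (simp add: divide_le_eq mult_left_mono)
    finally show "\<bar>f t - f s\<bar> \<le> M * (t - s) + e" by simp
  qed
qed

text \<open>Continuity in the second variable permits the approximation of \<open>u\<close> by functions with countably many
  values.\<close>

lemma borel_measurable_caratheodory:
  fixes J :: "'a \<Rightarrow> real \<Rightarrow> real"
  assumes m: "\<And>t. (\<lambda>x. J x t) \<in> borel_measurable M"
    and c: "\<And>x. x \<in> space M \<Longrightarrow> continuous_on UNIV (J x)"
    and u: "u \<in> borel_measurable M"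
  shows "(\<lambda>x. J x (u x)) \<in> borel_measurable M"
proof (rule borel_measurable_LIMSEQ_real)
  define v where "v n x = of_int \<lfloor>real (Suc n) * u x\<rfloor> / real (Suc n)" for n x
  show "(\<lambda>n. J x (v n x)) \<longlonglongrightarrow> J x (u x)" if x: "x \<in> space M" for x
  proof -
    have "(\<lambda>n. v n x) \<longlonglongrightarrow> u x"
    proof (rule tendsto_sandwich)
      show "(\<lambda>n. u x - 1 / real (Suc n)) \<longlonglongrightarrow> u x"
        using tendsto_diff[OF tendsto_const LIMSEQ_Suc[OF lim_1_over_n], of "u x"] by simp
      have "u x - 1 / real (Suc n) \<le> v n x" for n
      proof -
        have "real (Suc n) * u x - 1 \<le> of_int \<lfloor>real (Suc n) * u x\<rfloor>" by linarith
        then have "(real (Suc n) * u x - 1) / real (Suc n) \<le> v n x"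
          unfolding v_def by (rule divide_right_mono) simp
        then show ?thesis by (simp add: diff_divide_distrib)
      qed
      then show "\<forall>\<^sub>F n in sequentially. u x - 1 / real (Suc n) \<le> v n x" by simp
      have "v n x \<le> u x" for n
      proof -
        have "of_int \<lfloor>real (Suc n) * u x\<rfloor> \<le> real (Suc n) * u x" by linarith
        then have "v n x \<le> (real (Suc n) * u x) / real (Suc n)"
          unfolding v_def by (rule divide_right_mono) simp
        then show ?thesis by simp
      qed
      then show "\<forall>\<^sub>F n in sequentially. v n x \<le> u x" by simp
    qed simp
    moreover have "isCont (J x) (u x)" using c[OF x] by (simp add: continuous_on_eq_continuous_at)
    ultimately show ?thesis by (rule isCont_tendsto_compose[rotated])
  qed
  show "(\<lambda>x. J x (v n x)) \<in> borel_measurable M" for n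
    unfolding v_def
  proof (rule measurable_compose_countable[where f = "\<lambda>i x. J x (of_int i / real (Suc n))"])
    show "(\<lambda>x. \<lfloor>real (Suc n) * u x\<rfloor>) \<in> measurable M (count_space UNIV)"
      using u by measurable
  qed (rule m)
qed

lemma borel_measurable_clarke:
  fixes J :: "'a \<Rightarrow> real \<Rightarrow> real"
  assumes m: "\<And>t. (\<lambda>x. J x t) \<in> borel_measurable M"
    and c: "\<And>x. x \<in> space M \<Longrightarrow> continuous_on UNIV (J x)"
    and u: "u \<in> borel_measurable M"
  shows "(\<lambda>x. clarke_hi (J x) (u x)) \<in> borel_measurable M" "(\<lambda>x. clarke_lo (J x) (u x)) \<in> borel_measurable M"
proof -
  have "(\<lambda>x. J x (u x + y)) \<in> borel_measurable M" for y
    by (rule borel_measurable_caratheodory[OF m c]) (use u in auto)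
  from this this[of "_ + _", folded add.assoc]
  have d: "(\<lambda>x. ereal (dq (J x) (u x) y s)) \<in> borel_measurable M" for y s
    unfolding dq_def by measurable
  let ?d = "\<lambda>z x. ereal (dq (J x) (u x) (fst z) (snd z))"
  have dz: "?d z \<in> borel_measurable M" for z by (rule d)
  have "(\<lambda>x. SUP z\<in>qpairs n. ?d z x) \<in> borel_measurable M" for n
    by (rule borel_measurable_SUP[where F = ?d]) (rule countable_qpairs, rule dz)
  then have "(\<lambda>x. INF n. SUP z\<in>qpairs n. ?d z x) \<in> borel_measurable M"
    by (intro borel_measurable_INF[where F = "\<lambda>n x. SUP z\<in>qpairs n. ?d z x"]) simp_all
  then show "(\<lambda>x. clarke_hi (J x) (u x)) \<in> borel_measurable M"
    by (simp only: clarke_hi_def case_prod_unfold)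
  have "(\<lambda>x. INF z\<in>qpairs n. ?d z x) \<in> borel_measurable M" for n
    by (rule borel_measurable_INF[where F = ?d]) (rule countable_qpairs, rule dz)
  then have "(\<lambda>x. SUP n. INF z\<in>qpairs n. ?d z x) \<in> borel_measurable M"
    by (intro borel_measurable_SUP[where F = "\<lambda>n x. INF z\<in>qpairs n. ?d z x"]) simp_all
  then show "(\<lambda>x. clarke_lo (J x) (u x)) \<in> borel_measurable M"
    by (simp only: clarke_lo_def case_prod_unfold)
qed

section \<open>Subcritical Sobolev inequality and compactness\<close>

lemma powr_tangent:
  fixes m y q :: real
  assumes "q \<ge> 1" "m \<ge> 0" "y \<ge> 0"
  shows "m powr q + q * m powr (q - 1) * (y - m) \<le> y powr q"
proof (cases "m = 0 \<or> y = 0")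
  case True
  then show ?thesis
  proof
    assume "y = 0"
    have "m powr q \<le> q * (m powr (q - 1) * m)"
    proof (cases "m = 0")
      case False
      then have "m powr (q - 1) * m = m powr q" using assms(2) by (simp add: powr_mult_base[symmetric] powr_diff)
      then show ?thesis using assms(1) by (simp add: mult_right_mono[of 1 q, simplified])
    qed simp
    then show ?thesis using \<open>y = 0\<close> by (simp add: algebra_simps)
  qed simp
next
  case False
  then have pos: "m > 0" "y > 0" using assms by auto
  have "(m powr q) powr (1 - 1 / q) * (y powr q) powr (1 / q) \<le> (1 - 1 / q) * m powr q + (1 / q) * y powr q"
    using assms(1) pos by (intro Youngs_inequality_0) auto
  moreover have "(m powr q) powr (1 - 1 / q) = m powr (q - 1)" "(y powr q) powr (1 / q) = y"
    using assms(1) pos by (simp_all add: powr_powr algebra_simps)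
  ultimately have "q * (m powr (q - 1) * y) \<le> q * ((1 - 1 / q) * m powr q + (1 / q) * y powr q)"
    using assms(1) by (intro mult_left_mono) auto
  also have "\<dots> = (q - 1) * m powr q + y powr q" using assms(1) by (simp add: field_simps)
  finally have 1: "q * (m powr (q - 1) * y) \<le> (q - 1) * m powr q + y powr q" .
  have "m powr (q - 1) * m = m powr q" using pos by (simp add: powr_diff)
  moreover have "q * m powr (q - 1) * (y - m) = q * (m powr (q - 1) * y) - q * (m powr (q - 1) * m)"
    by (simp add: algebra_simps)
  ultimately have e: "q * m powr (q - 1) * (y - m) = q * (m powr (q - 1) * y) - q * m powr q"
    by simp
  have "(q - 1) * m powr q = q * m powr q - m powr q" by (simp add: algebra_simps)
  then show ?thesis using 1 unfolding e by linarith
qed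

lemma integral_le_nn_integral:
  fixes g k :: "'a \<Rightarrow> real"
  assumes "integrable M g" "\<And>x. g x \<le> k x" "\<And>x. 0 \<le> k x"
  shows "ennreal (LINT x|M. g x) \<le> (\<integral>\<^sup>+x. ennreal (k x) \<partial>M)"
proof -
  have i: "integrable M (\<lambda>x. max 0 (g x))" using assms(1) by simp
  have "ennreal (LINT x|M. g x) \<le> ennreal (LINT x|M. max 0 (g x))"
    using assms(1) i by (intro ennreal_leI integral_mono) auto
  also have "\<dots> = (\<integral>\<^sup>+x. ennreal (max 0 (g x)) \<partial>M)"
    by (rule nn_integral_eq_integral[symmetric]) (use i in auto)
  also have "\<dots> \<le> (\<integral>\<^sup>+x. ennreal (k x) \<partial>M)"
    using assms by (intro nn_integral_mono ennreal_leI) auto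
  finally show ?thesis .
qed

text \<open>Integrating the tangent inequality for the power at the mean value \<open>m\<close> of \<open>f / w\<close> with respect to
  the weight \<open>w\<close> gives Hoelder's inequality without a conjugate exponent.\<close>

lemma weighted_hoelder:
  fixes f w :: "'a \<Rightarrow> real"
  assumes f: "integrable M f" "\<And>x. 0 \<le> f x" and w: "integrable M w" "\<And>x. 0 \<le> w x"
    and fw: "\<And>x. w x = 0 \<Longrightarrow> f x = 0" and q: "q \<ge> 1"
  shows "ennreal ((LINT x|M. f x) powr q) \<le>
    ennreal ((LINT x|M. w x) powr (q - 1)) * (\<integral>\<^sup>+x. ennreal (f x powr q * w x powr (1 - q)) \<partial>M)"
proof -
  define F W where "F = (LINT x|M. f x)" and "W = (LINT x|M. w x)"
  have F0: "F \<ge> 0" and W0: "W \<ge> 0" using f w by (auto simp: F_def W_def)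
  show ?thesis
  proof (cases "W = 0")
    case True
    then have "AE x in M. w x = 0"
      using integral_nonneg_eq_0_iff_AE[OF w(1)] w(2) by (simp add: W_def)
    then have "AE x in M. f x = 0" by eventually_elim (rule fw)
    then have "F = 0" unfolding F_def using integral_cong_AE[of f M "\<lambda>_. 0"] f(1) by simp
    then show ?thesis by (simp add: F_def[symmetric])
  next
    case False
    then have W: "W > 0" using W0 by simp
    define m where "m = F / W"
    have m: "m \<ge> 0" using F0 W by (simp add: m_def)
    define g where "g x = m powr q * w x + q * m powr (q - 1) * (f x - m * w x)" for x
    have gi: "integrable M g" unfolding g_def using f w by auto
    have "LINT x|M. g x = m powr q * W + q * m powr (q - 1) * (F - m * W)"
      unfolding g_def using f(1) w(1) by (simp add: F_def W_def)
    also have "\<dots> = m powr q * W" using W by (simp add: m_def)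
    finally have gI: "LINT x|M. g x = m powr q * W" .
    have le: "g x \<le> f x powr q * w x powr (1 - q)" for x
    proof (cases "w x = 0")
      case True
      then show ?thesis using fw[of x] by (simp add: g_def)
    next
      case False
      then have wx: "w x > 0" using w(2)[of x] by simp
      have "g x = w x * (m powr q + q * m powr (q - 1) * (f x / w x - m))"
        using wx by (simp add: g_def field_simps)
      also have "\<dots> \<le> w x * (f x / w x) powr q"
        using wx f(2)[of x] m q by (intro mult_left_mono powr_tangent) auto
      also have "\<dots> = f x powr q * w x powr (1 - q)"
        using wx f(2)[of x] by (simp add: powr_divide powr_diff)
      finally show ?thesis .
    qed
    have "ennreal (m powr q * W) \<le> (\<integral>\<^sup>+x. ennreal (f x powr q * w x powr (1 - q)) \<partial>M)"
      using integral_le_nn_integral[OF gi le] gI by simp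
    then have "ennreal (W powr (q - 1)) * ennreal (m powr q * W) \<le>
        ennreal (W powr (q - 1)) * (\<integral>\<^sup>+x. ennreal (f x powr q * w x powr (1 - q)) \<partial>M)"
      by (rule mult_left_mono) simp
    moreover have "W powr (q - 1) * (m powr q * W) = F powr q"
      using W F0 by (simp add: m_def powr_divide powr_diff)
    ultimately show ?thesis
      by (simp add: F_def[symmetric] W_def[symmetric] ennreal_mult[symmetric] W0)
  qed
qed

lemma nn_integral_scale:
  fixes f :: "'a::euclidean_space \<Rightarrow> ennreal"
  assumes [measurable]: "f \<in> borel_measurable borel" and s: "s > 0"
  shows "(\<integral>\<^sup>+h. f (x + s *\<^sub>R h) \<partial>lborel) = ennreal (inverse (s ^ DIM('a))) * (\<integral>\<^sup>+y. f y \<partial>lborel)"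
proof -
  have "(\<integral>\<^sup>+y. f y \<partial>lborel) = (\<integral>\<^sup>+y. f y \<partial>density (distr lborel borel (\<lambda>h. x + s *\<^sub>R h)) (\<lambda>_. ennreal (\<bar>s\<bar> ^ DIM('a))))"
    using lborel_affine[of s x] s by simp
  also have "\<dots> = (\<integral>\<^sup>+y. ennreal (\<bar>s\<bar> ^ DIM('a)) * f y \<partial>distr lborel borel (\<lambda>h. x + s *\<^sub>R h))"
    by (rule nn_integral_density) auto
  also have "\<dots> = (\<integral>\<^sup>+h. ennreal (\<bar>s\<bar> ^ DIM('a)) * f (x + s *\<^sub>R h) \<partial>lborel)"
    by (rule nn_integral_distr) auto
  also have "\<dots> = ennreal (s ^ DIM('a)) * (\<integral>\<^sup>+h. f (x + s *\<^sub>R h) \<partial>lborel)"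
    using s by (simp add: nn_integral_cmult)
  finally have "ennreal (inverse (s ^ DIM('a))) * (\<integral>\<^sup>+y. f y \<partial>lborel) =
      ennreal (inverse (s ^ DIM('a))) * ennreal (s ^ DIM('a)) * (\<integral>\<^sup>+h. f (x + s *\<^sub>R h) \<partial>lborel)"
    by (simp add: mult.assoc)
  also have "ennreal (inverse (s ^ DIM('a))) * ennreal (s ^ DIM('a)) = 1"
    using s by (simp add: ennreal_mult[symmetric])
  finally show ?thesis by simp
qed

text \<open>The fundamental theorem of calculus along the segment from \<open>x\<close> to \<open>x + T h\<close>.\<close>

lemma segment_estimate:
  fixes h :: "'a::euclidean_space"
  assumes \<phi>: "\<phi> \<in> test_functions \<Omega>" and T: "0 \<le> T"
  shows "ennreal \<bar>\<phi> (x + T *\<^sub>R h) - \<phi> x\<bar> \<le>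
    (\<integral>\<^sup>+t. ennreal (norm h) * ennreal (norm (grad \<phi> (x + t *\<^sub>R h))) * indicator {0<..T} t \<partial>lborel)"
proof -
  define f where "f t = grad \<phi> (x + t *\<^sub>R h) \<bullet> h" for t
  have hb: "has_bochner_integral lborel (\<lambda>t. indicator {0..T} t *\<^sub>R f t) (\<phi> (x + T *\<^sub>R h) - \<phi> (x + 0 *\<^sub>R h))"
  proof (rule has_bochner_integral_FTC_Icc[where F = "\<lambda>t. \<phi> (x + t *\<^sub>R h)", OF T])
    fix t
    have "((\<lambda>t. \<phi> (x + t *\<^sub>R h)) has_derivative (\<lambda>d. grad \<phi> (x + t *\<^sub>R h) \<bullet> (d *\<^sub>R h))) (at t)"
      by (rule has_derivative_compose[where g = \<phi> and f = "\<lambda>t. x + t *\<^sub>R h"])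
        (auto intro!: derivative_eq_intros has_derivative_test_function[OF \<phi>])
    then show "((\<lambda>t. \<phi> (x + t *\<^sub>R h)) has_vector_derivative f t) (at t within {0..T})"
      unfolding has_vector_derivative_def f_def by (auto intro: has_derivative_at_withinI)
  next
    show "continuous_on {0..T} f" unfolding f_def
      by (intro continuous_intros continuous_on_compose2[OF continuous_on_test_function(2)[OF \<phi>, of UNIV]]) auto
  qed
  have "ennreal \<bar>\<phi> (x + T *\<^sub>R h) - \<phi> x\<bar> = ennreal (norm (LINT t|lborel. indicator {0..T} t *\<^sub>R f t))"
    using has_bochner_integral_integral_eq[OF hb] by simp
  also have "\<dots> \<le> (\<integral>\<^sup>+t. ennreal (norm (indicator {0..T} t *\<^sub>R f t)) \<partial>lborel)"
    using hb by (intro integral_norm_bound_ennreal) (auto simp: has_bochner_integral_iff)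
  also have "\<dots> \<le> (\<integral>\<^sup>+t. ennreal (norm h) * ennreal (norm (grad \<phi> (x + t *\<^sub>R h))) * indicator {0<..T} t \<partial>lborel)"
  proof (rule nn_integral_mono_AE)
    show "AE t in lborel. ennreal (norm (indicator {0..T} t *\<^sub>R f t)) \<le>
        ennreal (norm h) * ennreal (norm (grad \<phi> (x + t *\<^sub>R h))) * indicator {0<..T} t"
      using AE_lborel_singleton[of 0]
    proof eventually_elim
      case (elim t)
      have "\<bar>f t\<bar> \<le> norm h * norm (grad \<phi> (x + t *\<^sub>R h))"
        unfolding f_def using Cauchy_Schwarz_ineq2[of "grad \<phi> (x + t *\<^sub>R h)" h] by (simp add: mult.commute)
      then have "ennreal \<bar>f t\<bar> \<le> ennreal (norm h) * ennreal (norm (grad \<phi> (x + t *\<^sub>R h)))"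
        by (simp add: ennreal_mult[symmetric] ennreal_leI)
      then show ?case using elim by (cases "t \<in> {0<..T}") auto
    qed
  qed
  finally show ?thesis .
qed

text \<open>In the segment estimate, integration over \<open>x\<close> makes every point of the segment contribute the same
  amount.\<close>

lemma translation_estimate:
  fixes \<phi> :: "'a::euclidean_space \<Rightarrow> real"
  assumes \<phi>: "\<phi> \<in> test_functions \<Omega>"
  shows "(\<integral>\<^sup>+x. ennreal \<bar>\<phi> (x + h) - \<phi> x\<bar> \<partial>lborel) \<le> ennreal (norm h) * (\<integral>\<^sup>+x. ennreal (norm (grad \<phi> x)) \<partial>lborel)"
proof -
  note [measurable] = borel_measurable_test_function[OF \<phi>]
  let ?I = "\<integral>\<^sup>+x. ennreal (norm (grad \<phi> x)) \<partial>lborel"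
  have "(\<integral>\<^sup>+x. ennreal \<bar>\<phi> (x + h) - \<phi> x\<bar> \<partial>lborel) \<le>
      (\<integral>\<^sup>+x. (\<integral>\<^sup>+t. ennreal (norm h) * ennreal (norm (grad \<phi> (x + t *\<^sub>R h))) * indicator {0<..1} t \<partial>lborel) \<partial>lborel)"
    using segment_estimate[OF \<phi>, of 1 _ h] by (intro nn_integral_mono) simp
  also have "\<dots> = (\<integral>\<^sup>+t. (\<integral>\<^sup>+x. ennreal (norm h) * ennreal (norm (grad \<phi> (x + t *\<^sub>R h))) * indicator {0<..1} t \<partial>lborel) \<partial>lborel)"
    by (rule lborel_pair.Fubini') measurable
  also have "\<dots> = (\<integral>\<^sup>+t. ennreal (norm h) * ?I * indicator {0<..1::real} t \<partial>lborel)"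
  proof (rule nn_integral_cong)
    fix t :: real
    have "(\<integral>\<^sup>+x. ennreal (norm (grad \<phi> (x + t *\<^sub>R h))) \<partial>lborel) = ?I"
      by (rule lborel_nn_integral_translation) simp
    then show "(\<integral>\<^sup>+x. ennreal (norm h) * ennreal (norm (grad \<phi> (x + t *\<^sub>R h))) * indicator {0<..1} t \<partial>lborel) =
        ennreal (norm h) * ?I * indicator {0<..1} t"
      by (simp add: nn_integral_multc nn_integral_cmult)
  qed
  also have "\<dots> = ennreal (norm h) * ?I" by (simp add: nn_integral_cmult)
  finally show ?thesis .
qed

text \<open>A translation by more than the diameter of \<open>\<Omega>\<close> moves every point of \<open>\<Omega>\<close> to a zero of \<open>\<phi>\<close>.\<close>

lemma poincare_test_function:
  fixes \<phi> :: "'a::euclidean_space \<Rightarrow> real"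
  assumes R: "R \<ge> 0" "\<And>x. x \<in> \<Omega> \<Longrightarrow> norm x \<le> R" and \<phi>: "\<phi> \<in> test_functions \<Omega>"
  shows "(\<integral>\<^sup>+x. ennreal \<bar>\<phi> x\<bar> \<partial>lborel) \<le> ennreal (2 * R + 1) * (\<integral>\<^sup>+x. ennreal (norm (grad \<phi> x)) \<partial>lborel)"
proof -
  obtain b :: 'a where b: "b \<in> Basis" using nonempty_Basis by blast
  define h where "h = (2 * R + 1) *\<^sub>R b"
  have nh: "norm h = 2 * R + 1" using b R(1) by (simp add: h_def)
  have "\<bar>\<phi> x\<bar> \<le> \<bar>\<phi> (x + h) - \<phi> x\<bar>" for x
  proof (cases "x \<in> \<Omega>")
    case True
    have "x + h \<notin> \<Omega>"
    proof
      assume "x + h \<in> \<Omega>"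
      then have "norm h \<le> R + R" using R(2)[of "x + h"] R(2)[OF True] norm_triangle_ineq4[of "x + h" x] by simp
      then show False using nh by simp
    qed
    then show ?thesis using test_function_outside(1)[OF \<phi>] by simp
  next
    case False
    then show ?thesis using test_function_outside(1)[OF \<phi>] by simp
  qed
  then have "(\<integral>\<^sup>+x. ennreal \<bar>\<phi> x\<bar> \<partial>lborel) \<le> (\<integral>\<^sup>+x. ennreal \<bar>\<phi> (x + h) - \<phi> x\<bar> \<partial>lborel)"
    by (intro nn_integral_mono ennreal_leI)
  also note translation_estimate[OF \<phi>, of h]
  finally show ?thesis by (simp add: nh)
qed

lemma nn_integral_powr_from_0:
  assumes "\<gamma> > -1" "T \<ge> 0"
  shows "(\<integral>\<^sup>+t. ennreal (t powr \<gamma>) * indicator {0<..T} t \<partial>lborel) = ennreal (T powr (\<gamma> + 1) / (\<gamma> + 1))"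
proof -
  have "(\<integral>\<^sup>+t. ennreal (t powr \<gamma>) * indicator {0<..T} t \<partial>lborel) = (\<integral>\<^sup>+t. ennreal (t powr \<gamma>) * indicator {0..T} t \<partial>lborel)"
    by (rule nn_integral_cong_AE) (use AE_lborel_singleton[of 0] in eventually_elim, auto simp: indicator_def)
  also have "\<dots> = ennreal (T powr (\<gamma> + 1) / (\<gamma> + 1))"
    by (rule nn_integral_has_integral_lebesgue'[OF _ has_integral_powr_from_0[OF assms]]) simp
  finally show ?thesis .
qed

lemma emeasure_unit_cube: "emeasure lborel (cbox (c::'a::euclidean_space) (c + One)) = 1"
  by (simp add: emeasure_lborel_cbox_eq inner_add_left)

text \<open>The value of \<open>\<phi>\<close> at \<open>x\<close> is recovered from the gradient along any ray that leaves \<open>\<Omega>\<close>.  Averaging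
  over directions \<open>h\<close> in a cube \<open>A\<close> gives \<open>|\<phi> x| \<le> H \<integral> S t x dt\<close> over \<open>0 < t \<le> T\<close>, where \<open>S t x\<close> is the
  average of the gradient norm over the cube \<open>x + t A\<close>.  The \<open>P\<close>-th power of \<open>S t x\<close> is at most the average
  \<open>K t x\<close> of the \<open>P\<close>-th power of the gradient norm.  There are two bounds for \<open>K\<close>: it is at most
  \<open>t powr (- N) * B\<close> everywhere, and its integral over \<open>x\<close> is at most \<open>B\<close>.  Writing the \<open>q\<close>-th power of
  \<open>S\<close> as the product of \<open>(S powr P) powr ((q - P) / P)\<close> and \<open>S powr P\<close>, the first factor is estimated by the
  first bound and the second factor by the second one.  Hoelder's inequality in \<open>t\<close> with weight
  \<open>t powr (- \<beta>)\<close> leaves a power of \<open>t\<close> that is integrable at zero because \<open>q\<close> is subcritical.\<close>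

lemma sobolev_test_functions:
  fixes \<Omega> :: "'a::euclidean_space set" and P q B :: real
  assumes bdd: "bounded \<Omega>" and P: "1 < P" "P < DIM('a)" and q: "P \<le> q" "q < DIM('a) * P / (DIM('a) - P)" and B: "B > 0"
  obtains C where "C \<ge> 0" "\<And>\<phi>. \<phi> \<in> test_functions \<Omega> \<Longrightarrow>
      (\<integral>\<^sup>+x. ennreal (norm (grad \<phi> x) powr P) \<partial>lborel) \<le> ennreal B \<Longrightarrow>
      (\<integral>\<^sup>+x. ennreal (\<bar>\<phi> x\<bar> powr q) \<partial>lborel) \<le> ennreal C"
proof -
  define N where "N = real DIM('a)"
  \<comment> \<open>The cube of directions is kept away from the origin, so that every \<open>x + T h\<close> has left \<open>\<Omega>\<close>.\<close>
  define A where "A = cbox (One::'a) (One + One)"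
  have Am[measurable]: "A \<in> sets borel" by (simp add: A_def)
  have A1: "emeasure lborel A = 1" by (simp add: A_def emeasure_unit_cube)
  obtain R0 where R0: "\<And>x. x \<in> \<Omega> \<Longrightarrow> norm x \<le> R0" using bdd by (auto simp: bounded_iff)
  define R where "R = \<bar>R0\<bar>"
  have R: "R \<ge> 0" "\<And>x. x \<in> \<Omega> \<Longrightarrow> norm x \<le> R" using R0 abs_ge_self[of R0] by (auto simp: R_def) (meson order_trans)
  define T where "T = 2 * R + 1"
  have T: "T > 0" using R by (simp add: T_def)
  obtain b0 :: 'a where b0: "b0 \<in> Basis" using nonempty_Basis by blast
  have nA1: "norm h \<ge> 1" if "h \<in> A" for h
  proof -
    have "1 \<le> h \<bullet> b0" using that b0 by (simp add: A_def mem_box)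
    also have "\<dots> \<le> norm h" using Basis_le_norm[OF b0, of h] by simp
    finally show ?thesis .
  qed
  obtain H where H: "H > 0" "\<And>h. h \<in> A \<Longrightarrow> norm h \<le> H"
    using bounded_cbox[of One "One + One :: 'a"] unfolding A_def bounded_pos by blast
  have q1: "q > 1" using P q by simp
  \<comment> \<open>Two conditions on the weight: \<open>\<beta> < 1\<close> makes \<open>t powr (- \<beta>)\<close> integrable at zero, and the lower
    bound on \<open>\<beta>\<close> gives \<open>\<gamma> > - 1\<close>.  They are compatible exactly for subcritical \<open>q\<close>.\<close>
  have "(N * (q / P - 1) - 1) / (q - 1) < 1"
  proof -
    have "q * (N - P) < N * P" using q(2) P by (simp add: N_def field_simps)
    then have "N * q < (N + q) * P" by (simp add: algebra_simps)
    then have "N * q / P < N + q" using P by (simp add: divide_less_eq)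
    then have "N * (q / P - 1) - 1 < q - 1" by (simp add: algebra_simps)
    then show ?thesis using q1 by (simp add: divide_less_eq)
  qed
  then obtain \<beta> where \<beta>: "0 < \<beta>" "(N * (q / P - 1) - 1) / (q - 1) < \<beta>" "\<beta> < 1"
    using dense[of "max 0 ((N * (q / P - 1) - 1) / (q - 1))" 1] by auto
  define \<gamma> where "\<gamma> = \<beta> * (q - 1) - N * (q / P - 1)"
  have \<gamma>: "\<gamma> > -1" using \<beta>(2) q1 by (simp add: \<gamma>_def divide_less_eq)
  define Z where "Z = T powr (- \<beta> + 1) / (- \<beta> + 1)"
  have Z: "Z \<ge> 0" using \<beta> by (simp add: Z_def)
  define C where "C = H powr q * Z powr (q - 1) * (B powr ((q - P) / P) * B * (T powr (\<gamma> + 1) / (\<gamma> + 1)))"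
  have C: "C \<ge> 0" using B \<gamma> H by (simp add: C_def)
  show ?thesis
  proof (rule that[OF C])
    fix \<phi> assume \<phi>: "\<phi> \<in> test_functions \<Omega>"
      and gB: "(\<integral>\<^sup>+x. ennreal (norm (grad \<phi> x) powr P) \<partial>lborel) \<le> ennreal B"
    note [measurable] = borel_measurable_test_function[OF \<phi>]
    define G where "G y = norm (grad \<phi> y)" for y
    have [measurable]: "G \<in> borel_measurable borel" unfolding G_def by measurable
    obtain BG where BG: "\<And>x. G x \<le> BG" using test_function_bounded[OF \<phi>] unfolding G_def by metis
    have G0: "0 \<le> G y" for y by (simp add: G_def)
    have BG0: "0 \<le> BG" using BG[of 0] G0[of 0] by simp
    have iA: "integrable lborel (\<lambda>h. indicator A h :: real)" "(LINT h|lborel. indicator A h) = (1::real)"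
      using A1 by (simp_all add: measure_def)
    define S where "S t x = (LINT h|lborel. indicator A h * G (x + t *\<^sub>R h))" for t x
    have S_int: "integrable lborel (\<lambda>h. indicator A h * G (x + t *\<^sub>R h))" for t x
    proof (rule Bochner_Integration.integrable_bound[where f = "\<lambda>h. BG * indicator A h"])
      show "AE h in lborel. norm (indicator A h * G (x + t *\<^sub>R h)) \<le> norm (BG * indicator A h)"
        using BG G0 BG0 by (intro AE_I2) (simp add: indicator_def)
    qed (use iA in simp_all)
    have S0: "0 \<le> S t x" for t x unfolding S_def using G0 by simp
    have SBG: "S t x \<le> BG" for t x
    proof -
      have "S t x \<le> (LINT h|lborel. BG * indicator A h)" unfolding S_def
        by (rule integral_mono[OF S_int]) (use iA BG in \<open>auto simp: indicator_def\<close>)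
      then show ?thesis using iA by simp
    qed
    have S_nn: "ennreal (S t x) = (\<integral>\<^sup>+h. ennreal (G (x + t *\<^sub>R h)) * indicator A h \<partial>lborel)" for t x
    proof -
      have "ennreal (S t x) = (\<integral>\<^sup>+h. ennreal (indicator A h * G (x + t *\<^sub>R h)) \<partial>lborel)"
        unfolding S_def using S_int G0 by (intro nn_integral_eq_integral[symmetric]) auto
      also have "\<dots> = (\<integral>\<^sup>+h. ennreal (G (x + t *\<^sub>R h)) * indicator A h \<partial>lborel)"
        by (intro nn_integral_cong) (auto simp: indicator_def)
      finally show ?thesis .
    qed
    have S_meas1[measurable]: "(\<lambda>t. S t x) \<in> borel_measurable borel" for x
      unfolding S_def by measurable
    define K where "K t x = (\<integral>\<^sup>+h. ennreal (G (x + t *\<^sub>R h) powr P) * indicator A h \<partial>lborel)" for t x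
    have K_meas[measurable (raw)]: "(\<lambda>z. K (a z) (b z)) \<in> borel_measurable M"
      if [measurable]: "a \<in> borel_measurable M" "b \<in> borel_measurable M" for a b and M :: "'z measure"
      unfolding K_def by measurable
    have SK: "ennreal (S t x powr P) \<le> K t x" for t x
    proof -
      have "ennreal (S t x powr P) \<le> ennreal ((LINT h|lborel. indicator A h) powr (P - 1)) *
          (\<integral>\<^sup>+h. ennreal ((indicator A h * G (x + t *\<^sub>R h)) powr P * indicator A h powr (1 - P)) \<partial>lborel)"
        unfolding S_def by (rule weighted_hoelder[OF S_int]) (use iA G0 P in \<open>auto simp: indicator_def\<close>)
      also have "(\<integral>\<^sup>+h. ennreal ((indicator A h * G (x + t *\<^sub>R h)) powr P * indicator A h powr (1 - P)) \<partial>lborel) = K t x"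
        unfolding K_def by (intro nn_integral_cong) (auto simp: indicator_def)
      finally show ?thesis by (simp only: iA(2) powr_one_eq_one ennreal_1 mult_1_left)
    qed
    have KB: "K t x \<le> ennreal (t powr (- N) * B)" if t: "t > 0" for t x
    proof -
      have "K t x \<le> (\<integral>\<^sup>+h. ennreal (G (x + t *\<^sub>R h) powr P) \<partial>lborel)"
        unfolding K_def by (intro nn_integral_mono) (auto simp: indicator_def)
      also have "\<dots> = ennreal (inverse (t ^ DIM('a))) * (\<integral>\<^sup>+y. ennreal (G y powr P) \<partial>lborel)"
        by (rule nn_integral_scale[OF _ t]) measurable
      also have "\<dots> \<le> ennreal (inverse (t ^ DIM('a))) * ennreal B"
        using gB unfolding G_def by (intro mult_left_mono) auto
      also have "\<dots> = ennreal (t powr (- N) * B)"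
        using t B by (simp add: ennreal_mult[symmetric] N_def powr_minus powr_realpow)
      finally show ?thesis .
    qed
    have Sq: "ennreal (S t x powr q) \<le> ennreal ((t powr (- N) * B) powr ((q - P) / P)) * K t x" if t: "t > 0" for t x
    proof -
      have "ennreal (S t x powr P) \<le> ennreal (t powr (- N) * B)" using SK KB[OF t] by (rule order_trans)
      then have le: "S t x powr P \<le> t powr (- N) * B" using B by simp
      have "S t x powr q = (S t x powr P) powr ((q - P) / P) * S t x powr P"
        using P by (simp add: powr_powr powr_add[symmetric])
      also have "\<dots> \<le> (t powr (- N) * B) powr ((q - P) / P) * S t x powr P"
        using le P q by (intro mult_right_mono powr_mono2) auto
      finally have "ennreal (S t x powr q) \<le> ennreal ((t powr (- N) * B) powr ((q - P) / P)) * ennreal (S t x powr P)"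
        by (simp add: ennreal_mult[symmetric] ennreal_leI)
      also have "\<dots> \<le> ennreal ((t powr (- N) * B) powr ((q - P) / P)) * K t x"
        by (intro mult_left_mono SK) simp
      finally show ?thesis .
    qed
    have xK: "(\<integral>\<^sup>+x. K t x \<partial>lborel) \<le> ennreal B" for t
    proof -
      have "(\<integral>\<^sup>+x. K t x \<partial>lborel) = (\<integral>\<^sup>+h. (\<integral>\<^sup>+x. ennreal (G (x + t *\<^sub>R h) powr P) * indicator A h \<partial>lborel) \<partial>lborel)"
        unfolding K_def by (rule lborel_pair.Fubini') measurable
      also have "\<dots> = (\<integral>\<^sup>+h. (\<integral>\<^sup>+x. ennreal (G x powr P) \<partial>lborel) * indicator A h \<partial>lborel)"
      proof (rule nn_integral_cong)
        fix h :: 'a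
        have "(\<integral>\<^sup>+x. ennreal (G (x + t *\<^sub>R h) powr P) \<partial>lborel) = (\<integral>\<^sup>+x. ennreal (G x powr P) \<partial>lborel)"
          by (rule lborel_nn_integral_translation) measurable
        then show "(\<integral>\<^sup>+x. ennreal (G (x + t *\<^sub>R h) powr P) * indicator A h \<partial>lborel) =
            (\<integral>\<^sup>+x. ennreal (G x powr P) \<partial>lborel) * indicator A h"
          by (simp add: nn_integral_multc)
      qed
      also have "\<dots> = (\<integral>\<^sup>+x. ennreal (G x powr P) \<partial>lborel)" using A1 by (simp add: nn_integral_cmult)
      finally show ?thesis using gB by (simp add: G_def)
    qed
    define w where "w t = t powr (- \<beta>) * indicator {0<..T} t" for t :: real
    have w_nn: "(\<integral>\<^sup>+t. ennreal (w t) \<partial>lborel) = ennreal Z"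
    proof -
      have "(\<integral>\<^sup>+t. ennreal (w t) \<partial>lborel) = (\<integral>\<^sup>+t. ennreal (t powr (- \<beta>)) * indicator {0<..T} t \<partial>lborel)"
        unfolding w_def by (intro nn_integral_cong) (auto simp: indicator_def)
      then show ?thesis using nn_integral_powr_from_0[of "- \<beta>" T] \<beta> T by (simp add: Z_def)
    qed
    have w0: "0 \<le> w t" for t by (simp add: w_def)
    have wm[measurable]: "w \<in> borel_measurable borel" unfolding w_def by measurable
    have w_int: "integrable lborel w" "(LINT t|lborel. w t) = Z"
    proof -
      show "integrable lborel w"
        by (rule integrableI_nonneg) (use w_nn w0 in auto)
      show "(LINT t|lborel. w t) = Z"
        by (rule integral_eq_nn_integral[THEN trans]) (use w_nn w0 Z in auto)
    qed
    define f where "f x t = S t x * indicator {0<..T} t" for x and t :: real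
    have f0: "0 \<le> f x t" for x t using S0 by (simp add: f_def)
    have fm[measurable]: "f x \<in> borel_measurable borel" for x unfolding f_def by measurable
    have iT: "integrable lborel (indicator {0<..T} :: real \<Rightarrow> real)"
      using T by (intro integrable_real_indicator) auto
    have f_int: "integrable lborel (f x)" for x
    proof (rule Bochner_Integration.integrable_bound[where f = "\<lambda>t. BG * indicator {0<..T} t"])
      show "AE t in lborel. norm (f x t) \<le> norm (BG * indicator {0<..T} t)"
        using SBG S0 BG0 by (intro AE_I2) (simp add: f_def indicator_def)
    qed (use iT in simp_all)
    have pt: "\<bar>\<phi> x\<bar> \<le> H * (LINT t|lborel. f x t)" for x
    proof (cases "x \<in> \<Omega>")
      case False
      then show ?thesis using test_function_outside(1)[OF \<phi>] f0 H(1) by (simp add: mult_nonneg_nonneg)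
    next
      case True
      have seg: "ennreal \<bar>\<phi> x\<bar> \<le> (\<integral>\<^sup>+t. ennreal H * ennreal (G (x + t *\<^sub>R h)) * indicator {0<..T} t \<partial>lborel)" if h: "h \<in> A" for h
      proof -
        have "x + T *\<^sub>R h \<notin> \<Omega>"
        proof
          assume "x + T *\<^sub>R h \<in> \<Omega>"
          then have "norm (T *\<^sub>R h) \<le> R + R"
            using R(2)[of "x + T *\<^sub>R h"] R(2)[OF True] norm_triangle_ineq4[of "x + T *\<^sub>R h" x] by simp
          moreover have "T \<le> norm (T *\<^sub>R h)" using nA1[OF h] T by simp
          ultimately show False by (simp add: T_def)
        qed
        then have "ennreal \<bar>\<phi> x\<bar> = ennreal \<bar>\<phi> (x + T *\<^sub>R h) - \<phi> x\<bar>" using test_function_outside(1)[OF \<phi>] by simp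
        also have "\<dots> \<le> (\<integral>\<^sup>+t. ennreal (norm h) * ennreal (norm (grad \<phi> (x + t *\<^sub>R h))) * indicator {0<..T} t \<partial>lborel)"
          using T by (intro segment_estimate[OF \<phi>]) simp
        also have "\<dots> \<le> (\<integral>\<^sup>+t. ennreal H * ennreal (G (x + t *\<^sub>R h)) * indicator {0<..T} t \<partial>lborel)"
          unfolding G_def using H(2)[OF h] by (intro nn_integral_mono mult_right_mono ennreal_leI) auto
        finally show ?thesis .
      qed
      have "ennreal \<bar>\<phi> x\<bar> = (\<integral>\<^sup>+h. ennreal \<bar>\<phi> x\<bar> * indicator A h \<partial>lborel)"
        using A1 by (simp add: nn_integral_cmult)
      also have "\<dots> \<le> (\<integral>\<^sup>+h. (\<integral>\<^sup>+t. ennreal H * ennreal (G (x + t *\<^sub>R h)) * indicator {0<..T} t * indicator A h \<partial>lborel) \<partial>lborel)"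
        using seg by (intro nn_integral_mono) (auto simp: indicator_def)
      also have "\<dots> = (\<integral>\<^sup>+t. (\<integral>\<^sup>+h. ennreal H * ennreal (G (x + t *\<^sub>R h)) * indicator {0<..T} t * indicator A h \<partial>lborel) \<partial>lborel)"
        by (rule lborel_pair.Fubini') measurable
      also have "\<dots> = (\<integral>\<^sup>+t. ennreal H * ennreal (f x t) \<partial>lborel)"
      proof (rule nn_integral_cong)
        fix t :: real
        have "(\<integral>\<^sup>+h. ennreal H * ennreal (G (x + t *\<^sub>R h)) * indicator {0<..T} t * indicator A h \<partial>lborel)
            = (\<integral>\<^sup>+h. (ennreal H * indicator {0<..T} t) * (ennreal (G (x + t *\<^sub>R h)) * indicator A h) \<partial>lborel)"
          by (intro nn_integral_cong) (simp add: mult_ac)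
        also have "\<dots> = ennreal H * indicator {0<..T} t * ennreal (S t x)"
          by (subst nn_integral_cmult) (simp_all add: S_nn)
        also have "\<dots> = ennreal H * ennreal (f x t)"
          by (auto simp: f_def indicator_def)
        finally show "(\<integral>\<^sup>+h. ennreal H * ennreal (G (x + t *\<^sub>R h)) * indicator {0<..T} t * indicator A h \<partial>lborel) = ennreal H * ennreal (f x t)" .
      qed
      also have "\<dots> = ennreal H * ennreal (LINT t|lborel. f x t)"
        using f_int f0 by (simp add: nn_integral_cmult nn_integral_eq_integral)
      finally have "ennreal \<bar>\<phi> x\<bar> \<le> ennreal (H * (LINT t|lborel. f x t))"
        using H(1) f0 by (simp add: ennreal_mult)
      then show ?thesis using H(1) f0 by (simp add: mult_nonneg_nonneg)
    qed
    define c where "c = H powr q * Z powr (q - 1)"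
    have ptq: "ennreal (\<bar>\<phi> x\<bar> powr q) \<le> ennreal c *
        (\<integral>\<^sup>+t. ennreal (B powr ((q - P) / P)) * (ennreal (t powr \<gamma>) * indicator {0<..T} t) * K t x \<partial>lborel)" for x
    proof -
      have "\<bar>\<phi> x\<bar> powr q \<le> (H * (LINT t|lborel. f x t)) powr q" using pt[of x] q1 by (intro powr_mono2) auto
      also have "\<dots> = H powr q * (LINT t|lborel. f x t) powr q" using H(1) f0 by (simp add: powr_mult)
      finally have "ennreal (\<bar>\<phi> x\<bar> powr q) \<le> ennreal (H powr q) * ennreal ((LINT t|lborel. f x t) powr q)"
        by (simp add: ennreal_mult[symmetric] ennreal_leI)
      also have "\<dots> \<le> ennreal (H powr q) * (ennreal ((LINT t|lborel. w t) powr (q - 1)) *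
          (\<integral>\<^sup>+t. ennreal (f x t powr q * w t powr (1 - q)) \<partial>lborel))"
        using q1 T by (intro mult_left_mono weighted_hoelder f_int f0 w_int w0) (auto simp: w_def f_def indicator_def)
      also have "\<dots> = ennreal c * (\<integral>\<^sup>+t. ennreal (f x t powr q * w t powr (1 - q)) \<partial>lborel)"
        using w_int(2) by (simp add: c_def ennreal_mult mult.assoc)
      also have "\<dots> \<le> ennreal c * (\<integral>\<^sup>+t. ennreal (B powr ((q - P) / P)) * (ennreal (t powr \<gamma>) * indicator {0<..T} t) * K t x \<partial>lborel)"
      proof (intro mult_left_mono nn_integral_mono)
        fix t :: real
        show "ennreal (f x t powr q * w t powr (1 - q)) \<le>
            ennreal (B powr ((q - P) / P)) * (ennreal (t powr \<gamma>) * indicator {0<..T} t) * K t x"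
        proof (cases "t \<in> {0<..T}")
          case True
          then have t: "t > 0" by simp
          have "ennreal (f x t powr q * w t powr (1 - q)) = ennreal (t powr (\<beta> * (q - 1))) * ennreal (S t x powr q)"
            using True by (simp add: f_def w_def powr_powr algebra_simps ennreal_mult[symmetric])
          also have "\<dots> \<le> ennreal (t powr (\<beta> * (q - 1))) * (ennreal ((t powr (- N) * B) powr ((q - P) / P)) * K t x)"
            by (intro mult_left_mono Sq[OF t]) simp
          also have "\<dots> = ennreal (t powr (\<beta> * (q - 1)) * (t powr (- N) * B) powr ((q - P) / P)) * K t x"
            by (simp add: ennreal_mult mult.assoc)
          also have "t powr (\<beta> * (q - 1)) * (t powr (- N) * B) powr ((q - P) / P) = B powr ((q - P) / P) * t powr \<gamma>"
          proof -
            have "(t powr (- N) * B) powr ((q - P) / P) = t powr (- N * ((q - P) / P)) * B powr ((q - P) / P)"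
              using B by (simp add: powr_mult powr_powr)
            moreover have "\<gamma> = \<beta> * (q - 1) + (- N * ((q - P) / P))" using P by (simp add: \<gamma>_def diff_divide_distrib)
            ultimately show ?thesis by (simp add: powr_add[symmetric])
          qed
          finally show ?thesis using True by (simp add: ennreal_mult)
        next
          case False
          then show ?thesis by (simp add: f_def)
        qed
      qed simp
      finally show ?thesis .
    qed
    have "(\<integral>\<^sup>+x. ennreal (\<bar>\<phi> x\<bar> powr q) \<partial>lborel) \<le>
        (\<integral>\<^sup>+x. ennreal c * (\<integral>\<^sup>+t. ennreal (B powr ((q - P) / P)) * (ennreal (t powr \<gamma>) * indicator {0<..T} t) * K t x \<partial>lborel) \<partial>lborel)"
      by (intro nn_integral_mono ptq)
    also have "\<dots> = ennreal c * (\<integral>\<^sup>+x. (\<integral>\<^sup>+t. ennreal (B powr ((q - P) / P)) * (ennreal (t powr \<gamma>) * indicator {0<..T} t) * K t x \<partial>lborel) \<partial>lborel)"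
      by (rule nn_integral_cmult) measurable
    also have "(\<integral>\<^sup>+x. (\<integral>\<^sup>+t. ennreal (B powr ((q - P) / P)) * (ennreal (t powr \<gamma>) * indicator {0<..T} t) * K t x \<partial>lborel) \<partial>lborel)
        = (\<integral>\<^sup>+t. (\<integral>\<^sup>+x. ennreal (B powr ((q - P) / P)) * (ennreal (t powr \<gamma>) * indicator {0<..T} t) * K t x \<partial>lborel) \<partial>lborel)"
      by (rule lborel_pair.Fubini') measurable
    also have "\<dots> = (\<integral>\<^sup>+t. ennreal (B powr ((q - P) / P)) * (ennreal (t powr \<gamma>) * indicator {0<..T} t) * (\<integral>\<^sup>+x. K t x \<partial>lborel) \<partial>lborel)"
      by (intro nn_integral_cong nn_integral_cmult) measurable
    also have "\<dots> \<le> (\<integral>\<^sup>+t. ennreal (B powr ((q - P) / P)) * (ennreal (t powr \<gamma>) * indicator {0<..T} t) * ennreal B \<partial>lborel)"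
      by (intro nn_integral_mono mult_left_mono xK) simp
    also have "\<dots> = ennreal (B powr ((q - P) / P)) * ennreal (T powr (\<gamma> + 1) / (\<gamma> + 1)) * ennreal B"
      using nn_integral_powr_from_0[OF \<gamma>, of T] T by (simp add: nn_integral_multc nn_integral_cmult)
    finally have "(\<integral>\<^sup>+x. ennreal (\<bar>\<phi> x\<bar> powr q) \<partial>lborel) \<le>
        ennreal c * (ennreal (B powr ((q - P) / P)) * ennreal (T powr (\<gamma> + 1) / (\<gamma> + 1)) * ennreal B)"
      by (simp add: mult_left_mono)
    also have "\<dots> = ennreal C"
      using B \<gamma> by (simp add: C_def c_def ennreal_mult[symmetric] mult_ac)
    finally show "(\<integral>\<^sup>+x. ennreal (\<bar>\<phi> x\<bar> powr q) \<partial>lborel) \<le> ennreal C" .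
  qed
qed

lemma cube_average_abs_le:
  fixes f :: "'a::euclidean_space \<Rightarrow> real"
  assumes [measurable]: "Q \<in> sets borel" and f: "integrable lborel (\<lambda>h. indicator Q h * f h)"
  shows "ennreal \<bar>LINT h|lborel. indicator Q h * f h\<bar> \<le> (\<integral>\<^sup>+h. ennreal \<bar>f h\<bar> * indicator Q h \<partial>lborel)"
proof -
  have "ennreal \<bar>LINT h|lborel. indicator Q h * f h\<bar> \<le> (\<integral>\<^sup>+h. ennreal (norm (indicator Q h * f h)) \<partial>lborel)"
    using integral_norm_bound_ennreal[OF f] by simp
  also have "\<dots> = (\<integral>\<^sup>+h. ennreal \<bar>f h\<bar> * indicator Q h \<partial>lborel)"
    by (intro nn_integral_cong) (auto simp: indicator_def)
  finally show ?thesis .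
qed

text \<open>The averages of the functions over cubes of side \<open>s\<close> are bounded and equicontinuous for fixed
  \<open>s\<close>, so a diagonal subsequence of them converges at all points of a countable dense set, hence everywhere,
  for each \<open>s = 1 / (k + 1)\<close>.  By bounded convergence these averages are Cauchy in \<open>L1\<close>, and by the translation
  estimate they are close in \<open>L1\<close> to the functions themselves, uniformly in \<open>n\<close>, for small \<open>s\<close>.\<close>

lemma rellich_test_functions:
  fixes \<Omega> :: "'a::euclidean_space set" and \<phi> :: "nat \<Rightarrow> 'a \<Rightarrow> real" and B :: real
  assumes bdd: "bounded \<Omega>" and \<phi>: "\<And>n. \<phi> n \<in> test_functions \<Omega>"
    and B: "B \<ge> 0" "\<And>n. (\<integral>\<^sup>+x. ennreal (norm (grad (\<phi> n) x)) \<partial>lborel) \<le> ennreal B"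
  obtains r :: "nat \<Rightarrow> nat" where "strict_mono r"
    "\<And>e. e > 0 \<Longrightarrow> \<exists>N. \<forall>m\<ge>N. \<forall>n\<ge>N. (\<integral>\<^sup>+x. ennreal \<bar>\<phi> (r m) x - \<phi> (r n) x\<bar> \<partial>lborel) \<le> ennreal e"
proof -
  define Q where "Q = cbox (0::'a) (0 + One)"
  have Qm[measurable]: "Q \<in> sets borel" by (simp add: Q_def)
  have Q1: "emeasure lborel Q = 1" unfolding Q_def by (rule emeasure_unit_cube)
  obtain H where H: "H > 0" "\<And>h. h \<in> Q \<Longrightarrow> norm h \<le> H"
    using bounded_cbox[of 0 "0 + One :: 'a"] unfolding Q_def bounded_pos by blast
  obtain R0 where R0: "\<And>x. x \<in> \<Omega> \<Longrightarrow> norm x \<le> R0" using bdd by (auto simp: bounded_iff)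
  define R where "R = \<bar>R0\<bar>"
  have R: "R \<ge> 0" "\<And>x. x \<in> \<Omega> \<Longrightarrow> norm x \<le> R" using R0 abs_ge_self[of R0] by (auto simp: R_def) (meson order_trans)
  define M0 where "M0 = (2 * R + 1) * B"
  have M0: "M0 \<ge> 0" using R B by (simp add: M0_def)
  note [measurable] = borel_measurable_test_function[OF \<phi>]
  have L1: "(\<integral>\<^sup>+x. ennreal \<bar>\<phi> n x\<bar> \<partial>lborel) \<le> ennreal M0" for n
  proof -
    have "(\<integral>\<^sup>+x. ennreal \<bar>\<phi> n x\<bar> \<partial>lborel) \<le> ennreal (2 * R + 1) * (\<integral>\<^sup>+x. ennreal (norm (grad (\<phi> n) x)) \<partial>lborel)"
      by (rule poincare_test_function[OF R \<phi>])
    also have "\<dots> \<le> ennreal (2 * R + 1) * ennreal B" by (intro mult_left_mono B) simp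
    finally show ?thesis using R B by (simp add: M0_def ennreal_mult)
  qed
  have transl: "(\<integral>\<^sup>+x. ennreal \<bar>\<phi> n (x + h) - \<phi> n x\<bar> \<partial>lborel) \<le> ennreal (norm h * B)" for n h
  proof -
    have "(\<integral>\<^sup>+x. ennreal \<bar>\<phi> n (x + h) - \<phi> n x\<bar> \<partial>lborel) \<le> ennreal (norm h) * (\<integral>\<^sup>+x. ennreal (norm (grad (\<phi> n) x)) \<partial>lborel)"
      by (rule translation_estimate[OF \<phi>])
    also have "\<dots> \<le> ennreal (norm h) * ennreal B" by (intro mult_left_mono B) simp
    finally show ?thesis using B by (simp add: ennreal_mult)
  qed
  have iQ: "integrable lborel (\<lambda>h. indicator Q h * c :: real)" for c
    using Q1 by simp
  have iQ1: "(LINT h|lborel. indicator Q h * c) = (c::real)" for c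
    using Q1 by (simp add: measure_def)
  have int: "integrable lborel (\<lambda>h. indicator Q h * \<phi> n (x + s *\<^sub>R h))" for n x s
  proof -
    obtain BG where BG: "BG > 0" "\<And>x. \<bar>\<phi> n x\<bar> \<le> BG" using test_function_bounded[OF \<phi>] by metis
    show ?thesis
    proof (rule Bochner_Integration.integrable_bound[OF iQ[of BG]])
      show "AE h in lborel. norm (indicator Q h * \<phi> n (x + s *\<^sub>R h)) \<le> norm (indicator Q h * BG)"
        using BG by (intro AE_I2) (simp add: indicator_def)
    qed simp
  qed
  define avg where "avg s n x = (LINT h|lborel. indicator Q h * \<phi> n (x + s *\<^sub>R h))" for s n x
  have avg_meas[measurable]: "avg s n \<in> borel_measurable borel" for s n
    unfolding avg_def by measurable
  have avg_bound: "\<bar>avg s n x\<bar> \<le> inverse (s ^ DIM('a)) * M0" if s: "s > 0" for s n x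
  proof -
    have "ennreal \<bar>avg s n x\<bar> \<le> (\<integral>\<^sup>+h. ennreal \<bar>\<phi> n (x + s *\<^sub>R h)\<bar> * indicator Q h \<partial>lborel)"
      unfolding avg_def by (rule cube_average_abs_le[OF Qm int])
    also have "\<dots> \<le> (\<integral>\<^sup>+h. ennreal \<bar>\<phi> n (x + s *\<^sub>R h)\<bar> \<partial>lborel)"
      by (intro nn_integral_mono) (auto simp: indicator_def)
    also have "\<dots> = ennreal (inverse (s ^ DIM('a))) * (\<integral>\<^sup>+y. ennreal \<bar>\<phi> n y\<bar> \<partial>lborel)"
      by (rule nn_integral_scale[OF _ s]) measurable
    also have "\<dots> \<le> ennreal (inverse (s ^ DIM('a))) * ennreal M0" by (intro mult_left_mono L1) simp
    finally show ?thesis using s M0 by (simp add: ennreal_mult[symmetric] zero_le_mult_iff)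
  qed
  have avg_lip: "\<bar>avg s n x - avg s n y\<bar> \<le> inverse (s ^ DIM('a)) * (norm (x - y) * B)" if s: "s > 0" for s n x y
  proof -
    let ?d = "\<lambda>h. \<phi> n (x + s *\<^sub>R h) - \<phi> n (y + s *\<^sub>R h)"
    have i: "integrable lborel (\<lambda>h. indicator Q h * ?d h)"
      using Bochner_Integration.integrable_diff[OF int[of n x s] int[of n y s]] by (simp add: right_diff_distrib)
    have "avg s n x - avg s n y = (LINT h|lborel. indicator Q h * ?d h)"
      unfolding avg_def using int[of n x s] int[of n y s] by (simp add: right_diff_distrib)
    then have "ennreal \<bar>avg s n x - avg s n y\<bar> \<le> (\<integral>\<^sup>+h. ennreal \<bar>?d h\<bar> * indicator Q h \<partial>lborel)"
      using cube_average_abs_le[OF Qm i] by simp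
    also have "\<dots> \<le> (\<integral>\<^sup>+h. ennreal \<bar>\<phi> n (y + s *\<^sub>R h + (x - y)) - \<phi> n (y + s *\<^sub>R h)\<bar> \<partial>lborel)"
      by (intro nn_integral_mono) (auto simp: indicator_def algebra_simps)
    also have "\<dots> = ennreal (inverse (s ^ DIM('a))) * (\<integral>\<^sup>+z. ennreal \<bar>\<phi> n (z + (x - y)) - \<phi> n z\<bar> \<partial>lborel)"
      by (rule nn_integral_scale[where f = "\<lambda>z. ennreal \<bar>\<phi> n (z + (x - y)) - \<phi> n z\<bar>", OF _ s]) measurable
    also have "\<dots> \<le> ennreal (inverse (s ^ DIM('a))) * ennreal (norm (x - y) * B)"
      by (intro mult_left_mono transl) simp
    finally show ?thesis using s B by (simp add: ennreal_mult[symmetric] zero_le_mult_iff)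
  qed
  have avg_close: "(\<integral>\<^sup>+x. ennreal \<bar>avg s n x - \<phi> n x\<bar> \<partial>lborel) \<le> ennreal (s * H * B)" if s: "s > 0" for s n
  proof -
    have "ennreal \<bar>avg s n x - \<phi> n x\<bar> \<le> (\<integral>\<^sup>+h. ennreal \<bar>\<phi> n (x + s *\<^sub>R h) - \<phi> n x\<bar> * indicator Q h \<partial>lborel)" for x
    proof -
      let ?d = "\<lambda>h. \<phi> n (x + s *\<^sub>R h) - \<phi> n x"
      have i: "integrable lborel (\<lambda>h. indicator Q h * ?d h)"
        using Bochner_Integration.integrable_diff[OF int[of n x s] iQ[of "\<phi> n x"]] by (simp add: right_diff_distrib)
      have "avg s n x - (LINT h|lborel. indicator Q h * \<phi> n x) = (LINT h|lborel. indicator Q h * \<phi> n (x + s *\<^sub>R h) - indicator Q h * \<phi> n x)"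
        unfolding avg_def by (rule Bochner_Integration.integral_diff[symmetric, OF int iQ])
      then have "avg s n x - \<phi> n x = (LINT h|lborel. indicator Q h * ?d h)"
        unfolding iQ1 by (simp add: right_diff_distrib)
      then show ?thesis using cube_average_abs_le[OF Qm i] by simp
    qed
    then have "(\<integral>\<^sup>+x. ennreal \<bar>avg s n x - \<phi> n x\<bar> \<partial>lborel) \<le>
        (\<integral>\<^sup>+x. (\<integral>\<^sup>+h. ennreal \<bar>\<phi> n (x + s *\<^sub>R h) - \<phi> n x\<bar> * indicator Q h \<partial>lborel) \<partial>lborel)"
      by (rule nn_integral_mono)
    also have "\<dots> = (\<integral>\<^sup>+h. (\<integral>\<^sup>+x. ennreal \<bar>\<phi> n (x + s *\<^sub>R h) - \<phi> n x\<bar> * indicator Q h \<partial>lborel) \<partial>lborel)"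
      by (rule lborel_pair.Fubini') measurable
    also have "\<dots> \<le> (\<integral>\<^sup>+h. ennreal (s * H * B) * indicator Q h \<partial>lborel)"
    proof (rule nn_integral_mono)
      fix h :: 'a
      show "(\<integral>\<^sup>+x. ennreal \<bar>\<phi> n (x + s *\<^sub>R h) - \<phi> n x\<bar> * indicator Q h \<partial>lborel) \<le> ennreal (s * H * B) * indicator Q h"
      proof (cases "h \<in> Q")
        case True
        have "(\<integral>\<^sup>+x. ennreal \<bar>\<phi> n (x + s *\<^sub>R h) - \<phi> n x\<bar> \<partial>lborel) \<le> ennreal (norm (s *\<^sub>R h) * B)"
          by (rule transl)
        also have "\<dots> \<le> ennreal (s * H * B)"
          using H(2)[OF True] s B by (intro ennreal_leI mult_right_mono) auto
        finally show ?thesis using True by simp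
      qed simp
    qed
    also have "\<dots> = ennreal (s * H * B)" using Q1 by (simp add: nn_integral_cmult)
    finally show ?thesis .
  qed
  define s where "s k = 1 / real (Suc k)" for k
  have s: "s k > 0" for k by (simp add: s_def)
  obtain D :: "'a set" where D: "countable D" "\<And>X. open X \<Longrightarrow> X \<noteq> {} \<Longrightarrow> \<exists>d\<in>D. d \<in> X"
    by (rule countable_dense_exists[THEN exE]) blast
  \<comment> \<open>The factor \<open>s ^ DIM('a)\<close> compensates for the growth of the bound on the averages, which makes
    the family uniformly bounded over all scales.\<close>
  define F where "F n z = (s (fst z)) ^ DIM('a) * avg (s (fst z)) n (snd z)" for n and z :: "nat \<times> 'a"
  have "countable (UNIV \<times> D :: (nat \<times> 'a) set)" using D(1) by simp
  moreover have "norm (F n z) \<le> M0" for n z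
  proof -
    have "\<bar>F n z\<bar> \<le> s (fst z) ^ DIM('a) * (inverse (s (fst z) ^ DIM('a)) * M0)"
      unfolding F_def abs_mult using avg_bound[OF s, of "fst z" n "snd z"] s[of "fst z"]
      by (intro mult_mono) auto
    then show ?thesis using s[of "fst z"] by (simp add: mult.assoc[symmetric])
  qed
  ultimately obtain r where r: "strict_mono r" "\<And>z. z \<in> UNIV \<times> D \<Longrightarrow> \<exists>l. (\<lambda>n. F (r n) z) \<longlonglongrightarrow> l"
    using function_convergent_subsequence[of "UNIV \<times> D" F M0] by blast
  have convD: "Cauchy (\<lambda>n. avg (s k) (r n) d)" if d: "d \<in> D" for k d
  proof -
    obtain l where "(\<lambda>n. F (r n) (k, d)) \<longlonglongrightarrow> l" using r(2)[of "(k, d)"] d by auto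
    then have "(\<lambda>n. inverse (s k ^ DIM('a)) * F (r n) (k, d)) \<longlonglongrightarrow> inverse (s k ^ DIM('a)) * l"
      by (intro tendsto_intros)
    moreover have "inverse (s k ^ DIM('a)) * F (r n) (k, d) = avg (s k) (r n) d" for n
      using s[of k] by (simp add: F_def)
    ultimately show ?thesis using LIMSEQ_imp_Cauchy by simp
  qed
  have conv: "Cauchy (\<lambda>n. avg (s k) (r n) x)" for k x
  proof (rule metric_CauchyI)
    fix e :: real assume e: "e > 0"
    define L where "L = inverse (s k ^ DIM('a)) * B + 1"
    have L: "L > 0" using s[of k] B by (simp add: L_def add_nonneg_pos)
    have "e / (3 * L) > 0" using e L by simp
    then have "ball x (e / (3 * L)) \<noteq> {}" by (simp only: ball_eq_empty not_le)
    then obtain d where d: "d \<in> D" "d \<in> ball x (e / (3 * L))" using D(2)[OF open_ball] by blast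
    have close: "\<bar>avg (s k) n x - avg (s k) n d\<bar> < e / 3" for n
    proof -
      have "\<bar>avg (s k) n x - avg (s k) n d\<bar> \<le> inverse (s k ^ DIM('a)) * (norm (x - d) * B)" by (rule avg_lip[OF s])
      also have "\<dots> = (inverse (s k ^ DIM('a)) * B) * norm (x - d)" by simp
      also have "\<dots> \<le> L * norm (x - d)" by (intro mult_right_mono) (simp_all add: L_def)
      also have "\<dots> < L * (e / (3 * L))" using d(2) L by (intro mult_strict_left_mono) (auto simp: dist_norm)
      finally show ?thesis using L by simp
    qed
    obtain N where N: "\<And>m n. m \<ge> N \<Longrightarrow> n \<ge> N \<Longrightarrow> dist (avg (s k) (r m) d) (avg (s k) (r n) d) < e / 3"
      using metric_CauchyD[OF convD[OF d(1), of k], of "e / 3"] e by auto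
    show "\<exists>M. \<forall>m\<ge>M. \<forall>n\<ge>M. dist (avg (s k) (r m) x) (avg (s k) (r n) x) < e"
    proof (intro exI[of _ N] allI impI)
      fix m n assume "m \<ge> N" "n \<ge> N"
      then show "dist (avg (s k) (r m) x) (avg (s k) (r n) x) < e"
        using N[of m n] close[of "r m"] close[of "r n"] unfolding dist_real_def by linarith
    qed
  qed
  define l where "l k x = lim (\<lambda>n. avg (s k) (r n) x)" for k x
  have l: "(\<lambda>n. avg (s k) (r n) x) \<longlonglongrightarrow> l k x" for k x
    using conv[of k x] by (simp add: l_def Cauchy_convergent_iff convergent_LIMSEQ_iff)
  have lm[measurable]: "l k \<in> borel_measurable borel" for k
    by (rule borel_measurable_LIMSEQ_real[OF l]) simp
  \<comment> \<open>Outside this ball of finite measure all the functions vanish, though their averages need not.\<close>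
  define \<Omega>' where "\<Omega>' = cball (0::'a) R"
  have \<Omega>m[measurable]: "\<Omega>' \<in> sets borel" by (simp add: \<Omega>'_def)
  have fin: "emeasure lborel \<Omega>' < \<infinity>" using emeasure_lborel_cball_finite[of 0 R] by (simp add: \<Omega>'_def)
  have dct: "(\<lambda>n. \<integral>\<^sup>+x. ennreal \<bar>avg (s k) (r n) x - l k x\<bar> * indicator \<Omega>' x \<partial>lborel) \<longlonglongrightarrow> 0" for k
  proof -
    let ?b = "inverse (s k ^ DIM('a)) * M0"
    have lb: "\<bar>l k x\<bar> \<le> ?b" for x
      by (rule LIMSEQ_le_const2[OF tendsto_rabs[OF l]]) (use avg_bound[OF s] in auto)
    have "(\<lambda>n. \<integral>\<^sup>+x. ennreal \<bar>avg (s k) (r n) x - l k x\<bar> * indicator \<Omega>' x \<partial>lborel) \<longlonglongrightarrow> (\<integral>\<^sup>+x. 0 \<partial>(lborel :: 'a measure))"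
    proof (rule nn_integral_dominated_convergence[where w = "\<lambda>x. ennreal (2 * ?b) * indicator \<Omega>' x"])
      show "AE x in lborel. ennreal \<bar>avg (s k) (r n) x - l k x\<bar> * indicator \<Omega>' x \<le> ennreal (2 * ?b) * indicator \<Omega>' x" for n
      proof (rule AE_I2)
        fix x
        have "\<bar>avg (s k) (r n) x - l k x\<bar> \<le> 2 * ?b" using avg_bound[OF s, of k "r n" x] lb[of x] by linarith
        then show "ennreal \<bar>avg (s k) (r n) x - l k x\<bar> * indicator \<Omega>' x \<le> ennreal (2 * ?b) * indicator \<Omega>' x"
          by (intro mult_right_mono ennreal_leI) auto
      qed
      show "(\<integral>\<^sup>+x. ennreal (2 * ?b) * indicator \<Omega>' x \<partial>lborel) < \<infinity>"
        using fin by (simp add: nn_integral_cmult ennreal_mult_less_top)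
      show "AE x in lborel. (\<lambda>n. ennreal \<bar>avg (s k) (r n) x - l k x\<bar> * indicator \<Omega>' x) \<longlonglongrightarrow> 0"
      proof (rule AE_I2)
        fix x
        have "(\<lambda>n. \<bar>avg (s k) (r n) x - l k x\<bar>) \<longlonglongrightarrow> 0"
          using tendsto_rabs[OF tendsto_diff[OF l[of k x] tendsto_const[of "l k x"]]] by simp
        then have "(\<lambda>n. ennreal \<bar>avg (s k) (r n) x - l k x\<bar>) \<longlonglongrightarrow> ennreal 0" by (rule tendsto_ennrealI)
        then show "(\<lambda>n. ennreal \<bar>avg (s k) (r n) x - l k x\<bar> * indicator \<Omega>' x) \<longlonglongrightarrow> 0"
          by (cases "x \<in> \<Omega>'") auto
      qed
    qed measurable
    then show ?thesis by simp
  qed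
  show ?thesis
  proof (rule that[OF r(1)])
    fix e :: real assume e: "e > 0"
    obtain k where k: "s k < e / (4 * (H * B + 1))"
      using nat_approx_posE[of "e / (4 * (H * B + 1))"] e H B unfolding s_def by (metis add_nonneg_pos divide_pos_pos mult_nonneg_nonneg mult_pos_pos less_imp_le zero_less_numeral zero_less_one)
    have sk: "s k * H * B \<le> e / 4"
    proof -
      have "s k * (H * B) \<le> e / (4 * (H * B + 1)) * (H * B)"
        using k H B by (intro mult_right_mono) auto
      also have "\<dots> \<le> e / (4 * (H * B + 1)) * (H * B + 1)"
        using e H B by (intro mult_left_mono) auto
      also have "\<dots> = e / 4"
      proof -
        have "H * B + 1 > 0" using H B by (intro add_nonneg_pos mult_nonneg_nonneg) auto
        then show ?thesis by (simp add: divide_simps)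
      qed
      finally show ?thesis by (simp add: mult.assoc)
    qed
    have "\<forall>\<^sub>F n in sequentially. (\<integral>\<^sup>+x. ennreal \<bar>avg (s k) (r n) x - l k x\<bar> * indicator \<Omega>' x \<partial>lborel) < ennreal (e / 4)"
      by (rule order_tendstoD(2)[OF dct]) (use e in simp)
    then obtain N where N: "\<And>n. n \<ge> N \<Longrightarrow> (\<integral>\<^sup>+x. ennreal \<bar>avg (s k) (r n) x - l k x\<bar> * indicator \<Omega>' x \<partial>lborel) \<le> ennreal (e / 4)"
      unfolding eventually_sequentially using less_imp_le by metis
    have "(\<integral>\<^sup>+x. ennreal \<bar>\<phi> (r m) x - \<phi> (r n) x\<bar> \<partial>lborel) \<le> ennreal e" if mn: "m \<ge> N" "n \<ge> N" for m n
    proof -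
      let ?a = "\<lambda>m x. ennreal \<bar>avg (s k) (r m) x - \<phi> (r m) x\<bar>"
      let ?b = "\<lambda>m x. ennreal \<bar>avg (s k) (r m) x - l k x\<bar> * indicator \<Omega>' x"
      have "ennreal \<bar>\<phi> (r m) x - \<phi> (r n) x\<bar> \<le> (?a m x + ?a n x) + (?b m x + ?b n x)" for x
      proof (cases "x \<in> \<Omega>'")
        case True
        have "\<bar>\<phi> (r m) x - \<phi> (r n) x\<bar> \<le> (\<bar>avg (s k) (r m) x - \<phi> (r m) x\<bar> + \<bar>avg (s k) (r n) x - \<phi> (r n) x\<bar>) +
            (\<bar>avg (s k) (r m) x - l k x\<bar> + \<bar>avg (s k) (r n) x - l k x\<bar>)" by linarith
        then show ?thesis using True by (simp add: ennreal_plus[symmetric] del: ennreal_plus)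
      next
        case False
        then have "x \<notin> \<Omega>" using R(2) by (auto simp: \<Omega>'_def)
        then show ?thesis using test_function_outside(1)[OF \<phi>] by simp
      qed
      then have "(\<integral>\<^sup>+x. ennreal \<bar>\<phi> (r m) x - \<phi> (r n) x\<bar> \<partial>lborel) \<le> (\<integral>\<^sup>+x. (?a m x + ?a n x) + (?b m x + ?b n x) \<partial>lborel)"
        by (rule nn_integral_mono)
      also have "\<dots> = ((\<integral>\<^sup>+x. ?a m x \<partial>lborel) + (\<integral>\<^sup>+x. ?a n x \<partial>lborel)) + ((\<integral>\<^sup>+x. ?b m x \<partial>lborel) + (\<integral>\<^sup>+x. ?b n x \<partial>lborel))"
        by (simp add: nn_integral_add)
      also have "\<dots> \<le> (ennreal (e / 4) + ennreal (e / 4)) + (ennreal (e / 4) + ennreal (e / 4))"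
      proof (intro add_mono)
        have "(\<integral>\<^sup>+x. ?a j x \<partial>lborel) \<le> ennreal (e / 4)" for j
          using avg_close[OF s, of k "r j"] sk by (meson ennreal_leI order_trans)
        then show "(\<integral>\<^sup>+x. ?a m x \<partial>lborel) \<le> ennreal (e / 4)" "(\<integral>\<^sup>+x. ?a n x \<partial>lborel) \<le> ennreal (e / 4)" by blast+
      qed (use N mn in blast)+
      also have "\<dots> = ennreal e" using e by (simp add: ennreal_plus[symmetric] del: ennreal_plus)
      finally show ?thesis .
    qed
    then show "\<exists>N. \<forall>m\<ge>N. \<forall>n\<ge>N. (\<integral>\<^sup>+x. ennreal \<bar>\<phi> (r m) x - \<phi> (r n) x\<bar> \<partial>lborel) \<le> ennreal e" by blast
  qed
qed

section \<open>Modular spaces with variable exponent\<close>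

lemma midpoint_powr_less:
  fixes x y :: real
  assumes q: "q > 1" and xy: "0 \<le> x" "x < y"
  shows "((x + y) / 2) powr q < (x powr q + y powr q) / 2"
proof -
  define m where "m = (x + y) / 2"
  have m: "x < m" "m < y" "m - x = y - m" using xy by (auto simp: m_def field_simps)
  have mv: "\<exists>z. a < z \<and> z < b \<and> b powr q - a powr q = (b - a) * (q * z powr (q - 1))" if ab: "0 \<le> a" "a < b" for a b :: real
  proof -
    have "\<exists>l z. a < z \<and> z < b \<and> DERIV (\<lambda>t. t powr q) z :> l \<and> b powr q - a powr q = (b - a) * l"
    proof (rule MVT[OF ab(2)])
      show "continuous_on {a..b} (\<lambda>t. t powr q)"
        using ab q by (intro continuous_on_powr' continuous_intros) auto
      show "(\<lambda>t. t powr q) differentiable (at t)" if "a < t" "t < b" for t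
        using that ab has_real_derivative_powr[of t q] real_differentiable_def by auto
    qed
    then obtain l z where z: "a < z" "z < b" "DERIV (\<lambda>t. t powr q) z :> l" "b powr q - a powr q = (b - a) * l" by blast
    have "l = q * z powr (q - 1)" using DERIV_unique[OF z(3) has_real_derivative_powr[of z q]] z(1) ab by simp
    then show ?thesis using z by auto
  qed
  obtain z1 z2 where z: "x < z1" "z1 < m" "m powr q - x powr q = (m - x) * (q * z1 powr (q - 1))"
    "m < z2" "z2 < y" "y powr q - m powr q = (y - m) * (q * z2 powr (q - 1))"
    using mv[of x m] mv[of m y] m xy by auto
  have "z1 powr (q - 1) < z2 powr (q - 1)" using z xy q by (intro powr_less_mono2) auto
  then have "m powr q - x powr q < y powr q - m powr q"
    unfolding z(3,6) m(3) using m(2) q by (intro mult_strict_left_mono) auto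
  then show ?thesis by (simp add: m_def)
qed

text \<open>For different norms this is the strict convexity of the power.  For equal norms it follows from the
  triangle inequality, in which equality would force \<open>a = b\<close>.\<close>

lemma midpoint_norm_powr_less:
  fixes a b :: "'b::real_inner"
  assumes s: "s > 1" and ab: "a \<noteq> b"
  shows "norm ((1 / 2) *\<^sub>R (a + b)) powr s < (norm a powr s + norm b powr s) / 2"
proof -
  have n: "norm ((1 / 2) *\<^sub>R (a + b)) = norm (a + b) / 2" by simp
  consider "norm a < norm b" | "norm b < norm a" | "norm a = norm b" by linarith
  then show ?thesis
  proof cases
    case 1
    have "(norm (a + b) / 2) powr s \<le> ((norm a + norm b) / 2) powr s"
      using s norm_triangle_ineq[of a b] by (intro powr_mono2) auto
    also have "\<dots> < (norm a powr s + norm b powr s) / 2" by (rule midpoint_powr_less) (use s 1 in auto)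
    finally show ?thesis by (simp add: n)
  next
    case 2
    have "(norm (a + b) / 2) powr s \<le> ((norm b + norm a) / 2) powr s"
      using s norm_triangle_ineq[of a b] by (intro powr_mono2) auto
    also have "\<dots> < (norm b powr s + norm a powr s) / 2" by (rule midpoint_powr_less) (use s 2 in auto)
    finally show ?thesis by (simp add: n)
  next
    case 3
    have na: "norm a > 0" using 3 ab by (metis norm_eq_zero zero_less_norm_iff)
    have "norm (a + b) \<noteq> norm a + norm b"
    proof
      assume "norm (a + b) = norm a + norm b"
      then have "norm a *\<^sub>R b = norm b *\<^sub>R a" by (simp add: norm_triangle_eq)
      then show False using 3 na ab by simp
    qed
    then have "norm (a + b) / 2 < norm a" using norm_triangle_ineq[of a b] 3 by simp
    then have "(norm (a + b) / 2) powr s < norm a powr s" using s by (intro powr_less_mono2) auto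
    then show ?thesis using 3 by (simp add: n)
  qed
qed

lemma midpoint_norm_powr_le:
  fixes a b :: "'b::real_inner"
  assumes s: "s > 1"
  shows "norm ((1 / 2) *\<^sub>R (a + b)) powr s \<le> (norm a powr s + norm b powr s) / 2"
proof (cases "a = b")
  case False
  then show ?thesis using midpoint_norm_powr_less[OF s] less_imp_le by blast
qed (simp add: scaleR_2[symmetric])

lemma powr_add_le:
  fixes x y :: real
  assumes "0 \<le> x" "0 \<le> y" "0 \<le> s" "s \<le> S"
  shows "(x + y) powr s \<le> 2 powr S * (x powr s + y powr s)"
proof -
  have "(x + y) powr s \<le> (2 * max x y) powr s" using assms by (intro powr_mono2) auto
  also have "\<dots> = 2 powr s * max x y powr s" using assms by (simp add: powr_mult)
  also have "\<dots> \<le> 2 powr S * (x powr s + y powr s)"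
    using assms by (intro mult_mono powr_mono) (auto simp: max_def)
  finally show ?thesis .
qed

text \<open>By homogeneity the larger of the two norms may be taken to be one, which leaves a compact set of
  exponents and vectors.  Where \<open>a\<close> and \<open>b\<close> are close the first term on the right suffices; on the rest, which
  is compact, the convexity gap is bounded below by a positive constant.\<close>

lemma uniform_convexity_powr:
  fixes pm pp e :: real
  assumes pm: "1 < pm" "pm \<le> pp" and e: "e > 0"
  obtains C where "C \<ge> 0" "\<And>s (a::'b::euclidean_space) b. pm \<le> s \<Longrightarrow> s \<le> pp \<Longrightarrow>
    norm (a - b) powr s \<le> e * (norm a powr s + norm b powr s) +
      C * ((norm a powr s + norm b powr s) / 2 - norm ((1 / 2) *\<^sub>R (a + b)) powr s)"
proof -
  define gap where "gap = (\<lambda>(s::real, a::'b, b). (norm a powr s + norm b powr s) / 2 - norm ((1 / 2) *\<^sub>R (a + b)) powr s)"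
  define X where "X = {pm..pp} \<times> cball (0::'b) 1 \<times> cball (0::'b) 1"
  have X: "compact X" unfolding X_def by (intro compact_Times) auto
  have cgap: "continuous_on X gap"
    unfolding gap_def case_prod_unfold X_def
    by (intro continuous_intros continuous_on_powr') (use pm in auto)
  define K where "K = X \<inter> {z. max (norm (fst (snd z))) (norm (snd (snd z))) = 1 \<and> e \<le> norm (fst (snd z) - snd (snd z)) powr fst z}"
  have K: "compact K"
  proof -
    have "closedin (top_of_set X) {z\<in>X. max (norm (fst (snd z))) (norm (snd (snd z))) = 1}"
      by (intro continuous_closedin_preimage_constant continuous_intros)
    moreover have "closedin (top_of_set X) {z\<in>X. e \<le> norm (fst (snd z) - snd (snd z)) powr fst z}"
    proof -
      have "continuous_on X (\<lambda>z. norm (fst (snd z) - snd (snd z)) powr fst z)"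
        unfolding X_def by (intro continuous_intros continuous_on_powr') (use pm in auto)
      from continuous_closedin_preimage[OF this closed_atLeast[of e]]
      show ?thesis by (simp add: vimage_def Int_def)
    qed
    ultimately have "closedin (top_of_set X) ({z\<in>X. max (norm (fst (snd z))) (norm (snd (snd z))) = 1} \<inter>
        {z\<in>X. e \<le> norm (fst (snd z) - snd (snd z)) powr fst z})" by (rule closedin_Int)
    moreover have "\<dots> = K" by (auto simp: K_def)
    ultimately show ?thesis using closedin_compact[OF X] by metis
  qed
  have gap0: "gap (s, a, b) \<ge> 0" if "s \<ge> pm" for s a b
    using midpoint_norm_powr_le[of s a b] that pm by (simp add: gap_def)
  obtain \<delta> where \<delta>: "\<delta> > 0" "\<And>z. z \<in> K \<Longrightarrow> \<delta> \<le> gap z"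
  proof (cases "K = {}")
    case True
    then show ?thesis using that[of 1] by auto
  next
    case False
    have "continuous_on K gap" using cgap by (rule continuous_on_subset) (auto simp: K_def)
    then obtain z where z: "z \<in> K" "\<And>y. y \<in> K \<Longrightarrow> gap z \<le> gap y"
      using continuous_attains_inf[OF K False] by blast
    obtain s a b where zs: "z = (s, a, b)" by (cases z)
    have "a \<noteq> b" using z(1) e by (auto simp: K_def zs)
    moreover have "s > 1" using z(1) pm by (auto simp: K_def X_def zs)
    ultimately have "gap z > 0" using midpoint_norm_powr_less[of s a b] by (simp add: gap_def zs)
    then show ?thesis using that z(2) by blast
  qed
  define C where "C = 2 powr pp / \<delta>"
  have C: "C \<ge> 0" using \<delta>(1) by (simp add: C_def)
  have unit: "norm (a - b) powr s \<le> e * (norm a powr s + norm b powr s) + C * gap (s, a, b)"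
    if s: "pm \<le> s" "s \<le> pp" and ab: "max (norm a) (norm b) = 1" for s and a b :: 'b
  proof (cases "e \<le> norm (a - b) powr s")
    case True
    have n: "norm a \<le> 1" "norm b \<le> 1" using ab by (auto simp: max_def split: if_splits)
    then have "(s, a, b) \<in> K" using True s ab by (auto simp: K_def X_def)
    then have "\<delta> \<le> gap (s, a, b)" by (rule \<delta>(2))
    then have "C * \<delta> \<le> C * gap (s, a, b)" by (rule mult_left_mono[OF _ C])
    moreover have "norm (a - b) powr s \<le> 2 powr pp"
    proof -
      have "norm (a - b) \<le> 2" using norm_triangle_ineq4[of a b] n by simp
      then have "norm (a - b) powr s \<le> 2 powr s" using s pm by (intro powr_mono2) auto
      also have "\<dots> \<le> 2 powr pp" using s by (intro powr_mono) auto
      finally show ?thesis .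
    qed
    moreover have "0 \<le> e * (norm a powr s + norm b powr s)" using e by simp
    ultimately show ?thesis using \<delta>(1) by (simp add: C_def)
  next
    case False
    have "1 \<le> norm a powr s + norm b powr s" using ab by (auto simp: max_def split: if_splits)
    then have "e * 1 \<le> e * (norm a powr s + norm b powr s)" using e by (intro mult_left_mono) auto
    moreover have "0 \<le> C * gap (s, a, b)" using C gap0[OF s(1)] by simp
    ultimately show ?thesis using False by linarith
  qed
  show ?thesis
  proof (rule that[OF C])
    fix s and a b :: 'b assume s: "pm \<le> s" "s \<le> pp"
    define m where "m = max (norm a) (norm b)"
    show "norm (a - b) powr s \<le> e * (norm a powr s + norm b powr s) +
      C * ((norm a powr s + norm b powr s) / 2 - norm ((1 / 2) *\<^sub>R (a + b)) powr s)"
    proof (cases "m = 0")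
      case True
      then have "norm a = 0 \<and> norm b = 0" by (auto simp: m_def max_def split: if_splits)
      then show ?thesis by simp
    next
      case False
      then have m: "m > 0" by (simp add: m_def less_max_iff_disj max_def split: if_splits)
      define a' b' where "a' = (1 / m) *\<^sub>R a" and "b' = (1 / m) *\<^sub>R b"
      have a: "a = m *\<^sub>R a'" and b: "b = m *\<^sub>R b'" using m by (simp_all add: a'_def b'_def)
      have "max (norm a') (norm b') = 1"
        using m by (auto simp: a'_def b'_def m_def max_def field_simps split: if_splits)
      from unit[OF s this]
      have "m powr s * norm (a' - b') powr s \<le> m powr s * (e * (norm a' powr s + norm b' powr s) + C * gap (s, a', b'))"
        by (rule mult_left_mono) simp
      moreover have "norm (a - b) powr s = m powr s * norm (a' - b') powr s"
        using m unfolding a b by (simp add: scaleR_diff_right[symmetric] powr_mult)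
      moreover have "norm a powr s = m powr s * norm a' powr s" "norm b powr s = m powr s * norm b' powr s"
        using m unfolding a b by (simp_all add: powr_mult)
      moreover have "norm ((1 / 2) *\<^sub>R (a + b)) powr s = m powr s * norm ((1 / 2) *\<^sub>R (a' + b')) powr s"
      proof -
        have "(1 / 2) *\<^sub>R (a + b) = m *\<^sub>R ((1 / 2) *\<^sub>R (a' + b'))" unfolding a b by (simp add: algebra_simps)
        then have "norm ((1 / 2) *\<^sub>R (a + b)) = m * norm ((1 / 2) *\<^sub>R (a' + b'))" using m by (simp only: norm_scaleR abs_of_pos)
        then show ?thesis by (simp only: powr_mult)
      qed
      ultimately show ?thesis by (simp add: gap_def algebra_simps)
    qed
  qed
qed

text \<open>Where the norm exceeds \<open>e\<close>, the quotient \<open>norm (f x) / e\<close> is at most its \<open>p x\<close>-th power.  Dividing by a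
  small \<open>e\<close> first is what makes the additive term small.\<close>

lemma (in finite_measure) nn_L1_le_modular:
  fixes f :: "'a \<Rightarrow> 'b::euclidean_space"
  assumes f[measurable]: "f \<in> borel_measurable M" "p \<in> borel_measurable M"
    and p: "\<And>x. x \<in> space M \<Longrightarrow> 1 \<le> p x" "\<And>x. x \<in> space M \<Longrightarrow> p x \<le> pp"
    and e: "0 < e" "e \<le> 1"
  shows "(\<integral>\<^sup>+x. ennreal (norm (f x)) \<partial>M) \<le>
    ennreal (e * measure M (space M)) + ennreal (e powr (1 - pp)) * (\<integral>\<^sup>+x. ennreal (norm (f x) powr p x) \<partial>M)"
proof -
  have pt: "norm (f x) \<le> e + e powr (1 - pp) * norm (f x) powr p x" if x: "x \<in> space M" for x
  proof (cases "norm (f x) \<le> e")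
    case False
    let ?t = "norm (f x)"
    have t: "?t > e" using False by simp
    have "?t = e * (?t / e) powr 1" using e t by simp
    also have "\<dots> \<le> e * (?t / e) powr p x" using e t p[OF x] by (intro mult_left_mono powr_mono) auto
    also have "\<dots> = e powr (1 - p x) * ?t powr p x" using e t by (simp add: powr_divide powr_diff)
    also have "\<dots> \<le> e powr (1 - pp) * ?t powr p x"
      using e p[OF x] by (intro mult_right_mono powr_mono') auto
    finally show ?thesis using e by simp
  qed (use e in \<open>simp add: add_increasing2\<close>)
  have "(\<integral>\<^sup>+x. ennreal (norm (f x)) \<partial>M) \<le> (\<integral>\<^sup>+x. ennreal e + ennreal (e powr (1 - pp)) * ennreal (norm (f x) powr p x) \<partial>M)"
    by (rule nn_integral_mono) (use pt e in \<open>simp add: ennreal_mult[symmetric] ennreal_plus[symmetric] ennreal_leI del: ennreal_plus\<close>)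
  also have "\<dots> = ennreal e * emeasure M (space M) + ennreal (e powr (1 - pp)) * (\<integral>\<^sup>+x. ennreal (norm (f x) powr p x) \<partial>M)"
    by (simp add: nn_integral_add nn_integral_cmult)
  finally show ?thesis using e by (simp add: emeasure_eq_measure ennreal_mult)
qed

text \<open>The almost everywhere convergent subsequence is part of the conclusion because Fatou's lemma is
  applied along it.\<close>

lemma L1_complete:
  fixes s :: "nat \<Rightarrow> 'a \<Rightarrow> 'b::euclidean_space"
  assumes s: "\<And>n. integrable M (s n)"
    and cau: "\<And>e. e > 0 \<Longrightarrow> \<exists>N. \<forall>i\<ge>N. \<forall>j\<ge>N. (\<integral>\<^sup>+x. ennreal (norm (s i x - s j x)) \<partial>M) \<le> ennreal e"
  obtains r g where "strict_mono (r :: nat \<Rightarrow> nat)" "integrable M g" "AE x in M. (\<lambda>i. s (r i) x) \<longlonglongrightarrow> g x"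
    "(\<lambda>n. \<integral>\<^sup>+x. ennreal (norm (s n x - g x)) \<partial>M) \<longlonglongrightarrow> 0"
proof -
  have cau': "\<exists>N. \<forall>i\<ge>N. \<forall>j\<ge>N. (LINT x|M. norm (s i x - s j x)) < e" if e: "e > 0" for e
  proof -
    obtain N where N: "\<forall>i\<ge>N. \<forall>j\<ge>N. (\<integral>\<^sup>+x. ennreal (norm (s i x - s j x)) \<partial>M) \<le> ennreal (e / 2)"
      using cau[of "e / 2"] e by auto
    have "(LINT x|M. norm (s i x - s j x)) < e" if "i \<ge> N" "j \<ge> N" for i j
    proof -
      have "ennreal (LINT x|M. norm (s i x - s j x)) = (\<integral>\<^sup>+x. ennreal (norm (s i x - s j x)) \<partial>M)"
        by (rule nn_integral_eq_integral[symmetric]) (use s in auto)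
      also have "\<dots> \<le> ennreal (e / 2)" using N that by blast
      finally show ?thesis using e by simp
    qed
    then show ?thesis by blast
  qed
  obtain r where r: "strict_mono r" "AE x in M. Cauchy (\<lambda>i. s (r i) x)"
    by (rule cauchy_L1_AE_cauchy_subseq[OF s cau'])
  define g where "g x = lim (\<lambda>i. s (r i) x)" for x
  have lim: "AE x in M. (\<lambda>i. s (r i) x) \<longlonglongrightarrow> g x"
    using r(2) by eventually_elim (simp add: g_def Cauchy_convergent_iff convergent_LIMSEQ_iff)
  have sm[measurable]: "s n \<in> borel_measurable M" for n using s by auto
  have gm[measurable]: "g \<in> borel_measurable M"
    unfolding g_def by (rule borel_measurable_lim_metric) simp
  have le: "(\<integral>\<^sup>+x. ennreal (norm (s n x - g x)) \<partial>M) \<le> ennreal e"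
    if N: "\<forall>i\<ge>N. \<forall>j\<ge>N. (\<integral>\<^sup>+x. ennreal (norm (s i x - s j x)) \<partial>M) \<le> ennreal e" and n: "n \<ge> N" for n N e
  proof -
    have "(\<integral>\<^sup>+x. ennreal (norm (s n x - g x)) \<partial>M) = (\<integral>\<^sup>+x. liminf (\<lambda>i. ennreal (norm (s n x - s (r i) x))) \<partial>M)"
    proof (rule nn_integral_cong_AE)
      show "AE x in M. ennreal (norm (s n x - g x)) = liminf (\<lambda>i. ennreal (norm (s n x - s (r i) x)))"
        using lim
      proof eventually_elim
        case (elim x)
        then have "(\<lambda>i. ennreal (norm (s n x - s (r i) x))) \<longlonglongrightarrow> ennreal (norm (s n x - g x))"
          by (intro tendsto_ennrealI tendsto_intros)
        then show ?case by (metis lim_imp_Liminf trivial_limit_sequentially)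
      qed
    qed
    also have "\<dots> \<le> liminf (\<lambda>i. \<integral>\<^sup>+x. ennreal (norm (s n x - s (r i) x)) \<partial>M)"
      by (rule nn_integral_liminf) simp
    also have "\<dots> \<le> ennreal e"
    proof (rule Liminf_le)
      show "\<forall>\<^sub>F i in sequentially. (\<integral>\<^sup>+x. ennreal (norm (s n x - s (r i) x)) \<partial>M) \<le> ennreal e"
        unfolding eventually_sequentially using N n seq_suble[OF r(1)] by (meson order_trans)
    qed simp
    finally show ?thesis .
  qed
  have conv: "(\<lambda>n. \<integral>\<^sup>+x. ennreal (norm (s n x - g x)) \<partial>M) \<longlonglongrightarrow> 0"
  proof (rule tendsto_0_if_Limsup_eq_0_ennreal)
    have "Limsup sequentially (\<lambda>n. \<integral>\<^sup>+x. ennreal (norm (s n x - g x)) \<partial>M) \<le> 0"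
    proof (rule ennreal_le_epsilon)
      fix e :: real assume e: "e > 0"
      obtain N where N: "\<forall>i\<ge>N. \<forall>j\<ge>N. (\<integral>\<^sup>+x. ennreal (norm (s i x - s j x)) \<partial>M) \<le> ennreal e" using cau[OF e] by blast
      have "Limsup sequentially (\<lambda>n. \<integral>\<^sup>+x. ennreal (norm (s n x - g x)) \<partial>M) \<le> ennreal e"
        by (rule Limsup_bounded) (use le[OF N] in \<open>auto simp: eventually_sequentially\<close>)
      then show "Limsup sequentially (\<lambda>n. \<integral>\<^sup>+x. ennreal (norm (s n x - g x)) \<partial>M) \<le> 0 + ennreal e" by simp
    qed
    then show "Limsup sequentially (\<lambda>n. \<integral>\<^sup>+x. ennreal (norm (s n x - g x)) \<partial>M) = 0" by simp
  qed
  have "integrable M g"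
  proof -
    obtain N where N: "\<forall>i\<ge>N. \<forall>j\<ge>N. (\<integral>\<^sup>+x. ennreal (norm (s i x - s j x)) \<partial>M) \<le> ennreal 1" using cau[of 1] by auto
    have "(\<integral>\<^sup>+x. ennreal (norm (s N x - g x)) \<partial>M) < \<infinity>" using le[OF N, of N] by (simp add: le_less_trans)
    then have "integrable M (\<lambda>x. s N x - g x)" by (intro integrableI_bounded) auto
    from Bochner_Integration.integrable_diff[OF s[of N] this] show ?thesis by simp
  qed
  then show ?thesis using that[OF r(1) _ lim conv] by blast
qed

lemma test_functions_partial:
  assumes \<psi>: "\<psi> \<in> test_functions \<Omega>" and b: "b \<in> Basis"
  shows "(\<lambda>x. grad \<psi> x \<bullet> b) \<in> test_functions \<Omega>"
proof -
  have e: "grad \<psi> x \<bullet> b = frechet_derivative \<psi> (at x) b" for x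
    using frechet_derivative_at[OF has_derivative_test_function[OF \<psi>, of x]] by (metis (no_types))
  have C: "C_k k (\<lambda>x. grad \<psi> x \<bullet> b)" for k
    unfolding e by (rule C_k_SucD(2)[OF test_functionsD(1)[OF \<psi>, of "Suc k"] b])
  let ?K = "closure {x. \<psi> x \<noteq> 0}"
  have "{x. grad \<psi> x \<bullet> b \<noteq> 0} \<subseteq> ?K"
    using test_function_support(2)[OF \<psi>] by (metis (mono_tags, lifting) inner_zero_left mem_Collect_eq subsetI)
  then have sub: "closure {x. grad \<psi> x \<bullet> b \<noteq> 0} \<subseteq> ?K" by (rule closure_minimal) (rule closed_closure)
  moreover have "compact (closure {x. grad \<psi> x \<bullet> b \<noteq> 0})"
    using closed_Int_compact[OF closed_closure test_functionsD(2)[OF \<psi>]] sub by (metis Int_absorb2)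
  ultimately show ?thesis using C test_functionsD(3)[OF \<psi>] unfolding test_functions_def by blast
qed

lemma integrable_locally_integrable_grad:
  fixes u :: "'a::euclidean_space \<Rightarrow> real"
  assumes \<Omega>: "open \<Omega>" and u: "locally_integrable \<Omega> u" and \<psi>: "\<psi> \<in> test_functions \<Omega>"
  shows "integrable (lebesgue_on \<Omega>) (\<lambda>x. u x *\<^sub>R grad \<psi> x)"
proof -
  have "u x *\<^sub>R grad \<psi> x = (\<Sum>b\<in>Basis. ((grad \<psi> x \<bullet> b) *\<^sub>R u x) *\<^sub>R b)" for x
    by (subst euclidean_representation[of "grad \<psi> x", symmetric]) (simp add: scaleR_sum_right mult.commute)
  moreover have "integrable (lebesgue_on \<Omega>) (\<lambda>x. \<Sum>b\<in>Basis. ((grad \<psi> x \<bullet> b) *\<^sub>R u x) *\<^sub>R b)"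
    by (intro Bochner_Integration.integrable_sum integrable_scaleR_left
      integrable_locally_integrable_test[OF \<Omega> u test_functions_partial[OF \<psi>]])
  ultimately show ?thesis by simp
qed

lemma has_weak_grad_diff_test:
  fixes u :: "'a::euclidean_space \<Rightarrow> real"
  assumes \<Omega>: "open \<Omega>" and u: "has_weak_grad \<Omega> u g" and \<phi>: "\<phi> \<in> test_functions \<Omega>"
  shows "has_weak_grad \<Omega> (\<lambda>x. u x - \<phi> x) (\<lambda>x. g x - grad \<phi> x)"
proof -
  note h = has_weak_grad_test_function[OF \<Omega> \<phi>]
  have li: "locally_integrable \<Omega> u" "locally_integrable \<Omega> g" "locally_integrable \<Omega> \<phi>" "locally_integrable \<Omega> (grad \<phi>)"
    using u h by (auto simp: has_weak_grad_def)
  show ?thesis unfolding has_weak_grad_def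
  proof (intro conjI ballI)
    show "locally_integrable \<Omega> (\<lambda>x. u x - \<phi> x)" "locally_integrable \<Omega> (\<lambda>x. g x - grad \<phi> x)"
      using li by (auto simp: locally_integrable_def)
    fix \<psi> assume \<psi>: "\<psi> \<in> test_functions \<Omega>"
    have i: "integrable (lebesgue_on \<Omega>) (\<lambda>x. u x *\<^sub>R grad \<psi> x)" "integrable (lebesgue_on \<Omega>) (\<lambda>x. \<phi> x *\<^sub>R grad \<psi> x)"
      "integrable (lebesgue_on \<Omega>) (\<lambda>x. \<psi> x *\<^sub>R g x)" "integrable (lebesgue_on \<Omega>) (\<lambda>x. \<psi> x *\<^sub>R grad \<phi> x)"
      by (rule integrable_locally_integrable_grad[OF \<Omega> li(1) \<psi>] integrable_locally_integrable_grad[OF \<Omega> li(3) \<psi>]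
        integrable_locally_integrable_test[OF \<Omega> li(2) \<psi>] integrable_locally_integrable_test[OF \<Omega> li(4) \<psi>])+
    have "(LINT x|lebesgue_on \<Omega>. u x *\<^sub>R grad \<psi> x) = - (LINT x|lebesgue_on \<Omega>. \<psi> x *\<^sub>R g x)"
      "(LINT x|lebesgue_on \<Omega>. \<phi> x *\<^sub>R grad \<psi> x) = - (LINT x|lebesgue_on \<Omega>. \<psi> x *\<^sub>R grad \<phi> x)"
      using u h \<psi> by (auto simp: has_weak_grad_def)
    then show "(LINT x|lebesgue_on \<Omega>. (u x - \<phi> x) *\<^sub>R grad \<psi> x) = - (LINT x|lebesgue_on \<Omega>. \<psi> x *\<^sub>R (g x - grad \<phi> x))"
      using i by (simp add: scaleR_diff_left scaleR_diff_right)
  qed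
qed

lemma has_weak_grad_weak_grad: "has_weak_grad \<Omega> u g \<Longrightarrow> has_weak_grad \<Omega> u (weak_grad \<Omega> u)"
  unfolding weak_grad_def by (rule someI[of "has_weak_grad \<Omega> u"])

lemma borel_measurable_locally_integrable:
  fixes f :: "'a::euclidean_space \<Rightarrow> 'b::euclidean_space"
  assumes \<Omega>: "open \<Omega>" and f: "locally_integrable \<Omega> f"
  shows "f \<in> borel_measurable (lebesgue_on \<Omega>)"
proof -
  obtain \<D> where \<D>: "countable \<D>" "\<And>X. X \<in> \<D> \<Longrightarrow> X \<subseteq> \<Omega>" "\<And>X. X \<in> \<D> \<Longrightarrow> \<exists>a b. X = cbox a b" "\<Union>\<D> = \<Omega>"
    by (rule open_countable_Union_open_cbox[OF \<Omega>]) blast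
  show ?thesis
  proof (rule measurable_piecewise_restrict[OF \<D>(1)])
    fix X assume X: "X \<in> \<D>"
    obtain a b where ab: "X = cbox a b" using \<D>(3)[OF X] by blast
    have Xl: "X \<in> sets lebesgue" unfolding ab by simp
    show "X \<inter> space (lebesgue_on \<Omega>) \<in> sets (lebesgue_on \<Omega>)"
      using Xl \<Omega> \<D>(2)[OF X] by (simp add: sets_restrict_space_iff Int_absorb2)
    have "integrable (lebesgue_on X) f"
      using f \<D>(2)[OF X] compact_cbox unfolding locally_integrable_def ab by blast
    moreover have "restrict_space (lebesgue_on \<Omega>) X = lebesgue_on X"
      using \<D>(2)[OF X] Xl \<Omega> by (subst restrict_restrict_space) (auto simp: Int_absorb1)
    ultimately show "f \<in> borel_measurable (restrict_space (lebesgue_on \<Omega>) X)" by simp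
  qed (use \<D>(4) in simp)
qed

text \<open>Any constants that enclose the exponent may serve as \<open>pm\<close> and \<open>pp\<close>; the intended ones are the
  infimum and the supremum.\<close>

locale var_exp =
  fixes \<Omega> :: "'a::euclidean_space set" and p :: "'a \<Rightarrow> real" and pm pp :: real
  assumes open_dom: "open \<Omega>" and bounded_dom: "bounded \<Omega>"
    and p_meas [measurable]: "p \<in> borel_measurable (lebesgue_on \<Omega>)"
    and pm: "1 < pm" and pm_le_pp: "pm \<le> pp" and p_ge: "\<And>x. x \<in> \<Omega> \<Longrightarrow> pm \<le> p x" and p_le: "\<And>x. x \<in> \<Omega> \<Longrightarrow> p x \<le> pp"
begin

abbreviation M :: "'a measure" where "M \<equiv> lebesgue_on \<Omega>"

lemma dom_sets [simp]: "\<Omega> \<in> sets lebesgue" using open_dom by auto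

lemma finite_M: "finite_measure M"
  using bounded_set_imp_lmeasurable[OF bounded_dom] by (intro finite_measure_lebesgue_on) simp

sublocale M: finite_measure M by (rule finite_M)

text \<open>The modular.  Being an integral it is easier to estimate than the Luxemburg norm, and by
  \<open>luxemburg_le\<close> and \<open>rho_le_luxemburg\<close> it defines the same convergence.  The value type is arbitrary in
  order to cover both functions and gradients.\<close>

definition rho :: "('a \<Rightarrow> 'b::euclidean_space) \<Rightarrow> ennreal" where
  "rho f = (\<integral>\<^sup>+x. ennreal (norm (f x) powr p x) \<partial>M)"

lemma p_gt_1: "x \<in> \<Omega> \<Longrightarrow> 1 < p x" using p_ge[of x] pm by simp

lemma rho_cong_AE: "AE x in M. norm (f x) = norm (g x) \<Longrightarrow> rho f = rho g"
  unfolding rho_def by (rule nn_integral_cong_AE) auto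

lemma rho_minus: "rho (\<lambda>x. f x - g x) = rho (\<lambda>x. g x - f x)"
  unfolding rho_def by (simp add: norm_minus_commute)

lemma rho_add:
  assumes [measurable]: "f \<in> borel_measurable M" "g \<in> borel_measurable M"
  shows "rho (\<lambda>x. f x + g x) \<le> ennreal (2 powr pp) * (rho f + rho g)"
proof -
  have "rho (\<lambda>x. f x + g x) \<le> (\<integral>\<^sup>+x. ennreal (2 powr pp) * (ennreal (norm (f x) powr p x) + ennreal (norm (g x) powr p x)) \<partial>M)"
    unfolding rho_def
  proof (rule nn_integral_mono)
    fix x assume "x \<in> space M"
    then have x: "x \<in> \<Omega>" by simp
    have "norm (f x + g x) powr p x \<le> (norm (f x) + norm (g x)) powr p x"
      using p_gt_1[OF x] by (intro powr_mono2 norm_triangle_ineq) auto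
    also have "\<dots> \<le> 2 powr pp * (norm (f x) powr p x + norm (g x) powr p x)"
      using p_gt_1[OF x] p_le[OF x] by (intro powr_add_le) auto
    finally show "ennreal (norm (f x + g x) powr p x) \<le> ennreal (2 powr pp) * (ennreal (norm (f x) powr p x) + ennreal (norm (g x) powr p x))"
      by (simp add: ennreal_plus[symmetric] ennreal_mult[symmetric] ennreal_leI del: ennreal_plus)
  qed
  also have "\<dots> = ennreal (2 powr pp) * (rho f + rho g)"
    unfolding rho_def by (simp add: nn_integral_cmult nn_integral_add)
  finally show ?thesis .
qed

lemma rho_triangle:
  assumes [measurable]: "f \<in> borel_measurable M" "g \<in> borel_measurable M" "h \<in> borel_measurable M"
  shows "rho (\<lambda>x. f x - h x) \<le> ennreal (2 powr pp) * (rho (\<lambda>x. f x - g x) + rho (\<lambda>x. g x - h x))"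
  using rho_add[of "\<lambda>x. f x - g x" "\<lambda>x. g x - h x"] by simp

lemma rho_midpoint:
  assumes [measurable]: "f \<in> borel_measurable M" "g \<in> borel_measurable M"
    and le: "rho f \<le> ennreal e" "rho g \<le> ennreal e" "e \<ge> 0"
  shows "rho (\<lambda>x. (1 / 2) *\<^sub>R (f x + g x)) \<le> ennreal e"
proof -
  have "rho (\<lambda>x. (1 / 2) *\<^sub>R (f x + g x)) \<le> (\<integral>\<^sup>+x. ennreal (1 / 2) * (ennreal (norm (f x) powr p x) + ennreal (norm (g x) powr p x)) \<partial>M)"
    unfolding rho_def
  proof (rule nn_integral_mono)
    fix x assume "x \<in> space M"
    then have "norm ((1 / 2) *\<^sub>R (f x + g x)) powr p x \<le> (1 / 2) * (norm (f x) powr p x + norm (g x) powr p x)"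
      using midpoint_norm_powr_le[OF p_gt_1[of x], of "f x" "g x"] by simp
    then show "ennreal (norm ((1 / 2) *\<^sub>R (f x + g x)) powr p x) \<le> ennreal (1 / 2) * (ennreal (norm (f x) powr p x) + ennreal (norm (g x) powr p x))"
      by (subst ennreal_plus[symmetric], simp, simp, subst ennreal_mult[symmetric], simp, simp, rule ennreal_leI)
  qed
  also have "\<dots> = ennreal (1 / 2) * (rho f + rho g)"
    unfolding rho_def by (simp add: nn_integral_cmult nn_integral_add)
  also have "\<dots> \<le> ennreal (1 / 2) * (ennreal e + ennreal e)" by (intro mult_left_mono add_mono le) simp
  also have "\<dots> = ennreal ((1 / 2) * (e + e))"
    by (subst ennreal_plus[OF le(3) le(3), symmetric], subst ennreal_mult'[symmetric]) simp_all
  finally show ?thesis by simp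
qed

lemma rho_finite_bounded:
  assumes "\<And>x. x \<in> \<Omega> \<Longrightarrow> norm (f x) \<le> B"
  shows "rho f < \<infinity>"
proof -
  have "rho f \<le> (\<integral>\<^sup>+x. ennreal ((max 1 B) powr pp) \<partial>M)"
    unfolding rho_def
  proof (rule nn_integral_mono)
    fix x assume "x \<in> space M"
    then have x: "x \<in> \<Omega>" by simp
    have "norm (f x) powr p x \<le> (max 1 B) powr p x" using assms[OF x] p_gt_1[OF x] by (intro powr_mono2) auto
    also have "\<dots> \<le> (max 1 B) powr pp" using p_le[OF x] by (intro powr_mono) auto
    finally show "ennreal (norm (f x) powr p x) \<le> ennreal ((max 1 B) powr pp)" by (rule ennreal_leI)
  qed
  also have "\<dots> < \<infinity>"
  proof -
    have "emeasure M \<Omega> < top" by (metis M.emeasure_finite infinity_ennreal_def top.not_eq_extremum)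
    then show ?thesis by (simp add: ennreal_mult_less_top)
  qed
  finally show ?thesis .
qed

lemma rho_integrable:
  assumes [measurable]: "f \<in> borel_measurable M" and r: "rho f < \<infinity>"
  shows "integrable M f"
proof (rule integrableI_bounded)
  have "(\<integral>\<^sup>+x. ennreal (norm (f x)) \<partial>M) \<le> ennreal (1 * measure M (space M)) + ennreal (1 powr (1 - pp)) * rho f"
    unfolding rho_def by (rule M.nn_L1_le_modular) (use p_gt_1 p_le in \<open>auto intro: less_imp_le\<close>)
  also have "\<dots> < \<infinity>" using r by (simp add: ennreal_mult_less_top)
  finally show "(\<integral>\<^sup>+x. ennreal (norm (f x)) \<partial>M) < \<infinity>" .
qed simp

lemma rho_small_L1:
  assumes e: "e > 0"
  obtains d where "d > 0" "\<And>f :: 'a \<Rightarrow> 'b::euclidean_space. f \<in> borel_measurable M \<Longrightarrow> rho f \<le> ennreal d \<Longrightarrow>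
    (\<integral>\<^sup>+x. ennreal (norm (f x)) \<partial>M) \<le> ennreal e"
proof -
  define m where "m = measure M (space M)"
  have m: "m \<ge> 0" by (simp add: m_def)
  define t where "t = min 1 (e / (2 * (m + 1)))"
  have t: "0 < t" "t \<le> 1" using e m by (auto simp: t_def)
  have tm: "t * m \<le> e / 2"
  proof -
    have "t * m \<le> e / (2 * (m + 1)) * (m + 1)" using m e by (intro mult_mono) (auto simp: t_def)
    also have "\<dots> = e / 2" using m by (simp add: field_simps)
    finally show ?thesis .
  qed
  define d where "d = (e / 2) / t powr (1 - pp)"
  have d: "d > 0" using e t by (simp add: d_def)
  show ?thesis
  proof (rule that[OF d])
    fix f :: "'a \<Rightarrow> 'b" assume f: "f \<in> borel_measurable M" and r: "rho f \<le> ennreal d"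
    have "(\<integral>\<^sup>+x. ennreal (norm (f x)) \<partial>M) \<le> ennreal (t * m) + ennreal (t powr (1 - pp)) * rho f"
      unfolding rho_def m_def by (rule M.nn_L1_le_modular) (use f t p_gt_1 p_le in \<open>auto intro: less_imp_le\<close>)
    also have "\<dots> \<le> ennreal (e / 2) + ennreal (t powr (1 - pp)) * ennreal d"
      by (intro add_mono mult_left_mono r ennreal_leI tm) simp
    also have "\<dots> = ennreal e"
      using d e t by (simp add: ennreal_mult[symmetric] ennreal_plus[symmetric] d_def del: ennreal_plus)
    finally show "(\<integral>\<^sup>+x. ennreal (norm (f x)) \<partial>M) \<le> ennreal e" .
  qed
qed

lemma test_measurable [measurable]:
  assumes "\<phi> \<in> test_functions \<Omega>"
  shows "\<phi> \<in> borel_measurable M" "grad \<phi> \<in> borel_measurable M"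
  using borel_measurable_test_function[OF assms] by (auto intro!: measurable_restrict_space1 measurable_completion)

lemma rho_finite_test:
  assumes "\<phi> \<in> test_functions \<Omega>"
  shows "rho \<phi> < \<infinity>" "rho (grad \<phi>) < \<infinity>"
  using test_function_bounded[OF assms] by (metis rho_finite_bounded real_norm_def)+

subsection \<open>The Luxemburg norm and the modular\<close>

lemma luxemburg_set_nonempty:
  fixes f :: "'a \<Rightarrow> real"
  assumes [measurable]: "f \<in> borel_measurable M" and "rho f < \<infinity>"
  shows "{s. s > 0 \<and> (\<integral>\<^sup>+x. ennreal (\<bar>f x / s\<bar> powr p x) \<partial>M) \<le> 1} \<noteq> {}"
proof -
  define R where "R = enn2real (rho f)"
  have R: "rho f = ennreal R" "R \<ge> 0" using assms(2) by (simp_all add: R_def less_top)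
  define s where "s = R + 1"
  have s: "s \<ge> 1" using R by (simp add: s_def)
  have "(\<integral>\<^sup>+x. ennreal (\<bar>f x / s\<bar> powr p x) \<partial>M) \<le> (\<integral>\<^sup>+x. ennreal (1 / s) * ennreal (norm (f x) powr p x) \<partial>M)"
  proof (rule nn_integral_mono)
    fix x assume "x \<in> space M"
    then have x: "1 < p x" using p_gt_1 by simp
    have "\<bar>f x / s\<bar> powr p x = \<bar>f x\<bar> powr p x / s powr p x" using s by (simp add: abs_divide powr_divide)
    also have "\<dots> \<le> \<bar>f x\<bar> powr p x / s powr 1" using s x by (intro divide_left_mono powr_mono) auto
    finally have "\<bar>f x / s\<bar> powr p x \<le> (1 / s) * norm (f x) powr p x" using s by simp
    then show "ennreal (\<bar>f x / s\<bar> powr p x) \<le> ennreal (1 / s) * ennreal (norm (f x) powr p x)"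
      using s by (simp add: ennreal_mult[symmetric] ennreal_leI)
  qed
  also have "\<dots> = ennreal (1 / s) * rho f" unfolding rho_def by (rule nn_integral_cmult) measurable
  also have "\<dots> = ennreal (R / s)" using R s by (simp add: ennreal_mult[symmetric])
  also have "\<dots> \<le> 1" using R by (simp add: s_def)
  finally show ?thesis using s by (intro ex_in_conv[THEN iffD1] exI[of _ s]) simp
qed

lemma luxemburg_nonneg:
  fixes f :: "'a \<Rightarrow> real"
  assumes "f \<in> borel_measurable M" "rho f < \<infinity>"
  shows "0 \<le> luxemburg_norm \<Omega> p f"
  unfolding luxemburg_norm_def by (rule cInf_greatest[OF luxemburg_set_nonempty[OF assms]]) simp

text \<open>Division by \<open>e \<le> 1\<close> enlarges the modular at most by the factor \<open>e powr (- pp)\<close>.\<close>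

lemma luxemburg_le:
  fixes f :: "'a \<Rightarrow> real"
  assumes [measurable]: "f \<in> borel_measurable M" and e: "0 < e" "e \<le> 1" and r: "rho f \<le> ennreal (e powr pp)"
  shows "luxemburg_norm \<Omega> p f \<le> e"
  unfolding luxemburg_norm_def
proof (rule cInf_lower)
  have "(\<integral>\<^sup>+x. ennreal (\<bar>f x / e\<bar> powr p x) \<partial>M) \<le> (\<integral>\<^sup>+x. ennreal (e powr (- pp)) * ennreal (norm (f x) powr p x) \<partial>M)"
  proof (rule nn_integral_mono)
    fix x assume "x \<in> space M"
    then have x: "1 < p x" "p x \<le> pp" using p_gt_1 p_le by auto
    have "\<bar>f x / e\<bar> powr p x = e powr (- p x) * \<bar>f x\<bar> powr p x" using e by (simp add: abs_divide powr_divide powr_minus_divide)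
    also have "\<dots> \<le> e powr (- pp) * \<bar>f x\<bar> powr p x" using e x by (intro mult_right_mono powr_mono') auto
    finally show "ennreal (\<bar>f x / e\<bar> powr p x) \<le> ennreal (e powr (- pp)) * ennreal (norm (f x) powr p x)"
      by (simp add: ennreal_mult[symmetric] ennreal_leI)
  qed
  also have "\<dots> = ennreal (e powr (- pp)) * rho f" unfolding rho_def by (rule nn_integral_cmult) measurable
  also have "\<dots> \<le> ennreal (e powr (- pp)) * ennreal (e powr pp)" by (intro mult_left_mono r) simp
  also have "\<dots> = 1" using e by (simp add: ennreal_mult[symmetric] powr_add[symmetric])
  finally show "e \<in> {s. s > 0 \<and> (\<integral>\<^sup>+x. ennreal (\<bar>f x / s\<bar> powr p x) \<partial>M) \<le> 1}" using e by simp
qed (auto intro: bdd_belowI[of _ 0])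

text \<open>For \<open>s \<le> 1\<close> the factor \<open>s powr p x\<close> is at most \<open>s\<close>, as the exponent is at least one.\<close>

lemma rho_le_luxemburg:
  fixes f :: "'a \<Rightarrow> real"
  assumes [measurable]: "f \<in> borel_measurable M" and r: "rho f < \<infinity>" and e: "e \<le> 1" "luxemburg_norm \<Omega> p f < e"
  shows "rho f \<le> ennreal e"
proof -
  obtain s where s: "s > 0" "s < e" and 1: "(\<integral>\<^sup>+x. ennreal (\<bar>f x / s\<bar> powr p x) \<partial>M) \<le> 1"
    using cInf_lessD[OF luxemburg_set_nonempty[OF assms(1) r]] e(2) unfolding luxemburg_norm_def by blast
  have "rho f \<le> (\<integral>\<^sup>+x. ennreal s * ennreal (\<bar>f x / s\<bar> powr p x) \<partial>M)"
    unfolding rho_def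
  proof (rule nn_integral_mono)
    fix x assume "x \<in> space M"
    then have x: "1 < p x" using p_gt_1 by simp
    have "\<bar>f x\<bar> powr p x = s powr p x * \<bar>f x / s\<bar> powr p x" using s by (simp add: abs_divide powr_divide)
    also have "\<dots> \<le> s powr 1 * \<bar>f x / s\<bar> powr p x" using s e x by (intro mult_right_mono powr_mono') auto
    finally show "ennreal (norm (f x) powr p x) \<le> ennreal s * ennreal (\<bar>f x / s\<bar> powr p x)"
      using s by (simp add: ennreal_mult[symmetric] ennreal_leI)
  qed
  also have "\<dots> = ennreal s * (\<integral>\<^sup>+x. ennreal (\<bar>f x / s\<bar> powr p x) \<partial>M)" by (rule nn_integral_cmult) measurable
  also have "\<dots> \<le> ennreal s * 1" by (intro mult_left_mono 1) simp
  also have "\<dots> \<le> ennreal e" using s by (simp add: ennreal_leI)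
  finally show ?thesis .
qed

subsection \<open>Functions with zero boundary values together with their gradients\<close>

text \<open>The pairs of a function and its gradient that are limits, in the modular, of test functions and
  their gradients.  With the gradient as an explicit component, closure properties reduce to limits of the two
  components; \<open>W0_imp_W01p\<close> and \<open>W01p_imp_W0\<close> identify these pairs with the Sobolev space.\<close>

definition W0 :: "('a \<Rightarrow> real) \<Rightarrow> ('a \<Rightarrow> 'a) \<Rightarrow> bool" where
  "W0 u g \<longleftrightarrow> u \<in> borel_measurable M \<and> g \<in> borel_measurable M \<and>
    (\<forall>e>0. \<exists>\<phi>\<in>test_functions \<Omega>. rho (\<lambda>x. u x - \<phi> x) \<le> ennreal e \<and> rho (\<lambda>x. g x - grad \<phi> x) \<le> ennreal e)"

lemma W0_measurable: assumes "W0 u g" shows "u \<in> borel_measurable M" "g \<in> borel_measurable M"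
  using assms by (auto simp: W0_def)

lemma W0_test: "\<phi> \<in> test_functions \<Omega> \<Longrightarrow> W0 \<phi> (grad \<phi>)"
  unfolding W0_def by (auto simp: test_measurable intro!: bexI[of _ \<phi>]) (simp_all add: rho_def)

lemma W0_rho_finite:
  assumes W: "W0 u g"
  shows "rho u < \<infinity>" "rho g < \<infinity>"
proof -
  note [measurable] = W0_measurable[OF W]
  obtain \<phi> where \<phi>: "\<phi> \<in> test_functions \<Omega>" "rho (\<lambda>x. u x - \<phi> x) \<le> ennreal 1" "rho (\<lambda>x. g x - grad \<phi> x) \<le> ennreal 1"
    using W unfolding W0_def by (metis zero_less_one)
  note [measurable] = test_measurable[OF \<phi>(1)]
  have "rho (\<lambda>x. (u x - \<phi> x) + \<phi> x) \<le> ennreal (2 powr pp) * (rho (\<lambda>x. u x - \<phi> x) + rho \<phi>)" by (rule rho_add) measurable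
  also have "\<dots> \<le> ennreal (2 powr pp) * (ennreal 1 + rho \<phi>)" by (intro mult_left_mono add_mono \<phi>) auto
  also have "\<dots> < \<infinity>" using rho_finite_test[OF \<phi>(1)] by (simp add: ennreal_mult_less_top)
  finally show "rho u < \<infinity>" by simp
  have "rho (\<lambda>x. (g x - grad \<phi> x) + grad \<phi> x) \<le> ennreal (2 powr pp) * (rho (\<lambda>x. g x - grad \<phi> x) + rho (grad \<phi>))" by (rule rho_add) measurable
  also have "\<dots> \<le> ennreal (2 powr pp) * (ennreal 1 + rho (grad \<phi>))" by (intro mult_left_mono add_mono \<phi>) auto
  also have "\<dots> < \<infinity>" using rho_finite_test[OF \<phi>(1)] by (simp add: ennreal_mult_less_top)
  finally show "rho g < \<infinity>" by simp
qed

lemma W0_closed: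
  assumes [measurable]: "u \<in> borel_measurable M" "g \<in> borel_measurable M"
    and ap: "\<And>e. e > 0 \<Longrightarrow> \<exists>v h. W0 v h \<and> rho (\<lambda>x. u x - v x) \<le> ennreal e \<and> rho (\<lambda>x. g x - h x) \<le> ennreal e"
  shows "W0 u g"
  unfolding W0_def
proof (intro conjI allI impI assms(1,2))
  fix e :: real assume e: "e > 0"
  define d where "d = e / (2 * 2 powr pp)"
  have d: "d > 0" using e by (simp add: d_def)
  obtain v h where vh: "W0 v h" "rho (\<lambda>x. u x - v x) \<le> ennreal d" "rho (\<lambda>x. g x - h x) \<le> ennreal d" using ap[OF d] by blast
  obtain \<phi> where \<phi>: "\<phi> \<in> test_functions \<Omega>" "rho (\<lambda>x. v x - \<phi> x) \<le> ennreal d" "rho (\<lambda>x. h x - grad \<phi> x) \<le> ennreal d"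
    using vh(1) d unfolding W0_def by blast
  note [measurable] = test_measurable[OF \<phi>(1)] W0_measurable[OF vh(1)]
  have de: "ennreal (2 powr pp) * (ennreal d + ennreal d) = ennreal e"
    using d by (simp add: ennreal_plus[symmetric] ennreal_mult[symmetric] d_def del: ennreal_plus)
  have "rho (\<lambda>x. u x - \<phi> x) \<le> ennreal (2 powr pp) * (rho (\<lambda>x. u x - v x) + rho (\<lambda>x. v x - \<phi> x))" by (rule rho_triangle) measurable
  also have "\<dots> \<le> ennreal (2 powr pp) * (ennreal d + ennreal d)" by (intro mult_left_mono add_mono vh \<phi>) simp
  finally have 1: "rho (\<lambda>x. u x - \<phi> x) \<le> ennreal e" by (simp only: de)
  have "rho (\<lambda>x. g x - grad \<phi> x) \<le> ennreal (2 powr pp) * (rho (\<lambda>x. g x - h x) + rho (\<lambda>x. h x - grad \<phi> x))" by (rule rho_triangle) measurable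
  also have "\<dots> \<le> ennreal (2 powr pp) * (ennreal d + ennreal d)" by (intro mult_left_mono add_mono vh \<phi>) simp
  finally have 2: "rho (\<lambda>x. g x - grad \<phi> x) \<le> ennreal e" by (simp only: de)
  show "\<exists>\<phi>\<in>test_functions \<Omega>. rho (\<lambda>x. u x - \<phi> x) \<le> ennreal e \<and> rho (\<lambda>x. g x - grad \<phi> x) \<le> ennreal e"
    using \<phi>(1) 1 2 by blast
qed

lemma W0_midpoint:
  assumes W: "W0 u g" "W0 v h"
  shows "W0 (\<lambda>x. (1 / 2) *\<^sub>R (u x + v x)) (\<lambda>x. (1 / 2) *\<^sub>R (g x + h x))"
  unfolding W0_def
proof (intro conjI allI impI)
  note [measurable] = W0_measurable[OF W(1)] W0_measurable[OF W(2)]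
  show "(\<lambda>x. (1 / 2) *\<^sub>R (u x + v x)) \<in> borel_measurable M" "(\<lambda>x. (1 / 2) *\<^sub>R (g x + h x)) \<in> borel_measurable M" by measurable
  fix e :: real assume e: "e > 0"
  obtain \<phi> where \<phi>: "\<phi> \<in> test_functions \<Omega>" "rho (\<lambda>x. u x - \<phi> x) \<le> ennreal e" "rho (\<lambda>x. g x - grad \<phi> x) \<le> ennreal e"
    using W(1) e unfolding W0_def by blast
  obtain \<psi> where \<psi>: "\<psi> \<in> test_functions \<Omega>" "rho (\<lambda>x. v x - \<psi> x) \<le> ennreal e" "rho (\<lambda>x. h x - grad \<psi> x) \<le> ennreal e"
    using W(2) e unfolding W0_def by blast
  note [measurable] = test_measurable[OF \<phi>(1)] test_measurable[OF \<psi>(1)]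
  define w where "w = (\<lambda>x. (1 / 2) * \<phi> x + (1 / 2) * \<psi> x)"
  have w: "w \<in> test_functions \<Omega>" unfolding w_def by (rule test_functions_lincomb(1)[OF \<phi>(1) \<psi>(1)])
  have gw: "grad w x = (1 / 2) *\<^sub>R grad \<phi> x + (1 / 2) *\<^sub>R grad \<psi> x" for x
    unfolding w_def by (rule test_functions_lincomb(2)[OF \<phi>(1) \<psi>(1)])
  have "rho (\<lambda>x. (1 / 2) *\<^sub>R ((u x - \<phi> x) + (v x - \<psi> x))) \<le> ennreal e"
    by (rule rho_midpoint) (use \<phi> \<psi> e in auto)
  moreover have "(\<lambda>x. (1 / 2) *\<^sub>R ((u x - \<phi> x) + (v x - \<psi> x))) = (\<lambda>x. (1 / 2) *\<^sub>R (u x + v x) - w x)"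
    by (rule ext) (simp add: w_def field_simps)
  ultimately have 1: "rho (\<lambda>x. (1 / 2) *\<^sub>R (u x + v x) - w x) \<le> ennreal e" by (simp only:)
  have "rho (\<lambda>x. (1 / 2) *\<^sub>R ((g x - grad \<phi> x) + (h x - grad \<psi> x))) \<le> ennreal e"
    by (rule rho_midpoint) (use \<phi> \<psi> e in auto)
  moreover have "(\<lambda>x. (1 / 2) *\<^sub>R ((g x - grad \<phi> x) + (h x - grad \<psi> x))) = (\<lambda>x. (1 / 2) *\<^sub>R (g x + h x) - grad w x)"
    unfolding gw by (rule ext) (simp add: algebra_simps)
  ultimately have "rho (\<lambda>x. (1 / 2) *\<^sub>R (g x + h x) - grad w x) \<le> ennreal e" by (simp only:)
  with 1 w show "\<exists>\<phi>\<in>test_functions \<Omega>. rho (\<lambda>x. (1 / 2) *\<^sub>R (u x + v x) - \<phi> x) \<le> ennreal e \<and>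
      rho (\<lambda>x. (1 / 2) *\<^sub>R (g x + h x) - grad \<phi> x) \<le> ennreal e"
    by blast
qed

lemma W0_add_test:
  assumes W: "W0 u g" and \<psi>: "\<psi> \<in> test_functions \<Omega>"
  shows "W0 (\<lambda>x. u x + t * \<psi> x) (\<lambda>x. g x + t *\<^sub>R grad \<psi> x)"
  unfolding W0_def
proof (intro conjI allI impI)
  note [measurable] = W0_measurable[OF W] test_measurable[OF \<psi>]
  show "(\<lambda>x. u x + t * \<psi> x) \<in> borel_measurable M" "(\<lambda>x. g x + t *\<^sub>R grad \<psi> x) \<in> borel_measurable M" by measurable
  fix e :: real assume e: "e > 0"
  obtain \<phi> where \<phi>: "\<phi> \<in> test_functions \<Omega>" "rho (\<lambda>x. u x - \<phi> x) \<le> ennreal e" "rho (\<lambda>x. g x - grad \<phi> x) \<le> ennreal e"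
    using W e unfolding W0_def by blast
  define w where "w = (\<lambda>x. 1 * \<phi> x + t * \<psi> x)"
  have w: "w \<in> test_functions \<Omega>" unfolding w_def by (rule test_functions_lincomb(1)[OF \<phi>(1) \<psi>])
  have "grad w x = 1 *\<^sub>R grad \<phi> x + t *\<^sub>R grad \<psi> x" for x
    unfolding w_def by (rule test_functions_lincomb(2)[OF \<phi>(1) \<psi>])
  then have "(\<lambda>x. g x + t *\<^sub>R grad \<psi> x - grad w x) = (\<lambda>x. g x - grad \<phi> x)" by simp
  moreover have "(\<lambda>x. u x + t * \<psi> x - w x) = (\<lambda>x. u x - \<phi> x)" by (simp add: w_def)
  ultimately show "\<exists>\<phi>\<in>test_functions \<Omega>. rho (\<lambda>x. u x + t * \<psi> x - \<phi> x) \<le> ennreal e \<and>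
      rho (\<lambda>x. g x + t *\<^sub>R grad \<psi> x - grad \<phi> x) \<le> ennreal e"
    using w \<phi>(2,3) by metis
qed

text \<open>Convergence in the modular implies convergence in \<open>L1\<close>, under which integration by parts is
  preserved.\<close>

lemma W0_has_weak_grad:
  assumes W: "W0 u g"
  shows "has_weak_grad \<Omega> u g"
proof -
  note [measurable] = W0_measurable[OF W]
  have iu: "integrable M u" and ig: "integrable M g"
    using W0_rho_finite[OF W] by (auto intro!: rho_integrable)
  have li: "locally_integrable \<Omega> u" "locally_integrable \<Omega> g"
    using iu ig by (auto intro: locally_integrable_integrable[OF open_dom])
  have "(LINT x|M. u x *\<^sub>R grad \<psi> x) + (LINT x|M. \<psi> x *\<^sub>R g x) = 0" if \<psi>: "\<psi> \<in> test_functions \<Omega>" for \<psi>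
  proof -
    obtain B where B: "B > 0" "\<And>x. \<bar>\<psi> x\<bar> \<le> B" "\<And>x. norm (grad \<psi> x) \<le> B" using test_function_bounded[OF \<psi>] by metis
    have "norm ((LINT x|M. u x *\<^sub>R grad \<psi> x) + (LINT x|M. \<psi> x *\<^sub>R g x)) \<le> e" if e: "e > 0" for e
    proof -
      define e' where "e' = e / (2 * B)"
      have e': "e' > 0" using e B by (simp add: e'_def)
      obtain d1 where d1: "d1 > 0" "\<And>f :: 'a \<Rightarrow> real. f \<in> borel_measurable M \<Longrightarrow> rho f \<le> ennreal d1 \<Longrightarrow> (\<integral>\<^sup>+x. ennreal (norm (f x)) \<partial>M) \<le> ennreal e'"
        using rho_small_L1[OF e'] by metis
      obtain d2 where d2: "d2 > 0" "\<And>f :: 'a \<Rightarrow> 'a. f \<in> borel_measurable M \<Longrightarrow> rho f \<le> ennreal d2 \<Longrightarrow> (\<integral>\<^sup>+x. ennreal (norm (f x)) \<partial>M) \<le> ennreal e'"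
        using rho_small_L1[OF e'] by metis
      have "min d1 d2 > 0" using d1 d2 by simp
      then obtain \<phi> where \<phi>: "\<phi> \<in> test_functions \<Omega>" "rho (\<lambda>x. u x - \<phi> x) \<le> ennreal (min d1 d2)" "rho (\<lambda>x. g x - grad \<phi> x) \<le> ennreal (min d1 d2)"
        using W unfolding W0_def by blast
      note [measurable] = test_measurable[OF \<phi>(1)]
      have n1: "(\<integral>\<^sup>+x. ennreal (norm (u x - \<phi> x)) \<partial>M) \<le> ennreal e'"
        by (rule d1(2)) (use order_trans[OF \<phi>(2) ennreal_leI] in auto)
      have n2: "(\<integral>\<^sup>+x. ennreal (norm (g x - grad \<phi> x)) \<partial>M) \<le> ennreal e'"
        by (rule d2(2)) (use order_trans[OF \<phi>(3) ennreal_leI] in auto)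
      note hd = has_weak_grad_test_function[OF open_dom \<phi>(1)]
      have liphi: "locally_integrable \<Omega> \<phi>" "locally_integrable \<Omega> (grad \<phi>)" using hd by (auto simp: has_weak_grad_def)
      have i: "integrable M (\<lambda>x. u x *\<^sub>R grad \<psi> x)" "integrable M (\<lambda>x. \<phi> x *\<^sub>R grad \<psi> x)"
        "integrable M (\<lambda>x. \<psi> x *\<^sub>R g x)" "integrable M (\<lambda>x. \<psi> x *\<^sub>R grad \<phi> x)"
        by (rule integrable_locally_integrable_grad[OF open_dom li(1) \<psi>] integrable_locally_integrable_grad[OF open_dom liphi(1) \<psi>]
          integrable_locally_integrable_test[OF open_dom li(2) \<psi>] integrable_locally_integrable_test[OF open_dom liphi(2) \<psi>])+
      have z: "(LINT x|M. \<phi> x *\<^sub>R grad \<psi> x) + (LINT x|M. \<psi> x *\<^sub>R grad \<phi> x) = 0"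
        using hd \<psi> by (simp add: has_weak_grad_def)
      have b: "norm (LINT x|M. f x) \<le> B * e'"
        if f: "integrable M f" "\<And>x. norm (f x) \<le> B * norm (h x)" "h \<in> borel_measurable M" "(\<integral>\<^sup>+x. ennreal (norm (h x)) \<partial>M) \<le> ennreal e'"
        for f :: "'a \<Rightarrow> 'a" and h :: "'a \<Rightarrow> 'b::euclidean_space"
      proof -
        have "ennreal (norm (LINT x|M. f x)) \<le> (\<integral>\<^sup>+x. ennreal (norm (f x)) \<partial>M)" by (rule integral_norm_bound_ennreal[OF f(1)])
        also have "\<dots> \<le> (\<integral>\<^sup>+x. ennreal B * ennreal (norm (h x)) \<partial>M)"
          using f(2) B(1) by (intro nn_integral_mono) (simp add: ennreal_mult[symmetric] ennreal_leI)
        also have "\<dots> = ennreal B * (\<integral>\<^sup>+x. ennreal (norm (h x)) \<partial>M)" using f(3) by (intro nn_integral_cmult) measurable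
        also have "\<dots> \<le> ennreal B * ennreal e'" by (intro mult_left_mono f) simp
        finally show ?thesis using B e' by (simp add: ennreal_mult[symmetric])
      qed
      have "(LINT x|M. u x *\<^sub>R grad \<psi> x) + (LINT x|M. \<psi> x *\<^sub>R g x) =
          (LINT x|M. (u x - \<phi> x) *\<^sub>R grad \<psi> x) + (LINT x|M. \<psi> x *\<^sub>R (g x - grad \<phi> x))"
        using i z by (simp add: scaleR_diff_left scaleR_diff_right algebra_simps)
      moreover have "norm (LINT x|M. (u x - \<phi> x) *\<^sub>R grad \<psi> x) \<le> B * e'"
      proof (rule b[OF _ _ _ n1])
        show "integrable M (\<lambda>x. (u x - \<phi> x) *\<^sub>R grad \<psi> x)" using i by (simp add: scaleR_diff_left)
        show "norm ((u x - \<phi> x) *\<^sub>R grad \<psi> x) \<le> B * norm (u x - \<phi> x)" for x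
          using B(3)[of x] by (simp add: mult.commute mult_right_mono)
      qed measurable
      moreover have "norm (LINT x|M. \<psi> x *\<^sub>R (g x - grad \<phi> x)) \<le> B * e'"
      proof (rule b[OF _ _ _ n2])
        show "integrable M (\<lambda>x. \<psi> x *\<^sub>R (g x - grad \<phi> x))" using i by (simp add: scaleR_diff_right)
        show "norm (\<psi> x *\<^sub>R (g x - grad \<phi> x)) \<le> B * norm (g x - grad \<phi> x)" for x
          using B(2)[of x] by (simp add: mult_right_mono)
      qed measurable
      moreover have "B * e' + B * e' = e" using B by (simp add: e'_def)
      ultimately show ?thesis by (smt (verit) norm_triangle_ineq)
    qed
    then have "norm ((LINT x|M. u x *\<^sub>R grad \<psi> x) + (LINT x|M. \<psi> x *\<^sub>R g x)) \<le> 0" by (rule field_le_epsilon[of _ 0, simplified])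
    then show ?thesis by simp
  qed
  with li show ?thesis unfolding has_weak_grad_def by (simp add: eq_neg_iff_add_eq_0)
qed

lemma luxemburg_cong_AE:
  fixes f g :: "'a \<Rightarrow> real"
  assumes "AE x in M. f x = g x" shows "luxemburg_norm \<Omega> p f = luxemburg_norm \<Omega> p g"
proof -
  have "(\<integral>\<^sup>+x. ennreal (\<bar>f x / s\<bar> powr p x) \<partial>M) = (\<integral>\<^sup>+x. ennreal (\<bar>g x / s\<bar> powr p x) \<partial>M)" for s
    by (rule nn_integral_cong_AE) (use assms in auto)
  then show ?thesis by (simp add: luxemburg_norm_def)
qed

lemma AE_weak_grad_eq: "has_weak_grad \<Omega> u g \<Longrightarrow> AE x in M. weak_grad \<Omega> u x = g x"
  using weak_grad_unique[OF open_dom has_weak_grad_weak_grad] by blast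

lemma Lp_var_iff: "f \<in> Lp_var \<Omega> p \<longleftrightarrow> f \<in> borel_measurable M \<and> rho f < \<infinity>"
  by (simp add: Lp_var_def rho_def)

lemma weak_grad_measurable: "has_weak_grad \<Omega> u g \<Longrightarrow> weak_grad \<Omega> u \<in> borel_measurable M"
  using has_weak_grad_weak_grad[of \<Omega> u g] by (intro borel_measurable_locally_integrable[OF open_dom]) (auto simp: has_weak_grad_def)

lemma rho_norm: "rho (\<lambda>x. norm (f x)) = rho f" by (simp add: rho_def)

lemma W0_imp_W01p:
  assumes W: "W0 u g"
  shows "u \<in> W01p \<Omega> p" "AE x in M. weak_grad \<Omega> u x = g x"
proof -
  have wg: "has_weak_grad \<Omega> u g" by (rule W0_has_weak_grad[OF W])
  show ae: "AE x in M. weak_grad \<Omega> u x = g x" by (rule AE_weak_grad_eq[OF wg])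
  note [measurable] = W0_measurable[OF W] weak_grad_measurable[OF wg]
  have "rho (weak_grad \<Omega> u) = rho g" by (rule rho_cong_AE) (use ae in auto)
  then have "u \<in> W1p \<Omega> p" unfolding W1p_def
    using W0_rho_finite[OF W] wg by (auto simp: Lp_var_iff rho_norm)
  moreover have "\<exists>\<phi>\<in>test_functions \<Omega>. W1p_norm \<Omega> p (\<lambda>x. u x - \<phi> x) < e" if e: "e > 0" for e
  proof -
    define d where "d = min 1 (e / 3)"
    have d: "0 < d" "d \<le> 1" "d + d < e" using e by (auto simp: d_def min_def)
    have "d powr pp > 0" using d by simp
    then obtain \<phi> where \<phi>: "\<phi> \<in> test_functions \<Omega>" "rho (\<lambda>x. u x - \<phi> x) \<le> ennreal (d powr pp)" "rho (\<lambda>x. g x - grad \<phi> x) \<le> ennreal (d powr pp)"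
      using W unfolding W0_def by blast
    note [measurable] = test_measurable[OF \<phi>(1)]
    have "luxemburg_norm \<Omega> p (\<lambda>x. u x - \<phi> x) \<le> d" by (rule luxemburg_le) (use d \<phi> in auto)
    moreover have "AE x in M. weak_grad \<Omega> (\<lambda>x. u x - \<phi> x) x = g x - grad \<phi> x"
      by (rule AE_weak_grad_eq[OF has_weak_grad_diff_test[OF open_dom wg \<phi>(1)]])
    then have "luxemburg_norm \<Omega> p (\<lambda>x. norm (weak_grad \<Omega> (\<lambda>x. u x - \<phi> x) x)) = luxemburg_norm \<Omega> p (\<lambda>x. norm (g x - grad \<phi> x))"
      by (intro luxemburg_cong_AE) auto
    moreover have "luxemburg_norm \<Omega> p (\<lambda>x. norm (g x - grad \<phi> x)) \<le> d"
      by (rule luxemburg_le) (use d \<phi> in \<open>auto simp: rho_norm\<close>)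
    ultimately show ?thesis using \<phi>(1) d by (intro bexI[of _ \<phi>]) (auto simp: W1p_norm_def)
  qed
  ultimately show "u \<in> W01p \<Omega> p" by (auto simp: W01p_def)
qed

lemma W01p_imp_W0:
  assumes u: "u \<in> W01p \<Omega> p"
  shows "W0 u (weak_grad \<Omega> u)"
proof -
  have u1: "u \<in> Lp_var \<Omega> p" "\<exists>g. has_weak_grad \<Omega> u g" "(\<lambda>x. norm (weak_grad \<Omega> u x)) \<in> Lp_var \<Omega> p"
    using u by (auto simp: W01p_def W1p_def)
  then obtain g where "has_weak_grad \<Omega> u g" by blast
  then have wg: "has_weak_grad \<Omega> u (weak_grad \<Omega> u)" by (rule has_weak_grad_weak_grad)
  have [measurable]: "u \<in> borel_measurable M" "weak_grad \<Omega> u \<in> borel_measurable M"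
    using u1(1) weak_grad_measurable[OF wg] by (auto simp: Lp_var_iff)
  have fin: "rho u < \<infinity>" "rho (weak_grad \<Omega> u) < \<infinity>" using u1 by (auto simp: Lp_var_iff rho_norm)
  show ?thesis unfolding W0_def
  proof (intro conjI allI impI)
    fix e :: real assume e: "e > 0"
    define d where "d = min 1 e"
    have d: "0 < d" "d \<le> 1" "d \<le> e" using e by (auto simp: d_def)
    obtain \<phi> where \<phi>: "\<phi> \<in> test_functions \<Omega>" "W1p_norm \<Omega> p (\<lambda>x. u x - \<phi> x) < d"
      using u d(1) by (auto simp: W01p_def)
    note [measurable] = test_measurable[OF \<phi>(1)]
    have f1: "rho (\<lambda>x. u x - \<phi> x) < \<infinity>"
    proof -
      have "rho (\<lambda>x. u x - \<phi> x) \<le> ennreal (2 powr pp) * (rho (\<lambda>x. u x - 0) + rho (\<lambda>x. 0 - \<phi> x))" by (rule rho_triangle) measurable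
      also have "\<dots> < \<infinity>" using fin rho_finite_test[OF \<phi>(1)] rho_minus[of "\<lambda>x. 0" \<phi>] by (simp add: ennreal_mult_less_top)
      finally show ?thesis .
    qed
    have f2: "rho (\<lambda>x. weak_grad \<Omega> u x - grad \<phi> x) < \<infinity>"
    proof -
      have "rho (\<lambda>x. weak_grad \<Omega> u x - grad \<phi> x) \<le> ennreal (2 powr pp) * (rho (\<lambda>x. weak_grad \<Omega> u x - 0) + rho (\<lambda>x. 0 - grad \<phi> x))"
        by (rule rho_triangle) measurable
      also have "\<dots> < \<infinity>" using fin rho_finite_test[OF \<phi>(1)] rho_minus[of "\<lambda>x. 0" "grad \<phi>"] by (simp add: ennreal_mult_less_top)
      finally show ?thesis .
    qed
    have "AE x in M. weak_grad \<Omega> (\<lambda>x. u x - \<phi> x) x = weak_grad \<Omega> u x - grad \<phi> x"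
      by (rule AE_weak_grad_eq[OF has_weak_grad_diff_test[OF open_dom wg \<phi>(1)]])
    then have l: "luxemburg_norm \<Omega> p (\<lambda>x. norm (weak_grad \<Omega> (\<lambda>x. u x - \<phi> x) x)) = luxemburg_norm \<Omega> p (\<lambda>x. norm (weak_grad \<Omega> u x - grad \<phi> x))"
      by (intro luxemburg_cong_AE) auto
    have n1: "0 \<le> luxemburg_norm \<Omega> p (\<lambda>x. u x - \<phi> x)" by (rule luxemburg_nonneg) (use f1 in auto)
    have n2: "0 \<le> luxemburg_norm \<Omega> p (\<lambda>x. norm (weak_grad \<Omega> u x - grad \<phi> x))"
      by (rule luxemburg_nonneg) (use f2 in \<open>auto simp: rho_norm\<close>)
    have "rho (\<lambda>x. u x - \<phi> x) \<le> ennreal d"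
      by (rule rho_le_luxemburg) (use f1 d n2 l \<phi>(2) in \<open>auto simp: W1p_norm_def\<close>)
    moreover have "rho (\<lambda>x. norm (weak_grad \<Omega> u x - grad \<phi> x)) \<le> ennreal d"
      by (rule rho_le_luxemburg) (use f2 d n1 l \<phi>(2) in \<open>auto simp: W1p_norm_def rho_norm\<close>)
    ultimately show "\<exists>\<phi>\<in>test_functions \<Omega>. rho (\<lambda>x. u x - \<phi> x) \<le> ennreal e \<and> rho (\<lambda>x. weak_grad \<Omega> u x - grad \<phi> x) \<le> ennreal e"
      using \<phi>(1) d(3) by (intro bexI[of _ \<phi>]) (auto simp: rho_norm intro: order_trans ennreal_leI)
  qed measurable
qed

end

lemma ennreal_le_diffI:
  assumes "A + ennreal x \<le> ennreal y" "0 \<le> x"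
  shows "A \<le> ennreal (y - x)"
proof (cases A)
  case (real a)
  then have "ennreal (a + x) \<le> ennreal y" using assms by simp
  then have "a + x \<le> y \<or> a + x \<le> 0" by (metis ennreal_le_iff2 linorder_not_le)
  then show ?thesis
  proof
    assume "a + x \<le> 0"
    then have "a = 0" using real assms by simp
    then show ?thesis using real by simp
  qed (use real in \<open>simp add: ennreal_leI\<close>)
next
  case top
  then show ?thesis using assms by (simp add: top_unique)
qed

context var_exp
begin

section \<open>Lower semicontinuity of the energy and compactness\<close>

text \<open>The factor \<open>1 / p x\<close> makes the \<open>p(x)\<close>-Laplacian the derivative of this functional.\<close>

definition energy :: "('a \<Rightarrow> 'b::euclidean_space) \<Rightarrow> ennreal" where
  "energy g = (\<integral>\<^sup>+x. ennreal (norm (g x) powr p x / p x) \<partial>M)"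

lemma energy_le_rho: "energy g \<le> rho g"
  unfolding energy_def rho_def
proof (intro nn_integral_mono ennreal_leI)
  fix x assume "x \<in> space M"
  then have "1 < p x" by (simp add: p_gt_1)
  then show "norm (g x) powr p x / p x \<le> norm (g x) powr p x" using mult_left_mono[of 1 "p x" "norm (g x) powr p x"] by (simp add: divide_le_eq)
qed

lemma pp_pos: "0 < pp" using pm pm_le_pp by simp

lemma rho_le_energy:
  assumes [measurable]: "g \<in> borel_measurable M"
  shows "rho g \<le> ennreal pp * energy g"
proof -
  have "rho g \<le> (\<integral>\<^sup>+x. ennreal pp * ennreal (norm (g x) powr p x / p x) \<partial>M)"
    unfolding rho_def
  proof (rule nn_integral_mono)
    fix x assume "x \<in> space M"
    then have x: "1 < p x" "p x \<le> pp" by (auto simp: p_gt_1 p_le)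
    have "norm (g x) powr p x * p x \<le> norm (g x) powr p x * pp" using x by (intro mult_left_mono) auto
    then have "norm (g x) powr p x \<le> pp * (norm (g x) powr p x / p x)" using x by (simp add: field_simps)
    then show "ennreal (norm (g x) powr p x) \<le> ennreal pp * ennreal (norm (g x) powr p x / p x)"
      using x pp_pos by (simp add: ennreal_mult[symmetric] ennreal_leI)
  qed
  also have "\<dots> = ennreal pp * energy g" unfolding energy_def by (rule nn_integral_cmult) measurable
  finally show ?thesis .
qed

text \<open>The integrated form of \<open>uniform_convexity_powr\<close>.  The convexity gap is written as two terms on
  opposite sides since subtraction of extended nonnegative numbers is truncated.\<close>

lemma energy_uniform_convexity:
  assumes e: "e > 0"
  obtains K where "K \<ge> 0" "\<And>g h :: 'a \<Rightarrow> 'b::euclidean_space. g \<in> borel_measurable M \<Longrightarrow> h \<in> borel_measurable M \<Longrightarrow>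
    rho (\<lambda>x. g x - h x) + ennreal K * energy (\<lambda>x. (1 / 2) *\<^sub>R (g x + h x)) \<le>
    ennreal e * (rho g + rho h) + ennreal (K / 2) * (energy g + energy h)"
proof -
  obtain C where C: "C \<ge> 0" "\<And>s (a::'b) b. pm \<le> s \<Longrightarrow> s \<le> pp \<Longrightarrow>
    norm (a - b) powr s \<le> e * (norm a powr s + norm b powr s) +
      C * ((norm a powr s + norm b powr s) / 2 - norm ((1 / 2) *\<^sub>R (a + b)) powr s)"
    using uniform_convexity_powr[OF pm pm_le_pp e] by metis
  define K where "K = C * pp"
  have K: "K \<ge> 0" using C(1) pp_pos by (simp add: K_def)
  show ?thesis
  proof (rule that[OF K])
    fix g h :: "'a \<Rightarrow> 'b" assume [measurable]: "g \<in> borel_measurable M" "h \<in> borel_measurable M"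
    have "(\<integral>\<^sup>+x. ennreal (norm (g x - h x) powr p x) + ennreal K * ennreal (norm ((1 / 2) *\<^sub>R (g x + h x)) powr p x / p x) \<partial>M) \<le>
      (\<integral>\<^sup>+x. ennreal e * (ennreal (norm (g x) powr p x) + ennreal (norm (h x) powr p x)) +
        ennreal (K / 2) * (ennreal (norm (g x) powr p x / p x) + ennreal (norm (h x) powr p x / p x)) \<partial>M)"
    proof (rule nn_integral_mono)
      fix x assume "x \<in> space M"
      then have x: "pm \<le> p x" "p x \<le> pp" "1 < p x" by (auto simp: p_gt_1 p_le p_ge)
      define A a b c where "A = norm (g x - h x) powr p x" and "a = norm (g x) powr p x" and "b = norm (h x) powr p x"
        and "c = norm ((1 / 2) *\<^sub>R (g x + h x)) powr p x"
      have nn: "0 \<le> A" "0 \<le> a" "0 \<le> b" "0 \<le> a / p x" "0 \<le> b / p x" "0 \<le> c / p x"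
        using x by (simp_all add: A_def a_def b_def c_def)
      have "0 \<le> (a + b) / 2 - c" unfolding a_def b_def c_def using midpoint_norm_powr_le[OF x(3), of "g x" "h x"] by simp
      then have "C * p x * (((a + b) / 2 - c) / p x) \<le> K * (((a + b) / 2 - c) / p x)"
        unfolding K_def using C(1) x by (intro mult_right_mono mult_left_mono) auto
      then have "C * ((a + b) / 2 - c) \<le> K * (((a + b) / 2 - c) / p x)" using x by simp
      also have "\<dots> = K / 2 * (a / p x + b / p x) - K * (c / p x)" using x by (simp add: field_simps)
      finally have "A + K * (c / p x) \<le> e * (a + b) + K / 2 * (a / p x + b / p x)"
        using C(2)[OF x(1,2), of "g x" "h x"] unfolding A_def a_def b_def c_def by linarith
      then have "ennreal (A + K * (c / p x)) \<le> ennreal (e * (a + b) + K / 2 * (a / p x + b / p x))"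
        by (rule ennreal_leI)
      moreover have "ennreal (A + K * (c / p x)) = ennreal A + ennreal K * ennreal (c / p x)"
        by (simp only: ennreal_plus[OF nn(1) mult_nonneg_nonneg[OF K nn(6)]] ennreal_mult[OF K nn(6)])
      moreover have "ennreal (e * (a + b) + K / 2 * (a / p x + b / p x)) =
          ennreal (e * (a + b)) + ennreal (K / 2 * (a / p x + b / p x))"
        by (rule ennreal_plus) (use nn K e in auto)
      moreover have "ennreal (e * (a + b)) = ennreal e * (ennreal a + ennreal b)"
        by (simp only: ennreal_mult[OF less_imp_le[OF e] add_nonneg_nonneg[OF nn(2,3)]] ennreal_plus[OF nn(2,3)])
      moreover have "ennreal (K / 2 * (a / p x + b / p x)) = ennreal (K / 2) * (ennreal (a / p x) + ennreal (b / p x))"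
      proof -
        have "0 \<le> K / 2" using K by simp
        then show ?thesis by (simp only: ennreal_mult[OF _ add_nonneg_nonneg[OF nn(4,5)]] ennreal_plus[OF nn(4,5)])
      qed
      ultimately show "ennreal (norm (g x - h x) powr p x) + ennreal K * ennreal (norm ((1 / 2) *\<^sub>R (g x + h x)) powr p x / p x) \<le>
          ennreal e * (ennreal (norm (g x) powr p x) + ennreal (norm (h x) powr p x)) +
          ennreal (K / 2) * (ennreal (norm (g x) powr p x / p x) + ennreal (norm (h x) powr p x / p x))"
        unfolding A_def[symmetric] a_def[symmetric] b_def[symmetric] c_def[symmetric] by metis
    qed
    then show "rho (\<lambda>x. g x - h x) + ennreal K * energy (\<lambda>x. (1 / 2) *\<^sub>R (g x + h x)) \<le>
      ennreal e * (rho g + rho h) + ennreal (K / 2) * (energy g + energy h)"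
      unfolding rho_def energy_def by (simp add: nn_integral_add nn_integral_cmult)
  qed
qed

lemma rho_fatou:
  fixes h :: "nat \<Rightarrow> 'a \<Rightarrow> 'b::euclidean_space"
  assumes [measurable]: "f \<in> borel_measurable M" "\<And>n. h n \<in> borel_measurable M"
    and lim: "AE x in M. (\<lambda>n. h n x) \<longlonglongrightarrow> g x" and le: "\<forall>\<^sub>F n in sequentially. rho (\<lambda>x. f x - h n x) \<le> e"
  shows "rho (\<lambda>x. f x - g x) \<le> e"
proof -
  have "rho (\<lambda>x. f x - g x) = (\<integral>\<^sup>+x. liminf (\<lambda>n. ennreal (norm (f x - h n x) powr p x)) \<partial>M)"
    unfolding rho_def
  proof (rule nn_integral_cong_AE)
    show "AE x in M. ennreal (norm (f x - g x) powr p x) = liminf (\<lambda>n. ennreal (norm (f x - h n x) powr p x))"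
      using lim AE_space[of M]
    proof eventually_elim
      case (elim x)
      then have "0 < p x" using p_gt_1[of x] by simp
      then have "(\<lambda>n. ennreal (norm (f x - h n x) powr p x)) \<longlonglongrightarrow> ennreal (norm (f x - g x) powr p x)"
        using elim(1) by (intro tendsto_ennrealI tendsto_powr' tendsto_intros) auto
      then show ?case by (metis lim_imp_Liminf trivial_limit_sequentially)
    qed
  qed
  also have "\<dots> \<le> liminf (\<lambda>n. rho (\<lambda>x. f x - h n x))"
    unfolding rho_def by (rule nn_integral_liminf) measurable
  also have "\<dots> \<le> e" by (rule Liminf_le[OF sequentially_bot le])
  finally show ?thesis .
qed

lemma energy_fatou:
  fixes h :: "nat \<Rightarrow> 'a \<Rightarrow> 'b::euclidean_space"
  assumes [measurable]: "\<And>n. h n \<in> borel_measurable M"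
    and lim: "AE x in M. (\<lambda>n. h n x) \<longlonglongrightarrow> g x" and le: "\<forall>\<^sub>F n in sequentially. energy (h n) \<le> e"
  shows "energy g \<le> e"
proof -
  have "energy g = (\<integral>\<^sup>+x. liminf (\<lambda>n. ennreal (norm (h n x) powr p x / p x)) \<partial>M)"
    unfolding energy_def
  proof (rule nn_integral_cong_AE)
    show "AE x in M. ennreal (norm (g x) powr p x / p x) = liminf (\<lambda>n. ennreal (norm (h n x) powr p x / p x))"
      using lim AE_space[of M]
    proof eventually_elim
      case (elim x)
      then have "0 < p x" using p_gt_1[of x] by simp
      then have "(\<lambda>n. ennreal (norm (h n x) powr p x / p x)) \<longlonglongrightarrow> ennreal (norm (g x) powr p x / p x)"
        using elim(1) by (intro tendsto_ennrealI tendsto_divide tendsto_powr' tendsto_intros) auto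
      then show ?case by (metis lim_imp_Liminf trivial_limit_sequentially)
    qed
  qed
  also have "\<dots> \<le> liminf (\<lambda>n. energy (h n))"
    unfolding energy_def by (rule nn_integral_liminf) measurable
  also have "\<dots> \<le> e" by (rule Liminf_le[OF sequentially_bot le])
  finally show ?thesis .
qed

text \<open>Let \<open>S n\<close> be the set of gradients \<open>h\<close> of functions whose modular distance to \<open>u\<close> is at most \<open>d n\<close>.
  These sets decrease, contain the midpoints of their elements, and the infima of the energy over them increase
  to a limit of at most \<open>L\<close>.  Elements that nearly attain the infima have midpoints whose energy is hardly smaller
  than their own, so by uniform convexity they form a Cauchy sequence.  Its limit is the required
  gradient.\<close>

lemma W0_lower_semicontinuous:
  fixes u :: "'a \<Rightarrow> real"
  assumes W: "\<And>n::nat. W0 (v n) (g n)" and um[measurable]: "u \<in> borel_measurable M"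
    and conv: "(\<lambda>n. rho (\<lambda>x. v n x - u x)) \<longlonglongrightarrow> 0"
    and L: "L \<ge> 0" "\<And>e. e > 0 \<Longrightarrow> \<forall>\<^sub>F n in sequentially. energy (g n) \<le> ennreal (L + e)"
  obtains h where "W0 u h" "energy h \<le> ennreal L"
proof -
  define d where "d n = 1 / real (Suc n)" for n
  have d: "d n > 0" for n by (simp add: d_def)
  have dm: "n \<le> m \<Longrightarrow> d m \<le> d n" for n m by (simp add: d_def frac_le)
  have d0: "d \<longlonglongrightarrow> 0" unfolding d_def by (rule LIMSEQ_Suc[OF lim_1_over_n])
  define S where "S n = {h. \<exists>w. W0 w h \<and> rho (\<lambda>x. w x - u x) \<le> ennreal (d n)}" for n
  define i where "i n = (INF h\<in>S n. energy h)" for n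
  have iL: "i n \<le> ennreal L" for n
  proof (rule ennreal_le_epsilon)
    fix e :: real assume e: "e > 0"
    have "\<forall>\<^sub>F k in sequentially. rho (\<lambda>x. v k x - u x) < ennreal (d n)" by (rule order_tendstoD(2)[OF conv]) (simp add: d)
    then have "\<forall>\<^sub>F k in sequentially. i n \<le> ennreal (L + e)"
      using L(2)[OF e]
    proof eventually_elim
      case (elim k)
      have "g k \<in> S n" unfolding S_def using W[of k] elim(1) less_imp_le by blast
      then have "i n \<le> energy (g k)" unfolding i_def by (rule INF_lower)
      then show ?case using elim(2) by simp
    qed
    then have "i n \<le> ennreal (L + e)" by simp
    then show "i n \<le> ennreal L + ennreal e" using L(1) e by simp
  qed
  define ir where "ir n = enn2real (i n)" for n
  have ir: "i n = ennreal (ir n)" "0 \<le> ir n" "ir n \<le> L" for n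
  proof -
    have fin: "i n < top" using iL[of n] by (meson ennreal_less_top le_less_trans)
    then show "i n = ennreal (ir n)" by (simp add: ir_def)
    then show "ir n \<le> L" using iL[of n] L(1) by simp
  qed (simp add: ir_def)
  have "incseq ir"
  proof (rule incseq_SucI)
    fix n
    have "S (Suc n) \<subseteq> S n" 
    proof
      fix h assume "h \<in> S (Suc n)"
      then obtain w where "W0 w h" "rho (\<lambda>x. w x - u x) \<le> ennreal (d (Suc n))" unfolding S_def by blast
      moreover have "ennreal (d (Suc n)) \<le> ennreal (d n)" by (rule ennreal_leI) (simp add: dm)
      ultimately have "W0 w h \<and> rho (\<lambda>x. w x - u x) \<le> ennreal (d n)" by simp
      then show "h \<in> S n" unfolding S_def by blast
    qed
    then have "i n \<le> i (Suc n)" unfolding i_def by (rule INF_superset_mono) simp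
    then show "ir n \<le> ir (Suc n)" using ir by simp
  qed
  then have "convergent ir" using ir(3) by (intro Bseq_mono_convergent BseqI'[of _ L]) (auto simp: ir incseq_def)
  then have ir_cau: "Cauchy ir" by (rule convergent_Cauchy)
  have "\<exists>w h. W0 w h \<and> rho (\<lambda>x. w x - u x) \<le> ennreal (d n) \<and> energy h \<le> ennreal (ir n + d n)" for n
  proof -
    have "i n < ennreal (ir n + d n)" using d[of n] ir[of n] by (simp add: ennreal_less_iff)
    then obtain h where "h \<in> S n" "energy h < ennreal (ir n + d n)" unfolding i_def INF_less_iff by blast
    then show ?thesis unfolding S_def using less_imp_le by blast
  qed
  then obtain w h where w: "\<And>n. W0 (w n) (h n)" "\<And>n. rho (\<lambda>x. w n x - u x) \<le> ennreal (d n)"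
    and h: "\<And>n. energy (h n) \<le> ennreal (ir n + d n)" by metis
  have [measurable]: "w n \<in> borel_measurable M" "h n \<in> borel_measurable M" for n using W0_measurable[OF w(1)[of n]] by auto
  have rhoh: "rho (h n) \<le> ennreal (pp * (L + 1))" for n
  proof -
    have "rho (h n) \<le> ennreal pp * energy (h n)" by (rule rho_le_energy) measurable
    also have "\<dots> \<le> ennreal pp * ennreal (L + 1)"
    proof (intro mult_left_mono order_trans[OF h] ennreal_leI)
      have "d n \<le> 1" by (simp add: d_def)
      then show "ir n + d n \<le> L + 1" using ir(3)[of n] by simp
    qed simp
    finally show ?thesis using pp_pos L by (simp add: ennreal_mult)
  qed
  have half: "\<exists>N. \<forall>n\<ge>N. \<forall>m\<ge>n. rho (\<lambda>x. h n x - h m x) \<le> ennreal e" if e: "e > 0" for e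
  proof -
    define e1 where "e1 = e / (4 * (pp * (L + 1)))"
    have pL: "pp * (L + 1) > 0" using pp_pos L by simp
    have e1: "e1 > 0" using e pL by (simp add: e1_def)
    obtain K where K: "K \<ge> 0" "\<And>g h :: 'a \<Rightarrow> 'a. g \<in> borel_measurable M \<Longrightarrow> h \<in> borel_measurable M \<Longrightarrow>
      rho (\<lambda>x. g x - h x) + ennreal K * energy (\<lambda>x. (1 / 2) *\<^sub>R (g x + h x)) \<le>
      ennreal e1 * (rho g + rho h) + ennreal (K / 2) * (energy g + energy h)"
      by (rule energy_uniform_convexity[OF e1]) blast
    obtain N1 where N1: "\<And>m n. m \<ge> N1 \<Longrightarrow> n \<ge> N1 \<Longrightarrow> dist (ir m) (ir n) < e / (4 * (K + 1))"
      using metric_CauchyD[OF ir_cau, of "e / (4 * (K + 1))"] e K(1) by auto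
    have "\<forall>\<^sub>F n in sequentially. d n < e / (4 * (K + 1))"
      by (rule order_tendstoD(2)[OF d0]) (use e K(1) in simp)
    then obtain N2 where N2: "\<And>n. n \<ge> N2 \<Longrightarrow> d n < e / (4 * (K + 1))" unfolding eventually_sequentially by blast
    have "rho (\<lambda>x. h n x - h m x) \<le> ennreal e" if n: "n \<ge> max N1 N2" and m: "m \<ge> n" for n m
    proof -
      let ?mid = "\<lambda>x. (1 / 2) *\<^sub>R (h n x + h m x)"
      \<comment> \<open>Membership in \<open>S n\<close> bounds the energy of the midpoint below by \<open>ir n\<close>, while the energies of \<open>h n\<close> and \<open>h m\<close> exceed
        \<open>ir n\<close> by little because \<open>ir\<close> converges.\<close>
      have "?mid \<in> S n"
      proof -
        have "rho (\<lambda>x. (1 / 2) *\<^sub>R ((w n x - u x) + (w m x - u x))) \<le> ennreal (d n)"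
          by (rule rho_midpoint) (use w(2)[of n] order_trans[OF w(2)[of m] ennreal_leI[OF dm[OF m]]] d[of n] in auto)
        moreover have "(\<lambda>x. (1 / 2) *\<^sub>R ((w n x - u x) + (w m x - u x))) = (\<lambda>x. (1 / 2) *\<^sub>R (w n x + w m x) - u x)"
          by (rule ext) (simp add: field_simps)
        ultimately show ?thesis unfolding S_def using W0_midpoint[OF w(1)[of n] w(1)[of m]] by (auto simp only: mem_Collect_eq)
      qed
      then have "ennreal (ir n) \<le> energy ?mid" unfolding ir(1)[symmetric] i_def by (rule INF_lower)
      then have "rho (\<lambda>x. h n x - h m x) + ennreal K * ennreal (ir n) \<le> rho (\<lambda>x. h n x - h m x) + ennreal K * energy ?mid"
        by (intro add_left_mono mult_left_mono) auto
      also have "\<dots> \<le> ennreal e1 * (rho (h n) + rho (h m)) + ennreal (K / 2) * (energy (h n) + energy (h m))"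
        by (rule K(2)) measurable
      also have "\<dots> \<le> ennreal e1 * (ennreal (pp * (L + 1)) + ennreal (pp * (L + 1))) + ennreal (K / 2) * (ennreal (ir n + d n) + ennreal (ir m + d m))"
        by (intro add_mono mult_left_mono rhoh h) auto
      also have "\<dots> = ennreal (e1 * (pp * (L + 1) + pp * (L + 1)) + K / 2 * ((ir n + d n) + (ir m + d m)))"
      proof -
        have 1: "0 \<le> pp * (L + 1)" "0 \<le> ir n + d n" "0 \<le> ir m + d m" "0 \<le> K / 2" "0 \<le> e1"
          using pL ir(2)[of n] ir(2)[of m] d[of n] d[of m] K(1) e1 by simp_all
        note 2 = add_nonneg_nonneg[OF 1(1) 1(1)] add_nonneg_nonneg[OF 1(2) 1(3)]
        show ?thesis
          by (simp only: ennreal_plus[OF 1(1) 1(1)] ennreal_plus[OF 1(2) 1(3)] ennreal_mult[OF 1(5) 2(1)] ennreal_mult[OF 1(4) 2(2)]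
            ennreal_plus[OF mult_nonneg_nonneg[OF 1(5) 2(1)] mult_nonneg_nonneg[OF 1(4) 2(2)]])
      qed
      also have "ennreal K * ennreal (ir n) = ennreal (K * ir n)" using K(1) ir(2) by (simp add: ennreal_mult)
      finally have "rho (\<lambda>x. h n x - h m x) \<le> ennreal (e1 * (pp * (L + 1) + pp * (L + 1)) + K / 2 * ((ir n + d n) + (ir m + d m)) - K * ir n)"
        using K(1) ir(2) by (intro ennreal_le_diffI) auto
      also have "\<dots> \<le> ennreal e"
      proof (rule ennreal_leI)
        have 1: "e1 * (pp * (L + 1) + pp * (L + 1)) = e / 2" using pL by (simp add: e1_def field_simps)
        have "(ir m - ir n) + d n + d m \<le> 3 * (e / (4 * (K + 1)))"
          using N1[of m n] N2[of n] N2[of m] n m by (auto simp: dist_real_def)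
        then have "K / 2 * ((ir m - ir n) + d n + d m) \<le> K / 2 * (3 * (e / (4 * (K + 1))))"
          using K(1) by (intro mult_left_mono) auto
        also have "\<dots> \<le> e / 2" using K(1) e by (simp add: field_simps)
        finally have "K / 2 * ((ir n + d n) + (ir m + d m)) - K * ir n \<le> e / 2" by (simp add: field_simps)
        then show "e1 * (pp * (L + 1) + pp * (L + 1)) + K / 2 * ((ir n + d n) + (ir m + d m)) - K * ir n \<le> e" using 1 by linarith
      qed
      finally show ?thesis .
    qed
    then show ?thesis by blast
  qed
  have cau: "\<exists>N. \<forall>n\<ge>N. \<forall>m\<ge>N. rho (\<lambda>x. h n x - h m x) \<le> ennreal e" if e: "e > 0" for e
  proof -
    obtain N where N: "\<And>n m. n \<ge> N \<Longrightarrow> m \<ge> n \<Longrightarrow> rho (\<lambda>x. h n x - h m x) \<le> ennreal e" using half[OF e] by blast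
    have "rho (\<lambda>x. h n x - h m x) \<le> ennreal e" if "n \<ge> N" "m \<ge> N" for n m
      using N[of n m] N[of m n] that rho_minus[of "h n" "h m"] by (cases "m \<ge> n") auto
    then show ?thesis by blast
  qed
  have hi: "integrable M (h n)" for n using W0_rho_finite(2)[OF w(1)] by (intro rho_integrable) auto
  have L1c: "\<exists>N. \<forall>n\<ge>N. \<forall>m\<ge>N. (\<integral>\<^sup>+x. ennreal (norm (h n x - h m x)) \<partial>M) \<le> ennreal e" if e: "e > 0" for e
  proof -
    obtain c where c: "c > 0" "\<And>f :: 'a \<Rightarrow> 'a. f \<in> borel_measurable M \<Longrightarrow> rho f \<le> ennreal c \<Longrightarrow> (\<integral>\<^sup>+x. ennreal (norm (f x)) \<partial>M) \<le> ennreal e"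
      using rho_small_L1[OF e] by metis
    obtain N where N: "\<forall>n\<ge>N. \<forall>m\<ge>N. rho (\<lambda>x. h n x - h m x) \<le> ennreal c" using cau[OF c(1)] by blast
    have "(\<integral>\<^sup>+x. ennreal (norm (h n x - h m x)) \<partial>M) \<le> ennreal e" if "n \<ge> N" "m \<ge> N" for n m
      by (rule c(2)) (use N that in auto)
    then show ?thesis by blast
  qed
  obtain r G where r: "strict_mono (r :: nat \<Rightarrow> nat)" "integrable M G" "AE x in M. (\<lambda>i. h (r i) x) \<longlonglongrightarrow> G x"
    by (rule L1_complete[OF hi L1c])
  have [measurable]: "G \<in> borel_measurable M" using r(2) by auto
  have "W0 u G"
  proof (rule W0_closed)
    fix e :: real assume e: "e > 0"
    obtain N where N: "\<And>n m. n \<ge> N \<Longrightarrow> m \<ge> N \<Longrightarrow> rho (\<lambda>x. h n x - h m x) \<le> ennreal e" using cau[OF e] by blast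
    have "\<forall>\<^sub>F n in sequentially. d n < e" by (rule order_tendstoD(2)[OF d0 e])
    then obtain N2 where N2: "\<And>n. n \<ge> N2 \<Longrightarrow> d n < e" unfolding eventually_sequentially by blast
    define n where "n = max N N2"
    have n: "d n \<le> e" "n \<ge> N" using N2[of n] by (auto simp: n_def less_imp_le)
    have "rho (\<lambda>x. h n x - G x) \<le> ennreal e"
    proof (rule rho_fatou[OF _ _ r(3)])
      show "\<forall>\<^sub>F i in sequentially. rho (\<lambda>x. h n x - h (r i) x) \<le> ennreal e"
        unfolding eventually_sequentially using N[OF n(2)] seq_suble[OF r(1)] order_trans by blast
    qed measurable
    moreover have "rho (\<lambda>x. w n x - u x) \<le> ennreal e" using w(2)[of n] n(1) by (meson ennreal_leI order_trans)
    ultimately show "\<exists>v h. W0 v h \<and> rho (\<lambda>x. u x - v x) \<le> ennreal e \<and> rho (\<lambda>x. G x - h x) \<le> ennreal e"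
      using w(1)[of n] rho_minus[of "w n" u] rho_minus[of "h n" G] by (intro exI[of _ "w n"] exI[of _ "h n"]) simp
  qed measurable
  moreover have "energy G \<le> ennreal L"
  proof (rule ennreal_le_epsilon)
    fix e :: real assume e: "e > 0"
    have "energy G \<le> ennreal (L + e)"
    proof (rule energy_fatou[OF _ r(3)])
      have "\<forall>\<^sub>F n in sequentially. d n < e" by (rule order_tendstoD(2)[OF d0 e])
      then have "\<forall>\<^sub>F i in sequentially. d (r i) < e" by (rule eventually_subseq[OF r(1)])
      then show "\<forall>\<^sub>F i in sequentially. energy (h (r i)) \<le> ennreal (L + e)"
      proof eventually_elim
        case (elim i)
        then have "ir (r i) + d (r i) \<le> L + e" using ir(3)[of "r i"] by simp
        then show ?case using h[of "r i"] by (meson ennreal_leI order_trans)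
      qed
    qed measurable
    then show "energy G \<le> ennreal L + ennreal e" using L(1) e by simp
  qed
  ultimately show ?thesis by (rule that)
qed

lemma powr_le_one_plus:
  fixes t :: real
  assumes "0 \<le> t" "0 \<le> s" "s \<le> q" shows "t powr s \<le> 1 + t powr q"
proof (cases "t \<le> 1")
  case True
  then have "t powr s \<le> 1" using assms powr_mono2[of s t 1] by simp
  then show ?thesis by (smt (verit) powr_ge_zero)
next
  case False
  then have "t powr s \<le> t powr q" using assms by (intro powr_mono) auto
  then show ?thesis by simp
qed

lemma W0_approx_sequence:
  assumes W: "W0 u g"
  obtains \<phi> where "\<And>n. \<phi> n \<in> test_functions \<Omega>" "\<And>n. rho (\<lambda>x. u x - \<phi> n x) \<le> ennreal (1 / real (Suc n))"
    "\<And>n. rho (\<lambda>x. g x - grad (\<phi> n) x) \<le> ennreal (1 / real (Suc n))"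
proof -
  have "\<exists>\<phi>\<in>test_functions \<Omega>. rho (\<lambda>x. u x - \<phi> x) \<le> ennreal (1 / real (Suc n)) \<and>
      rho (\<lambda>x. g x - grad \<phi> x) \<le> ennreal (1 / real (Suc n))" for n
  proof -
    have "1 / real (Suc n) > 0" by simp
    then show ?thesis using W unfolding W0_def by blast
  qed
  then obtain \<phi> where "\<And>n. \<phi> n \<in> test_functions \<Omega>" "\<And>n. rho (\<lambda>x. u x - \<phi> n x) \<le> ennreal (1 / real (Suc n))"
    "\<And>n. rho (\<lambda>x. g x - grad (\<phi> n) x) \<le> ennreal (1 / real (Suc n))" by metis
  then show ?thesis by (rule that)
qed

lemma rho_grad_approx_bound:
  assumes [measurable]: "g \<in> borel_measurable M" and \<phi>: "\<phi> \<in> test_functions \<Omega>"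
    and "rho g \<le> ennreal B" "B \<ge> 0" "rho (\<lambda>x. g x - grad \<phi> x) \<le> ennreal 1"
  shows "rho (grad \<phi>) \<le> ennreal (2 powr pp * (B + 1))"
proof -
  note [measurable] = test_measurable[OF \<phi>]
  have "rho (\<lambda>x. g x + (grad \<phi> x - g x)) \<le> ennreal (2 powr pp) * (rho g + rho (\<lambda>x. grad \<phi> x - g x))"
    by (rule rho_add) measurable
  also have "\<dots> \<le> ennreal (2 powr pp) * (ennreal B + ennreal 1)"
    using assms(3,5) rho_minus[of g "grad \<phi>"] by (intro mult_left_mono add_mono) auto
  also have "\<dots> = ennreal (2 powr pp * (B + 1))"
    using \<open>B \<ge> 0\<close> by (simp add: ennreal_mult ennreal_plus)
  finally show ?thesis by simp
qed

lemma test_nn_integral_lborel: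
  fixes f :: "'a \<Rightarrow> ennreal"
  assumes "f \<in> borel_measurable borel" "\<And>x. x \<notin> \<Omega> \<Longrightarrow> f x = 0"
  shows "(\<integral>\<^sup>+x. f x \<partial>M) = (\<integral>\<^sup>+x. f x \<partial>lborel)"
  by (rule nn_integral_lebesgue_on_eq_lborel) (use assms in auto)

lemma L1_bound_of_rho:
  fixes f :: "'a \<Rightarrow> 'b::euclidean_space"
  assumes "f \<in> borel_measurable M" "rho f \<le> ennreal B" "B \<ge> 0" and "0 \<le> s" "s \<le> pm"
  shows "(\<integral>\<^sup>+x. ennreal (norm (f x) powr s) \<partial>M) \<le> ennreal (measure M \<Omega> + B)"
proof -
  note [measurable] = assms(1)
  have "(\<integral>\<^sup>+x. ennreal (norm (f x) powr s) \<partial>M) \<le> (\<integral>\<^sup>+x. 1 + ennreal (norm (f x) powr p x) \<partial>M)"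
  proof (rule nn_integral_mono)
    fix x assume "x \<in> space M"
    then have "s \<le> p x" using p_ge[of x] assms(5) by simp
    then have "norm (f x) powr s \<le> 1 + norm (f x) powr p x" using assms(4) by (intro powr_le_one_plus) auto
    then have "ennreal (norm (f x) powr s) \<le> ennreal (1 + norm (f x) powr p x)" by (rule ennreal_leI)
    then show "ennreal (norm (f x) powr s) \<le> 1 + ennreal (norm (f x) powr p x)" by simp
  qed
  also have "\<dots> = emeasure M (space M) + rho f" unfolding rho_def by (simp add: nn_integral_add)
  also have "\<dots> \<le> ennreal (measure M \<Omega>) + ennreal B" using assms(2) by (intro add_mono) (auto simp: M.emeasure_eq_measure)
  finally show ?thesis using assms(3) by simp
qed

text \<open>The bound for test functions extends by Fatou's lemma, and on a set of finite measure the modular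
  controls the integral of the power \<open>pm\<close>.\<close>

lemma W0_sobolev:
  assumes pmN: "pm < DIM('a)" and Q: "pm \<le> Q" "Q < DIM('a) * pm / (DIM('a) - pm)" and B: "B \<ge> 0"
  obtains C where "C \<ge> 0" "\<And>u g. W0 u g \<Longrightarrow> rho g \<le> ennreal B \<Longrightarrow> (\<integral>\<^sup>+x. ennreal (\<bar>u x\<bar> powr Q) \<partial>M) \<le> ennreal C"
proof -
  define B2 where "B2 = measure M \<Omega> + 2 powr pp * (B + 1)"
  have B2: "B2 > 0" using B by (simp add: B2_def add_nonneg_pos)
  obtain C where C: "C \<ge> 0" "\<And>\<phi>. \<phi> \<in> test_functions \<Omega> \<Longrightarrow>
      (\<integral>\<^sup>+x. ennreal (norm (grad \<phi> x) powr pm) \<partial>lborel) \<le> ennreal B2 \<Longrightarrow>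
      (\<integral>\<^sup>+x. ennreal (\<bar>\<phi> x\<bar> powr Q) \<partial>lborel) \<le> ennreal C"
    using sobolev_test_functions[OF bounded_dom pm pmN Q B2] by metis
  show ?thesis
  proof (rule that[OF C(1)])
    fix u g assume W: "W0 u g" and gB: "rho g \<le> ennreal B"
    note [measurable] = W0_measurable[OF W]
    obtain \<phi> where \<phi>: "\<And>n. \<phi> n \<in> test_functions \<Omega>" "\<And>n. rho (\<lambda>x. u x - \<phi> n x) \<le> ennreal (1 / real (Suc n))"
      "\<And>n. rho (\<lambda>x. g x - grad (\<phi> n) x) \<le> ennreal (1 / real (Suc n))"
      by (rule W0_approx_sequence[OF W]) blast
    note [measurable] = test_measurable[OF \<phi>(1)]
    have bound: "(\<integral>\<^sup>+x. ennreal (\<bar>\<phi> n x\<bar> powr Q) \<partial>M) \<le> ennreal C" for n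
    proof -
      have "rho (\<lambda>x. g x - grad (\<phi> n) x) \<le> ennreal 1" by (rule order_trans[OF \<phi>(3)]) (simp add: ennreal_leI)
      then have "rho (grad (\<phi> n)) \<le> ennreal (2 powr pp * (B + 1))"
        by (intro rho_grad_approx_bound[OF _ \<phi>(1) gB B]) measurable
      then have "(\<integral>\<^sup>+x. ennreal (norm (grad (\<phi> n) x) powr pm) \<partial>M) \<le> ennreal B2"
        unfolding B2_def using B pm by (intro L1_bound_of_rho) auto
      moreover have "(\<integral>\<^sup>+x. ennreal (norm (grad (\<phi> n) x) powr pm) \<partial>M) = (\<integral>\<^sup>+x. ennreal (norm (grad (\<phi> n) x) powr pm) \<partial>lborel)"
        using borel_measurable_test_function[OF \<phi>(1)] test_function_outside[OF \<phi>(1)]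
        by (intro test_nn_integral_lborel) auto
      ultimately have "(\<integral>\<^sup>+x. ennreal (\<bar>\<phi> n x\<bar> powr Q) \<partial>lborel) \<le> ennreal C" using C(2)[OF \<phi>(1)] by simp
      moreover have "(\<integral>\<^sup>+x. ennreal (\<bar>\<phi> n x\<bar> powr Q) \<partial>M) = (\<integral>\<^sup>+x. ennreal (\<bar>\<phi> n x\<bar> powr Q) \<partial>lborel)"
        using borel_measurable_test_function[OF \<phi>(1)] test_function_outside[OF \<phi>(1)]
        by (intro test_nn_integral_lborel) auto
      ultimately show ?thesis by simp
    qed
    have int: "integrable M (\<lambda>x. \<phi> n x - u x)" for n
      using W0_rho_finite(1)[OF W] W0_rho_finite(1)[OF W0_test[OF \<phi>(1)]]
      by (intro Bochner_Integration.integrable_diff rho_integrable) auto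
    have "(\<lambda>n. LINT x|M. norm (\<phi> n x - u x)) \<longlonglongrightarrow> 0"
    proof (rule LIMSEQ_I)
      fix e :: real assume e: "e > 0"
      then have "e / 2 > 0" by simp
      from rho_small_L1[OF this] obtain c where c: "c > 0" "\<And>f :: 'a \<Rightarrow> real. f \<in> borel_measurable M \<Longrightarrow> rho f \<le> ennreal c \<Longrightarrow> (\<integral>\<^sup>+x. ennreal (norm (f x)) \<partial>M) \<le> ennreal (e / 2)"
        by metis
      obtain N where N: "1 / real (Suc N) < c" using nat_approx_posE[OF c(1)] by blast
      have "norm ((LINT x|M. norm (\<phi> n x - u x)) - 0) < e" if n: "n \<ge> N" for n
      proof -
        have "1 / real (Suc n) \<le> 1 / real (Suc N)" using n by (simp add: frac_le)
        then have "1 / real (Suc n) \<le> c" using N by simp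
        then have "rho (\<lambda>x. u x - \<phi> n x) \<le> ennreal c" using \<phi>(2)[of n] by (meson ennreal_leI order_trans)
        then have "rho (\<lambda>x. \<phi> n x - u x) \<le> ennreal c" by (simp only: rho_minus[of u "\<phi> n"])
        then have "(\<integral>\<^sup>+x. ennreal (norm (\<phi> n x - u x)) \<partial>M) \<le> ennreal (e / 2)" by (intro c(2)) measurable
        moreover have "(\<integral>\<^sup>+x. ennreal (norm (\<phi> n x - u x)) \<partial>M) = ennreal (LINT x|M. norm (\<phi> n x - u x))"
          by (rule nn_integral_eq_integral) (use int in auto)
        ultimately have "(LINT x|M. norm (\<phi> n x - u x)) \<le> e / 2" using e by simp
        moreover have "0 \<le> (LINT x|M. norm (\<phi> n x - u x))" by (rule integral_nonneg_AE) simp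
        ultimately show ?thesis using e by simp
      qed
      then show "\<exists>N. \<forall>n\<ge>N. norm ((LINT x|M. norm (\<phi> n x - u x)) - 0) < e" by blast
    qed
    from tendsto_L1_AE_subseq[OF int this] obtain r where r: "strict_mono r" "AE x in M. (\<lambda>n. \<phi> (r n) x - u x) \<longlonglongrightarrow> 0" by blast
    have "(\<integral>\<^sup>+x. ennreal (\<bar>u x\<bar> powr Q) \<partial>M) = (\<integral>\<^sup>+x. liminf (\<lambda>n. ennreal (\<bar>\<phi> (r n) x\<bar> powr Q)) \<partial>M)"
    proof (rule nn_integral_cong_AE)
      show "AE x in M. ennreal (\<bar>u x\<bar> powr Q) = liminf (\<lambda>n. ennreal (\<bar>\<phi> (r n) x\<bar> powr Q))"
        using r(2)
      proof eventually_elim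
        case (elim x)
        then have "(\<lambda>n. \<phi> (r n) x) \<longlonglongrightarrow> u x" by (simp add: LIM_zero_iff)
        then have "(\<lambda>n. ennreal (\<bar>\<phi> (r n) x\<bar> powr Q)) \<longlonglongrightarrow> ennreal (\<bar>u x\<bar> powr Q)"
          using Q pm by (intro tendsto_ennrealI tendsto_powr' tendsto_intros) auto
        then show ?case by (metis lim_imp_Liminf trivial_limit_sequentially)
      qed
    qed
    also have "\<dots> \<le> liminf (\<lambda>n. \<integral>\<^sup>+x. ennreal (\<bar>\<phi> (r n) x\<bar> powr Q) \<partial>M)"
      by (rule nn_integral_liminf) measurable
    also have "\<dots> \<le> ennreal C" by (rule Liminf_le) (use bound in auto)
    finally show "(\<integral>\<^sup>+x. ennreal (\<bar>u x\<bar> powr Q) \<partial>M) \<le> ennreal C" .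
  qed
qed

end

context var_exp
begin

lemma W0_powr_integrable:
  assumes pmN: "pm < DIM('a)" and q: "pm \<le> q" "q < DIM('a) * pm / (DIM('a) - pm)" and W: "W0 u g" and s: "0 \<le> s" "s \<le> q"
  shows "integrable M (\<lambda>x. \<bar>u x\<bar> powr s)"
proof (rule integrableI_bounded)
  note [measurable] = W0_measurable[OF W]
  show "(\<lambda>x. \<bar>u x\<bar> powr s) \<in> borel_measurable M" by measurable
  define B where "B = enn2real (rho g)"
  have B: "rho g \<le> ennreal B" "B \<ge> 0" using W0_rho_finite(2)[OF W] by (simp_all add: B_def less_top)
  obtain C where C: "C \<ge> 0" "\<And>u g. W0 u g \<Longrightarrow> rho g \<le> ennreal B \<Longrightarrow> (\<integral>\<^sup>+x. ennreal (\<bar>u x\<bar> powr q) \<partial>M) \<le> ennreal C"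
    by (rule W0_sobolev[OF pmN q B(2)]) blast
  have "(\<integral>\<^sup>+x. ennreal (norm (\<bar>u x\<bar> powr s)) \<partial>M) \<le> (\<integral>\<^sup>+x. 1 + ennreal (\<bar>u x\<bar> powr q) \<partial>M)"
  proof (rule nn_integral_mono)
    fix x
    have "ennreal (\<bar>u x\<bar> powr s) \<le> ennreal (1 + \<bar>u x\<bar> powr q)" using s by (intro ennreal_leI powr_le_one_plus) auto
    then show "ennreal (norm (\<bar>u x\<bar> powr s)) \<le> 1 + ennreal (\<bar>u x\<bar> powr q)" by simp
  qed
  also have "\<dots> = emeasure M (space M) + (\<integral>\<^sup>+x. ennreal (\<bar>u x\<bar> powr q) \<partial>M)" by (simp add: nn_integral_add)
  also have "\<dots> \<le> ennreal (measure M \<Omega>) + ennreal C"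
    using C(2)[OF W B(1)] by (intro add_mono) (auto simp: M.emeasure_eq_measure)
  also have "\<dots> < \<infinity>" by simp
  finally show "(\<integral>\<^sup>+x. ennreal (norm (\<bar>u x\<bar> powr s)) \<partial>M) < \<infinity>" .
qed

lemma W0_energy_integrable:
  assumes W: "W0 u g"
  shows "integrable M (\<lambda>x. norm (g x) powr p x / p x)" "energy g = ennreal (LINT x|M. norm (g x) powr p x / p x)"
    "0 \<le> (LINT x|M. norm (g x) powr p x / p x)"
proof -
  note [measurable] = W0_measurable[OF W]
  have nn: "AE x in M. 0 \<le> norm (g x) powr p x / p x" by (rule AE_I2) (simp add: less_imp_le[OF less_trans[OF zero_less_one p_gt_1]])
  have "energy g < \<infinity>" using energy_le_rho W0_rho_finite(2)[OF W] by (rule le_less_trans)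
  then show i: "integrable M (\<lambda>x. norm (g x) powr p x / p x)"
    unfolding energy_def by (intro integrableI_nonneg nn) measurable
  show "energy g = ennreal (LINT x|M. norm (g x) powr p x / p x)"
    unfolding energy_def by (rule nn_integral_eq_integral[OF i nn])
  show "0 \<le> (LINT x|M. norm (g x) powr p x / p x)" by (rule integral_nonneg_AE[OF nn])
qed

text \<open>Below the threshold \<open>T\<close> the second term dominates, above it the first one.\<close>

lemma interpolate_powr:
  fixes t :: real
  assumes t: "0 \<le> t" and T: "T > 0" and q: "1 \<le> q" "q \<le> Q"
  shows "t powr q \<le> T powr (q - Q) * t powr Q + T powr (q - 1) * t"
proof (cases "t \<le> T")
  case True
  have "t powr q = t powr (q - 1) * t"
    using t q by (cases "t = 0") (auto simp: powr_diff)
  also have "\<dots> \<le> T powr (q - 1) * t" using True t q by (intro mult_right_mono powr_mono2) auto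
  finally show ?thesis by (simp add: add_increasing)
next
  case False
  have "t powr q = t powr (q - Q) * t powr Q" by (simp add: powr_add[symmetric])
  also have "\<dots> \<le> T powr (q - Q) * t powr Q" using False T q by (intro mult_right_mono powr_mono2') auto
  finally show ?thesis using t by (simp add: add_increasing2)
qed

text \<open>Each function is close to a test function with comparable gradient, so Rellich's theorem yields a
  subsequence converging in \<open>L1\<close>.  The Sobolev bound with the larger exponent \<open>Q\<close> and interpolation between
  \<open>L1\<close> and \<open>LQ\<close> improve this to the exponent \<open>q\<close>, and \<open>t powr p x \<le> t + t powr q\<close> to the modular.\<close>

lemma W0_compact:
  fixes u :: "nat \<Rightarrow> 'a \<Rightarrow> real"
  assumes pmN: "pm < DIM('a)" and q: "pp \<le> q" "q < Q" "Q < DIM('a) * pm / (DIM('a) - pm)"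
    and W: "\<And>n. W0 (u n) (g n)" and B: "B \<ge> 0" "\<And>n. rho (g n) \<le> ennreal B"
  obtains r v where "strict_mono (r :: nat \<Rightarrow> nat)" "v \<in> borel_measurable M" "AE x in M. (\<lambda>n. u (r n) x) \<longlonglongrightarrow> v x"
    "(\<lambda>n. \<integral>\<^sup>+x. ennreal (\<bar>u (r n) x - v x\<bar> powr q) \<partial>M) \<longlonglongrightarrow> 0" "(\<lambda>n. rho (\<lambda>x. u (r n) x - v x)) \<longlonglongrightarrow> 0"
proof -
  note [measurable] = W0_measurable[OF W]
  define d where "d n = 1 / real (Suc n)" for n
  have d: "d n > 0" "d n \<le> 1" for n by (simp_all add: d_def)
  have d0: "d \<longlonglongrightarrow> 0" unfolding d_def by (rule LIMSEQ_Suc[OF lim_1_over_n])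
  have "\<exists>\<phi>\<in>test_functions \<Omega>. rho (\<lambda>x. u n x - \<phi> x) \<le> ennreal (d n) \<and> rho (\<lambda>x. g n x - grad \<phi> x) \<le> ennreal (d n)" for n
    using W[of n] d(1)[of n] unfolding W0_def by blast
  then obtain \<phi> where \<phi>: "\<And>n. \<phi> n \<in> test_functions \<Omega>" "\<And>n. rho (\<lambda>x. u n x - \<phi> n x) \<le> ennreal (d n)"
    "\<And>n. rho (\<lambda>x. g n x - grad (\<phi> n) x) \<le> ennreal (d n)" by metis
  note [measurable] = test_measurable[OF \<phi>(1)]
  define B2 where "B2 = measure M \<Omega> + 2 powr pp * (B + 1)"
  have B2: "B2 \<ge> 0" using B by (simp add: B2_def)
  have gB: "(\<integral>\<^sup>+x. ennreal (norm (grad (\<phi> n) x)) \<partial>lborel) \<le> ennreal B2" for n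
  proof -
    have "rho (\<lambda>x. g n x - grad (\<phi> n) x) \<le> ennreal 1" by (rule order_trans[OF \<phi>(3)]) (rule ennreal_leI[OF d(2)])
    then have "rho (grad (\<phi> n)) \<le> ennreal (2 powr pp * (B + 1))"
      by (intro rho_grad_approx_bound[OF _ \<phi>(1) B(2,1)]) measurable
    then have "(\<integral>\<^sup>+x. ennreal (norm (grad (\<phi> n) x) powr 1) \<partial>M) \<le> ennreal B2"
      unfolding B2_def using B pm by (intro L1_bound_of_rho) auto
    moreover have "(\<integral>\<^sup>+x. ennreal (norm (grad (\<phi> n) x)) \<partial>M) = (\<integral>\<^sup>+x. ennreal (norm (grad (\<phi> n) x)) \<partial>lborel)"
      using borel_measurable_test_function[OF \<phi>(1)] test_function_outside[OF \<phi>(1)]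
      by (intro test_nn_integral_lborel) auto
    ultimately show ?thesis by simp
  qed
  obtain r where r: "strict_mono (r :: nat \<Rightarrow> nat)"
    "\<And>e. e > 0 \<Longrightarrow> \<exists>N. \<forall>m\<ge>N. \<forall>n\<ge>N. (\<integral>\<^sup>+x. ennreal \<bar>\<phi> (r m) x - \<phi> (r n) x\<bar> \<partial>lborel) \<le> ennreal e"
    by (rule rellich_test_functions[of \<Omega> \<phi> B2, OF bounded_dom \<phi>(1) B2 gB]) blast
  have ui: "integrable M (u n)" for n using W0_rho_finite(1)[OF W] by (intro rho_integrable) auto
  have cau: "\<exists>N. \<forall>m\<ge>N. \<forall>n\<ge>N. (\<integral>\<^sup>+x. ennreal (norm (u (r m) x - u (r n) x)) \<partial>M) \<le> ennreal e" if e: "e > 0" for e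
  proof -
    have e3: "e / 3 > 0" using e by simp
    obtain c where c: "c > 0" "\<And>f :: 'a \<Rightarrow> real. f \<in> borel_measurable M \<Longrightarrow> rho f \<le> ennreal c \<Longrightarrow> (\<integral>\<^sup>+x. ennreal (norm (f x)) \<partial>M) \<le> ennreal (e / 3)"
      by (rule rho_small_L1[OF e3]) blast
    obtain N1 where N1: "\<forall>m\<ge>N1. \<forall>n\<ge>N1. (\<integral>\<^sup>+x. ennreal \<bar>\<phi> (r m) x - \<phi> (r n) x\<bar> \<partial>lborel) \<le> ennreal (e / 3)" using r(2)[OF e3] by blast
    have "\<forall>\<^sub>F n in sequentially. d n < c" by (rule order_tendstoD(2)[OF d0 c(1)])
    then obtain N2 where N2: "\<And>n. n \<ge> N2 \<Longrightarrow> d n < c" unfolding eventually_sequentially by blast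
    have ap: "(\<integral>\<^sup>+x. ennreal (norm (u (r n) x - \<phi> (r n) x)) \<partial>M) \<le> ennreal (e / 3)" if "n \<ge> N2" for n
    proof (rule c(2))
      have "d (r n) \<le> c" using N2[of "r n"] seq_suble[OF r(1), of n] that by simp
      then show "rho (\<lambda>x. u (r n) x - \<phi> (r n) x) \<le> ennreal c" using \<phi>(2)[of "r n"] by (meson ennreal_leI order_trans)
    qed measurable
    have "(\<integral>\<^sup>+x. ennreal (norm (u (r m) x - u (r n) x)) \<partial>M) \<le> ennreal e" if mn: "m \<ge> max N1 N2" "n \<ge> max N1 N2" for m n
    proof -
      have "(\<integral>\<^sup>+x. ennreal (norm (u (r m) x - u (r n) x)) \<partial>M) \<le>
        (\<integral>\<^sup>+x. ennreal (norm (u (r m) x - \<phi> (r m) x)) + ennreal \<bar>\<phi> (r m) x - \<phi> (r n) x\<bar> + ennreal (norm (u (r n) x - \<phi> (r n) x)) \<partial>M)"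
      proof (rule nn_integral_mono)
        fix x
        have "norm (u (r m) x - u (r n) x) \<le> norm (u (r m) x - \<phi> (r m) x) + \<bar>\<phi> (r m) x - \<phi> (r n) x\<bar> + norm (u (r n) x - \<phi> (r n) x)"
          unfolding real_norm_def by linarith
        then show "ennreal (norm (u (r m) x - u (r n) x)) \<le> ennreal (norm (u (r m) x - \<phi> (r m) x)) + ennreal \<bar>\<phi> (r m) x - \<phi> (r n) x\<bar> + ennreal (norm (u (r n) x - \<phi> (r n) x))"
          by (simp add: ennreal_plus[symmetric] ennreal_leI del: ennreal_plus)
      qed
      also have "\<dots> = (\<integral>\<^sup>+x. ennreal (norm (u (r m) x - \<phi> (r m) x)) \<partial>M) + (\<integral>\<^sup>+x. ennreal \<bar>\<phi> (r m) x - \<phi> (r n) x\<bar> \<partial>M) + (\<integral>\<^sup>+x. ennreal (norm (u (r n) x - \<phi> (r n) x)) \<partial>M)"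
        by (simp add: nn_integral_add)
      also have "(\<integral>\<^sup>+x. ennreal \<bar>\<phi> (r m) x - \<phi> (r n) x\<bar> \<partial>M) = (\<integral>\<^sup>+x. ennreal \<bar>\<phi> (r m) x - \<phi> (r n) x\<bar> \<partial>lborel)"
        using borel_measurable_test_function(1)[OF \<phi>(1)] test_function_outside[OF \<phi>(1)]
        by (intro test_nn_integral_lborel) auto
      also have "(\<integral>\<^sup>+x. ennreal (norm (u (r m) x - \<phi> (r m) x)) \<partial>M) + (\<integral>\<^sup>+x. ennreal \<bar>\<phi> (r m) x - \<phi> (r n) x\<bar> \<partial>lborel) + (\<integral>\<^sup>+x. ennreal (norm (u (r n) x - \<phi> (r n) x)) \<partial>M)
          \<le> ennreal (e / 3) + ennreal (e / 3) + ennreal (e / 3)"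
        using N1 mn by (intro add_mono ap) auto
      also have "\<dots> = ennreal (e / 3 + e / 3 + e / 3)" using e by (subst ennreal_plus; (subst ennreal_plus)?; simp)
      finally show ?thesis by simp
    qed
    then show ?thesis by blast
  qed
  obtain r2 v where r2: "strict_mono (r2 :: nat \<Rightarrow> nat)" "integrable M v" "AE x in M. (\<lambda>i. u (r (r2 i)) x) \<longlonglongrightarrow> v x"
    "(\<lambda>n. \<integral>\<^sup>+x. ennreal (norm (u (r n) x - v x)) \<partial>M) \<longlonglongrightarrow> 0"
    by (rule L1_complete[of M "\<lambda>n. u (r n)", OF ui cau])
  have vm[measurable]: "v \<in> borel_measurable M" using r2(2) by auto
  define k where "k n = r (r2 n)" for n
  have k: "strict_mono k" using strict_mono_o[OF r(1) r2(1)] by (simp add: k_def[abs_def] o_def)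
  have kae: "AE x in M. (\<lambda>n. u (k n) x) \<longlonglongrightarrow> v x" using r2(3) by (simp add: k_def)
  have kL1: "(\<lambda>n. \<integral>\<^sup>+x. ennreal \<bar>u (k n) x - v x\<bar> \<partial>M) \<longlonglongrightarrow> 0"
    using LIMSEQ_subseq_LIMSEQ[OF r2(4) r2(1)] by (simp add: k_def o_def)
  have q1: "1 < q" and pq: "pm \<le> q" using q pm pm_le_pp by auto
  have "pm \<le> Q" using pq q by simp
  then obtain C where C: "C \<ge> 0" "\<And>u g. W0 u g \<Longrightarrow> rho g \<le> ennreal B \<Longrightarrow> (\<integral>\<^sup>+x. ennreal (\<bar>u x\<bar> powr Q) \<partial>M) \<le> ennreal C"
    by (rule W0_sobolev[OF pmN _ q(3) B(1)]) blast
  have vC: "(\<integral>\<^sup>+x. ennreal (\<bar>v x\<bar> powr Q) \<partial>M) \<le> ennreal C"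
  proof -
    have "(\<integral>\<^sup>+x. ennreal (\<bar>v x\<bar> powr Q) \<partial>M) = (\<integral>\<^sup>+x. liminf (\<lambda>n. ennreal (\<bar>u (k n) x\<bar> powr Q)) \<partial>M)"
    proof (rule nn_integral_cong_AE)
      show "AE x in M. ennreal (\<bar>v x\<bar> powr Q) = liminf (\<lambda>n. ennreal (\<bar>u (k n) x\<bar> powr Q))"
        using kae
      proof eventually_elim
        case (elim x)
        then have "(\<lambda>n. ennreal (\<bar>u (k n) x\<bar> powr Q)) \<longlonglongrightarrow> ennreal (\<bar>v x\<bar> powr Q)"
          using q q1 by (intro tendsto_ennrealI tendsto_powr' tendsto_intros) auto
        then show ?case by (metis lim_imp_Liminf trivial_limit_sequentially)
      qed
    qed
    also have "\<dots> \<le> liminf (\<lambda>n. \<integral>\<^sup>+x. ennreal (\<bar>u (k n) x\<bar> powr Q) \<partial>M)"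
      by (rule nn_integral_liminf) measurable
    also have "\<dots> \<le> ennreal C" by (rule Liminf_le) (use C(2)[OF W B(2)] in auto)
    finally show ?thesis .
  qed
  define C' where "C' = 2 powr Q * (C + C)"
  have C': "C' \<ge> 0" using C(1) by (simp add: C'_def)
  have dQ: "(\<integral>\<^sup>+x. ennreal (\<bar>u (k n) x - v x\<bar> powr Q) \<partial>M) \<le> ennreal C'" for n
  proof -
    have "(\<integral>\<^sup>+x. ennreal (\<bar>u (k n) x - v x\<bar> powr Q) \<partial>M) \<le> (\<integral>\<^sup>+x. ennreal (2 powr Q) * (ennreal (\<bar>u (k n) x\<bar> powr Q) + ennreal (\<bar>v x\<bar> powr Q)) \<partial>M)"
    proof (rule nn_integral_mono)
      fix x
      have "\<bar>u (k n) x - v x\<bar> powr Q \<le> (\<bar>u (k n) x\<bar> + \<bar>v x\<bar>) powr Q" using q q1 by (intro powr_mono2) auto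
      also have "\<dots> \<le> 2 powr Q * (\<bar>u (k n) x\<bar> powr Q + \<bar>v x\<bar> powr Q)" using q q1 by (intro powr_add_le) auto
      finally show "ennreal (\<bar>u (k n) x - v x\<bar> powr Q) \<le> ennreal (2 powr Q) * (ennreal (\<bar>u (k n) x\<bar> powr Q) + ennreal (\<bar>v x\<bar> powr Q))"
        by (simp add: ennreal_plus[symmetric] ennreal_mult[symmetric] ennreal_leI del: ennreal_plus)
    qed
    also have "\<dots> = ennreal (2 powr Q) * ((\<integral>\<^sup>+x. ennreal (\<bar>u (k n) x\<bar> powr Q) \<partial>M) + (\<integral>\<^sup>+x. ennreal (\<bar>v x\<bar> powr Q) \<partial>M))"
      by (simp add: nn_integral_cmult nn_integral_add)
    also have "\<dots> \<le> ennreal (2 powr Q) * (ennreal C + ennreal C)"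
      by (intro mult_left_mono add_mono vC C(2)[OF W B(2)]) simp
    also have "\<dots> = ennreal C'" by (simp only: C'_def ennreal_mult[OF powr_ge_zero add_nonneg_nonneg[OF C(1) C(1)]] ennreal_plus[OF C(1) C(1)])
    finally show ?thesis .
  qed
  have kq: "(\<lambda>n. \<integral>\<^sup>+x. ennreal (\<bar>u (k n) x - v x\<bar> powr q) \<partial>M) \<longlonglongrightarrow> 0"
  proof (rule tendsto_zero_ennreal)
    fix e :: real assume e: "e > 0"
    \<comment> \<open>The threshold is chosen so that the contribution of the power \<open>Q\<close> is at most \<open>e / 4\<close>.\<close>
    define T where "T = (4 * (C' + 1) / e) powr (1 / (Q - q))"
    have T: "T > 0" using C' e by (simp add: T_def)
    have Te: "T powr (q - Q) * C' \<le> e / 4"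
    proof -
      have "1 / (Q - q) * (q - Q) = - 1" using q(2) by (simp add: field_simps)
      then have "T powr (q - Q) = (4 * (C' + 1) / e) powr (- 1)" by (simp only: T_def powr_powr)
      also have "\<dots> = e / (4 * (C' + 1))" using C' e by (simp add: powr_minus_divide)
      finally have "T powr (q - Q) * C' = e / (4 * (C' + 1)) * C'" by simp
      also have "\<dots> \<le> e / (4 * (C' + 1)) * (C' + 1)" using C' e by (intro mult_left_mono) auto
      also have "\<dots> = e / 4" using C' by (simp add: divide_simps)
      finally show ?thesis .
    qed
    have "\<forall>\<^sub>F n in sequentially. (\<integral>\<^sup>+x. ennreal \<bar>u (k n) x - v x\<bar> \<partial>M) < ennreal (e / (4 * T powr (q - 1)))"
      by (rule order_tendstoD(2)[OF kL1]) (use e T in simp)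
    then show "\<forall>\<^sub>F n in sequentially. (\<integral>\<^sup>+x. ennreal (\<bar>u (k n) x - v x\<bar> powr q) \<partial>M) < ennreal e"
    proof eventually_elim
      case (elim n)
      have "(\<integral>\<^sup>+x. ennreal (\<bar>u (k n) x - v x\<bar> powr q) \<partial>M) \<le>
        (\<integral>\<^sup>+x. ennreal (T powr (q - Q)) * ennreal (\<bar>u (k n) x - v x\<bar> powr Q) + ennreal (T powr (q - 1)) * ennreal \<bar>u (k n) x - v x\<bar> \<partial>M)"
      proof (rule nn_integral_mono)
        fix x
        have "\<bar>u (k n) x - v x\<bar> powr q \<le> T powr (q - Q) * \<bar>u (k n) x - v x\<bar> powr Q + T powr (q - 1) * \<bar>u (k n) x - v x\<bar>"
          using T q q1 by (intro interpolate_powr) auto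
        then have "ennreal (\<bar>u (k n) x - v x\<bar> powr q) \<le> ennreal (T powr (q - Q) * \<bar>u (k n) x - v x\<bar> powr Q + T powr (q - 1) * \<bar>u (k n) x - v x\<bar>)"
          by (rule ennreal_leI)
        then show "ennreal (\<bar>u (k n) x - v x\<bar> powr q) \<le> ennreal (T powr (q - Q)) * ennreal (\<bar>u (k n) x - v x\<bar> powr Q) + ennreal (T powr (q - 1)) * ennreal \<bar>u (k n) x - v x\<bar>"
          by (simp add: ennreal_plus ennreal_mult)
      qed
      also have "\<dots> = ennreal (T powr (q - Q)) * (\<integral>\<^sup>+x. ennreal (\<bar>u (k n) x - v x\<bar> powr Q) \<partial>M) + ennreal (T powr (q - 1)) * (\<integral>\<^sup>+x. ennreal \<bar>u (k n) x - v x\<bar> \<partial>M)"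
        by (simp add: nn_integral_cmult nn_integral_add)
      also have "\<dots> \<le> ennreal (T powr (q - Q)) * ennreal C' + ennreal (T powr (q - 1)) * ennreal (e / (4 * T powr (q - 1)))"
        using elim by (intro add_mono mult_left_mono dQ) auto
      also have "\<dots> = ennreal (T powr (q - Q) * C' + e / 4)"
        using T e C' by (simp add: ennreal_mult[symmetric] ennreal_plus)
      also have "\<dots> \<le> ennreal (e / 4 + e / 4)" using Te by (intro ennreal_leI) simp
      also have "\<dots> < ennreal e" using e by (intro ennreal_lessI) auto
      finally show ?case .
    qed
  qed
  have "(\<lambda>n. (\<integral>\<^sup>+x. ennreal \<bar>u (k n) x - v x\<bar> \<partial>M) + (\<integral>\<^sup>+x. ennreal (\<bar>u (k n) x - v x\<bar> powr q) \<partial>M)) \<longlonglongrightarrow> 0 + 0"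
    by (intro tendsto_add kL1 kq)
  then have sum0: "(\<lambda>n. (\<integral>\<^sup>+x. ennreal \<bar>u (k n) x - v x\<bar> \<partial>M) + (\<integral>\<^sup>+x. ennreal (\<bar>u (k n) x - v x\<bar> powr q) \<partial>M)) \<longlonglongrightarrow> 0"
    by simp
  have "(\<lambda>n. rho (\<lambda>x. u (k n) x - v x)) \<longlonglongrightarrow> 0"
  proof (rule tendsto_sandwich[OF _ _ tendsto_const sum0])
    show "\<forall>\<^sub>F n in sequentially. rho (\<lambda>x. u (k n) x - v x) \<le> (\<integral>\<^sup>+x. ennreal \<bar>u (k n) x - v x\<bar> \<partial>M) + (\<integral>\<^sup>+x. ennreal (\<bar>u (k n) x - v x\<bar> powr q) \<partial>M)"
    proof (rule always_eventually, rule allI)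
      fix n
      have "rho (\<lambda>x. u (k n) x - v x) \<le> (\<integral>\<^sup>+x. ennreal \<bar>u (k n) x - v x\<bar> + ennreal (\<bar>u (k n) x - v x\<bar> powr q) \<partial>M)"
        unfolding rho_def
      proof (rule nn_integral_mono)
        fix x assume "x \<in> space M"
        then have x: "1 < p x" "p x \<le> q" using p_gt_1[of x] p_le[of x] q by auto
        let ?t = "\<bar>u (k n) x - v x\<bar>"
        have "?t powr p x \<le> ?t + ?t powr q"
        proof (cases "?t \<le> 1")
          case True
          then have "?t powr p x \<le> ?t powr 1" using x by (intro powr_mono') auto
          moreover have "0 \<le> ?t powr q" by simp
          ultimately show ?thesis by (simp del: powr_ge_zero)
        next
          case False
          then have "?t powr p x \<le> ?t powr q" using x by (intro powr_mono) auto
          then show ?thesis by simp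
        qed
        then have "ennreal (?t powr p x) \<le> ennreal (?t + ?t powr q)" by (rule ennreal_leI)
        then show "ennreal (norm (u (k n) x - v x) powr p x) \<le> ennreal ?t + ennreal (?t powr q)" by simp
      qed
      also have "\<dots> = (\<integral>\<^sup>+x. ennreal \<bar>u (k n) x - v x\<bar> \<partial>M) + (\<integral>\<^sup>+x. ennreal (\<bar>u (k n) x - v x\<bar> powr q) \<partial>M)"
        by (simp add: nn_integral_add)
      finally show "rho (\<lambda>x. u (k n) x - v x) \<le> (\<integral>\<^sup>+x. ennreal \<bar>u (k n) x - v x\<bar> \<partial>M) + (\<integral>\<^sup>+x. ennreal (\<bar>u (k n) x - v x\<bar> powr q) \<partial>M)" .
    qed
  qed simp
  then show ?thesis by (rule that[OF k vm kae kq])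
qed

text \<open>The direct method.  Along a minimising sequence coercivity bounds the energies, so after passage to
  a subsequence the energies converge to some \<open>L\<close> and the functions converge to some \<open>v\<close>.  Lower semicontinuity
  gives \<open>v\<close> a gradient of energy at most \<open>L\<close>.  For the other term only an upper bound on the limit \<open>J v\<close> is
  needed.  It comes from Fatou's lemma, applied after the addition of a majorant whose integral converges.\<close>

lemma minimiser_exists:
  fixes F :: "'a \<Rightarrow> real \<Rightarrow> real"
  assumes pmN: "pm < DIM('a)" and q: "pp \<le> q" "q < DIM('a) * pm / (DIM('a) - pm)"
    and Fm: "\<And>t. (\<lambda>x. F x t) \<in> borel_measurable M" and Fc: "\<And>x. x \<in> \<Omega> \<Longrightarrow> continuous_on UNIV (F x)"
    and Fb: "\<And>x t. x \<in> \<Omega> \<Longrightarrow> \<bar>F x t\<bar> \<le> K * (1 + \<bar>t\<bar> powr q)" and K: "K \<ge> 0"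
    and below: "\<And>u g. W0 u g \<Longrightarrow> c0 \<le> (LINT x|M. norm (g x) powr p x / p x) + (LINT x|M. F x (u x))"
    and coercive: "\<And>u g. W0 u g \<Longrightarrow> (LINT x|M. norm (g x) powr p x / p x) \<le>
        A * ((LINT x|M. norm (g x) powr p x / p x) + (LINT x|M. F x (u x))) + A'" and A: "A \<ge> 0"
  obtains u g where "W0 u g" "\<And>v h. W0 v h \<Longrightarrow> (LINT x|M. norm (g x) powr p x / p x) + (LINT x|M. F x (u x)) \<le>
      (LINT x|M. norm (h x) powr p x / p x) + (LINT x|M. F x (v x))"
proof -
  define E where "E g = (LINT x|M. norm (g x) powr p x / p x)" for g :: "'a \<Rightarrow> 'a"
  define J where "J u = (LINT x|M. F x (u x))" for u
  define R where "R = (\<lambda>(u, g). E g + J u)"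
  define X where "X = {(u, g). W0 u g}"
  have pq: "pm \<le> q" and q1: "q > 1" using q pm pm_le_pp by auto
  have Xne: "X \<noteq> {}" using W0_test[OF test_functions_zero(1)] by (auto simp: X_def)
  have bdd: "bdd_below (R ` X)"
    by (rule bdd_belowI[of _ c0]) (use below in \<open>auto simp: X_def R_def E_def J_def\<close>)
  define i where "i = Inf (R ` X)"
  have i_le: "i \<le> E g + J u" if "W0 u g" for u g
    unfolding i_def using that by (intro cInf_lower bdd) (auto simp: X_def R_def image_iff intro!: bexI[of _ "(u, g)"])
  have "\<exists>u g. W0 u g \<and> E g + J u < i + 1 / real (Suc n)" for n
  proof -
    have "Inf (R ` X) < i + 1 / real (Suc n)" by (simp add: i_def)
    then obtain z where "z \<in> X" "R z < i + 1 / real (Suc n)" using cInf_lessD[of "R ` X"] Xne by blast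
    then show ?thesis by (cases z) (auto simp: X_def R_def)
  qed
  then obtain u g where W: "\<And>n. W0 (u n) (g n)" and Ri: "\<And>n. E (g n) + J (u n) < i + 1 / real (Suc n)" by metis
  have Rlim: "(\<lambda>n. E (g n) + J (u n)) \<longlonglongrightarrow> i"
  proof (rule tendsto_sandwich[OF _ _ tendsto_const])
    show "(\<lambda>n. i + 1 / real (Suc n)) \<longlonglongrightarrow> i"
      using tendsto_add[OF tendsto_const LIMSEQ_Suc[OF lim_1_over_n], of i] by simp
    show "\<forall>\<^sub>F n in sequentially. i \<le> E (g n) + J (u n)" using i_le[OF W] by simp
    show "\<forall>\<^sub>F n in sequentially. E (g n) + J (u n) \<le> i + 1 / real (Suc n)"
      by (rule always_eventually) (use Ri less_imp_le in blast)
  qed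
  define B where "B = A * (i + 1) + A'"
  have E0: "0 \<le> E (g n)" for n unfolding E_def by (rule W0_energy_integrable(3)[OF W])
  have EB: "E (g n) \<le> B" for n
  proof -
    have "E (g n) \<le> A * (E (g n) + J (u n)) + A'" unfolding E_def J_def by (rule coercive[OF W])
    also have "\<dots> \<le> A * (i + 1) + A'"
    proof (intro add_right_mono mult_left_mono A)
      have "1 / real (Suc n) \<le> 1" by simp
      then show "E (g n) + J (u n) \<le> i + 1" using Ri[of n] by linarith
    qed
    finally show ?thesis by (simp add: B_def)
  qed
  have B0: "B \<ge> 0" using E0[of 0] EB[of 0] by simp
  have "bounded (range (\<lambda>n. E (g n)))" using E0 EB by (intro boundedI[of _ B]) auto
  then obtain L r1 where r1: "strict_mono (r1 :: nat \<Rightarrow> nat)" "((\<lambda>n. E (g n)) \<circ> r1) \<longlonglongrightarrow> L"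
    using bounded_imp_convergent_subsequence by blast
  have energy: "energy (g n) = ennreal (E (g n))" for n unfolding E_def by (rule W0_energy_integrable(2)[OF W])
  have rhoB: "rho (g n) \<le> ennreal (pp * B)" for n
  proof -
    have "rho (g n) \<le> ennreal pp * energy (g n)" using W0_measurable[OF W] by (intro rho_le_energy) auto
    also have "\<dots> \<le> ennreal pp * ennreal B" unfolding energy using EB by (intro mult_left_mono ennreal_leI) auto
    finally show ?thesis using pp_pos B0 by (simp add: ennreal_mult)
  qed
  obtain Q where Q: "q < Q" "Q < DIM('a) * pm / (DIM('a) - pm)" using dense[OF q(2)] by blast
  have "pp * B \<ge> 0" using pp_pos B0 by simp
  obtain r2 v where r2: "strict_mono (r2 :: nat \<Rightarrow> nat)" "v \<in> borel_measurable M" "AE x in M. (\<lambda>n. u (r1 (r2 n)) x) \<longlonglongrightarrow> v x"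
    "(\<lambda>n. \<integral>\<^sup>+x. ennreal (\<bar>u (r1 (r2 n)) x - v x\<bar> powr q) \<partial>M) \<longlonglongrightarrow> 0" "(\<lambda>n. rho (\<lambda>x. u (r1 (r2 n)) x - v x)) \<longlonglongrightarrow> 0"
    by (rule W0_compact[OF pmN q(1) Q, of "\<lambda>n. u (r1 n)" "\<lambda>n. g (r1 n)", OF W \<open>pp * B \<ge> 0\<close> rhoB])
  define k where "k n = r1 (r2 n)" for n
  have k: "strict_mono k" using strict_mono_o[OF r1(1) r2(1)] by (simp add: k_def[abs_def] o_def)
  note kv = r2(2-5)[folded k_def]
  have Elim: "(\<lambda>n. E (g (k n))) \<longlonglongrightarrow> L" using LIMSEQ_subseq_LIMSEQ[OF r1(2) r2(1)] by (simp add: o_def k_def)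
  have L0: "L \<ge> 0" by (rule LIMSEQ_le_const[OF Elim]) (use E0 in auto)
  have en: "\<forall>\<^sub>F n in sequentially. energy (g (k n)) \<le> ennreal (L + e)" if "e > 0" for e
  proof -
    have "\<forall>\<^sub>F n in sequentially. E (g (k n)) < L + e" by (rule order_tendstoD(2)[OF Elim]) (use that in simp)
    then show ?thesis by eventually_elim (simp add: energy ennreal_leI)
  qed
  obtain h where h: "W0 v h" "energy h \<le> ennreal L"
    by (rule W0_lower_semicontinuous[OF W kv(1) kv(4) L0 en])
  have Eh: "E h \<le> L" using h(2) L0 W0_energy_integrable(2)[OF h(1)] by (simp add: E_def)
  have Jlim: "(\<lambda>n. J (u (k n))) \<longlonglongrightarrow> i - L"
    using tendsto_diff[OF LIMSEQ_subseq_LIMSEQ[OF Rlim k] Elim] by (simp add: o_def)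
  have Jv: "J v \<le> i - L"
  proof -
    \<comment> \<open>By \<open>|u| \<le> |v| + |u - v|\<close> and \<open>powr_add_le\<close>, the growth bound at \<open>u\<close> is at most the sum of
      \<open>K2 * (1 + |v| powr q)\<close> and \<open>K2 * |u - v| powr q\<close>, and the integral of the latter tends to zero.\<close>
    define K2 where "K2 = K * 2 powr q"
    have K2: "K \<le> K2" "0 \<le> K2" using K q1 ge_one_powr_ge_zero[of 2 q] mult_left_mono[of 1 "2 powr q" K] by (simp_all add: K2_def)
    note [measurable] = W0_measurable[OF W] kv(1)
    have Fum[measurable]: "(\<lambda>x. F x (w x)) \<in> borel_measurable M" if "w \<in> borel_measurable M" for w
      by (rule borel_measurable_caratheodory[OF Fm _ that]) (use Fc in simp)
    have qi: "integrable M (\<lambda>x. \<bar>w x\<bar> powr q)" if "W0 w h" for w h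
      by (rule W0_powr_integrable[OF pmN pq q(2) that]) (use q1 in auto)
    have Fi: "integrable M (\<lambda>x. F x (w x))" if "W0 w h" for w h
    proof (rule Bochner_Integration.integrable_bound[where f = "\<lambda>x. K * (1 + \<bar>w x\<bar> powr q)"])
      show "integrable M (\<lambda>x. K * (1 + \<bar>w x\<bar> powr q))" using qi[OF that] by simp
      show "AE x in M. norm (F x (w x)) \<le> norm (K * (1 + \<bar>w x\<bar> powr q))"
        by (rule AE_I2) (use Fb K in \<open>auto simp: abs_mult\<close>)
    qed (use W0_measurable(1)[OF that] in measurable)
    define a where "a n = (LINT x|M. \<bar>u (k n) x - v x\<bar> powr q)" for n
    have di: "integrable M (\<lambda>x. \<bar>u (k n) x - v x\<bar> powr q)" for n
    proof (rule Bochner_Integration.integrable_bound[where f = "\<lambda>x. 2 powr q * (\<bar>u (k n) x\<bar> powr q + \<bar>v x\<bar> powr q)"])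
      show "integrable M (\<lambda>x. 2 powr q * (\<bar>u (k n) x\<bar> powr q + \<bar>v x\<bar> powr q))" using qi[OF W] qi[OF h(1)] by simp
      have "\<bar>u (k n) x - v x\<bar> powr q \<le> 2 powr q * (\<bar>u (k n) x\<bar> powr q + \<bar>v x\<bar> powr q)" for x
      proof -
        have "\<bar>u (k n) x - v x\<bar> powr q \<le> (\<bar>u (k n) x\<bar> + \<bar>v x\<bar>) powr q" using q1 by (intro powr_mono2) auto
        also have "\<dots> \<le> 2 powr q * (\<bar>u (k n) x\<bar> powr q + \<bar>v x\<bar> powr q)" using q1 by (intro powr_add_le) auto
        finally show ?thesis .
      qed
      then show "AE x in M. norm (\<bar>u (k n) x - v x\<bar> powr q) \<le> norm (2 powr q * (\<bar>u (k n) x\<bar> powr q + \<bar>v x\<bar> powr q))"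
        by (simp add: abs_mult)
    qed measurable
    have a_nn: "ennreal (a n) = (\<integral>\<^sup>+x. ennreal (\<bar>u (k n) x - v x\<bar> powr q) \<partial>M)" for n
      unfolding a_def by (rule nn_integral_eq_integral[symmetric, OF di]) simp
    have a0: "0 \<le> a n" for n unfolding a_def by (rule integral_nonneg_AE) simp
    have alim: "a \<longlonglongrightarrow> 0"
    proof -
      have "(\<lambda>n. ennreal (a n)) \<longlonglongrightarrow> ennreal 0" using kv(3) by (simp add: a_nn)
      then show ?thesis using a0 by (subst (asm) tendsto_ennreal_iff) auto
    qed
    define S where "S = (LINT x|M. K2 * (1 + \<bar>v x\<bar> powr q))"
    have Si: "integrable M (\<lambda>x. K2 * (1 + \<bar>v x\<bar> powr q))" using qi[OF h(1)] by simp
    have G0: "0 \<le> F x (u (k n) x) + (K2 * (1 + \<bar>v x\<bar> powr q) + K2 * \<bar>u (k n) x - v x\<bar> powr q)" if x: "x \<in> \<Omega>" for n x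
    proof -
      have "\<bar>u (k n) x\<bar> powr q \<le> (\<bar>v x\<bar> + \<bar>u (k n) x - v x\<bar>) powr q" using q1 by (intro powr_mono2) auto
      also have "\<dots> \<le> 2 powr q * (\<bar>v x\<bar> powr q + \<bar>u (k n) x - v x\<bar> powr q)" using q1 by (intro powr_add_le) auto
      finally have "K * (1 + \<bar>u (k n) x\<bar> powr q) \<le> K * (1 + 2 powr q * (\<bar>v x\<bar> powr q + \<bar>u (k n) x - v x\<bar> powr q))"
        using K by (intro mult_left_mono) auto
      also have "\<dots> = K + K2 * (\<bar>v x\<bar> powr q + \<bar>u (k n) x - v x\<bar> powr q)" by (simp add: K2_def algebra_simps)
      also have "\<dots> \<le> K2 + K2 * (\<bar>v x\<bar> powr q + \<bar>u (k n) x - v x\<bar> powr q)" using K2(1) by simp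
      finally have "\<bar>F x (u (k n) x)\<bar> \<le> K2 + K2 * (\<bar>v x\<bar> powr q + \<bar>u (k n) x - v x\<bar> powr q)" using Fb[OF x, of "u (k n) x"] by simp
      then show ?thesis by (simp add: distrib_left)
    qed
    have G0': "0 \<le> F x (v x) + K2 * (1 + \<bar>v x\<bar> powr q)" if x: "x \<in> \<Omega>" for x
    proof -
      have "\<bar>F x (v x)\<bar> \<le> K * (1 + \<bar>v x\<bar> powr q)" by (rule Fb[OF x])
      also have "\<dots> \<le> K2 * (1 + \<bar>v x\<bar> powr q)" by (rule mult_right_mono[OF K2(1)]) simp
      finally have "\<bar>F x (v x)\<bar> \<le> K2 * (1 + \<bar>v x\<bar> powr q)" .
      then show ?thesis by simp
    qed
    have lhs: "(\<integral>\<^sup>+x. ennreal (F x (v x) + K2 * (1 + \<bar>v x\<bar> powr q)) \<partial>M) = ennreal (J v + S)"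
    proof -
      have "(\<integral>\<^sup>+x. ennreal (F x (v x) + K2 * (1 + \<bar>v x\<bar> powr q)) \<partial>M) = ennreal (LINT x|M. F x (v x) + K2 * (1 + \<bar>v x\<bar> powr q))"
        by (rule nn_integral_eq_integral) (use Fi[OF h(1)] Si G0' in \<open>auto intro!: AE_I2 simp del: distrib_left_numeral\<close>)
      also have "(LINT x|M. F x (v x) + K2 * (1 + \<bar>v x\<bar> powr q)) = J v + S"
        unfolding J_def S_def by (rule Bochner_Integration.integral_add[OF Fi[OF h(1)] Si])
      finally show ?thesis .
    qed
    have rhs: "(\<integral>\<^sup>+x. ennreal (F x (u (k n) x) + (K2 * (1 + \<bar>v x\<bar> powr q) + K2 * \<bar>u (k n) x - v x\<bar> powr q)) \<partial>M) = ennreal (J (u (k n)) + (S + K2 * a n))" for n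
    proof -
      have di': "integrable M (\<lambda>x. K2 * \<bar>u (k n) x - v x\<bar> powr q)" using di[of n] by simp
      note i2 = Bochner_Integration.integrable_add[OF Si di']
      have "(\<integral>\<^sup>+x. ennreal (F x (u (k n) x) + (K2 * (1 + \<bar>v x\<bar> powr q) + K2 * \<bar>u (k n) x - v x\<bar> powr q)) \<partial>M) =
          ennreal (LINT x|M. F x (u (k n) x) + (K2 * (1 + \<bar>v x\<bar> powr q) + K2 * \<bar>u (k n) x - v x\<bar> powr q))"
        by (rule nn_integral_eq_integral[OF Bochner_Integration.integrable_add[OF Fi[OF W] i2]]) (use G0 in \<open>auto intro!: AE_I2\<close>)
      also have "(LINT x|M. F x (u (k n) x) + (K2 * (1 + \<bar>v x\<bar> powr q) + K2 * \<bar>u (k n) x - v x\<bar> powr q)) =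
          J (u (k n)) + (LINT x|M. K2 * (1 + \<bar>v x\<bar> powr q) + K2 * \<bar>u (k n) x - v x\<bar> powr q)"
        unfolding J_def by (rule Bochner_Integration.integral_add[OF Fi[OF W] i2])
      also have "(LINT x|M. K2 * (1 + \<bar>v x\<bar> powr q) + K2 * \<bar>u (k n) x - v x\<bar> powr q) = S + K2 * a n"
        unfolding S_def a_def using Bochner_Integration.integral_add[OF Si di'] by simp
      finally show ?thesis .
    qed
    have "ennreal (J v + S) = (\<integral>\<^sup>+x. liminf (\<lambda>n. ennreal (F x (u (k n) x) + (K2 * (1 + \<bar>v x\<bar> powr q) + K2 * \<bar>u (k n) x - v x\<bar> powr q))) \<partial>M)"
      unfolding lhs[symmetric]
    proof (rule nn_integral_cong_AE)
      show "AE x in M. ennreal (F x (v x) + K2 * (1 + \<bar>v x\<bar> powr q)) =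
          liminf (\<lambda>n. ennreal (F x (u (k n) x) + (K2 * (1 + \<bar>v x\<bar> powr q) + K2 * \<bar>u (k n) x - v x\<bar> powr q)))"
        using kv(2) AE_space[of M]
      proof eventually_elim
        case (elim x)
        have "isCont (F x) (v x)" using Fc[of x] elim(2) by (simp add: continuous_on_eq_continuous_at)
        then have "(\<lambda>n. F x (u (k n) x)) \<longlonglongrightarrow> F x (v x)" using elim(1) by (rule isCont_tendsto_compose)
        moreover have "(\<lambda>n. \<bar>u (k n) x - v x\<bar> powr q) \<longlonglongrightarrow> \<bar>v x - v x\<bar> powr q"
          using elim(1) q1 by (intro tendsto_powr' tendsto_intros) auto
        ultimately have "(\<lambda>n. F x (u (k n) x) + (K2 * (1 + \<bar>v x\<bar> powr q) + K2 * \<bar>u (k n) x - v x\<bar> powr q)) \<longlonglongrightarrow>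
            F x (v x) + (K2 * (1 + \<bar>v x\<bar> powr q) + K2 * \<bar>v x - v x\<bar> powr q)"
          by (intro tendsto_add tendsto_mult tendsto_const)
        then have "(\<lambda>n. ennreal (F x (u (k n) x) + (K2 * (1 + \<bar>v x\<bar> powr q) + K2 * \<bar>u (k n) x - v x\<bar> powr q))) \<longlonglongrightarrow>
            ennreal (F x (v x) + (K2 * (1 + \<bar>v x\<bar> powr q) + K2 * \<bar>v x - v x\<bar> powr q))" by (rule tendsto_ennrealI)
        then have "liminf (\<lambda>n. ennreal (F x (u (k n) x) + (K2 * (1 + \<bar>v x\<bar> powr q) + K2 * \<bar>u (k n) x - v x\<bar> powr q))) =
            ennreal (F x (v x) + (K2 * (1 + \<bar>v x\<bar> powr q) + K2 * \<bar>v x - v x\<bar> powr q))"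
          by (rule lim_imp_Liminf[OF sequentially_bot])
        then show ?case by simp
      qed
    qed
    also have "\<dots> \<le> liminf (\<lambda>n. \<integral>\<^sup>+x. ennreal (F x (u (k n) x) + (K2 * (1 + \<bar>v x\<bar> powr q) + K2 * \<bar>u (k n) x - v x\<bar> powr q)) \<partial>M)"
      by (rule nn_integral_liminf) measurable
    also have "\<dots> = ennreal (i - L + (S + K2 * 0))"
      unfolding rhs by (intro lim_imp_Liminf[OF sequentially_bot] tendsto_ennrealI tendsto_intros Jlim alim)
    finally have fin: "ennreal (J v + S) \<le> ennreal (i - L + S)" by simp
    have "0 \<le> J (u (k n)) + (S + K2 * a n)" for n
    proof -
      have di': "integrable M (\<lambda>x. K2 * \<bar>u (k n) x - v x\<bar> powr q)" using di[of n] by simp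
      note i2 = Bochner_Integration.integrable_add[OF Si di']
      have "0 \<le> (LINT x|M. F x (u (k n) x) + (K2 * (1 + \<bar>v x\<bar> powr q) + K2 * \<bar>u (k n) x - v x\<bar> powr q))"
        by (rule integral_nonneg_AE) (use G0 in \<open>auto intro!: AE_I2\<close>)
      also have "\<dots> = J (u (k n)) + (LINT x|M. K2 * (1 + \<bar>v x\<bar> powr q) + K2 * \<bar>u (k n) x - v x\<bar> powr q)"
        unfolding J_def by (rule Bochner_Integration.integral_add[OF Fi[OF W] i2])
      also have "(LINT x|M. K2 * (1 + \<bar>v x\<bar> powr q) + K2 * \<bar>u (k n) x - v x\<bar> powr q) = S + K2 * a n"
        unfolding S_def a_def using Bochner_Integration.integral_add[OF Si di'] by simp
      finally show ?thesis .
    qed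
    moreover have "(\<lambda>n. J (u (k n)) + (S + K2 * a n)) \<longlonglongrightarrow> i - L + (S + K2 * 0)"
      by (intro tendsto_intros Jlim alim)
    ultimately have "0 \<le> i - L + (S + K2 * 0)" by (intro LIMSEQ_le_const[where a = 0]) auto
    then show ?thesis using fin by (simp add: ennreal_le_iff)
  qed
  show ?thesis
  proof (rule that[OF h(1)])
    fix w h' assume "W0 w h'"
    then have "i \<le> E h' + J w" by (rule i_le)
    then show "(LINT x|M. norm (h x) powr p x / p x) + (LINT x|M. F x (v x)) \<le> (LINT x|M. norm (h' x) powr p x / p x) + (LINT x|M. F x (w x))"
      using Eh Jv unfolding E_def J_def by linarith
  qed
qed

end

section \<open>Linear functionals bounded by a weighted integral\<close>

lemma (in var_exp) integrable_weight_bounded: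
  fixes d h :: "'a \<Rightarrow> real"
  assumes d: "integrable M d" and h: "h \<in> borel_measurable M" and B: "\<And>x. x \<in> \<Omega> \<Longrightarrow> \<bar>h x\<bar> \<le> B"
  shows "integrable M (\<lambda>x. d x * h x)"
proof (rule Bochner_Integration.integrable_bound[where f = "\<lambda>x. d x * B"])
  show "integrable M (\<lambda>x. d x * B)" using d by simp
  show "(\<lambda>x. d x * h x) \<in> borel_measurable M" by (intro borel_measurable_times h borel_measurable_integrable[OF d])
  show "AE x in M. norm (d x * h x) \<le> norm (d x * B)"
    using B by (intro AE_I2) (auto simp: abs_mult intro!: mult_left_mono order_trans[OF B abs_ge_self])
qed

text \<open>The dual of a weighted \<open>L1\<close> space, obtained by minimising the quadratic functional
  \<open>I \<phi> = q \<phi> \<phi> / 2 - l \<phi>\<close> over test functions, where \<open>q\<close> is the inner product with weight \<open>d\<close>.  It is bounded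
  below since \<open>2 |\<phi>| \<le> 1 + \<phi>^2\<close>.  A minimising sequence \<open>f\<close> is Cauchy for \<open>q\<close> by the parallelogram law, whence
  \<open>d f\<close> is Cauchy in \<open>L1\<close>.  Its limit \<open>V\<close> represents \<open>l\<close> because the first variation vanishes in the
  limit, and \<open>|V| \<le> d\<close> follows from the bound on \<open>l\<close> by the fundamental lemma.\<close>

lemma (in var_exp) representation_weighted_L1:
  fixes d :: "'a \<Rightarrow> real" and l :: "('a \<Rightarrow> real) \<Rightarrow> real"
  assumes d: "integrable M d" "\<And>x. x \<in> \<Omega> \<Longrightarrow> 0 \<le> d x"
    and lin: "\<And>a b \<phi> \<psi>. \<phi> \<in> test_functions \<Omega> \<Longrightarrow> \<psi> \<in> test_functions \<Omega> \<Longrightarrow>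
        l (\<lambda>x. a * \<phi> x + b * \<psi> x) = a * l \<phi> + b * l \<psi>"
    and bound: "\<And>\<phi>. \<phi> \<in> test_functions \<Omega> \<Longrightarrow> l \<phi> \<le> (LINT x|M. d x * \<bar>\<phi> x\<bar>)"
  obtains V where "integrable M V" "AE x in M. \<bar>V x\<bar> \<le> d x"
    "\<And>\<phi>. \<phi> \<in> test_functions \<Omega> \<Longrightarrow> l \<phi> = (LINT x|M. V x * \<phi> x)"
proof -
  let ?T = "test_functions \<Omega>"
  note [measurable] = borel_measurable_integrable[OF d(1)]
  have int1: "integrable M (\<lambda>x. d x * \<phi> x)" if "\<phi> \<in> ?T" for \<phi>
    using test_function_bounded[OF that] integrable_weight_bounded[OF d(1) test_measurable(1)[OF that]] by metis
  have int1a: "integrable M (\<lambda>x. d x * \<bar>\<phi> x\<bar>)" if T: "\<phi> \<in> ?T" for \<phi>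
  proof -
    obtain B where B: "\<And>x. \<bar>\<phi> x\<bar> \<le> B" using test_function_bounded[OF T] by metis
    show ?thesis by (rule integrable_weight_bounded[OF d(1), where B = B]) (use B test_measurable(1)[OF T] in auto)
  qed
  have int2: "integrable M (\<lambda>x. d x * (\<phi> x * \<psi> x))" if "\<phi> \<in> ?T" "\<psi> \<in> ?T" for \<phi> \<psi>
    using int1[OF test_functions_mult(1)[OF that]] .
  define q where "q \<phi> \<psi> = (LINT x|M. d x * (\<phi> x * \<psi> x))" for \<phi> \<psi>
  have q_nonneg: "0 \<le> q \<phi> \<phi>" for \<phi> unfolding q_def
    by (rule integral_nonneg_AE) (use d(2) in \<open>auto intro!: AE_I2\<close>)
  have q_comb: "q (\<lambda>x. a * \<phi> x + b * \<psi> x) (\<lambda>x. a * \<phi> x + b * \<psi> x) = a\<^sup>2 * q \<phi> \<phi> + 2 * a * b * q \<phi> \<psi> + b\<^sup>2 * q \<psi> \<psi>"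
    if T: "\<phi> \<in> ?T" "\<psi> \<in> ?T" for a b \<phi> \<psi>
  proof -
    have "q (\<lambda>x. a * \<phi> x + b * \<psi> x) (\<lambda>x. a * \<phi> x + b * \<psi> x) =
        (LINT x|M. a\<^sup>2 * (d x * (\<phi> x * \<phi> x)) + (2 * a * b * (d x * (\<phi> x * \<psi> x)) + b\<^sup>2 * (d x * (\<psi> x * \<psi> x))))"
      unfolding q_def by (intro Bochner_Integration.integral_cong) (auto simp: power2_eq_square algebra_simps)
    also have "\<dots> = a\<^sup>2 * q \<phi> \<phi> + (2 * a * b * q \<phi> \<psi> + b\<^sup>2 * q \<psi> \<psi>)"
      unfolding q_def using int2[OF T(1) T(1)] int2[OF T(1) T(2)] int2[OF T(2) T(2)] by simp
    finally show ?thesis by simp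
  qed
  define I where "I \<phi> = q \<phi> \<phi> / 2 - l \<phi>" for \<phi>
  define D where "D = (LINT x|M. d x)"
  have D0: "D \<ge> 0" unfolding D_def by (rule integral_nonneg_AE) (use d(2) in \<open>auto intro!: AE_I2\<close>)
  have below: "- D / 2 \<le> I \<phi>" if T: "\<phi> \<in> ?T" for \<phi>
  proof -
    have "(LINT x|M. d x * \<bar>\<phi> x\<bar>) \<le> (LINT x|M. d x / 2 + d x * (\<phi> x * \<phi> x) / 2)"
    proof (rule integral_mono[OF int1a[OF T]])
      show "integrable M (\<lambda>x. d x / 2 + d x * (\<phi> x * \<phi> x) / 2)" using d(1) int2[OF T T] by simp
      fix x assume "x \<in> space M"
      then have "0 \<le> d x * (\<bar>\<phi> x\<bar> - 1)\<^sup>2" using d(2) by simp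
      then show "d x * \<bar>\<phi> x\<bar> \<le> d x / 2 + d x * (\<phi> x * \<phi> x) / 2"
        by (simp add: power2_eq_square algebra_simps)
    qed
    also have "\<dots> = D / 2 + q \<phi> \<phi> / 2" unfolding D_def q_def using d(1) int2[OF T T] by simp
    finally show ?thesis using bound[OF T] by (simp add: I_def)
  qed
  define i where "i = Inf (I ` ?T)"
  have bdd: "bdd_below (I ` ?T)" using below by (intro bdd_belowI[of _ "- D / 2"]) auto
  have ne: "I ` ?T \<noteq> {}" using test_functions_zero(1) by blast
  have i_le: "i \<le> I \<phi>" if "\<phi> \<in> ?T" for \<phi> unfolding i_def using that by (intro cInf_lower bdd) auto
  have "\<exists>\<phi>\<in>?T. I \<phi> < i + 1 / real (Suc n)" for n
  proof -
    have "Inf (I ` ?T) < i + 1 / real (Suc n)" by (simp add: i_def)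
    from cInf_lessD[OF ne this] show ?thesis by auto
  qed
  then obtain f where f: "\<And>n. f n \<in> ?T" "\<And>n. I (f n) < i + 1 / real (Suc n)" by metis
  note [measurable] = test_measurable[OF f(1)]
  have par: "q (\<lambda>x. 1 * f n x + (-1) * f m x) (\<lambda>x. 1 * f n x + (-1) * f m x) \<le> 4 * (1 / real (Suc n) + 1 / real (Suc m))" for n m
  proof -
    let ?h = "\<lambda>x. (1 / 2) * f n x + (1 / 2) * f m x"
    have "i \<le> I ?h" by (rule i_le[OF test_functions_lincomb(1)[OF f(1) f(1)]])
    also have "I ?h = (q (f n) (f n) + 2 * q (f n) (f m) + q (f m) (f m)) / 8 - (l (f n) + l (f m)) / 2"
      unfolding I_def q_comb[OF f(1) f(1)] lin[OF f(1) f(1)] by (simp add: power2_eq_square field_simps)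
    finally have 1: "i \<le> (q (f n) (f n) + 2 * q (f n) (f m) + q (f m) (f m)) / 8 - (l (f n) + l (f m)) / 2" .
    have 2: "q (f n) (f n) / 2 - l (f n) < i + 1 / real (Suc n)" "q (f m) (f m) / 2 - l (f m) < i + 1 / real (Suc m)"
      using f(2)[of n] f(2)[of m] by (simp_all add: I_def)
    have "q (\<lambda>x. 1 * f n x + (-1) * f m x) (\<lambda>x. 1 * f n x + (-1) * f m x) = q (f n) (f n) - 2 * q (f n) (f m) + q (f m) (f m)"
      unfolding q_comb[OF f(1) f(1)] by simp
    then show ?thesis using 1 2 by argo
  qed
  have si: "integrable M (\<lambda>x. d x * f n x)" for n by (rule int1[OF f(1)])
  have cau: "\<exists>N. \<forall>n\<ge>N. \<forall>m\<ge>N. (\<integral>\<^sup>+x. ennreal (norm (d x * f n x - d x * f m x)) \<partial>M) \<le> ennreal e" if e: "e > 0" for e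
  proof -
    \<comment> \<open>By \<open>|h| \<le> c / 2 + h^2 / (2 c)\<close>, with \<open>c\<close> so small that the first summand contributes at most \<open>e / 2\<close>.\<close>
    define c where "c = e / (D + 1)"
    have c: "c > 0" using e D0 by (simp add: c_def)
    have cD: "c * D \<le> e" using e D0 by (simp add: c_def field_simps)
    obtain N where N: "1 / real (Suc N) < c * e / 8" using nat_approx_posE[of "c * e / 8"] c e by auto
    have "(\<integral>\<^sup>+x. ennreal (norm (d x * f n x - d x * f m x)) \<partial>M) \<le> ennreal e" if nm: "n \<ge> N" "m \<ge> N" for n m
    proof -
      define h where "h = (\<lambda>x. 1 * f n x + (-1) * f m x)"
      have h: "h \<in> ?T" unfolding h_def by (rule test_functions_lincomb(1)[OF f(1) f(1)])
      have "1 / real (Suc n) \<le> 1 / real (Suc N)" "1 / real (Suc m) \<le> 1 / real (Suc N)" using nm by (simp_all add: frac_le)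
      then have qh: "q h h \<le> c * e" using par[of n m] N unfolding h_def by argo
      have "(LINT x|M. d x * \<bar>h x\<bar>) \<le> (LINT x|M. c * d x / 2 + d x * (h x * h x) / (2 * c))"
      proof (rule integral_mono[OF int1a[OF h]])
        show "integrable M (\<lambda>x. c * d x / 2 + d x * (h x * h x) / (2 * c))" using d(1) int2[OF h h] by simp
        fix x assume "x \<in> space M"
        then have "0 \<le> d x * (\<bar>h x\<bar> - c)\<^sup>2 / (2 * c)" using d(2) c by simp
        then show "d x * \<bar>h x\<bar> \<le> c * d x / 2 + d x * (h x * h x) / (2 * c)"
          using c by (simp add: power2_eq_square field_simps)
      qed
      also have "\<dots> = c * D / 2 + q h h / (2 * c)" unfolding D_def q_def using d(1) int2[OF h h] by simp
      also have "\<dots> \<le> e / 2 + e / 2"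
      proof (rule add_mono)
        show "c * D / 2 \<le> e / 2" using cD by simp
        show "q h h / (2 * c) \<le> e / 2" using qh c by (simp add: field_simps)
      qed
      finally have "(LINT x|M. d x * \<bar>h x\<bar>) \<le> e" by simp
      moreover have "(\<integral>\<^sup>+x. ennreal (norm (d x * f n x - d x * f m x)) \<partial>M) = (\<integral>\<^sup>+x. ennreal (d x * \<bar>h x\<bar>) \<partial>M)"
      proof (rule nn_integral_cong)
        fix x assume "x \<in> space M"
        then have "norm (d x * f n x - d x * f m x) = d x * \<bar>h x\<bar>"
          using d(2)[of x] by (simp add: h_def abs_mult right_diff_distrib[symmetric])
        then show "ennreal (norm (d x * f n x - d x * f m x)) = ennreal (d x * \<bar>h x\<bar>)" by simp
      qed
      moreover have "(\<integral>\<^sup>+x. ennreal (d x * \<bar>h x\<bar>) \<partial>M) = ennreal (LINT x|M. d x * \<bar>h x\<bar>)"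
        by (rule nn_integral_eq_integral[OF int1a[OF h]]) (use d(2) in \<open>auto intro!: AE_I2\<close>)
      ultimately show ?thesis by (simp add: ennreal_leI)
    qed
    then show ?thesis by blast
  qed
  obtain r V where V: "integrable M V" "(\<lambda>n. \<integral>\<^sup>+x. ennreal (norm (d x * f n x - V x)) \<partial>M) \<longlonglongrightarrow> 0"
    by (rule L1_complete[OF si cau])
  have iV: "integrable M (\<lambda>x. V x * \<phi> x)" if "\<phi> \<in> ?T" for \<phi>
    using test_function_bounded[OF that] integrable_weight_bounded[OF V(1) test_measurable(1)[OF that]] by metis
  have Vlim: "(\<lambda>n. LINT x|M. d x * (f n x * \<psi> x)) \<longlonglongrightarrow> (LINT x|M. V x * \<psi> x)" if \<psi>: "\<psi> \<in> ?T" for \<psi>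
  proof (rule tendsto_L1_int[OF int2[OF f(1) \<psi>] iV[OF \<psi>]])
    obtain B where B: "B > 0" "\<And>x. \<bar>\<psi> x\<bar> \<le> B" using test_function_bounded[OF \<psi>] by metis
    note [measurable] = borel_measurable_integrable[OF V(1)] test_measurable[OF \<psi>]
    have "(\<lambda>n. ennreal B * (\<integral>\<^sup>+x. ennreal (norm (d x * f n x - V x)) \<partial>M)) \<longlonglongrightarrow> ennreal B * 0"
      by (rule ennreal_tendsto_cmult[OF _ V(2)]) simp
    then have lim: "(\<lambda>n. ennreal B * (\<integral>\<^sup>+x. ennreal (norm (d x * f n x - V x)) \<partial>M)) \<longlonglongrightarrow> 0" by simp
    show "(\<lambda>n. \<integral>\<^sup>+x. ennreal (norm (d x * (f n x * \<psi> x) - V x * \<psi> x)) \<partial>M) \<longlonglongrightarrow> 0"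
    proof (rule tendsto_sandwich[OF _ _ tendsto_const lim])
      show "\<forall>\<^sub>F n in sequentially. (\<integral>\<^sup>+x. ennreal (norm (d x * (f n x * \<psi> x) - V x * \<psi> x)) \<partial>M) \<le>
          ennreal B * (\<integral>\<^sup>+x. ennreal (norm (d x * f n x - V x)) \<partial>M)"
      proof (rule always_eventually, rule allI)
        fix n
        have "(\<integral>\<^sup>+x. ennreal (norm (d x * (f n x * \<psi> x) - V x * \<psi> x)) \<partial>M) \<le> (\<integral>\<^sup>+x. ennreal B * ennreal (norm (d x * f n x - V x)) \<partial>M)"
        proof (rule nn_integral_mono)
          fix x
          have "norm (d x * (f n x * \<psi> x) - V x * \<psi> x) = \<bar>d x * f n x - V x\<bar> * \<bar>\<psi> x\<bar>"
            by (simp add: abs_mult[symmetric] algebra_simps)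
          also have "\<dots> \<le> B * norm (d x * f n x - V x)" using B(2)[of x] by (simp add: mult.commute mult_right_mono)
          finally show "ennreal (norm (d x * (f n x * \<psi> x) - V x * \<psi> x)) \<le> ennreal B * ennreal (norm (d x * f n x - V x))"
            using B(1) by (simp add: ennreal_mult[symmetric] ennreal_leI)
        qed
        also have "\<dots> = ennreal B * (\<integral>\<^sup>+x. ennreal (norm (d x * f n x - V x)) \<partial>M)"
          by (rule nn_integral_cmult) measurable
        finally show "(\<integral>\<^sup>+x. ennreal (norm (d x * (f n x * \<psi> x) - V x * \<psi> x)) \<partial>M) \<le>
          ennreal B * (\<integral>\<^sup>+x. ennreal (norm (d x * f n x - V x)) \<partial>M)" .
      qed
    qed simp
  qed
  have rep: "l \<psi> = (LINT x|M. V x * \<psi> x)" if \<psi>: "\<psi> \<in> ?T" for \<psi>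
  proof -
    define y where "y = (LINT x|M. V x * \<psi> x) - l \<psi>"
    have ge: "0 \<le> s * y + s\<^sup>2 * q \<psi> \<psi> / 2" for s
    proof -
      have "0 \<le> 1 / real (Suc n) + s * (q (f n) \<psi> - l \<psi>) + s\<^sup>2 * q \<psi> \<psi> / 2" for n
      proof -
        have "i \<le> I (\<lambda>x. 1 * f n x + s * \<psi> x)" by (rule i_le[OF test_functions_lincomb(1)[OF f(1) \<psi>]])
        also have "\<dots> = I (f n) + s * (q (f n) \<psi> - l \<psi>) + s\<^sup>2 * q \<psi> \<psi> / 2"
          unfolding I_def q_comb[OF f(1) \<psi>] lin[OF f(1) \<psi>] by (simp add: field_simps)
        finally show ?thesis using f(2)[of n] by linarith
      qed
      moreover have "(\<lambda>n. 1 / real (Suc n) + s * (q (f n) \<psi> - l \<psi>) + s\<^sup>2 * q \<psi> \<psi> / 2) \<longlonglongrightarrow> 0 + s * y + s\<^sup>2 * q \<psi> \<psi> / 2"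
        unfolding y_def by (intro tendsto_add tendsto_mult tendsto_diff tendsto_const LIMSEQ_Suc[OF lim_1_over_n] Vlim[OF \<psi>, folded q_def])
      ultimately have "0 \<le> 0 + s * y + s\<^sup>2 * q \<psi> \<psi> / 2" by (intro LIMSEQ_le_const[where a = 0]) auto
      then show ?thesis by simp
    qed
    have "y = 0"
    proof (rule ccontr)
      assume "y \<noteq> 0"
      \<comment> \<open>A nonzero slope \<open>y\<close> would make the parabola in \<open>s\<close> negative at \<open>s = - y / Q\<close>; adding one avoids division
        by zero.\<close>
      define Q where "Q = q \<psi> \<psi> + 1"
      have Q: "Q > 0" "q \<psi> \<psi> < Q" using q_nonneg[of \<psi>] by (simp_all add: Q_def)
      have "(- y / Q)\<^sup>2 * q \<psi> \<psi> / 2 \<le> (- y / Q)\<^sup>2 * Q / 2" using Q by (intro divide_right_mono mult_left_mono) auto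
      then have "0 \<le> (- y / Q) * y + (- y / Q)\<^sup>2 * Q / 2" using ge[of "- y / Q"] by linarith
      also have "\<dots> = - (y\<^sup>2 / (2 * Q))" using Q by (simp add: power2_eq_square field_simps)
      finally have "y\<^sup>2 / (2 * Q) \<le> 0" by simp
      moreover have "y\<^sup>2 / (2 * Q) > 0" using Q \<open>y \<noteq> 0\<close> by simp
      ultimately show False by simp
    qed
    then show ?thesis by (simp add: y_def)
  qed
  have neg: "l (\<lambda>x. - \<phi> x) = - l \<phi>" "(\<lambda>x. - \<phi> x) \<in> ?T" if "\<phi> \<in> ?T" for \<phi>
    using lin[OF that that, of "-1" 0] test_functions_lincomb(1)[OF that that, of "-1" 0] by simp_all
  have nn1: "AE x in M. 0 \<le> d x - V x"
  proof (rule AE_nonneg_of_test_functions[OF open_dom])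
    show "locally_integrable \<Omega> (\<lambda>x. d x - V x)" using d(1) V(1) by (intro locally_integrable_integrable[OF open_dom]) simp
    show "\<forall>\<phi>\<in>?T. (\<forall>x. 0 \<le> \<phi> x \<and> \<phi> x \<le> 1) \<longrightarrow> 0 \<le> (LINT x|M. (d x - V x) * \<phi> x)"
    proof (intro ballI impI)
      fix \<phi> assume \<phi>: "\<phi> \<in> ?T" "\<forall>x. 0 \<le> \<phi> x \<and> \<phi> x \<le> 1"
      have "(LINT x|M. (d x - V x) * \<phi> x) = (LINT x|M. d x * \<bar>\<phi> x\<bar>) - l \<phi>"
        using \<phi>(2) int1[OF \<phi>(1)] iV[OF \<phi>(1)] by (simp add: rep[OF \<phi>(1)] left_diff_distrib)
      then show "0 \<le> (LINT x|M. (d x - V x) * \<phi> x)" using bound[OF \<phi>(1)] by simp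
    qed
  qed
  have nn2: "AE x in M. 0 \<le> d x + V x"
  proof (rule AE_nonneg_of_test_functions[OF open_dom])
    show "locally_integrable \<Omega> (\<lambda>x. d x + V x)" using d(1) V(1) by (intro locally_integrable_integrable[OF open_dom]) simp
    show "\<forall>\<phi>\<in>?T. (\<forall>x. 0 \<le> \<phi> x \<and> \<phi> x \<le> 1) \<longrightarrow> 0 \<le> (LINT x|M. (d x + V x) * \<phi> x)"
    proof (intro ballI impI)
      fix \<phi> assume \<phi>: "\<phi> \<in> ?T" "\<forall>x. 0 \<le> \<phi> x \<and> \<phi> x \<le> 1"
      have "(LINT x|M. (d x + V x) * \<phi> x) = (LINT x|M. d x * \<bar>\<phi> x\<bar>) + l \<phi>"
        using \<phi>(2) int1[OF \<phi>(1)] iV[OF \<phi>(1)] by (simp add: rep[OF \<phi>(1)] distrib_right)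
      then show "0 \<le> (LINT x|M. (d x + V x) * \<phi> x)" using bound[OF neg(2)[OF \<phi>(1)]] neg(1)[OF \<phi>(1)] by simp
    qed
  qed
  have "AE x in M. \<bar>V x\<bar> \<le> d x" using nn1 nn2 by eventually_elim auto
  from that[OF V(1) this rep] show ?thesis .
qed

section \<open>The Euler-Lagrange inclusion\<close>

lemma norm_powr_pair_le:
  fixes a b :: "'b::real_inner"
  shows "\<bar>norm a powr (s - 2) * (a \<bullet> b)\<bar> \<le> norm a powr (s - 1) * norm b"
proof (cases "a = 0")
  case False
  have "\<bar>norm a powr (s - 2) * (a \<bullet> b)\<bar> \<le> norm a powr (s - 2) * (norm a * norm b)"
    by (simp add: abs_mult Cauchy_Schwarz_ineq2 mult_left_mono)
  also have "norm a powr (s - 2) * (norm a * norm b) = norm a powr (s - 1) * norm b"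
  proof -
    have "norm a powr (s - 2) * norm a = norm a powr (s - 2) * norm a powr 1" by simp
    also have "\<dots> = norm a powr (s - 1)" by (simp only: powr_add[symmetric]) simp
    finally show ?thesis by (simp add: mult.assoc[symmetric])
  qed
  finally show ?thesis .
qed simp

text \<open>The convexity of \<open>\<lambda>a. norm a powr s / s\<close>, whose gradient at \<open>a\<close> is \<open>norm a powr (s - 2) *\<^sub>R a\<close>.\<close>

lemma norm_powr_gradient_le:
  fixes a b :: "'b::real_inner"
  assumes s: "s > 1"
  shows "norm a powr s / s + norm a powr (s - 2) * (a \<bullet> (b - a)) \<le> norm b powr s / s"
proof -
  have aa: "norm a powr (s - 2) * (a \<bullet> a) = norm a powr s" and a1: "norm a powr (s - 1) * norm a = norm a powr s"
  proof -
    have "norm a powr (s - 1) * norm a = norm a powr s \<and> norm a powr (s - 2) * (a \<bullet> a) = norm a powr s"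
    proof (cases "a = 0")
      case False
      then have "norm a powr (s - 2) * (norm a * norm a) = norm a powr s" "norm a powr (s - 1) * norm a = norm a powr s"
        by (simp_all add: powr_diff power2_eq_square[symmetric] powr_numeral)
      then show ?thesis by (simp add: power2_norm_eq_inner[symmetric] power2_eq_square)
    qed simp
    then show "norm a powr (s - 2) * (a \<bullet> a) = norm a powr s" "norm a powr (s - 1) * norm a = norm a powr s" by auto
  qed
  have "norm a powr (s - 2) * (a \<bullet> (b - a)) = norm a powr (s - 2) * (a \<bullet> b) - norm a powr s"
    by (simp add: inner_diff_right right_diff_distrib aa)
  also have "\<dots> \<le> norm a powr (s - 1) * norm b - norm a powr (s - 1) * norm a"
    using norm_powr_pair_le[of a s b] a1 by (simp add: abs_le_iff)
  finally have 1: "norm a powr (s - 2) * (a \<bullet> (b - a)) \<le> norm a powr (s - 1) * (norm b - norm a)"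
    by (simp add: right_diff_distrib)
  have "norm a powr s + s * norm a powr (s - 1) * (norm b - norm a) \<le> norm b powr s"
    using s by (intro powr_tangent) auto
  then have "(norm a powr s + s * norm a powr (s - 1) * (norm b - norm a)) / s \<le> norm b powr s / s"
    using s by (intro divide_right_mono) auto
  then have "norm a powr s / s + norm a powr (s - 1) * (norm b - norm a) \<le> norm b powr s / s"
    using s by (simp add: add_divide_distrib)
  then show ?thesis using 1 by linarith
qed

text \<open>At \<open>a = 0\<close> the factor \<open>norm (x n) powr (s - 2)\<close> may be unbounded, and the limit comes from the bound by
  \<open>norm (x n) powr (s - 1) * norm b\<close>.\<close>

lemma tendsto_norm_powr_pair:
  fixes a :: "'b::real_inner"
  assumes s: "s > 1" and x: "(\<lambda>n::nat. x n) \<longlonglongrightarrow> a"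
  shows "(\<lambda>n. norm (x n) powr (s - 2) * (x n \<bullet> b)) \<longlonglongrightarrow> norm a powr (s - 2) * (a \<bullet> b)"
proof (cases "a = 0")
  case True
  have "(\<lambda>n. norm (x n) powr (s - 1) * norm b) \<longlonglongrightarrow> norm a powr (s - 1) * norm b"
    using s by (intro tendsto_mult tendsto_const tendsto_powr' tendsto_norm x) auto
  then have "(\<lambda>n. norm (x n) powr (s - 1) * norm b) \<longlonglongrightarrow> 0" using True by simp
  then have "(\<lambda>n. norm (x n) powr (s - 2) * (x n \<bullet> b)) \<longlonglongrightarrow> 0"
    by (rule Lim_null_comparison[rotated]) (rule always_eventually, simp add: norm_powr_pair_le)
  then show ?thesis using True by simp
next
  case False
  then show ?thesis by (intro tendsto_mult tendsto_inner tendsto_const x tendsto_powr tendsto_norm) auto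
qed

context var_exp
begin

lemma powr_over_p_integrable:
  fixes f :: "'a \<Rightarrow> 'b::euclidean_space"
  assumes [measurable]: "f \<in> borel_measurable M" and r: "rho f < \<infinity>"
  shows "integrable M (\<lambda>x. norm (f x) powr p x / p x)" "integrable M (\<lambda>x. norm (f x) powr p x)"
proof -
  show "integrable M (\<lambda>x. norm (f x) powr p x)"
    by (rule integrableI_nonneg) (use r in \<open>auto simp: rho_def\<close>)
  have nn: "AE x in M. 0 \<le> norm (f x) powr p x / p x" by (rule AE_I2) (simp add: less_imp_le[OF less_trans[OF zero_less_one p_gt_1]])
  have "energy f < \<infinity>" using energy_le_rho r by (rule le_less_trans)
  then show "integrable M (\<lambda>x. norm (f x) powr p x / p x)"
    unfolding energy_def by (intro integrableI_nonneg nn) measurable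
qed

lemma pair_dominated:
  fixes a b :: "'b::euclidean_space"
  assumes x: "x \<in> \<Omega>" and B: "0 \<le> B" "norm b \<le> B" and a: "norm a \<le> t + B" "0 \<le> t"
  shows "\<bar>norm a powr (p x - 2) * (a \<bullet> b)\<bar> \<le> (1 + 2 powr pp * (t powr p x + (1 + B powr pp))) * B"
proof -
  have px: "1 < p x" "p x \<le> pp" using p_gt_1[OF x] p_le[OF x] by auto
  have "\<bar>norm a powr (p x - 2) * (a \<bullet> b)\<bar> \<le> norm a powr (p x - 1) * norm b" by (rule norm_powr_pair_le)
  also have "\<dots> \<le> (1 + 2 powr pp * (t powr p x + (1 + B powr pp))) * B"
  proof (rule mult_mono)
    have "norm a powr (p x - 1) \<le> (t + B) powr (p x - 1)" using a px by (intro powr_mono2) auto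
    also have "\<dots> \<le> 1 + (t + B) powr p x" using a B px by (intro powr_le_one_plus) auto
    also have "(t + B) powr p x \<le> 2 powr pp * (t powr p x + B powr p x)" using a B px by (intro powr_add_le) auto
    also have "B powr p x \<le> 1 + B powr pp" using B px by (intro powr_le_one_plus) auto
    finally show "norm a powr (p x - 1) \<le> 1 + 2 powr pp * (t powr p x + (1 + B powr pp))" by simp
  qed (use B in auto)
  finally show ?thesis .
qed

text \<open>By convexity the difference quotient lies between the derivatives at the two ends of the step.  This
  gives both its pointwise limit and an integrable majorant.\<close>

lemma modular_derivative:
  fixes f \<psi> :: "'a \<Rightarrow> 'b::euclidean_space"
  assumes f[measurable]: "f \<in> borel_measurable M" and r: "rho f < \<infinity>"
    and \<psi>[measurable]: "\<psi> \<in> borel_measurable M" and B: "\<And>x. norm (\<psi> x) \<le> B"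
  shows "integrable M (\<lambda>x. norm (f x) powr (p x - 2) * (f x \<bullet> \<psi> x))"
    and "(\<lambda>n. LINT x|M. (norm (f x + (1 / real (Suc n)) *\<^sub>R \<psi> x) powr p x / p x - norm (f x) powr p x / p x) / (1 / real (Suc n)))
      \<longlonglongrightarrow> (LINT x|M. norm (f x) powr (p x - 2) * (f x \<bullet> \<psi> x))"
proof -
  have B0: "B \<ge> 0" using B[of undefined] norm_ge_zero order_trans by blast
  define w where "w x = (1 + 2 powr pp * (norm (f x) powr p x + (1 + B powr pp))) * B" for x
  have wi: "integrable M w" unfolding w_def using powr_over_p_integrable(2)[OF f r] by simp
  have w0: "0 \<le> w x" for x unfolding w_def using B0 by (intro mult_nonneg_nonneg add_nonneg_nonneg) auto
  define t where "t n = 1 / real (Suc n)" for n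
  have t: "0 < t n" "t n \<le> 1" for n by (simp_all add: t_def)
  have t0: "t \<longlonglongrightarrow> 0" unfolding t_def by (rule LIMSEQ_Suc[OF lim_1_over_n])
  have dom: "\<bar>norm (f x) powr (p x - 2) * (f x \<bullet> \<psi> x)\<bar> \<le> w x" if "x \<in> \<Omega>" for x
    unfolding w_def using B0 B by (intro pair_dominated[OF that]) auto
  show i: "integrable M (\<lambda>x. norm (f x) powr (p x - 2) * (f x \<bullet> \<psi> x))"
    by (rule Bochner_Integration.integrable_bound[OF wi]) (use dom w0 in \<open>auto intro!: AE_I2\<close>)
  have lower: "norm (f x) powr (p x - 2) * (f x \<bullet> \<psi> x) \<le> (norm (f x + t n *\<^sub>R \<psi> x) powr p x / p x - norm (f x) powr p x / p x) / t n"
    if x: "x \<in> \<Omega>" for x n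
  proof -
    have "norm (f x) powr p x / p x + norm (f x) powr (p x - 2) * (f x \<bullet> (t n *\<^sub>R \<psi> x)) \<le> norm (f x + t n *\<^sub>R \<psi> x) powr p x / p x"
      using norm_powr_gradient_le[OF p_gt_1[OF x], of "f x" "f x + t n *\<^sub>R \<psi> x"] by simp
    then show ?thesis using t(1)[of n] by (simp add: pos_le_divide_eq algebra_simps)
  qed
  have upper: "(norm (f x + t n *\<^sub>R \<psi> x) powr p x / p x - norm (f x) powr p x / p x) / t n \<le>
      norm (f x + t n *\<^sub>R \<psi> x) powr (p x - 2) * ((f x + t n *\<^sub>R \<psi> x) \<bullet> \<psi> x)" if x: "x \<in> \<Omega>" for x n
  proof -
    let ?b = "f x + t n *\<^sub>R \<psi> x"
    have "norm ?b powr p x / p x + norm ?b powr (p x - 2) * (?b \<bullet> (f x - ?b)) \<le> norm (f x) powr p x / p x"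
      by (rule norm_powr_gradient_le[OF p_gt_1[OF x]])
    moreover have "f x - ?b = - (t n *\<^sub>R \<psi> x)" by simp
    ultimately have "norm ?b powr p x / p x - norm ?b powr (p x - 2) * (t n * (?b \<bullet> \<psi> x)) \<le> norm (f x) powr p x / p x"
      by (simp only: inner_minus_right inner_scaleR_right mult_minus_right add_uminus_conv_diff)
    then show ?thesis using t(1)[of n] by (simp add: pos_divide_le_eq algebra_simps)
  qed
  have "(\<lambda>n. LINT x|M. (norm (f x + t n *\<^sub>R \<psi> x) powr p x / p x - norm (f x) powr p x / p x) / t n)
      \<longlonglongrightarrow> (LINT x|M. norm (f x) powr (p x - 2) * (f x \<bullet> \<psi> x))"
  proof (rule integral_dominated_convergence[where w = w])
    show "AE x in M. (\<lambda>n. (norm (f x + t n *\<^sub>R \<psi> x) powr p x / p x - norm (f x) powr p x / p x) / t n) \<longlonglongrightarrow> norm (f x) powr (p x - 2) * (f x \<bullet> \<psi> x)"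
    proof (rule AE_I2)
      fix x assume "x \<in> space M"
      then have x: "x \<in> \<Omega>" by simp
      have "(\<lambda>n. f x + t n *\<^sub>R \<psi> x) \<longlonglongrightarrow> f x + 0 *\<^sub>R \<psi> x" by (intro tendsto_intros t0)
      then have "(\<lambda>n. f x + t n *\<^sub>R \<psi> x) \<longlonglongrightarrow> f x" by simp
      note lim = tendsto_norm_powr_pair[OF p_gt_1[OF x] this, of "\<psi> x"]
      show "(\<lambda>n. (norm (f x + t n *\<^sub>R \<psi> x) powr p x / p x - norm (f x) powr p x / p x) / t n) \<longlonglongrightarrow> norm (f x) powr (p x - 2) * (f x \<bullet> \<psi> x)"
        by (rule tendsto_sandwich[OF _ _ tendsto_const lim]; rule always_eventually; intro allI lower[OF x] upper[OF x])
    qed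
    show "AE x in M. norm ((norm (f x + t n *\<^sub>R \<psi> x) powr p x / p x - norm (f x) powr p x / p x) / t n) \<le> w x" for n
    proof (rule AE_I2)
      fix x assume "x \<in> space M"
      then have x: "x \<in> \<Omega>" by simp
      have "norm (f x + t n *\<^sub>R \<psi> x) \<le> norm (f x) + t n * norm (\<psi> x)"
        using norm_triangle_ineq[of "f x" "t n *\<^sub>R \<psi> x"] t(1)[of n] by simp
      also have "t n * norm (\<psi> x) \<le> 1 * B" using t[of n] B[of x] by (intro mult_mono) auto
      finally have "\<bar>norm (f x + t n *\<^sub>R \<psi> x) powr (p x - 2) * ((f x + t n *\<^sub>R \<psi> x) \<bullet> \<psi> x)\<bar> \<le> w x"
        unfolding w_def using B0 B by (intro pair_dominated[OF x]) auto
      then show "norm ((norm (f x + t n *\<^sub>R \<psi> x) powr p x / p x - norm (f x) powr p x / p x) / t n) \<le> w x"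
        using lower[OF x, of n] upper[OF x, of n] dom[OF x] unfolding real_norm_def by linarith
    qed
  qed (use wi in measurable)
  then show "(\<lambda>n. LINT x|M. (norm (f x + (1 / real (Suc n)) *\<^sub>R \<psi> x) powr p x / p x - norm (f x) powr p x / p x) / (1 / real (Suc n)))
      \<longlonglongrightarrow> (LINT x|M. norm (f x) powr (p x - 2) * (f x \<bullet> \<psi> x))"
    by (simp only: t_def)
qed

text \<open>Between \<open>s\<close> and \<open>t\<close> the subdifferentials are bounded by the value of the growth function at
  \<open>\<bar>t\<bar> + \<bar>s\<bar>\<close>, so the mean value inequality applies.\<close>

lemma clarke_growth_lipschitz:
  assumes lip: "locally_lipschitz j" and K: "K \<ge> 0" and q: "q \<ge> 1"
    and gr: "\<And>t v. v \<in> clarke_subdiff j t \<Longrightarrow> \<bar>v\<bar> \<le> K * (1 + \<bar>t\<bar> powr (q - 1))"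
  shows "\<bar>j t - j s\<bar> \<le> K * (1 + (\<bar>t\<bar> + \<bar>s\<bar>) powr (q - 1)) * \<bar>t - s\<bar>"
proof -
  have *: "\<bar>j b - j a\<bar> \<le> K * (1 + (\<bar>a\<bar> + \<bar>b\<bar>) powr (q - 1)) * (b - a)" if ab: "a \<le> b" for a b
  proof (rule lipschitz_of_clarke_subdiff_bound[OF lip ab])
    fix \<tau> v assume \<tau>: "a \<le> \<tau>" "\<tau> \<le> b" and v: "v \<in> clarke_subdiff j \<tau>"
    have "\<bar>v\<bar> \<le> K * (1 + \<bar>\<tau>\<bar> powr (q - 1))" by (rule gr[OF v])
    also have "\<dots> \<le> K * (1 + (\<bar>a\<bar> + \<bar>b\<bar>) powr (q - 1))"
      using \<tau> q K by (intro mult_left_mono add_left_mono powr_mono2) auto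
    finally show "\<bar>v\<bar> \<le> K * (1 + (\<bar>a\<bar> + \<bar>b\<bar>) powr (q - 1))" .
  qed
  show ?thesis
  proof (cases "s \<le> t")
    case True
    then show ?thesis using *[OF True] by (simp add: add.commute)
  next
    case False
    then show ?thesis using *[of t s] by (simp add: abs_minus_commute)
  qed
qed

text \<open>Comparison with \<open>u + t \<phi>\<close> bounds the derivative of the smooth part in direction \<open>\<phi>\<close> by the integral of
  the support function of the interval \<open>[lo x, hi x]\<close> at \<open>- \<phi> x\<close>.  The support function of an interval is the
  linear function given by its midpoint \<open>c\<close> plus half the length \<open>d\<close> times the absolute value.  Therefore
  what remains after subtraction of the midpoint is a linear functional to which
  \<open>representation_weighted_L1\<close> applies.\<close>

lemma euler_lagrange_inclusion:
  fixes J :: "'a \<Rightarrow> real \<Rightarrow> real"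
  assumes pmN: "pm < DIM('a)" and q: "pp \<le> q" "q < DIM('a) * pm / (DIM('a) - pm)"
    and Jm: "\<And>t. (\<lambda>x. J x t) \<in> borel_measurable M" and Jl: "\<And>x. x \<in> \<Omega> \<Longrightarrow> locally_lipschitz (J x)"
    and J0: "\<And>x. x \<in> \<Omega> \<Longrightarrow> J x 0 = 0" and K: "K \<ge> 0"
    and gr: "\<And>x t v. x \<in> \<Omega> \<Longrightarrow> v \<in> clarke_subdiff (J x) t \<Longrightarrow> \<bar>v\<bar> \<le> K * (1 + \<bar>t\<bar> powr (q - 1))"
    and W: "W0 u g"
    and minimal: "\<And>v h. W0 v h \<Longrightarrow>
      (LINT x|M. norm (g x) powr p x / p x) + (LINT x|M. - lam * (\<bar>u x\<bar> powr p x / p x) - J x (u x)) \<le>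
      (LINT x|M. norm (h x) powr p x / p x) + (LINT x|M. - lam * (\<bar>v x\<bar> powr p x / p x) - J x (v x))"
  obtains v where "locally_integrable \<Omega> v" "AE x in M. v x \<in> clarke_subdiff (J x) (u x)"
    "\<And>\<phi>. \<phi> \<in> test_functions \<Omega> \<Longrightarrow> (LINT x|M. norm (g x) powr (p x - 2) * (g x \<bullet> grad \<phi> x)) =
       (LINT x|M. lam * \<bar>u x\<bar> powr (p x - 2) * u x * \<phi> x) + (LINT x|M. v x * \<phi> x)"
proof -
  let ?T = "test_functions \<Omega>"
  have q1: "q > 1" and pq: "pm \<le> q" using q pm pm_le_pp by auto
  note [measurable] = W0_measurable[OF W]
  have Jc: "continuous_on UNIV (J x)" if "x \<in> \<Omega>" for x by (rule locally_lipschitz_continuous[OF Jl[OF that]])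
  have Jwm[measurable]: "(\<lambda>x. J x (w x)) \<in> borel_measurable M" if "w \<in> borel_measurable M" for w
    by (rule borel_measurable_caratheodory[OF Jm _ that]) (use Jc in simp)
  have Jlip: "\<bar>J x t - J x s\<bar> \<le> K * (1 + (\<bar>t\<bar> + \<bar>s\<bar>) powr (q - 1)) * \<bar>t - s\<bar>" if "x \<in> \<Omega>" for x t s
    by (rule clarke_growth_lipschitz[OF Jl[OF that] K _ gr[OF that]]) (use q1 in auto)
  have Ji: "integrable M (\<lambda>x. J x (w x))" if w: "W0 w h" for w h
  proof (rule Bochner_Integration.integrable_bound[where f = "\<lambda>x. K * (\<bar>w x\<bar> powr 1 + \<bar>w x\<bar> powr q)"])
    show "integrable M (\<lambda>x. K * (\<bar>w x\<bar> powr 1 + \<bar>w x\<bar> powr q))"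
      using q1 by (intro integrable_mult_right Bochner_Integration.integrable_add W0_powr_integrable[OF pmN pq q(2) w]) auto
    show "AE x in M. norm (J x (w x)) \<le> norm (K * (\<bar>w x\<bar> powr 1 + \<bar>w x\<bar> powr q))"
    proof (rule AE_I2)
      fix x assume "x \<in> space M"
      then have x: "x \<in> \<Omega>" by simp
      have "\<bar>J x (w x)\<bar> \<le> K * (1 + \<bar>w x\<bar> powr (q - 1)) * \<bar>w x\<bar>" using Jlip[OF x, of "w x" 0] J0[OF x] by simp
      also have "\<dots> = K * (\<bar>w x\<bar> powr 1 + \<bar>w x\<bar> powr q)"
      proof -
        have "\<bar>w x\<bar> powr (q - 1) * \<bar>w x\<bar> = \<bar>w x\<bar> powr q" by (cases "w x = 0") (auto simp: powr_diff)
        then show ?thesis by (simp add: distrib_left distrib_right mult.assoc)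
      qed
      finally show "norm (J x (w x)) \<le> norm (K * (\<bar>w x\<bar> powr 1 + \<bar>w x\<bar> powr q))" by simp
    qed
  qed (rule Jwm[OF W0_measurable(1)[OF w]])
  have pi: "integrable M (\<lambda>x. \<bar>w x\<bar> powr p x / p x)" if w: "W0 w h" for w h
    using powr_over_p_integrable(1)[OF W0_measurable(1)[OF w] W0_rho_finite(1)[OF w]] by simp
  define hi where "hi x = real_of_ereal (clarke_hi (J x) (u x))" for x
  define lo where "lo x = real_of_ereal (clarke_lo (J x) (u x))" for x
  have hm[measurable]: "hi \<in> borel_measurable M"
    unfolding hi_def by (intro borel_measurable_real_of_ereal borel_measurable_clarke(1)[OF Jm]) (use Jc in auto)
  have lm[measurable]: "lo \<in> borel_measurable M"
    unfolding lo_def by (intro borel_measurable_real_of_ereal borel_measurable_clarke(2)[OF Jm]) (use Jc in auto)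
  have lh: "lo x \<le> hi x" if "x \<in> \<Omega>" for x unfolding lo_def hi_def by (rule clarke_hi_lo_real(3)[OF Jl[OF that]])
  have bd: "\<bar>hi x\<bar> \<le> K * (1 + \<bar>u x\<bar> powr (q - 1))" "\<bar>lo x\<bar> \<le> K * (1 + \<bar>u x\<bar> powr (q - 1))" if x: "x \<in> \<Omega>" for x
    using lh[OF x] unfolding hi_def lo_def
    by (rule gr[OF x clarke_interval[OF Jl[OF x] _ order_refl]], rule gr[OF x clarke_interval[OF Jl[OF x] order_refl]])
  have gi: "integrable M (\<lambda>x. K * (1 + \<bar>u x\<bar> powr (q - 1)))"
  proof -
    have "integrable M (\<lambda>x. \<bar>u x\<bar> powr (q - 1))" by (rule W0_powr_integrable[OF pmN pq q(2) W]) (use q1 in auto)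
    then show ?thesis by simp
  qed
  have hii: "integrable M hi" and loi: "integrable M lo"
    by (rule Bochner_Integration.integrable_bound[OF gi]; use bd in \<open>force intro!: AE_I2\<close>)+
  define a where "a \<phi> = (LINT x|M. norm (g x) powr (p x - 2) * (g x \<bullet> grad \<phi> x))" for \<phi>
  define b where "b \<phi> = (LINT x|M. norm (u x) powr (p x - 2) * (u x \<bullet> \<phi> x))" for \<phi>
  have ai: "integrable M (\<lambda>x. norm (g x) powr (p x - 2) * (g x \<bullet> grad \<phi> x))" if T: "\<phi> \<in> ?T" for \<phi>
  proof -
    obtain B where "\<And>x. norm (grad \<phi> x) \<le> B" using test_function_bounded[OF T] by metis
    from modular_derivative(1)[OF W0_measurable(2)[OF W] W0_rho_finite(2)[OF W] test_measurable(2)[OF T] this] show ?thesis .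
  qed
  have bi: "integrable M (\<lambda>x. norm (u x) powr (p x - 2) * (u x \<bullet> \<phi> x))" if T: "\<phi> \<in> ?T" for \<phi>
  proof -
    obtain B where "\<And>x. norm (\<phi> x) \<le> B" using test_function_bounded[OF T] unfolding real_norm_def by metis
    from modular_derivative(1)[OF W0_measurable(1)[OF W] W0_rho_finite(1)[OF W] test_measurable(1)[OF T] this] show ?thesis .
  qed
  have key: "lam * b \<phi> - a \<phi> \<le> (LINT x|M. max (- \<phi> x * hi x) (- \<phi> x * lo x))" if T: "\<phi> \<in> ?T" for \<phi>
  proof -
    note [measurable] = test_measurable[OF T]
    obtain B where B: "B > 0" "\<And>x. \<bar>\<phi> x\<bar> \<le> B" "\<And>x. norm (grad \<phi> x) \<le> B" using test_function_bounded[OF T] by metis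
    define t where "t n = 1 / real (Suc n)" for n
    have t: "0 < t n" "t n \<le> 1" for n by (simp_all add: t_def)
    have t0: "t \<longlonglongrightarrow> 0" unfolding t_def by (rule LIMSEQ_Suc[OF lim_1_over_n])
    have Wt: "W0 (\<lambda>x. u x + t n * \<phi> x) (\<lambda>x. g x + t n *\<^sub>R grad \<phi> x)" for n by (rule W0_add_test[OF W T])
    define D1 where "D1 n = (LINT x|M. (norm (g x + t n *\<^sub>R grad \<phi> x) powr p x / p x - norm (g x) powr p x / p x) / t n)" for n
    define D2 where "D2 n = (LINT x|M. (norm (u x + t n *\<^sub>R \<phi> x) powr p x / p x - norm (u x) powr p x / p x) / t n)" for n
    define N where "N n x = (J x (u x) - J x (u x + t n * \<phi> x)) / t n" for n x
    define m where "m x = max (- \<phi> x * hi x) (- \<phi> x * lo x)" for x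
    have D1: "D1 \<longlonglongrightarrow> a \<phi>" unfolding D1_def a_def t_def
      by (rule modular_derivative(2)[OF W0_measurable(2)[OF W] W0_rho_finite(2)[OF W] test_measurable(2)[OF T] B(3)])
    have D2: "D2 \<longlonglongrightarrow> b \<phi>" unfolding D2_def b_def t_def
      by (rule modular_derivative(2)[OF W0_measurable(1)[OF W] W0_rho_finite(1)[OF W] test_measurable(1)[OF T]])
        (use B(2) in simp)
    have Ni: "integrable M (N n)" for n unfolding N_def using Ji[OF W] Ji[OF Wt] by simp
    have N_ge: "lam * D2 n - D1 n \<le> (LINT x|M. N n x)" for n
    proof -
      let ?g1 = "LINT x|M. norm (g x + t n *\<^sub>R grad \<phi> x) powr p x / p x" and ?g0 = "LINT x|M. norm (g x) powr p x / p x"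
      let ?u1 = "LINT x|M. \<bar>u x + t n * \<phi> x\<bar> powr p x / p x" and ?u0 = "LINT x|M. \<bar>u x\<bar> powr p x / p x"
      let ?j1 = "LINT x|M. J x (u x + t n * \<phi> x)" and ?j0 = "LINT x|M. J x (u x)"
      have split: "(LINT x|M. - lam * (\<bar>w x\<bar> powr p x / p x) - J x (w x)) =
          - lam * (LINT x|M. \<bar>w x\<bar> powr p x / p x) - (LINT x|M. J x (w x))" if w: "W0 w h" for w h
      proof -
        have "(LINT x|M. - lam * (\<bar>w x\<bar> powr p x / p x) - J x (w x)) =
            (LINT x|M. - lam * (\<bar>w x\<bar> powr p x / p x)) - (LINT x|M. J x (w x))"
          by (rule Bochner_Integration.integral_diff[OF integrable_mult_right[OF pi[OF w]] Ji[OF w]])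
        then show ?thesis by (simp only: integral_mult_right_zero)
      qed
      note s = split[OF W] and s1 = split[OF Wt[of n]]
      have "?g0 + (- lam * ?u0 - ?j0) \<le> ?g1 + (- lam * ?u1 - ?j1)"
        using minimal[OF Wt[of n]] unfolding s s1 .
      then have le: "lam * (?u1 - ?u0) - (?g1 - ?g0) \<le> ?j0 - ?j1" by (simp add: algebra_simps)
      have d1: "D1 n = (?g1 - ?g0) / t n"
        unfolding D1_def using W0_energy_integrable(1)[OF W] W0_energy_integrable(1)[OF Wt[of n]] by simp
      have d2: "D2 n = (?u1 - ?u0) / t n"
        unfolding D2_def using pi[OF W] pi[OF Wt[of n]] by simp
      have nn: "(LINT x|M. N n x) = (?j0 - ?j1) / t n"
        unfolding N_def using Ji[OF W] Ji[OF Wt[of n]] by simp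
      have "lam * D2 n - D1 n = (lam * (?u1 - ?u0) - (?g1 - ?g0)) / t n"
        unfolding d1 d2 by (simp only: diff_divide_distrib[of "lam * (?u1 - ?u0)" "?g1 - ?g0" "t n"] times_divide_eq_right)
      also have "\<dots> \<le> (?j0 - ?j1) / t n" using le t(1)[of n] by (intro divide_right_mono) auto
      finally show ?thesis unfolding nn .
    qed
    \<comment> \<open>The quotients \<open>N n x\<close> need not converge; an asymptotic upper bound is all that Clarke derivatives
      provide.  For \<open>\<phi> x < 0\<close> the step is reversed, with its base point at \<open>u x + t n * \<phi> x\<close>.\<close>
    have N_up: "\<forall>\<^sub>F n in sequentially. N n x \<le> m x + c" if x: "x \<in> \<Omega>" and c: "c > 0" for x c
    proof -
      note R = clarke_hi_lo_real[OF Jl[OF x], of "u x"]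
      consider "\<phi> x = 0" | "\<phi> x < 0" | "\<phi> x > 0" by linarith
      then show ?thesis
      proof cases
        case 1
        then show ?thesis using c by (simp add: N_def m_def)
      next
        case 2
        define h where "h = - \<phi> x"
        have h: "h > 0" using 2 by (simp add: h_def)
        have "clarke_hi (J x) (u x) < ereal (hi x + c / h)"
          using h c unfolding hi_def by (subst R(1)) simp
        from clarke_hi_lessD[OF Jc[OF x] this] obtain d where d: "d > 0"
          "\<And>y s. \<bar>y\<bar> < d \<Longrightarrow> 0 < s \<Longrightarrow> s < d \<Longrightarrow> dq (J x) (u x) y s \<le> hi x + c / h" by blast
        have "(\<lambda>n. t n * h) \<longlonglongrightarrow> 0 * h" by (intro tendsto_mult t0 tendsto_const)
        then have "\<forall>\<^sub>F n in sequentially. t n * h < d" by (rule order_tendstoD(2)) (use d in simp)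
        then show ?thesis
        proof eventually_elim
          case (elim n)
          have "dq (J x) (u x) (- (t n * h)) (t n * h) \<le> hi x + c / h"
            using elim t(1)[of n] h by (intro d(2)) auto
          moreover have "N n x = h * dq (J x) (u x) (- (t n * h)) (t n * h)"
            using h t(1)[of n] by (simp add: N_def dq_def h_def field_simps)
          ultimately have "N n x \<le> h * (hi x + c / h)" using h by (simp add: mult_left_mono)
          also have "\<dots> = h * hi x + c" using h by (simp add: distrib_left)
          also have "\<dots> = - \<phi> x * hi x + c" by (simp add: h_def)
          finally show ?case by (simp add: m_def max_def)
        qed
      next
        case 3
        have "ereal (lo x - c / \<phi> x) < clarke_lo (J x) (u x)"
          using 3 c unfolding lo_def by (subst R(2)) simp
        from clarke_lo_greaterD[OF Jc[OF x] this] obtain d where d: "d > 0"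
          "\<And>y s. \<bar>y\<bar> < d \<Longrightarrow> 0 < s \<Longrightarrow> s < d \<Longrightarrow> lo x - c / \<phi> x \<le> dq (J x) (u x) y s" by blast
        have "(\<lambda>n. t n * \<phi> x) \<longlonglongrightarrow> 0 * \<phi> x" by (intro tendsto_mult t0 tendsto_const)
        then have "\<forall>\<^sub>F n in sequentially. t n * \<phi> x < d" by (rule order_tendstoD(2)) (use d in simp)
        then show ?thesis
        proof eventually_elim
          case (elim n)
          have "lo x - c / \<phi> x \<le> dq (J x) (u x) 0 (t n * \<phi> x)"
            using elim t(1)[of n] 3 d(1) by (intro d(2)) auto
          then have "\<phi> x * (lo x - c / \<phi> x) \<le> \<phi> x * dq (J x) (u x) 0 (t n * \<phi> x)" using 3 by (intro mult_left_mono) auto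
          moreover have "N n x = - (\<phi> x * dq (J x) (u x) 0 (t n * \<phi> x))"
            using 3 t(1)[of n] by (simp add: N_def dq_def field_simps)
          moreover have "\<phi> x * (lo x - c / \<phi> x) = \<phi> x * lo x - c" using 3 by (simp add: right_diff_distrib)
          ultimately have "N n x \<le> - \<phi> x * lo x + c" by simp
          then show ?case by (simp add: m_def max_def)
        qed
      qed
    qed
    define w where "w x = K * (1 + (2 * \<bar>u x\<bar> + B) powr (q - 1)) * B" for x
    have wi: "integrable M w"
    proof (rule Bochner_Integration.integrable_bound[where f = "\<lambda>x. K * (1 + (1 + 2 powr q * (2 powr q * \<bar>u x\<bar> powr q + B powr q))) * B"])
      have "integrable M (\<lambda>x. \<bar>u x\<bar> powr q)" by (rule W0_powr_integrable[OF pmN pq q(2) W]) (use q1 in auto)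
      then show "integrable M (\<lambda>x. K * (1 + (1 + 2 powr q * (2 powr q * \<bar>u x\<bar> powr q + B powr q))) * B)" by simp
      show "w \<in> borel_measurable M" unfolding w_def by measurable
      show "AE x in M. norm (w x) \<le> norm (K * (1 + (1 + 2 powr q * (2 powr q * \<bar>u x\<bar> powr q + B powr q))) * B)"
      proof (rule AE_I2)
        fix x
        have "(2 * \<bar>u x\<bar> + B) powr (q - 1) \<le> 1 + (2 * \<bar>u x\<bar> + B) powr q" using B(1) q1 by (intro powr_le_one_plus) auto
        also have "(2 * \<bar>u x\<bar> + B) powr q \<le> 2 powr q * ((2 * \<bar>u x\<bar>) powr q + B powr q)" using B(1) q1 by (intro powr_add_le) auto
        also have "(2 * \<bar>u x\<bar>) powr q = 2 powr q * \<bar>u x\<bar> powr q" by (simp add: powr_mult)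
        finally have "w x \<le> K * (1 + (1 + 2 powr q * (2 powr q * \<bar>u x\<bar> powr q + B powr q))) * B"
          unfolding w_def using K B(1) by (intro mult_right_mono mult_left_mono) auto
        moreover have "0 \<le> w x" unfolding w_def using K B(1) by (intro mult_nonneg_nonneg add_nonneg_nonneg) auto
        ultimately show "norm (w x) \<le> norm (K * (1 + (1 + 2 powr q * (2 powr q * \<bar>u x\<bar> powr q + B powr q))) * B)" by simp
      qed
    qed
    have Nw: "\<bar>N n x\<bar> \<le> w x" if x: "x \<in> \<Omega>" for n x
    proof -
      have tb: "\<bar>t n * \<phi> x\<bar> \<le> 1 * B" unfolding abs_mult using t[of n] B(2)[of x] by (intro mult_mono) auto
      have "\<bar>J x (u x) - J x (u x + t n * \<phi> x)\<bar> \<le> K * (1 + (\<bar>u x\<bar> + \<bar>u x + t n * \<phi> x\<bar>) powr (q - 1)) * \<bar>u x - (u x + t n * \<phi> x)\<bar>"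
        by (rule Jlip[OF x])
      also have "\<dots> = K * (1 + (\<bar>u x\<bar> + \<bar>u x + t n * \<phi> x\<bar>) powr (q - 1)) * (t n * \<bar>\<phi> x\<bar>)" using t(1)[of n] by (simp add: abs_mult)
      also have "\<dots> \<le> K * (1 + (2 * \<bar>u x\<bar> + B) powr (q - 1)) * (t n * B)"
        using K q1 tb t[of n] B(2)[of x] by (intro mult_mono mult_left_mono add_left_mono powr_mono2 mult_nonneg_nonneg add_nonneg_nonneg) auto
      finally have "\<bar>J x (u x) - J x (u x + t n * \<phi> x)\<bar> \<le> w x * t n" by (simp add: w_def mult_ac)
      then show ?thesis using t(1)[of n] by (simp add: N_def abs_divide pos_divide_le_eq)
    qed
    have mw: "\<bar>m x\<bar> \<le> w x" if x: "x \<in> \<Omega>" for x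
    proof -
      have A: "\<bar>- \<phi> x * y\<bar> \<le> w x" if y: "\<bar>y\<bar> \<le> K * (1 + \<bar>u x\<bar> powr (q - 1))" for y
      proof -
        have "\<bar>- \<phi> x * y\<bar> = \<bar>y\<bar> * \<bar>\<phi> x\<bar>" by (simp add: abs_mult)
        also have "\<dots> \<le> (K * (1 + \<bar>u x\<bar> powr (q - 1))) * B" using y B(1) B(2)[of x] K by (intro mult_mono) auto
        also have "\<dots> \<le> w x" unfolding w_def using K B(1) q1 by (intro mult_right_mono mult_left_mono add_left_mono powr_mono2) auto
        finally show ?thesis .
      qed
      show ?thesis using A[OF bd(1)[OF x]] A[OF bd(2)[OF x]] by (auto simp: m_def max_def)
    qed
    have mm[measurable]: "m \<in> borel_measurable M" unfolding m_def by measurable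
    have mi: "integrable M m"
    proof (rule Bochner_Integration.integrable_bound[OF wi mm], rule AE_I2)
      fix x assume "x \<in> space M"
      then have "\<bar>m x\<bar> \<le> w x" using mw by simp
      then show "norm (m x) \<le> norm (w x)" by simp
    qed
    have Nm[measurable]: "N n \<in> borel_measurable M" for n using Ni by auto
    \<comment> \<open>Replacing \<open>N n\<close> by its maximum with \<open>m\<close> turns the upper bound into convergence to \<open>m\<close>.\<close>
    have dct: "(\<lambda>n. LINT x|M. max (N n x) (m x)) \<longlonglongrightarrow> (LINT x|M. m x)"
    proof (rule integral_dominated_convergence[OF _ _ wi])
      show "AE x in M. (\<lambda>n. max (N n x) (m x)) \<longlonglongrightarrow> m x"
      proof (rule AE_I2, rule LIMSEQ_I)
        fix x and e :: real assume x: "x \<in> space M" and e: "e > 0"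
        have "\<forall>\<^sub>F n in sequentially. N n x \<le> m x + e / 2" using N_up[of x "e / 2"] x e by simp
        then have "\<forall>\<^sub>F n in sequentially. norm (max (N n x) (m x) - m x) < e"
          by eventually_elim (use e in \<open>auto simp: max_def\<close>)
        then show "\<exists>no. \<forall>n\<ge>no. norm (max (N n x) (m x) - m x) < e" unfolding eventually_sequentially .
      qed
      show "AE x in M. norm (max (N n x) (m x)) \<le> w x" for n
        by (rule AE_I2) (use Nw mw in \<open>auto simp: max_def\<close>)
    qed measurable
    have "lam * D2 n - D1 n \<le> (LINT x|M. max (N n x) (m x))" for n
    proof -
      have "(LINT x|M. N n x) \<le> (LINT x|M. max (N n x) (m x))" using Ni mi by (intro integral_mono) auto
      then show ?thesis using N_ge[of n] by linarith
    qed
    moreover have "(\<lambda>n. lam * D2 n - D1 n) \<longlonglongrightarrow> lam * b \<phi> - a \<phi>" by (intro tendsto_intros D1 D2)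
    ultimately have "lam * b \<phi> - a \<phi> \<le> (LINT x|M. m x)" by (intro LIMSEQ_le[OF _ dct]) auto
    then show ?thesis by (simp only: m_def)
  qed
  define c where "c x = (hi x + lo x) / 2" for x
  define d where "d x = (hi x - lo x) / 2" for x
  have ci: "integrable M c" and di: "integrable M d" unfolding c_def d_def using hii loi by auto
  have d0: "0 \<le> d x" if "x \<in> \<Omega>" for x using lh[OF that] by (simp add: d_def)
  have bnd: "\<exists>B. \<forall>x. \<bar>\<phi> x\<bar> \<le> B" if "\<phi> \<in> ?T" for \<phi> using test_function_bounded[OF that] by metis
  have cpi: "integrable M (\<lambda>x. c x * \<phi> x)" if T: "\<phi> \<in> ?T" for \<phi>
    using bnd[OF T] integrable_weight_bounded[OF ci test_measurable(1)[OF T]] by metis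
  have dpi: "integrable M (\<lambda>x. d x * \<bar>\<phi> x\<bar>)" if T: "\<phi> \<in> ?T" for \<phi>
  proof -
    obtain B where B: "\<And>x. \<bar>\<phi> x\<bar> \<le> B" using bnd[OF T] by blast
    show ?thesis by (rule integrable_weight_bounded[OF di, where B = B]) (use B test_measurable(1)[OF T] in auto)
  qed
  define l where "l \<phi> = a \<phi> - lam * b \<phi> - (LINT x|M. c x * \<phi> x)" for \<phi>
  have a_lin: "a (\<lambda>x. s * \<phi> x + t * \<psi> x) = s * a \<phi> + t * a \<psi>" if T: "\<phi> \<in> ?T" "\<psi> \<in> ?T" for s t \<phi> \<psi>
  proof -
    have "a (\<lambda>x. s * \<phi> x + t * \<psi> x) = (LINT x|M. s * (norm (g x) powr (p x - 2) * (g x \<bullet> grad \<phi> x)) + t * (norm (g x) powr (p x - 2) * (g x \<bullet> grad \<psi> x)))"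
      unfolding a_def test_functions_lincomb(2)[OF T] by (simp add: inner_add_right algebra_simps)
    then show ?thesis unfolding a_def using ai[OF T(1)] ai[OF T(2)] by simp
  qed
  have b_lin: "b (\<lambda>x. s * \<phi> x + t * \<psi> x) = s * b \<phi> + t * b \<psi>" if T: "\<phi> \<in> ?T" "\<psi> \<in> ?T" for s t \<phi> \<psi>
  proof -
    have "b (\<lambda>x. s * \<phi> x + t * \<psi> x) = (LINT x|M. s * (norm (u x) powr (p x - 2) * (u x \<bullet> \<phi> x)) + t * (norm (u x) powr (p x - 2) * (u x \<bullet> \<psi> x)))"
      unfolding b_def by (simp add: algebra_simps)
    then show ?thesis unfolding b_def using bi[OF T(1)] bi[OF T(2)] by simp
  qed
  have c_lin: "(LINT x|M. c x * (s * \<phi> x + t * \<psi> x)) = s * (LINT x|M. c x * \<phi> x) + t * (LINT x|M. c x * \<psi> x)"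
    if T: "\<phi> \<in> ?T" "\<psi> \<in> ?T" for s t \<phi> \<psi>
  proof -
    have "(LINT x|M. c x * (s * \<phi> x + t * \<psi> x)) = (LINT x|M. s * (c x * \<phi> x) + t * (c x * \<psi> x))"
      by (simp add: algebra_simps)
    then show ?thesis using cpi[OF T(1)] cpi[OF T(2)] by simp
  qed
  have l_lin: "l (\<lambda>x. s * \<phi> x + t * \<psi> x) = s * l \<phi> + t * l \<psi>" if T: "\<phi> \<in> ?T" "\<psi> \<in> ?T" for s t \<phi> \<psi>
    unfolding l_def a_lin[OF T] b_lin[OF T] c_lin[OF T] by (simp add: algebra_simps)
  have l_bound: "l \<phi> \<le> (LINT x|M. d x * \<bar>\<phi> x\<bar>)" if T: "\<phi> \<in> ?T" for \<phi>
  proof -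
    have T': "(\<lambda>x. (-1) * \<phi> x + 0 * \<phi> x) \<in> ?T" by (rule test_functions_lincomb(1)[OF T T])
    have "a \<phi> - lam * b \<phi> = lam * b (\<lambda>x. (-1) * \<phi> x + 0 * \<phi> x) - a (\<lambda>x. (-1) * \<phi> x + 0 * \<phi> x)"
      unfolding a_lin[OF T T] b_lin[OF T T] by simp
    also have "\<dots> \<le> (LINT x|M. max (- ((-1) * \<phi> x + 0 * \<phi> x) * hi x) (- ((-1) * \<phi> x + 0 * \<phi> x) * lo x))"
      by (rule key[OF T'])
    also have "\<dots> = (LINT x|M. c x * \<phi> x + d x * \<bar>\<phi> x\<bar>)"
    proof (rule Bochner_Integration.integral_cong[OF refl])
      fix x assume "x \<in> space M"
      then have le: "lo x \<le> hi x" using lh by simp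
      show "max (- ((-1) * \<phi> x + 0 * \<phi> x) * hi x) (- ((-1) * \<phi> x + 0 * \<phi> x) * lo x) = c x * \<phi> x + d x * \<bar>\<phi> x\<bar>"
      proof (cases "\<phi> x \<ge> 0")
        case True
        then have "\<phi> x * lo x \<le> \<phi> x * hi x" using le by (intro mult_left_mono)
        then show ?thesis using True by (simp add: max_def c_def d_def field_simps)
      next
        case False
        then have "\<phi> x * hi x \<le> \<phi> x * lo x" using le by (intro mult_left_mono_neg) auto
        then show ?thesis using False by (simp add: max_def c_def d_def field_simps)
      qed
    qed
    also have "\<dots> = (LINT x|M. c x * \<phi> x) + (LINT x|M. d x * \<bar>\<phi> x\<bar>)" using cpi[OF T] dpi[OF T] by simp
    finally show ?thesis by (simp add: l_def)
  qed
  obtain V where V: "integrable M V" "AE x in M. \<bar>V x\<bar> \<le> d x" "\<And>\<phi>. \<phi> \<in> ?T \<Longrightarrow> l \<phi> = (LINT x|M. V x * \<phi> x)"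
  proof (rule representation_weighted_L1[of d l])
    show "integrable M d" by (rule di)
    show "0 \<le> d x" if "x \<in> \<Omega>" for x by (rule d0[OF that])
    show "l (\<lambda>x. a * \<phi> x + b * \<psi> x) = a * l \<phi> + b * l \<psi>" if "\<phi> \<in> ?T" "\<psi> \<in> ?T" for a b \<phi> \<psi>
      by (rule l_lin[OF that])
    show "l \<phi> \<le> (LINT x|M. d x * \<bar>\<phi> x\<bar>)" if "\<phi> \<in> ?T" for \<phi> by (rule l_bound[OF that])
  qed (rule that)
  have Vpi: "integrable M (\<lambda>x. V x * \<phi> x)" if T: "\<phi> \<in> ?T" for \<phi>
    using bnd[OF T] integrable_weight_bounded[OF V(1) test_measurable(1)[OF T]] by metis
  define v where "v x = c x + V x" for x
  show ?thesis
  proof (rule that[of v])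
    show "locally_integrable \<Omega> v" unfolding v_def using ci V(1) by (intro locally_integrable_integrable[OF open_dom]) simp
    show "AE x in M. v x \<in> clarke_subdiff (J x) (u x)"
      using V(2) AE_space[of M]
    proof eventually_elim
      case (elim x)
      then have x: "x \<in> \<Omega>" by simp
      have "lo x \<le> v x" "v x \<le> hi x" using elim(1) unfolding v_def c_def d_def abs_le_iff by (simp_all add: field_simps)
      then show ?case unfolding lo_def hi_def by (rule clarke_interval[OF Jl[OF x]])
    qed
    fix \<phi> assume T: "\<phi> \<in> ?T"
    have "(LINT x|M. v x * \<phi> x) = (LINT x|M. c x * \<phi> x) + l \<phi>"
      unfolding v_def distrib_right using cpi[OF T] Vpi[OF T] V(3)[OF T] by simp
    also have "\<dots> = a \<phi> - lam * b \<phi>" by (simp add: l_def)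
    finally have "a \<phi> = lam * b \<phi> + (LINT x|M. v x * \<phi> x)" by simp
    moreover have "lam * b \<phi> = (LINT x|M. lam * \<bar>u x\<bar> powr (p x - 2) * u x * \<phi> x)"
    proof -
      have "lam * b \<phi> = (LINT x|M. lam * (norm (u x) powr (p x - 2) * (u x \<bullet> \<phi> x)))" unfolding b_def by simp
      then show ?thesis by (simp add: mult.assoc)
    qed
    ultimately show "(LINT x|M. norm (g x) powr (p x - 2) * (g x \<bullet> grad \<phi> x)) =
       (LINT x|M. lam * \<bar>u x\<bar> powr (p x - 2) * u x * \<phi> x) + (LINT x|M. v x * \<phi> x)"
      unfolding a_def by simp
  qed
qed

end

section \<open>Coercivity and the existence of a nontrivial solution\<close>

lemma clarke_subdiff_zero: "v \<in> clarke_subdiff (\<lambda>t. 0) t \<Longrightarrow> v = 0"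
proof (rule ccontr)
  assume v: "v \<in> clarke_subdiff (\<lambda>t. 0) t" and "v \<noteq> 0"
  have *: "\<not> ereal w \<le> clarke_deriv (\<lambda>t. 0) t h" if "w > 0" for w h
    
  proof
    assume "ereal w \<le> clarke_deriv (\<lambda>t. 0) t h"
    then have "\<exists>y s. \<bar>y\<bar> < (1::real) \<and> 0 < s \<and> s < (1::real) \<and> 0 < (0 - 0) / s"
      unfolding le_clarke_deriv_iff using that by (metis zero_less_one)
    then show False by simp
  qed
  have "ereal (v * sgn v) \<le> clarke_deriv (\<lambda>t. 0) t (sgn v)" using v by (simp add: clarke_subdiff_def)
  moreover have "v * sgn v > 0" using \<open>v \<noteq> 0\<close> by (simp add: abs_sgn[symmetric])
  ultimately show False using * by blast
qed

text \<open>Completeness of Lebesgue measure makes \<open>g\<close> measurable along with \<open>f\<close>.\<close>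

lemma integral_lebesgue_on_cong_AE:
  fixes f g :: "'a::euclidean_space \<Rightarrow> real"
  assumes S: "S \<in> sets lebesgue" and f: "f \<in> borel_measurable (lebesgue_on S)"
    and eq: "AE x in lebesgue_on S. f x = g x"
  shows "(LINT x|lebesgue_on S. f x) = (LINT x|lebesgue_on S. g x)"
proof -
  have S': "S \<inter> space lebesgue \<in> sets lebesgue" using S by simp
  have 1: "(\<lambda>x. indicator S x *\<^sub>R f x) \<in> borel_measurable lebesgue"
    using f unfolding borel_measurable_restrict_space_iff[OF S'] .
  have 2: "AE x in lebesgue. indicator S x *\<^sub>R f x = indicator S x *\<^sub>R g x"
    using eq unfolding AE_restrict_space_iff[OF S'] by eventually_elim (auto simp: indicator_def)
  have "(LINT x|lebesgue. indicator S x *\<^sub>R f x) = (LINT x|lebesgue. indicator S x *\<^sub>R g x)"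
    by (rule integral_cong_AE[OF 1 borel_measurable_AE[OF 1 2] 2])
  then show ?thesis by (simp only: integral_restrict_space[OF S'])
qed

context var_exp
begin

lemma rayleigh_quotient:
  assumes W: "W0 u g"
  shows "lambda_star \<Omega> p * (LINT x|M. \<bar>u x\<bar> powr p x) \<le> (LINT x|M. norm (g x) powr p x)"
proof -
  note [measurable] = W0_measurable[OF W]
  have G0: "0 \<le> (LINT x|M. norm (g x) powr p x)" by (rule integral_nonneg_AE) simp
  show ?thesis
  proof (cases "ae_zero \<Omega> u")
    case True
    then have "AE x in M. \<bar>u x\<bar> powr p x = 0" unfolding ae_zero_def by eventually_elim simp
    then have "(LINT x|M. \<bar>u x\<bar> powr p x) = 0" using integral_cong_AE[of "\<lambda>x. \<bar>u x\<bar> powr p x" M "\<lambda>_. 0"] by simp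
    then show ?thesis using G0 by simp
  next
    case False
    let ?R = "\<lambda>u. (LINT x|M. norm (weak_grad \<Omega> u x) powr p x) / (LINT x|M. \<bar>u x\<bar> powr p x)"
    have ui: "integrable M (\<lambda>x. \<bar>u x\<bar> powr p x)"
      using powr_over_p_integrable(2)[OF W0_measurable(1)[OF W] W0_rho_finite(1)[OF W]] by simp
    have "(LINT x|M. \<bar>u x\<bar> powr p x) \<noteq> 0"
    proof
      assume "(LINT x|M. \<bar>u x\<bar> powr p x) = 0"
      then have "AE x in M. \<bar>u x\<bar> powr p x = 0" using integral_nonneg_eq_0_iff_AE[OF ui] by simp
      then have "AE x in M. u x = 0" by eventually_elim simp
      then show False using False by (simp add: ae_zero_def)
    qed
    moreover have "0 \<le> (LINT x|M. \<bar>u x\<bar> powr p x)" by (rule integral_nonneg_AE) simp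
    ultimately have U: "0 < (LINT x|M. \<bar>u x\<bar> powr p x)" by (simp only: less_le) argo
    have "lambda_star \<Omega> p \<le> ?R u"
      unfolding lambda_star_def
    proof (rule cINF_lower)
      show "bdd_below (?R ` {u \<in> W01p \<Omega> p. \<not> ae_zero \<Omega> u})"
        by (rule bdd_belowI[of _ 0]) (auto intro!: divide_nonneg_nonneg integral_nonneg_AE)
      show "u \<in> {u \<in> W01p \<Omega> p. \<not> ae_zero \<Omega> u}" using W0_imp_W01p(1)[OF W] False by simp
    qed
    also have "(LINT x|M. norm (weak_grad \<Omega> u x) powr p x) = (LINT x|M. norm (g x) powr p x)"
    proof (rule integral_cong_AE)
      have [measurable]: "weak_grad \<Omega> u \<in> borel_measurable M" by (rule weak_grad_measurable[OF W0_has_weak_grad[OF W]])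
      show "(\<lambda>x. norm (weak_grad \<Omega> u x) powr p x) \<in> borel_measurable M" by measurable
      show "AE x in M. norm (weak_grad \<Omega> u x) powr p x = norm (g x) powr p x"
        using W0_imp_W01p(2)[OF W] by eventually_elim simp
    qed measurable
    finally show ?thesis using U by (simp add: pos_le_divide_eq)
  qed
qed

text \<open>For positive \<open>lam\<close>, the bounds on the exponent and the Rayleigh quotient estimate the integral of
  \<open>lam * |u| powr p x / p x\<close> by \<open>lam * pp / (pm * lambda_star)\<close> times the gradient energy, and this factor is
  less than one by assumption.\<close>

lemma functional_coercive:
  fixes J :: "'a \<Rightarrow> real \<Rightarrow> real"
  assumes lam: "lam < pm / pp * lambda_star \<Omega> p"
    and J: "AE x in M. \<forall>t. J x t \<le> C" "C \<ge> 0"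
  obtains \<theta> where "0 \<le> \<theta>" "\<theta> < 1" "\<And>u g. W0 u g \<Longrightarrow> integrable M (\<lambda>x. J x (u x)) \<Longrightarrow>
     (1 - \<theta>) * (LINT x|M. norm (g x) powr p x / p x) - C * measure M \<Omega> \<le>
     (LINT x|M. norm (g x) powr p x / p x) + (LINT x|M. - lam * (\<bar>u x\<bar> powr p x / p x) - J x (u x))"
proof -
  define \<theta> where "\<theta> = (if lam \<le> 0 then 0 else lam * pp / (pm * lambda_star \<Omega> p))"
  have ls: "lambda_star \<Omega> p > 0" if "lam > 0"
  proof -
    have "0 < pm / pp * lambda_star \<Omega> p" using that lam by simp
    then show ?thesis using pm pp_pos by (simp add: zero_less_mult_iff zero_less_divide_iff)
  qed
  have \<theta>: "0 \<le> \<theta>" "\<theta> < 1"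
  proof -
    have "0 \<le> \<theta> \<and> \<theta> < 1"
    proof (cases "lam \<le> 0")
      case False
      then have "lam > 0" by simp
      have "lam * pp < pm * lambda_star \<Omega> p" using lam pp_pos by (simp add: field_simps)
      then show ?thesis using False ls pm pp_pos by (simp add: \<theta>_def divide_less_eq)
    qed (simp add: \<theta>_def)
    then show "0 \<le> \<theta>" "\<theta> < 1" by auto
  qed
  show ?thesis
  proof (rule that[OF \<theta>])
    fix u g assume W: "W0 u g" and Ji: "integrable M (\<lambda>x. J x (u x))"
    note [measurable] = W0_measurable[OF W]
    let ?E = "LINT x|M. norm (g x) powr p x / p x" and ?U = "LINT x|M. \<bar>u x\<bar> powr p x / p x"
    have Ei: "integrable M (\<lambda>x. norm (g x) powr p x / p x)" and E0: "0 \<le> ?E" using W0_energy_integrable[OF W] by auto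
    have Ui: "integrable M (\<lambda>x. \<bar>u x\<bar> powr p x / p x)" "integrable M (\<lambda>x. \<bar>u x\<bar> powr p x)"
      using powr_over_p_integrable[OF W0_measurable(1)[OF W] W0_rho_finite(1)[OF W]] by simp_all
    have Gi: "integrable M (\<lambda>x. norm (g x) powr p x)" by (rule powr_over_p_integrable(2)[OF W0_measurable(2)[OF W] W0_rho_finite(2)[OF W]])
    have U0: "0 \<le> ?U" by (rule integral_nonneg_AE) (rule AE_I2, simp add: less_imp_le[OF less_trans[OF zero_less_one p_gt_1]])
    have "(LINT x|M. J x (u x)) \<le> (LINT x|M. C)"
      by (rule integral_mono_AE[OF Ji]) (use J(1) in auto)
    then have JC: "(LINT x|M. J x (u x)) \<le> C * measure M \<Omega>" by (simp add: mult.commute)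
    have lamU: "lam * ?U \<le> \<theta> * ?E"
    proof (cases "lam \<le> 0")
      case True
      then show ?thesis using U0 by (simp add: \<theta>_def mult_nonpos_nonneg)
    next
      case False
      then have l: "lam > 0" by simp
      note s = ls[OF l]
      have "?U \<le> (LINT x|M. \<bar>u x\<bar> powr p x / pm)"
        using Ui pm p_ge p_gt_1 by (intro integral_mono) (auto intro!: divide_left_mono mult_pos_pos intro: less_trans[OF zero_less_one])
      then have "pm * ?U \<le> (LINT x|M. \<bar>u x\<bar> powr p x)" using pm by (simp add: field_simps)
      then have "lambda_star \<Omega> p * (pm * ?U) \<le> lambda_star \<Omega> p * (LINT x|M. \<bar>u x\<bar> powr p x)"
        using s by (intro mult_left_mono) auto
      also have "\<dots> \<le> (LINT x|M. norm (g x) powr p x)" by (rule rayleigh_quotient[OF W])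
      also have "\<dots> \<le> (LINT x|M. pp * (norm (g x) powr p x / p x))"
      proof (rule integral_mono[OF Gi])
        show "integrable M (\<lambda>x. pp * (norm (g x) powr p x / p x))" by (rule integrable_mult_right[OF Ei])
        fix x assume "x \<in> space M"
        then have x: "1 < p x" "p x \<le> pp" using p_gt_1 p_le by auto
        have "norm (g x) powr p x * p x \<le> norm (g x) powr p x * pp" using x by (intro mult_left_mono) auto
        then show "norm (g x) powr p x \<le> pp * (norm (g x) powr p x / p x)" using x by (simp add: field_simps)
      qed
      also have "\<dots> = pp * ?E" by (rule integral_mult_right_zero)
      finally have "lambda_star \<Omega> p * (pm * ?U) \<le> pp * ?E" .
      then have "lam * (lambda_star \<Omega> p * (pm * ?U)) \<le> lam * (pp * ?E)" using l by (intro mult_left_mono) auto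
      then have "lam * ?U \<le> (lam * (pp * ?E)) / (pm * lambda_star \<Omega> p)"
        using s pm by (simp add: pos_le_divide_eq mult_ac)
      then show ?thesis using False by (simp add: \<theta>_def mult_ac)
    qed
    have "(LINT x|M. - lam * (\<bar>u x\<bar> powr p x / p x) - J x (u x)) = (LINT x|M. - lam * (\<bar>u x\<bar> powr p x / p x)) - (LINT x|M. J x (u x))"
      by (rule Bochner_Integration.integral_diff[OF integrable_mult_right[OF Ui(1)] Ji])
    also have "(LINT x|M. - lam * (\<bar>u x\<bar> powr p x / p x)) = - lam * ?U" by (rule integral_mult_right_zero)
    finally have "(LINT x|M. - lam * (\<bar>u x\<bar> powr p x / p x) - J x (u x)) = - lam * ?U - (LINT x|M. J x (u x))" .
    then show "(1 - \<theta>) * ?E - C * measure M \<Omega> \<le> ?E + (LINT x|M. - lam * (\<bar>u x\<bar> powr p x / p x) - J x (u x))"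
      using JC lamU by (simp add: left_diff_distrib)
  qed
qed

text \<open>The minimiser may vanish, but then the minimum is zero, and every function at which the functional is
  nonpositive is a minimiser as well.\<close>

lemma nontrivial_solution:
  fixes J :: "'a \<Rightarrow> real \<Rightarrow> real"
  assumes pmN: "pm < DIM('a)" and q: "pp \<le> q" "q < DIM('a) * pm / (DIM('a) - pm)"
    and lam: "lam < pm / pp * lambda_star \<Omega> p"
    and Jm: "\<And>t. (\<lambda>x. J x t) \<in> borel_measurable M" and Jl: "\<And>x. x \<in> \<Omega> \<Longrightarrow> locally_lipschitz (J x)"
    and J0: "\<And>x. x \<in> \<Omega> \<Longrightarrow> J x 0 = 0" and K: "K \<ge> 0"
    and gr: "\<And>x t v. x \<in> \<Omega> \<Longrightarrow> v \<in> clarke_subdiff (J x) t \<Longrightarrow> \<bar>v\<bar> \<le> K * (1 + \<bar>t\<bar> powr (q - 1))"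
    and JC: "AE x in M. \<forall>t. J x t \<le> C" "C \<ge> 0"
    and ub: "ub \<in> W01p \<Omega> p" "\<not> ae_zero \<Omega> ub"
      "1 / pm * (LINT x|M. norm (weak_grad \<Omega> ub x) powr p x) + max 0 (- lam) / pm * (LINT x|M. \<bar>ub x\<bar> powr p x)
        \<le> (LINT x|M. J x (ub x))"
  shows "\<exists>u. weak_solution \<Omega> p lam J u \<and> \<not> ae_zero \<Omega> u"
proof -
  have q1: "q > 1" and pq: "pm \<le> q" using q pm pm_le_pp by auto
  have Jc: "continuous_on UNIV (J x)" if "x \<in> \<Omega>" for x by (rule locally_lipschitz_continuous[OF Jl[OF that]])
  have Jb: "\<bar>J x t\<bar> \<le> 2 * K * (1 + \<bar>t\<bar> powr q)" if x: "x \<in> \<Omega>" for x t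
  proof -
    have "\<bar>J x t - J x 0\<bar> \<le> K * (1 + (\<bar>t\<bar> + \<bar>0\<bar>) powr (q - 1)) * \<bar>t - 0\<bar>"
      by (rule clarke_growth_lipschitz[OF Jl[OF x] K _ gr[OF x]]) (use q1 in auto)
    then have "\<bar>J x t\<bar> \<le> K * (\<bar>t\<bar> + \<bar>t\<bar> powr (q - 1) * \<bar>t\<bar>)" using J0[OF x] by (simp add: algebra_simps)
    also have "\<bar>t\<bar> powr (q - 1) * \<bar>t\<bar> = \<bar>t\<bar> powr q" by (cases "t = 0") (auto simp: powr_diff)
    also have "K * (\<bar>t\<bar> + \<bar>t\<bar> powr q) \<le> K * (2 * (1 + \<bar>t\<bar> powr q))"
      using powr_le_one_plus[of "\<bar>t\<bar>" 1 q] q1 K by (intro mult_left_mono) auto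
    finally show ?thesis by (simp add: algebra_simps)
  qed
  define F where "F x t = - lam * (\<bar>t\<bar> powr p x / p x) - J x t" for x t
  have Fm: "(\<lambda>x. F x t) \<in> borel_measurable M" for t unfolding F_def using Jm by measurable
  have Fc: "continuous_on UNIV (F x)" if x: "x \<in> \<Omega>" for x
    unfolding F_def using p_gt_1[OF x] Jc[OF x] by (intro continuous_intros continuous_on_powr') auto
  have Fb: "\<bar>F x t\<bar> \<le> (\<bar>lam\<bar> + 2 * K) * (1 + \<bar>t\<bar> powr q)" if x: "x \<in> \<Omega>" for x t
  proof -
    have px: "1 < p x" "p x \<le> q" using p_gt_1[OF x] p_le[OF x] q by auto
    have "\<bar>t\<bar> powr p x / p x \<le> \<bar>t\<bar> powr p x / 1" using px by (intro divide_left_mono) auto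
    also have "\<dots> \<le> 1 + \<bar>t\<bar> powr q" using powr_le_one_plus[of "\<bar>t\<bar>" "p x" q] px by simp
    finally have "\<bar>lam\<bar> * (\<bar>t\<bar> powr p x / p x) \<le> \<bar>lam\<bar> * (1 + \<bar>t\<bar> powr q)" by (intro mult_left_mono) auto
    moreover have "\<bar>- lam * (\<bar>t\<bar> powr p x / p x)\<bar> = \<bar>lam\<bar> * (\<bar>t\<bar> powr p x / p x)" using px by (simp add: abs_mult)
    ultimately have "\<bar>F x t\<bar> \<le> \<bar>lam\<bar> * (1 + \<bar>t\<bar> powr q) + 2 * K * (1 + \<bar>t\<bar> powr q)"
      using Jb[OF x, of t] abs_triangle_ineq4[of "- lam * (\<bar>t\<bar> powr p x / p x)" "J x t"] unfolding F_def by argo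
    then show ?thesis by (simp add: distrib_right)
  qed
  have Ji: "integrable M (\<lambda>x. J x (w x))" if w: "W0 w h" for w h
  proof (rule Bochner_Integration.integrable_bound[where f = "\<lambda>x. 2 * K * (1 + \<bar>w x\<bar> powr q)"])
    have "integrable M (\<lambda>x. \<bar>w x\<bar> powr q)" by (rule W0_powr_integrable[OF pmN pq q(2) w]) (use q1 in auto)
    then show "integrable M (\<lambda>x. 2 * K * (1 + \<bar>w x\<bar> powr q))" by simp
    show "(\<lambda>x. J x (w x)) \<in> borel_measurable M"
      by (rule borel_measurable_caratheodory[OF Jm _ W0_measurable(1)[OF w]]) (use Jc in simp)
    show "AE x in M. norm (J x (w x)) \<le> norm (2 * K * (1 + \<bar>w x\<bar> powr q))"
    proof (rule AE_I2)
      fix x assume "x \<in> space M"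
      then have "\<bar>J x (w x)\<bar> \<le> 2 * K * (1 + \<bar>w x\<bar> powr q)" using Jb by simp
      then show "norm (J x (w x)) \<le> norm (2 * K * (1 + \<bar>w x\<bar> powr q))" by simp
    qed
  qed
  define E where "E h = (LINT x|M. norm (h x) powr p x / p x)" for h :: "'a \<Rightarrow> 'a"
  obtain \<theta> where \<theta>: "0 \<le> \<theta>" "\<theta> < 1" "\<And>u g. W0 u g \<Longrightarrow> integrable M (\<lambda>x. J x (u x)) \<Longrightarrow>
     (1 - \<theta>) * (LINT x|M. norm (g x) powr p x / p x) - C * measure M \<Omega> \<le>
     (LINT x|M. norm (g x) powr p x / p x) + (LINT x|M. - lam * (\<bar>u x\<bar> powr p x / p x) - J x (u x))"
    by (rule functional_coercive[OF lam JC]) blast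
  have co: "(1 - \<theta>) * E g - C * measure M \<Omega> \<le> E g + (LINT x|M. F x (u x))" if "W0 u g" for u g
    unfolding E_def F_def by (rule \<theta>(3)[OF that Ji[OF that]])
  have E0: "0 \<le> E g" if "W0 u g" for u g unfolding E_def by (rule W0_energy_integrable(3)[OF that])
  obtain u g where W: "W0 u g" and min: "\<And>v h. W0 v h \<Longrightarrow> E g + (LINT x|M. F x (u x)) \<le> E h + (LINT x|M. F x (v x))"
    unfolding E_def
  proof (rule minimiser_exists[OF pmN q, of F "\<bar>lam\<bar> + 2 * K" "- C * measure M \<Omega>" "1 / (1 - \<theta>)" "C * measure M \<Omega> / (1 - \<theta>)"])
    show "(\<lambda>x. F x t) \<in> borel_measurable M" for t by (rule Fm)
    show "continuous_on UNIV (F x)" if "x \<in> \<Omega>" for x by (rule Fc[OF that])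
    show "\<bar>F x t\<bar> \<le> (\<bar>lam\<bar> + 2 * K) * (1 + \<bar>t\<bar> powr q)" if "x \<in> \<Omega>" for x t by (rule Fb[OF that])
    show "0 \<le> \<bar>lam\<bar> + 2 * K" using K by simp
    show "- C * measure M \<Omega> \<le> (LINT x|M. norm (g x) powr p x / p x) + (LINT x|M. F x (u x))" if "W0 u g" for u g
    proof -
      have "0 \<le> (1 - \<theta>) * E g" using E0[OF that] \<theta>(2) by simp
      then show ?thesis using co[OF that] unfolding E_def by linarith
    qed
    show "(LINT x|M. norm (g x) powr p x / p x) \<le> 1 / (1 - \<theta>) * ((LINT x|M. norm (g x) powr p x / p x) + (LINT x|M. F x (u x))) +
        C * measure M \<Omega> / (1 - \<theta>)" if "W0 u g" for u g
    proof -
      have "(1 - \<theta>) * E g \<le> (E g + (LINT x|M. F x (u x))) + C * measure M \<Omega>" using co[OF that] by linarith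
      then have "E g \<le> ((E g + (LINT x|M. F x (u x))) + C * measure M \<Omega>) / (1 - \<theta>)"
        using \<theta>(2) by (simp add: pos_le_divide_eq mult.commute)
      then show ?thesis unfolding E_def by (simp add: add_divide_distrib)
    qed
    show "0 \<le> 1 / (1 - \<theta>)" using \<theta>(2) by simp
  qed blast
  have "\<exists>u g. W0 u g \<and> \<not> ae_zero \<Omega> u \<and> (\<forall>v h. W0 v h \<longrightarrow> E g + (LINT x|M. F x (u x)) \<le> E h + (LINT x|M. F x (v x)))"
  proof (cases "ae_zero \<Omega> u")
    case False
    then show ?thesis using W min by blast
  next
    case True
    have F0: "(LINT x|M. F x (u x)) = 0"
    proof -
      have "(LINT x|M. F x (u x)) = (LINT x|M. 0)"
      proof (rule integral_cong_AE)
        show "(\<lambda>x. F x (u x)) \<in> borel_measurable M"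
          by (rule borel_measurable_caratheodory[OF Fm _ W0_measurable(1)[OF W]]) (use Fc in simp)
        show "AE x in M. F x (u x) = 0"
          using True[unfolded ae_zero_def] AE_space[of M] by eventually_elim (use J0 in \<open>auto simp: F_def\<close>)
      qed simp
      then show ?thesis by simp
    qed
    have Wb: "W0 ub (weak_grad \<Omega> ub)" by (rule W01p_imp_W0[OF ub(1)])
    have Ui: "integrable M (\<lambda>x. \<bar>ub x\<bar> powr p x / p x)" "integrable M (\<lambda>x. \<bar>ub x\<bar> powr p x)"
      using powr_over_p_integrable[OF W0_measurable(1)[OF Wb] W0_rho_finite(1)[OF Wb]] by simp_all
    have Gi: "integrable M (\<lambda>x. norm (weak_grad \<Omega> ub x) powr p x)"
      by (rule powr_over_p_integrable(2)[OF W0_measurable(2)[OF Wb] W0_rho_finite(2)[OF Wb]])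
    let ?G = "LINT x|M. norm (weak_grad \<Omega> ub x) powr p x" and ?U = "LINT x|M. \<bar>ub x\<bar> powr p x"
    let ?UE = "LINT x|M. \<bar>ub x\<bar> powr p x / p x"
    have le: "y / p x \<le> y / pm" if "x \<in> \<Omega>" "0 \<le> y" for x y
      using that pm p_ge[OF that(1)] by (intro divide_left_mono) auto
    have "E (weak_grad \<Omega> ub) \<le> (LINT x|M. norm (weak_grad \<Omega> ub x) powr p x / pm)"
      unfolding E_def using W0_energy_integrable(1)[OF Wb] Gi le by (intro integral_mono) auto
    then have 1: "E (weak_grad \<Omega> ub) \<le> 1 / pm * ?G" by simp
    have "?UE \<le> (LINT x|M. \<bar>ub x\<bar> powr p x / pm)" using Ui le by (intro integral_mono) auto
    then have U1: "?UE \<le> ?U / pm" by simp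
    have U0: "0 \<le> ?UE" by (rule integral_nonneg_AE) (rule AE_I2, simp add: less_imp_le[OF less_trans[OF zero_less_one p_gt_1]])
    have "- lam * ?UE \<le> max 0 (- lam) * ?UE" using U0 by (intro mult_right_mono) auto
    also have "\<dots> \<le> max 0 (- lam) * (?U / pm)" using U1 by (intro mult_left_mono) auto
    finally have 2: "- lam * ?UE \<le> max 0 (- lam) / pm * ?U" by simp
    have "(LINT x|M. F x (ub x)) = (LINT x|M. - lam * (\<bar>ub x\<bar> powr p x / p x)) - (LINT x|M. J x (ub x))"
      unfolding F_def by (rule Bochner_Integration.integral_diff[OF integrable_mult_right[OF Ui(1)] Ji[OF Wb]])
    also have "(LINT x|M. - lam * (\<bar>ub x\<bar> powr p x / p x)) = - lam * ?UE" by (rule integral_mult_right_zero)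
    finally have "E (weak_grad \<Omega> ub) + (LINT x|M. F x (ub x)) \<le> 0" using 1 2 ub(3) by linarith
    also have "0 \<le> E g + (LINT x|M. F x (u x))" using E0[OF W] F0 by simp
    finally have "E (weak_grad \<Omega> ub) + (LINT x|M. F x (ub x)) \<le> E h + (LINT x|M. F x (v x))" if "W0 v h" for v h
      using min[OF that] by linarith
    then show ?thesis using Wb ub(2) by blast
  qed
  then obtain u g where W: "W0 u g" and nz: "\<not> ae_zero \<Omega> u"
    and min: "\<And>v h. W0 v h \<Longrightarrow> E g + (LINT x|M. F x (u x)) \<le> E h + (LINT x|M. F x (v x))" by blast
  obtain v where v: "locally_integrable \<Omega> v" "AE x in M. v x \<in> clarke_subdiff (J x) (u x)"
    "\<And>\<phi>. \<phi> \<in> test_functions \<Omega> \<Longrightarrow> (LINT x|M. norm (g x) powr (p x - 2) * (g x \<bullet> grad \<phi> x)) =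
       (LINT x|M. lam * \<bar>u x\<bar> powr (p x - 2) * u x * \<phi> x) + (LINT x|M. v x * \<phi> x)"
  proof (rule euler_lagrange_inclusion[of q J K u g lam])
    show "pm < DIM('a)" "pp \<le> q" "q < DIM('a) * pm / (DIM('a) - pm)" by (rule pmN q)+
    show "(\<lambda>x. J x t) \<in> borel_measurable M" for t by (rule Jm)
    show "locally_lipschitz (J x)" "J x 0 = 0" if "x \<in> \<Omega>" for x by (rule Jl[OF that] J0[OF that])+
    show "0 \<le> K" by (rule K)
    show "\<bar>v\<bar> \<le> K * (1 + \<bar>t\<bar> powr (q - 1))" if "x \<in> \<Omega>" "v \<in> clarke_subdiff (J x) t" for x t v by (rule gr[OF that])
    show "W0 u g" by (rule W)
    show "(LINT x|M. norm (g x) powr p x / p x) + (LINT x|M. - lam * (\<bar>u x\<bar> powr p x / p x) - J x (u x)) \<le>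
      (LINT x|M. norm (h x) powr p x / p x) + (LINT x|M. - lam * (\<bar>v x\<bar> powr p x / p x) - J x (v x))" if "W0 v h" for v h
      using min[OF that] unfolding E_def F_def .
  qed (rule that)
  note [measurable] = W0_measurable[OF W]
  have [measurable]: "weak_grad \<Omega> u \<in> borel_measurable M" by (rule weak_grad_measurable[OF W0_has_weak_grad[OF W]])
  have "weak_solution \<Omega> p lam J u"
    unfolding weak_solution_def
  proof (intro conjI exI[of _ v] ballI v(1,2) W0_imp_W01p(1)[OF W])
    fix \<phi> assume \<phi>: "\<phi> \<in> test_functions \<Omega>"
    note [measurable] = test_measurable[OF \<phi>]
    have "(LINT x|M. norm (weak_grad \<Omega> u x) powr (p x - 2) * (weak_grad \<Omega> u x \<bullet> grad \<phi> x)) =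
        (LINT x|M. norm (g x) powr (p x - 2) * (g x \<bullet> grad \<phi> x))"
    proof (rule integral_cong_AE)
      show "AE x in M. norm (weak_grad \<Omega> u x) powr (p x - 2) * (weak_grad \<Omega> u x \<bullet> grad \<phi> x) = norm (g x) powr (p x - 2) * (g x \<bullet> grad \<phi> x)"
        using W0_imp_W01p(2)[OF W] by eventually_elim simp
    qed measurable
    then show "(LINT x|M. norm (weak_grad \<Omega> u x) powr (p x - 2) * (weak_grad \<Omega> u x \<bullet> grad \<phi> x)) =
        (LINT x|M. lam * \<bar>u x\<bar> powr (p x - 2) * u x * \<phi> x) + (LINT x|M. v x * \<phi> x)"
      using v(3)[OF \<phi>] by simp
  qed
  then show ?thesis using nz by blast
qed

end

lemma bounds_on_closure:
  fixes f :: "'a::euclidean_space \<Rightarrow> real"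
  assumes "bounded S" "continuous_on (closure S) f"
  shows "bdd_below (f ` closure S)" "bdd_above (f ` closure S)" "bdd_below (f ` S)" "bdd_above (f ` S)"
proof -
  have "compact (closure S)" using assms(1) by simp
  then have "bounded (f ` closure S)" using compact_continuous_image[OF assms(2)] compact_imp_bounded by blast
  then show "bdd_below (f ` closure S)" "bdd_above (f ` closure S)" by (auto intro: bounded_imp_bdd_below bounded_imp_bdd_above)
  then show "bdd_below (f ` S)" "bdd_above (f ` S)" by (meson bdd_below_mono bdd_above_mono closure_subset image_mono)+
qed

theorem theorem3p5:
  fixes \<Omega> :: "(real ^ 'n) set"
    and p r a :: "real ^ 'n \<Rightarrow> real"
    and j :: "real ^ 'n \<Rightarrow> real \<Rightarrow> real"
    and lam c1 \<mu> :: real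
    and ubar :: "real ^ 'n \<Rightarrow> real"
  assumes dim: "CARD('n) > 2"
    and dom: "bounded_domain \<Omega>" "C2_boundary \<Omega>"
    and p_cont: "continuous_on (closure \<Omega>) p"
    and p_bounds: "1 < exp_inf \<Omega> p" "exp_sup \<Omega> p < real CARD('n)"
      "exp_sup \<Omega> p \<le> crit_exp \<Omega> p"
    and lam: "lam < exp_inf \<Omega> p / exp_sup \<Omega> p * lambda_star \<Omega> p"
    and j0: "\<forall>x\<in>\<Omega>. j x 0 = 0"
    and j_meas: "\<forall>t. (\<lambda>x. j x t) \<in> borel_measurable (lebesgue_on \<Omega>)"
    and j_lip: "AE x in lebesgue_on \<Omega>. locally_lipschitz (j x)"
    and a: "a \<in> borel_measurable (lebesgue_on \<Omega>)"
      "AE x in lebesgue_on \<Omega>. 0 \<le> a x"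
      "\<exists>C. AE x in lebesgue_on \<Omega>. a x \<le> C"
    and c1: "c1 > 0"
    and r: "continuous_on (closure \<Omega>) r" "\<forall>x\<in>closure \<Omega>. 1 \<le> r x"
      "exp_sup \<Omega> p \<le> exp_sup (closure \<Omega>) r" "exp_sup (closure \<Omega>) r < crit_exp \<Omega> p"
    and growth: "AE x in lebesgue_on \<Omega>. \<forall>t. \<forall>v\<in>clarke_subdiff (j x) t.
      \<bar>v\<bar> \<le> a x + c1 * rpow \<bar>t\<bar> (r x - 1)"
    and at_inf: "\<exists>c>0. \<exists>L>0. AE x in lebesgue_on \<Omega>. \<forall>t. L \<le> \<bar>t\<bar> \<longrightarrow>
      j x t \<le> - c * \<bar>t\<bar> powr p x"
    and mu: "\<mu> > 0"
    and at_zero: "\<forall>\<epsilon>>0. \<exists>\<delta>>0. AE x in lebesgue_on \<Omega>. \<forall>t. 0 < \<bar>t\<bar> \<and> \<bar>t\<bar> \<le> \<delta> \<longrightarrow>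
      j x t \<le> (- \<mu> + \<epsilon>) * \<bar>t\<bar> powr p x"
    and ubar: "ubar \<in> W01p \<Omega> p" "\<not> ae_zero \<Omega> ubar"
      "1 / exp_inf \<Omega> p * (LINT x|lebesgue_on \<Omega>. norm (weak_grad \<Omega> ubar x) powr p x)
        + max 0 (- lam) / exp_inf \<Omega> p * (LINT x|lebesgue_on \<Omega>. \<bar>ubar x\<bar> powr p x)
       \<le> (LINT x|lebesgue_on \<Omega>. j x (ubar x))"
  shows "\<exists>u. weak_solution \<Omega> p lam j u \<and> \<not> ae_zero \<Omega> u"
proof -
  have \<Omega>: "open \<Omega>" "bounded \<Omega>" "\<Omega> \<noteq> {}" using dom(1) by (auto simp: bounded_domain_def)
  define pm pp q where "pm = exp_inf \<Omega> p" and "pp = exp_sup \<Omega> p" and "q = exp_sup (closure \<Omega>) r"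
  have p_ge: "pm \<le> p x" and p_le: "p x \<le> pp" if "x \<in> \<Omega>" for x
    using bounds_on_closure(3,4)[OF \<Omega>(2) p_cont] that
    by (auto simp: pm_def pp_def exp_inf_def exp_sup_def intro: cINF_lower cSUP_upper)
  have pmpp: "pm \<le> pp" using \<Omega>(3) p_ge p_le by (meson all_not_in_conv order_trans)
  have r_le: "r x \<le> q" if "x \<in> closure \<Omega>" for x
    using bounds_on_closure(2)[OF \<Omega>(2) r(1)] that by (auto simp: q_def exp_sup_def intro: cSUP_upper)
  have p_meas: "p \<in> borel_measurable (lebesgue_on \<Omega>)"
    using \<Omega>(1) continuous_on_subset[OF p_cont closure_subset] by (intro continuous_imp_measurable_on_sets_lebesgue) auto
  interpret V: var_exp \<Omega> p pm pp
    by unfold_locales (use \<Omega> p_meas p_bounds(1) pmpp p_ge p_le in \<open>auto simp: pm_def[symmetric]\<close>)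
  have D: "DIM(real ^ 'n) = CARD('n)" by simp
  have pmN: "pm < DIM(real ^ 'n)" using pmpp p_bounds(2) D by (simp add: pp_def)
  have q: "pp \<le> q" "q < DIM(real ^ 'n) * pm / (DIM(real ^ 'n) - pm)"
    using r(3,4) by (simp_all add: q_def pp_def pm_def crit_exp_def)
  have q1: "q > 1" using q(1) pmpp p_bounds(1) by (simp add: pm_def)
  obtain Ca where Ca: "AE x in V.M. a x \<le> Ca" using a(3) by blast
  obtain c L where cL: "c > 0" "L > 0" and inf: "AE x in V.M. \<forall>t. L \<le> \<bar>t\<bar> \<longrightarrow> j x t \<le> - c * \<bar>t\<bar> powr p x"
    using at_inf by blast
  define good where "good x \<longleftrightarrow> locally_lipschitz (j x) \<and> (\<forall>t. \<forall>v\<in>clarke_subdiff (j x) t. \<bar>v\<bar> \<le> a x + c1 * rpow \<bar>t\<bar> (r x - 1)) \<and>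
    a x \<le> Ca \<and> (\<forall>t. L \<le> \<bar>t\<bar> \<longrightarrow> j x t \<le> - c * \<bar>t\<bar> powr p x)" for x
  have "AE x in V.M. good x" using j_lip growth Ca inf unfolding good_def by eventually_elim blast
  then obtain N where N: "N \<in> sets V.M" "emeasure V.M N = 0" "{x \<in> space V.M. \<not> good x} \<subseteq> N"
    by (auto elim!: AE_E)
  \<comment> \<open>Setting \<open>j\<close> to zero on the exceptional null set makes the hypotheses hold at every point of \<open>\<Omega>\<close>.\<close>
  define J where "J x t = (if x \<in> N then 0 else j x t)" for x t
  have AE_J: "AE x in V.M. x \<notin> N" using N(1,2) by (intro AE_not_in) auto
  have good: "good x" if "x \<in> \<Omega>" "x \<notin> N" for x using N(3) that by auto
  define K where "K = \<bar>Ca\<bar> + c1"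
  have K: "K \<ge> 0" using c1 by (simp add: K_def)
  have Jl: "locally_lipschitz (J x)" if x: "x \<in> \<Omega>" for x
  proof (cases "x \<in> N")
    case True
    then have "J x = (\<lambda>t. 0)" by (simp add: J_def fun_eq_iff)
    have "0-lipschitz_on (ball t 1) (\<lambda>t::real. 0::real)" for t by (simp add: lipschitz_on_def)
    then have "locally_lipschitz (\<lambda>t::real. 0)" unfolding locally_lipschitz_def by (intro allI exI[of _ "1::real"]) auto
    then show ?thesis using \<open>J x = (\<lambda>t. 0)\<close> by simp
  next
    case False
    then have "J x = j x" by (simp add: J_def fun_eq_iff)
    then show ?thesis using good[OF x False] by (simp add: good_def)
  qed
  have gr: "\<bar>v\<bar> \<le> K * (1 + \<bar>t\<bar> powr (q - 1))" if x: "x \<in> \<Omega>" and v: "v \<in> clarke_subdiff (J x) t" for x t v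
  proof (cases "x \<in> N")
    case True
    then have "J x = (\<lambda>t. 0)" by (simp add: J_def fun_eq_iff)
    then have "v = 0" using v clarke_subdiff_zero by simp
    then show ?thesis using K by simp
  next
    case False
    then have "J x = j x" by (simp add: J_def fun_eq_iff)
    then have 1: "\<bar>v\<bar> \<le> a x + c1 * rpow \<bar>t\<bar> (r x - 1)" "a x \<le> Ca" using v good[OF x False] by (auto simp: good_def)
    have xc: "x \<in> closure \<Omega>" using x closure_subset by blast
    have "rpow \<bar>t\<bar> (r x - 1) \<le> 1 + \<bar>t\<bar> powr (q - 1)"
      unfolding rpow_def using r(2) r_le[OF xc] xc V.powr_le_one_plus[of "\<bar>t\<bar>" "r x - 1" "q - 1"] by auto
    then have "c1 * rpow \<bar>t\<bar> (r x - 1) \<le> c1 * (1 + \<bar>t\<bar> powr (q - 1))" using c1 by (intro mult_left_mono) auto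
    moreover have "Ca \<le> \<bar>Ca\<bar> * (1 + \<bar>t\<bar> powr (q - 1))"
    proof -
      have "\<bar>Ca\<bar> * 1 \<le> \<bar>Ca\<bar> * (1 + \<bar>t\<bar> powr (q - 1))" by (intro mult_left_mono) auto
      then show ?thesis by linarith
    qed
    ultimately show ?thesis using 1 by (simp add: K_def distrib_right)
  qed
  have J0: "J x 0 = 0" if "x \<in> \<Omega>" for x using j0 that by (simp add: J_def)
  \<comment> \<open>Outside \<open>[- L, L]\<close> the function \<open>J x\<close> is nonpositive; inside it is bounded by the mean value inequality.\<close>
  define C where "C = K * (1 + L powr (q - 1)) * L"
  have C: "C \<ge> 0" using K cL by (simp add: C_def)
  have "J x t \<le> C" if x: "x \<in> \<Omega>" for x t
  proof (cases "\<bar>t\<bar> \<le> L")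
    case True
    have "\<bar>J x t - J x 0\<bar> \<le> K * (1 + (\<bar>t\<bar> + \<bar>0\<bar>) powr (q - 1)) * \<bar>t - 0\<bar>"
      by (rule V.clarke_growth_lipschitz[OF Jl[OF x] K _ gr[OF x]]) (use q1 in auto)
    also have "\<dots> \<le> C" unfolding C_def using True K q1 cL
      by (intro mult_mono mult_left_mono add_left_mono powr_mono2 mult_nonneg_nonneg) auto
    finally show ?thesis using J0[OF x] by simp
  next
    case False
    show ?thesis
    proof (cases "x \<in> N")
      case notN: False
      have "j x t \<le> - c * \<bar>t\<bar> powr p x" using good[OF x notN] False by (simp add: good_def)
      also have "\<dots> \<le> 0" using cL by (simp add: mult_nonneg_nonneg)
      finally show ?thesis using C notN by (simp add: J_def)
    qed (use C in \<open>simp add: J_def\<close>)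
  qed
  then have JC: "AE x in V.M. \<forall>t. J x t \<le> C" by (intro AE_I2) simp
  have Jm: "(\<lambda>x. J x t) \<in> borel_measurable V.M" for t
    unfolding J_def using N(1) j_meas by (intro measurable_If_set) auto
  have ub3: "1 / pm * (LINT x|V.M. norm (weak_grad \<Omega> ubar x) powr p x) + max 0 (- lam) / pm * (LINT x|V.M. \<bar>ubar x\<bar> powr p x)
        \<le> (LINT x|V.M. J x (ubar x))"
  proof -
    have Jum: "(\<lambda>x. J x (ubar x)) \<in> borel_measurable V.M"
      by (rule borel_measurable_caratheodory[OF Jm _ V.W0_measurable(1)[OF V.W01p_imp_W0[OF ubar(1)]]])
        (use locally_lipschitz_continuous[OF Jl] in simp)
    have "AE x in V.M. J x (ubar x) = j x (ubar x)" using AE_J by eventually_elim (simp add: J_def)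
    then have "(LINT x|V.M. J x (ubar x)) = (LINT x|V.M. j x (ubar x))"
      by (rule integral_lebesgue_on_cong_AE[OF V.dom_sets Jum])
    then show ?thesis using ubar(3) by (simp add: pm_def)
  qed
  have "\<exists>u. weak_solution \<Omega> p lam J u \<and> \<not> ae_zero \<Omega> u"
    by (rule V.nontrivial_solution[OF pmN q lam[folded pm_def pp_def] Jm Jl J0 K gr JC C ubar(1,2) ub3])
  then obtain u where u: "weak_solution \<Omega> p lam J u" "\<not> ae_zero \<Omega> u" by blast
  obtain v where v: "u \<in> W01p \<Omega> p" "locally_integrable \<Omega> v" "AE x in V.M. v x \<in> clarke_subdiff (J x) (u x)"
    "\<forall>\<phi>\<in>test_functions \<Omega>.
       (LINT x|V.M. norm (weak_grad \<Omega> u x) powr (p x - 2) * (weak_grad \<Omega> u x \<bullet> grad \<phi> x)) =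
       (LINT x|V.M. lam * \<bar>u x\<bar> powr (p x - 2) * u x * \<phi> x) + (LINT x|V.M. v x * \<phi> x)"
    using u(1) unfolding weak_solution_def by blast
  have "AE x in V.M. v x \<in> clarke_subdiff (j x) (u x)"
    using v(3) AE_J
  proof eventually_elim
    case (elim x)
    then have "J x = j x" by (simp add: J_def fun_eq_iff)
    then show ?case using elim by simp
  qed
  then have "weak_solution \<Omega> p lam j u" unfolding weak_solution_def using v by blast
  then show ?thesis using u(2) by blast
qed

end
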